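(* Let $\Omega$ be a bounded convex domain in $\mathbb{R}^d$, $d\ge 2$, and let $1<p<\infty$. Then $$L^p(\Omega,\mathbb{R}^d)=\mathrm{grad}\,W^{1,p}(\Omega)\oplus L^p_\sigma(\Omega).$$ That is, given any $\mathbf{u}\in L^p(\Omega,\mathbb{R}^d)$, there exist $\phi\in W^{1,p}(\Omega)$, unique up to an additive constant, and a unique $\mathbf{v}\in L^p_\sigma(\Omega)$ such that $\mathbf{u}=\nabla\phi+\mathbf{v}$. Moreover, $$\max\left\{\|\nabla\phi\|_{L^p(\Omega)},\|\mathbf{v}\|_{L^p(\Omega)}\right\}\le C_p\,\|\mathbf{u}\|_{L^p(\Omega)},$$ where $C_p$ depends only on $d$, $p$ and the Lipschitz character of $\Omega$.
   Context: $L^p_\sigma(\Omega)$ denotes the subspace of all $\mathbf{v}\in L^p(\Omega,\mathbb{R}^d)$ such that $\int_\Omega\mathbf{v}\cdot\nabla\phi\,dx=0$ for every $\phi\in C^1(\mathbb{R}^d)$. $\mathrm{grad}\,W^{1,p}(\Omega)=\{\nabla\phi:\phi\in W^{1,p}(\Omega)\}$. A bounded convex domain is a bounded Lipschitz domain: there are $r_0>0$, $M\ge 0$ and $N\in\mathbb{N}$ such that, with $C_0=10\sqrt d(1+M)$, for every $Q\in\partial\Omega$, after a rotation and a translation moving $Q$ to the origin, $B(0,C_0r_0)\cap\Omega=\{(x',x_d): x_d>\psi(x')\}\cap B(0,C_0r_0)$ for some Lipschitz $\psi:\mathbb{R}^{d-1}\to\mathbb{R}$ with $\psi(0)=0$,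 $\|\nabla\psi\|_\infty\le M$, and $\partial\Omega$ is covered by $N$ balls of radius $r_0$ centered on $\partial\Omega$. "Depends on the Lipschitz character of $\Omega$" means depending on $\Omega$ only through such $(r_0,M,N)$. *)

theory Defs
  imports "HOL-Analysis.Analysis"
begin

text \<open>
  Elements of Lebesgue and Sobolev spaces are represented by functions on the whole space of which
  only the values on \<open>\<Omega>\<close>, up to null sets, matter.
\<close>

definition ae_eq_on :: "'a::euclidean_space set \<Rightarrow> ('a \<Rightarrow> 'b) \<Rightarrow> ('a \<Rightarrow> 'b) \<Rightarrow> bool" where
  "ae_eq_on \<Omega> f g \<longleftrightarrow> (AE x in lebesgue. x \<in> \<Omega> \<longrightarrow> f x = g x)"

definition Lp :: "real \<Rightarrow> 'a::euclidean_space set \<Rightarrow> ('a \<Rightarrow> 'b::euclidean_space) set" where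
  "Lp p \<Omega> = {f. set_borel_measurable lebesgue \<Omega> f \<and>
                set_integrable lebesgue \<Omega> (\<lambda>x. norm (f x) powr p)}"

definition Lp_norm :: "real \<Rightarrow> 'a::euclidean_space set \<Rightarrow> ('a \<Rightarrow> 'b::euclidean_space) \<Rightarrow> real" where
  "Lp_norm p \<Omega> f = (LINT x:\<Omega>|lebesgue. norm (f x) powr p) powr (1 / p)"

definition C1_gradient :: "('a::euclidean_space \<Rightarrow> real) \<Rightarrow> ('a \<Rightarrow> 'a) \<Rightarrow> bool" where
  "C1_gradient f G \<longleftrightarrow> (\<forall>x. GDERIV f x :> G x) \<and> continuous_on UNIV G"

definition Lp_sigma :: "real \<Rightarrow> 'a::euclidean_space set \<Rightarrow> ('a \<Rightarrow> 'a) set" where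
  "Lp_sigma p \<Omega> = {v \<in> Lp p \<Omega>. \<forall>\<phi> G. C1_gradient \<phi> G \<longrightarrow> (LINT x:\<Omega>|lebesgue. v x \<bullet> G x) = 0}"

text \<open>
  Weak gradients of locally integrable functions, tested against compactly supported functions of
  class \<open>C\<^sup>1\<close>. By mollification this agrees with testing against smooth functions.
\<close>

definition has_weak_gradient ::
    "'a::euclidean_space set \<Rightarrow> ('a \<Rightarrow> real) \<Rightarrow> ('a \<Rightarrow> 'a) \<Rightarrow> bool" where
  "has_weak_gradient \<Omega> \<phi> g \<longleftrightarrow>
     (\<forall>K. compact K \<and> K \<subseteq> \<Omega> \<longrightarrow> set_integrable lebesgue K \<phi> \<and> set_integrable lebesgue K g) \<and>
     (\<forall>\<eta> G. C1_gradient \<eta> G \<and> compact (closure {x. \<eta> x \<noteq> 0}) \<and> closure {x. \<eta> x \<noteq> 0} \<subseteq> \<Omega> \<longrightarrow>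
        (LINT x:\<Omega>|lebesgue. \<phi> x *\<^sub>R G x) = - (LINT x:\<Omega>|lebesgue. \<eta> x *\<^sub>R g x))"

text \<open>
  A weak gradient on an open set is unique up to null sets, so the choice only fixes a
  representative.
\<close>

definition weak_gradient ::
    "'a::euclidean_space set \<Rightarrow> ('a \<Rightarrow> real) \<Rightarrow> 'a \<Rightarrow> 'a" where
  "weak_gradient \<Omega> \<phi> = (SOME g. has_weak_gradient \<Omega> \<phi> g)"

definition W1p :: "real \<Rightarrow> 'a::euclidean_space set \<Rightarrow> ('a \<Rightarrow> real) set" where
  "W1p p \<Omega> = {\<phi> \<in> Lp p \<Omega>. \<exists>g \<in> Lp p \<Omega>. has_weak_gradient \<Omega> \<phi> g}"

definition grad_W1p :: "real \<Rightarrow> 'a::euclidean_space set \<Rightarrow> ('a \<Rightarrow> 'a) set" where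
  "grad_W1p p \<Omega> = weak_gradient \<Omega> ` W1p p \<Omega>"

text \<open>
  \<open>X = Y \<oplus> Z\<close> for spaces of functions on \<open>\<Omega>\<close>, functions equal almost everywhere on \<open>\<Omega>\<close> being
  identified: \<open>Y\<close> and \<open>Z\<close> lie in \<open>X\<close>, span it, and intersect only in \<open>0\<close>.
\<close>

definition ae_direct_sum ::
    "'a::euclidean_space set \<Rightarrow> ('a \<Rightarrow> 'b::real_vector) set \<Rightarrow> ('a \<Rightarrow> 'b) set \<Rightarrow> ('a \<Rightarrow> 'b) set \<Rightarrow> bool"
  where
  "ae_direct_sum \<Omega> X Y Z \<longleftrightarrow>
     Y \<subseteq> X \<and> Z \<subseteq> X \<and>
     (\<forall>u\<in>X. \<exists>y\<in>Y. \<exists>z\<in>Z. ae_eq_on \<Omega> u (\<lambda>x. y x + z x)) \<and>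
     (\<forall>y\<in>Y. \<forall>z\<in>Z. ae_eq_on \<Omega> y z \<longrightarrow> ae_eq_on \<Omega> y (\<lambda>_. 0))"

text \<open>
  The graph function \<open>\<psi>\<close> of \<open>d - 1\<close> variables is represented by a function on the whole space that
  does not depend on the distinguished coordinate \<open>k\<close>, which plays the role of \<open>x\<^sub>d\<close>. Its gradient
  then has vanishing \<open>k\<close>-th component, and by Fubini an almost-everywhere bound on this gradient is
  the same as an almost-everywhere bound in \<open>d - 1\<close> dimensions.
\<close>

definition lipschitz_graph_function :: "'n \<Rightarrow> real \<Rightarrow> (real ^ 'n::finite \<Rightarrow> real) \<Rightarrow> bool" where
  "lipschitz_graph_function k M \<psi> \<longleftrightarrow>
     (\<forall>x y. (\<forall>i. i \<noteq> k \<longrightarrow> x $ i = y $ i) \<longrightarrow> \<psi> x = \<psi> y) \<and>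
     (\<exists>L. L-lipschitz_on UNIV \<psi>) \<and>
     (AE x in lebesgue. \<exists>D. GDERIV \<psi> x :> D \<and> norm D \<le> M) \<and>
     \<psi> 0 = 0"

definition lipschitz_character :: "(real ^ 'n::finite) set \<Rightarrow> real \<Rightarrow> real \<Rightarrow> nat \<Rightarrow> bool" where
  "lipschitz_character \<Omega> r\<^sub>0 M N \<longleftrightarrow>
     0 < r\<^sub>0 \<and> 0 \<le> M \<and>
     (let C\<^sub>0 = 10 * sqrt (real CARD('n)) * (1 + M) in
        \<forall>Q\<in>frontier \<Omega>. \<exists>R k \<psi>.
          orthogonal_transformation R \<and> det (matrix R) = 1 \<and> lipschitz_graph_function k M \<psi> \<and>
          ball 0 (C\<^sub>0 * r\<^sub>0) \<inter> (\<lambda>x. R (x - Q)) ` \<Omega> = {x. x $ k > \<psi> x} \<inter> ball 0 (C\<^sub>0 * r\<^sub>0)) \<and>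
     (\<exists>c :: nat \<Rightarrow> real ^ 'n. (\<forall>i<N. c i \<in> frontier \<Omega>) \<and> frontier \<Omega> \<subseteq> (\<Union>i<N. ball (c i) r\<^sub>0))"

end

theory Submission
  imports Defs "HOL-Analysis.Analysis"
begin

text \<open>
  Let \<open>P\<close> be the orthogonal projection of \<open>L\<^sup>2(\<Omega>)\<close> onto the closure of the gradients. Everything rests
  on the bilinear estimate \<open>\<bar>\<integral> P u \<bullet> w\<bar> \<le> C (\<integral> |u|\<^sup>p + \<integral> |w|\<^sup>q)\<close> for \<open>p \<ge> 2\<close>, \<open>q = p / (p - 1)\<close>, with \<open>C\<close>
  depending only on \<open>p\<close> and the dimension. It is proved by the Bellman function method of Nazarov, Treil and
  Volberg, in the form that Bakry's commutation argument gives it for log-concave measures: if \<open>m = exp (- V)\<close>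
  with \<open>V\<close> convex and \<open>D\<^sup>*\<close> is the adjoint of the gradient \<open>D\<close> in \<open>L\<^sup>2(m)\<close>, then \<open>D\<^sup>*\<close> intertwines the
  Laplacian \<open>A = D\<^sup>* D\<close> on functions with \<open>A + V''\<close> on vector fields. As \<open>V'' \<ge> 0\<close>, the integral of a suitable
  convex function \<open>B (u, w)\<close> decreases along the semigroup generated by \<open>A + V''\<close> at least as fast as a multiple
  of \<open>|\<langle>D\<^sup>* u, D\<^sup>* w\<rangle>|\<close>, and integrating in time gives \<open>\<langle>A\<^sup>-\<^sup>1 D\<^sup>* u, D\<^sup>* w\<rangle> = \<langle>P u, w\<rangle>\<close>.

  No regularity theory is needed: derivatives are replaced by difference quotients, for which the commutation is
  exact, the semigroup by powers of an explicit Euler step, and the indicator function of the convex set \<open>\<Omega>\<close> is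
  approximated by the weights \<open>\<Prod>\<^sub>f 1 / (1 + exp f)\<close> with finitely many affine functions \<open>f\<close>.

  The estimate for \<open>p < 2\<close> follows because \<open>P\<close> is symmetric. Testing with \<open>w = \<theta> |P u|\<^sup>p\<^sup>-\<^sup>2 P u\<close> turns it into the
  boundedness of \<open>P\<close> on \<open>L\<^sup>p\<close>, and duality gives uniqueness. As \<open>C\<close> does not depend on \<open>\<Omega>\<close> at all, the constant
  of the theorem is independent of the Lipschitz character.
\<close>

text \<open>The classical estimate uses the Hessian of the Bellman function, but only finite
  differences of \<open>u\<close> and \<open>w\<close> are available here. So convexity must be
  quantitative for arbitrary triples of points, and a global quadratic upper Taylor bound is needed
  to control an Euler step. Both hold for a sum, over geometric scales, of squares truncated below
  and above in the variables \<open>u / \<lambda>\<close> and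
  \<open>w / \<lambda> powr (p - 1)\<close>: at every triple some scale acts like a nondegenerate
  square, while the upper bound remains a geometric series. No equation is solved: the Euler sum
  merely nearly minimises a regularised Dirichlet functional. Near minimality survives the passage
  to the domain, and the Pythagorean identity turns it into L2 closeness to \<open>P u\<close>.
  Convexity of the domain also serves twice outside the weight: dilations about an interior point
  give smooth approximations, and segments give the Poincare inequality.\<close>

abbreviation cont :: "('a::topological_space => 'b::topological_space) => bool" where
 "cont \<equiv> continuous_on UNIV"

lemmas bint_cong = Bochner_Integration.integral_cong
 and bint_diff = Bochner_Integration.integral_diff
 and bintegrable_diff = Bochner_Integration.integrable_diff
 and bint_norm_bound = Bochner_Integration.integral_norm_bound_integral
 and bintegrable_bound = Bochner_Integration.integrable_bound
 and bint_add = Bochner_Integration.integral_add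
 and bintegrable_add = Bochner_Integration.integrable_add
 and bint_minus = Bochner_Integration.integral_minus

section \<open>The Bellman function\<close>

text \<open>This is the Huber function: quadratic up to the threshold \<open>b\<close>, affine with
  slope \<open>b\<close> beyond it.\<close>

definition hub :: "real => real => real" where
 "hub b r = (min r b)^2 / 2 + b * (r - min r b)"

text \<open>\<open>clf b r * r\<close> is \<open>min r b\<close>, the slope of \<open>hub b\<close>.
  Dividing by \<open>r\<close> makes the gradient of \<open>hub b (norm z)\<close> the multiple
  \<open>clf b (norm z)\<close> of \<open>z\<close>, with no special case at the origin.\<close>

definition clf :: "real => real => real" where
 "clf b r = b / max b r"

text \<open>The square \<open>r\<^sup>2 / 2\<close> is cut down to the part between the magnitudes \<open>1\<close> and \<open>3\<close>; the flags \<open>lo\<close> and \<open>hi\<close> switch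
  off the cut at the lower and at the upper end. The function \<open>kf\<close> is \<open>r \<mapsto> hf' r / r\<close>.\<close>

definition hf :: "bool => bool => real => real" where
 "hf lo hi r = (if hi then r^2 / 2 else hub 3 r) - (if lo then 0 else hub 1 r)"

definition kf :: "bool => bool => real => real" where
 "kf lo hi r = (if hi then 1 else clf 3 r) - (if lo then 0 else clf 1 r)"

lemma clf_alt: "b > 0 ==> clf b r = (if r <= b then 1 else b / r)"
 by (auto simp: clf_def max_def)

lemma hub_alt: "hub b r = (if r <= b then r^2 / 2 else b * r - b^2 / 2)"
 by (auto simp: hub_def min_def field_simps power2_eq_square)

lemma hub_tangent_below:
 assumes "0 < b" "0 <= r" "0 <= r'"
 shows "hub b r + min r b * (r' - r) <= hub b r'"
proof -
 have "0 <= (r - r')^2" "0 <= (r' - b)^2" "0 <= (r - b)^2" by simp_all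
 then show ?thesis
  using assms mult_nonneg_nonneg[of "r' - b" "b - r"] mult_nonneg_nonneg[of "r' - b" "r - b"]
   mult_nonneg_nonneg[of "b - r'" "r - b"] mult_nonneg_nonneg[of "b - r'" "b - r"]
  by (auto simp: hub_alt min_def power2_eq_square field_simps split: if_splits)
qed

text \<open>What the truncation removes from the square is half the square of the excess of
  \<open>r\<close> over \<open>b\<close>, again a convex function. Tangents below this remainder
  become bounds above for \<open>hub b\<close>.\<close>

lemma hub_compl_tangent_below:
 assumes "0 < b" "0 <= r" "0 <= r'"
 shows "(r^2 / 2 - hub b r) + (r - min r b) * (r' - r) <= r'^2 / 2 - hub b r'"
proof -
 have "0 <= (r - r')^2" "0 <= (r' - b)^2" "0 <= (r - b)^2" by simp_all
 then show ?thesis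
  using assms mult_nonneg_nonneg[of "r' - b" "b - r"] mult_nonneg_nonneg[of "r' - b" "r - b"]
   mult_nonneg_nonneg[of "b - r'" "r - b"] mult_nonneg_nonneg[of "b - r'" "b - r"]
  by (auto simp: hub_alt min_def power2_eq_square field_simps split: if_splits)
qed

text \<open>Cauchy-Schwarz lets a scalar tangent inequality in \<open>norm z\<close> dominate the
  corresponding vector inequality in \<open>z\<close>, as long as the slope factor is
  nonnegative.\<close>

lemma radial_tangent:
 fixes z z' :: "'a::real_inner"
 assumes "0 <= k"
 shows "k * (z \<bullet> (z' - z)) <= k * norm z * (norm z' - norm z)"
proof -
 have "z \<bullet> (z' - z) <= norm z * (norm z' - norm z)"
  using norm_cauchy_schwarz[of z z'] by (simp add: inner_diff_right algebra_simps power2_norm_eq_inner[symmetric] power2_eq_square)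
 then show ?thesis using assms by (metis mult.assoc mult_left_mono)
qed

lemma clf_mult: "b > 0 ==> r \<ge> 0 ==> clf b r * r = min r b"
 by (auto simp: clf_alt min_def)

lemma clf_bounds: "b > 0 ==> 0 <= clf b r & clf b r <= 1"
 by (auto simp: clf_alt)

text \<open>The square has an exact second order expansion; subtracting the tangent inequality of
  its convex remainder leaves the full quadratic term as the price.\<close>

lemma hub_upper:
 fixes z z' :: "'a::real_inner"
 assumes "b > 0"
 shows "hub b (norm z') <= hub b (norm z) + clf b (norm z) * (z \<bullet> (z' - z)) + (norm (z' - z))^2 / 2"
proof -
 have "(1 - clf b (norm z)) * (z \<bullet> (z' - z)) <= (1 - clf b (norm z)) * norm z * (norm z' - norm z)"
  by (rule radial_tangent) (use clf_bounds[OF assms] in auto)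
 also have "(1 - clf b (norm z)) * norm z = norm z - min (norm z) b"
  using clf_mult[OF assms, of "norm z"] by (simp add: algebra_simps)
 finally have "(norm z)^2 / 2 - hub b (norm z) + (1 - clf b (norm z)) * (z \<bullet> (z' - z)) <= (norm z')^2 / 2 - hub b (norm z')"
  using hub_compl_tangent_below[OF assms, of "norm z" "norm z'"] by auto
 moreover have "(norm (z' - z))^2 = (norm z')^2 - (norm z)^2 - 2 * (z \<bullet> (z' - z))"
  by (simp add: power2_norm_eq_inner inner_diff_left inner_diff_right inner_commute)
 ultimately show ?thesis by (simp add: algebra_simps)
qed

lemma hub_lower:
 fixes z z' :: "'a::real_inner"
 assumes "b > 0"
 shows "hub b (norm z) + clf b (norm z) * (z \<bullet> (z' - z)) <= hub b (norm z')"
proof -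
 have "clf b (norm z) * (z \<bullet> (z' - z)) <= clf b (norm z) * norm z * (norm z' - norm z)"
  by (rule radial_tangent) (use clf_bounds[OF assms] in auto)
 then show ?thesis
  using hub_tangent_below[OF assms, of "norm z" "norm z'"] clf_mult[OF assms, of "norm z"] by simp
qed

text \<open>The upper cut is bounded from above and the subtracted lower cut from below, so the
  quadratic remainder is paid only once.\<close>

lemma hf_taylor:
 fixes z z' :: "'a::real_inner"
 shows "hf lo hi (norm z') <= hf lo hi (norm z) + kf lo hi (norm z) * (z \<bullet> (z' - z)) + (norm (z' - z))^2 / 2"
proof -
 have "(norm (z' - z))^2 = (norm z')^2 - (norm z)^2 - 2 * (z \<bullet> (z' - z))"
  by (simp add: power2_norm_eq_inner inner_diff_left inner_diff_right inner_commute)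
 then have 1: "(norm z')^2 / 2 = (norm z)^2 / 2 + z \<bullet> (z' - z) + (norm (z' - z))^2 / 2"
  by linarith
 show ?thesis
  using 1 hub_upper[of 3 z' z] hub_lower[of 1 z z']
  by (auto simp: hf_def kf_def algebra_simps)
qed

lemma kf_bounds: "0 <= kf lo hi r" "kf lo hi r <= 1"
 by (auto simp: kf_def clf_alt field_simps)

text \<open>\<open>r * kf lo hi r\<close> is the derivative of \<open>hf lo hi\<close>, so this is
  the convexity of \<open>hf\<close>.\<close>

lemma kf_mult_mono:
 assumes "0 <= r" "r <= r'"
 shows "r * kf lo hi r <= r' * kf lo hi r'"
 using assms by (auto simp: kf_def clf_alt field_simps split: if_splits)

text \<open>Beyond 3 an active upper cut makes \<open>kf\<close> decay like a multiple of
  \<open>1 / r\<close>; hence the bound on \<open>r'\<close> unless \<open>hi\<close> holds.\<close>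

lemma kf_mono:
 assumes "0 <= r" "r <= r'" "hi \<or> r' <= 3"
 shows "kf lo hi r <= kf lo hi r'"
 using assms by (auto simp: kf_def clf_alt field_simps split: if_splits)

lemma kf_lo: "hi \<or> r <= 3 ==> kf True hi r = 1"
 by (auto simp: kf_def clf_alt)

lemma kf_ge:
 assumes "hi \<or> r <= 3" "t \<ge> 1" "t <= r"
 shows "1 - 1 / t <= kf lo hi r"
 using assms by (auto simp: kf_def clf_alt field_simps)

lemma hf_nonneg: "0 <= r ==> 0 <= hf lo hi r"
proof -
 have "r > 1 ==> 0 <= (r - 1)^2" by simp
 then show "0 <= r ==> 0 <= hf lo hi r"
  by (auto simp: hf_def hub_alt power2_eq_square field_simps)
qed

lemma hf_small: "0 <= r ==> r <= 1 ==> hf lo hi r <= (if lo then 1 / 2 else 0)"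
 using power_le_one[of r 2] by (auto simp: hf_def hub_alt)

lemma hf_linear: "0 <= r ==> \<not> hi ==> hf lo hi r <= 3 * r"
 using mult_nonneg_nonneg[of r "3 - r"] hf_nonneg[of r True True] mult_nonneg_nonneg[of r "1 - r"]
  mult_nonneg_nonneg[of "r - 1" "3 - r"]
 by (auto simp: hf_def hub_alt power2_eq_square field_simps split: if_splits)

lemma hf_zero: "hf lo hi 0 = 0"
 by (simp add: hf_def hub_alt)

lemma continuous_hf [continuous_intros]: "continuous_on S f ==> continuous_on S (%x. hf lo hi (f x))"
 by (cases lo; cases hi; auto simp: hf_def hub_def intro!: continuous_intros)

lemma continuous_kf [continuous_intros]: "continuous_on S f ==> continuous_on S (%x. kf lo hi (f x))"
 by (cases lo; cases hi; simp add: kf_def clf_def; intro continuous_intros; simp add: max_def)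

text \<open>The increment of the gradient of \<open>hf lo hi (norm z)\<close>, tested against
  \<open>z' - z\<close>: a discrete stand-in for the Hessian in that direction.\<close>

definition kgain :: "bool => bool => 'a::real_inner => 'a => real" where
 "kgain lo hi z z' = (kf lo hi (norm z') *\<^sub>R z' - kf lo hi (norm z) *\<^sub>R z) \<bullet> (z' - z)"

lemma kgain_eq:
 "kgain lo hi z z' = (kf lo hi (norm z) + kf lo hi (norm z')) / 2 * (norm (z' - z))^2
  + (kf lo hi (norm z') - kf lo hi (norm z)) / 2 * ((norm z')^2 - (norm z)^2)"
 by (simp add: kgain_def power2_norm_eq_inner inner_diff_left inner_diff_right inner_commute field_simps)

text \<open>Cauchy-Schwarz reduces the claim to the monotonicity of the scalar function
  \<open>r * kf lo hi r\<close>.\<close>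

lemma kgain_nonneg: "0 <= kgain lo hi z z'"
proof -
 let ?k = "kf lo hi (norm z)" and ?k' = "kf lo hi (norm z')"
 have "kgain lo hi z z' = ?k' * (norm z')^2 + ?k * (norm z)^2 - (?k + ?k') * (z \<bullet> z')"
  by (simp add: kgain_def power2_norm_eq_inner inner_diff_left inner_diff_right inner_commute algebra_simps)
 also have "\<dots> \<ge> ?k' * (norm z')^2 + ?k * (norm z)^2 - (?k + ?k') * (norm z * norm z')"
  using mult_left_mono[OF norm_cauchy_schwarz[of z z'], of "?k + ?k'"] kf_bounds by (simp add: add_nonneg_nonneg)
 moreover have "?k' * (norm z')^2 + ?k * (norm z)^2 - (?k + ?k') * (norm z * norm z')
   = (norm z' * ?k' - norm z * ?k) * (norm z' - norm z)"
  by (simp add: power2_eq_square algebra_simps)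
 moreover have "0 <= (norm z' * ?k' - norm z * ?k) * (norm z' - norm z)"
  using kf_mult_mono[of "norm z" "norm z'" lo hi] kf_mult_mono[of "norm z'" "norm z" lo hi]
  by (cases "norm z <= norm z'") (auto intro: mult_nonneg_nonneg mult_nonpos_nonpos)
 ultimately show ?thesis by linarith
qed

lemma kgain_ge:
 assumes "hi \<or> norm z <= 3" "hi \<or> norm z' <= 3"
 shows "(kf lo hi (norm z) + kf lo hi (norm z')) / 2 * (norm (z' - z))^2 <= kgain lo hi z z'"
proof -
 have "0 <= (kf lo hi (norm z') - kf lo hi (norm z)) / 2 * ((norm z')^2 - (norm z)^2)"
 proof (cases "norm z <= norm z'")
  case True
  then show ?thesis using kf_mono[of "norm z" "norm z'" hi lo] assms
   by (intro mult_nonneg_nonneg) (auto intro: power_mono)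
 next
  case False
  then show ?thesis using kf_mono[of "norm z'" "norm z" hi lo] assms
   by (intro mult_nonpos_nonpos) (auto intro: power_mono)
 qed
 then show ?thesis unfolding kgain_eq by linarith
qed

text \<open>The factor \<open>kf\<close> degenerates at small points, so one of the three points has
  to be of size 2 or the lower cut has to be switched off. If the centre is small and only one outer
  point is large, their difference is long and already controls the other difference.\<close>

lemma kgain_three_points:
 fixes z0 z1 z2 :: "'a::real_inner"
 assumes "hi \<or> (norm z0 <= 3 & norm z1 <= 3 & norm z2 <= 3)"
  and "lo \<or> 2 <= norm z0 \<or> 2 <= norm z1 \<or> 2 <= norm z2"
 shows "norm (z1 - z0) * norm (z2 - z0) <= 28 * (kgain lo hi z0 z1 + kgain lo hi z0 z2)"
proof -
 let ?a = "norm (z1 - z0)" and ?b = "norm (z2 - z0)"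
 let ?k = "%z. kf lo hi (norm z)"
 have g1: "(?k z0 + ?k z1) / 2 * ?a^2 <= kgain lo hi z0 z1"
  and g2: "(?k z0 + ?k z2) / 2 * ?b^2 <= kgain lo hi z0 z2"
  using kgain_ge assms(1) by blast+
 have amgm: "2 * (?a * ?b) <= ?a^2 + ?b^2" using sum_squares_bound[of ?a ?b] by simp
 have low: "x^2 <= c * G" if "1 / c <= (k + k') / 2" "(k + k') / 2 * x^2 <= G" "0 < c" for k k' x G c :: real
 proof -
  have "1 / c * x^2 <= G" using that mult_right_mono[OF that(1), of "x^2"] by (meson order_trans zero_le_power2)
  then show ?thesis using \<open>0 < c\<close> by (simp add: field_simps)
 qed
 have ab0: "0 <= ?a * ?b" "0 <= kgain lo hi z0 z1" "0 <= kgain lo hi z0 z2" using kgain_nonneg by auto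
 \<comment> \<open>The threshold 3/2 separates a centre where \<open>kf\<close> is at least 1/3 from
   a centre at distance more than 1/2 from every point of size 2.\<close>
 consider "?k z0 \<ge> 1/3" | "norm z0 < 3/2" "\<not> lo" "norm z1 \<ge> 2" "norm z2 \<ge> 2"
  | "norm z0 < 3/2" "\<not> lo" "norm z1 \<ge> 2" "norm z2 < 2" | "norm z0 < 3/2" "\<not> lo" "norm z1 < 2" "norm z2 \<ge> 2"
 proof (cases "lo \<or> norm z0 \<ge> 3/2")
  case True
  then have "?k z0 \<ge> 1/3" using kf_ge[of hi "norm z0" "3/2" lo] kf_lo[of hi "norm z0"] assms(1) by (cases lo) auto
  then show ?thesis using that by blast
 next
  case False
  then show ?thesis using that assms(2) by force
 qed
 then show ?thesis
 proof cases
  case 1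
  then have "1 / 6 <= (?k z0 + ?k z1) / 2" "1 / 6 <= (?k z0 + ?k z2) / 2"
   using kf_bounds(1)[of lo hi "norm z1"] kf_bounds(1)[of lo hi "norm z2"] by (simp_all add: field_simps)
  then have "?a^2 <= 6 * kgain lo hi z0 z1" "?b^2 <= 6 * kgain lo hi z0 z2"
   using low[OF _ g1, of 6] low[OF _ g2, of 6] by auto
  then show ?thesis using amgm ab0 by (simp add: distrib_left)
 next
  case 2
  then have "?k z1 \<ge> 1/2" "?k z2 \<ge> 1/2" using kf_ge[of hi _ 2 lo] assms(1) by force+
  then have "1 / 4 <= (?k z0 + ?k z1) / 2" "1 / 4 <= (?k z0 + ?k z2) / 2"
   using kf_bounds(1)[of lo hi "norm z0"] by (simp_all add: field_simps)
  then have "?a^2 <= 4 * kgain lo hi z0 z1" "?b^2 <= 4 * kgain lo hi z0 z2"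
   using low[OF _ g1, of 4] low[OF _ g2, of 4] by auto
  then show ?thesis using amgm ab0 by (simp add: distrib_left)
 next
  case 3
  then have "?k z1 \<ge> 1/2" using kf_ge[of hi _ 2 lo] assms(1) by force
  then have "1 / 4 <= (?k z0 + ?k z1) / 2"
   using kf_bounds(1)[of lo hi "norm z0"] by (simp add: field_simps)
  then have "?a^2 <= 4 * kgain lo hi z0 z1" using low[OF _ g1, of 4] by auto
  \<comment> \<open>Here \<open>?a > 1/2\<close> and \<open>?b < 7/2\<close>, which produces the 7
    and, with the factor 4 just obtained, the constant 28.\<close>
  moreover have "?b <= 7 * ?a" using 3 norm_triangle_ineq2[of z1 z0] norm_triangle_ineq4[of z2 z0] by linarith
  then have "?a * ?b <= 7 * ?a^2" using mult_left_mono[of ?b "7 * ?a" ?a] by (simp add: power2_eq_square)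
  ultimately show ?thesis using ab0 by (simp add: distrib_left)
 next
  case 4
  then have "?k z2 \<ge> 1/2" using kf_ge[of hi _ 2 lo] assms(1) by force
  then have "1 / 4 <= (?k z0 + ?k z2) / 2"
   using kf_bounds(1)[of lo hi "norm z0"] by (simp add: field_simps)
  then have "?b^2 <= 4 * kgain lo hi z0 z2" using low[OF _ g2, of 4] by auto
  moreover have "?a <= 7 * ?b" using 4 norm_triangle_ineq2[of z2 z0] norm_triangle_ineq4[of z1 z0] by linarith
  then have "?a * ?b <= 7 * ?b^2" using mult_right_mono[of ?a "7 * ?b" ?b] by (simp add: power2_eq_square)
  ultimately show ?thesis using ab0 by (simp add: distrib_left)
 qed
qed

section \<open>Superposition of truncated squares over geometric scales\<close>

locale scales =
 fixes p \<rho> l0 :: real and J :: nat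
 assumes p: "2 <= p" and \<rho>: "1 < \<rho>" "\<rho> powr (p - 1) = 3 / 2" and l0: "0 < l0"
begin

definition sc :: "nat => real" where "sc j = l0 * \<rho> ^ j"

text \<open>This anisotropic scaling multiplies both \<open>norm u powr p\<close> and
  \<open>norm w powr q\<close>, with \<open>q\<close> the conjugate exponent, by the same factor
  \<open>sc j powr (- p)\<close>; the product \<open>norm u * norm w\<close> scales in the same
  way.\<close>

definition rs :: "nat => 'a::real_inner \<times> 'a => 'a \<times> 'a" where
 "rs j z = (fst z /\<^sub>R sc j, snd z /\<^sub>R sc j powr (p - 1))"

definition kj :: "nat => 'a::real_inner \<times> 'a => real" where
 "kj j z = kf (j = 0) (j = J) (norm (rs j z))"

text \<open>Adjacent truncation windows overlap; only the lowest scale keeps the small values and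
  only the highest one the large values. The prefactor undoes the scaling of the product of the two
  norms.\<close>

definition BB :: "'a::real_inner \<times> 'a => real" where
 "BB z = (\<Sum>j\<le>J. sc j powr p * hf (j = 0) (j = J) (norm (rs j z)))"

text \<open>The gradient of \<open>BB\<close>; \<open>rs j\<close> is linear and self-adjoint, so
  the chain rule applies it twice.\<close>

definition GG :: "'a::real_inner \<times> 'a => 'a \<times> 'a" where
 "GG z = (\<Sum>j\<le>J. (sc j powr p * kj j z) *\<^sub>R rs j (rs j z))"

lemma sc_pos: "0 < sc j"
 using l0 \<rho> by (simp add: sc_def)

lemma sc_powr: "sc j powr p = sc j * sc j powr (p - 1)"
 using sc_pos[of j] powr_mult_base[of "sc j" "p - 1"] by simp

lemma rs_inner: "rs j z \<bullet> z' = z \<bullet> rs j z'"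
 by (simp add: rs_def inner_prod_def)

lemma rs_diff: "rs j (z - z') = rs j z - rs j z'"
 by (simp add: rs_def scaleR_diff_right)

lemma rs_zero: "rs j 0 = 0" by (simp add: rs_def zero_prod_def)

lemma GG_inner: "GG z \<bullet> h = (\<Sum>j\<le>J. sc j powr p * (kj j z * (rs j z \<bullet> rs j h)))"
 by (simp add: GG_def inner_sum_left rs_inner mult.assoc)

lemma norm_rs_le: "norm (rs j z) <= (1 / sc j + 1 / sc j powr (p - 1)) * norm z"
proof -
 have "norm (rs j z) <= norm (fst z /\<^sub>R sc j) + norm (snd z /\<^sub>R sc j powr (p - 1))"
  unfolding rs_def by (rule norm_Pair_le)
 also have "\<dots> = norm (fst z) / sc j + norm (snd z) / sc j powr (p - 1)"
  using sc_pos[of j] by (simp add: divide_inverse)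
 also have "\<dots> <= norm z / sc j + norm z / sc j powr (p - 1)"
  using sc_pos[of j] norm_fst_le[of "fst z" "snd z"] norm_snd_le[of "snd z" "fst z"]
  by (intro add_mono divide_right_mono) auto
 finally show ?thesis by (simp add: algebra_simps)
qed

lemma BB_taylor: "\<exists>L\<ge>0. \<forall>z z' :: 'a::real_inner \<times> 'a. BB z' <= BB z + GG z \<bullet> (z' - z) + L * (norm (z' - z))^2"
proof (intro exI conjI allI)
 let ?c = "%j. 1 / sc j + 1 / sc j powr (p - 1)"
 let ?L = "\<Sum>j\<le>J. sc j powr p * (?c j)^2 / 2"
 show "0 <= ?L" by (intro sum_nonneg) auto
 fix z z' :: "'a \<times> 'a"
 have "BB z' <= (\<Sum>j\<le>J. sc j powr p * hf (j = 0) (j = J) (norm (rs j z))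
   + sc j powr p * (kj j z * (rs j z \<bullet> rs j (z' - z))) + sc j powr p * (?c j)^2 / 2 * (norm (z' - z))^2)"
  unfolding BB_def
 proof (rule sum_mono)
  fix j assume "j \<in> {..J}"
  have "(norm (rs j (z' - z)))^2 <= (?c j * norm (z' - z))^2"
   by (rule power_mono[OF norm_rs_le]) simp
  then have "hf (j = 0) (j = J) (norm (rs j z')) <= hf (j = 0) (j = J) (norm (rs j z))
   + kj j z * (rs j z \<bullet> rs j (z' - z)) + (?c j)^2 * (norm (z' - z))^2 / 2"
   using hf_taylor[of "j = 0" "j = J" "rs j z'" "rs j z"]
   by (simp add: kj_def rs_diff power_mult_distrib)
  from mult_left_mono[OF this, of "sc j powr p"]
  show "sc j powr p * hf (j = 0) (j = J) (norm (rs j z')) <= sc j powr p * hf (j = 0) (j = J) (norm (rs j z))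
   + sc j powr p * (kj j z * (rs j z \<bullet> rs j (z' - z))) + sc j powr p * (?c j)^2 / 2 * (norm (z' - z))^2"
   by (simp add: algebra_simps)
 qed
 also have "\<dots> = BB z + GG z \<bullet> (z' - z) + ?L * (norm (z' - z))^2"
  by (simp add: BB_def GG_inner sum.distrib sum_distrib_right)
 finally show "BB z' <= BB z + GG z \<bullet> (z' - z) + ?L * (norm (z' - z))^2" .
qed

lemma GG_bound: "\<exists>L\<ge>0. \<forall>z :: 'a::real_inner \<times> 'a. norm (GG z) <= L * norm z"
proof (intro exI conjI allI)
 let ?c = "%j. 1 / sc j + 1 / sc j powr (p - 1)"
 have c: "0 <= ?c j" for j using sc_pos[of j] by simp
 let ?L = "\<Sum>j\<le>J. sc j powr p * (?c j * ?c j)"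
 show "0 <= ?L" using c by (intro sum_nonneg mult_nonneg_nonneg) auto
 fix z :: "'a \<times> 'a"
 have "norm (GG z) <= (\<Sum>j\<le>J. sc j powr p * (?c j * ?c j) * norm z)"
  unfolding GG_def
 proof (rule sum_norm_le)
  fix j
  have "norm (rs j (rs j z)) <= ?c j * norm (rs j z)" by (rule norm_rs_le)
  also have "\<dots> <= ?c j * (?c j * norm z)" by (rule mult_left_mono[OF norm_rs_le c])
  finally have r: "norm (rs j (rs j z)) <= ?c j * (?c j * norm z)" .
  have "norm ((sc j powr p * kj j z) *\<^sub>R rs j (rs j z)) = sc j powr p * (kj j z * norm (rs j (rs j z)))"
   using kf_bounds(1) by (simp add: kj_def abs_mult)
  also have "\<dots> <= sc j powr p * (1 * (?c j * (?c j * norm z)))"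
   using kf_bounds r by (intro mult_left_mono mult_mono) (auto simp: kj_def)
  finally show "norm ((sc j powr p * kj j z) *\<^sub>R rs j (rs j z)) <= sc j powr p * (?c j * ?c j) * norm z"
   by (simp add: mult.assoc)
 qed
 then show "norm (GG z) <= ?L * norm z" by (simp add: sum_distrib_right)
qed

lemma continuous_rs [continuous_intros]: "continuous_on S f ==> continuous_on S (%x. rs j (f x))"
 by (simp add: rs_def) (intro continuous_intros)

lemma continuous_BB: "continuous_on S BB"
 unfolding BB_def by (intro continuous_intros)

lemma continuous_GG: "continuous_on S GG"
 unfolding GG_def kj_def by (intro continuous_intros)

lemma gain_eq: "(GG z' - GG z) \<bullet> (z' - z) = (\<Sum>j\<le>J. sc j powr p * kgain (j = 0) (j = J) (rs j z) (rs j z'))"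
proof -
 have "(GG z' - GG z) \<bullet> (z' - z) = (\<Sum>j\<le>J. sc j powr p * (kj j z' * (rs j z' \<bullet> rs j (z' - z))) - sc j powr p * (kj j z * (rs j z \<bullet> rs j (z' - z))))"
  by (simp only: inner_diff_left GG_inner sum_subtractf)
 also have "\<dots> = (\<Sum>j\<le>J. sc j powr p * kgain (j = 0) (j = J) (rs j z) (rs j z'))"
  by (intro sum.cong refl) (simp add: kgain_def kj_def rs_diff inner_diff_left algebra_simps)
 finally show ?thesis .
qed

lemma gain_nonneg: "0 <= (GG z' - GG z) \<bullet> (z' - z)"
 unfolding gain_eq by (intro sum_nonneg mult_nonneg_nonneg kgain_nonneg) auto

text \<open>The ratio \<open>\<rho>\<close> is chosen so that the second component changes exactly
  by 3/2, and \<open>p >= 2\<close> makes the factor \<open>\<rho>\<close> of the first component no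
  larger. This 3/2 is the ratio of the thresholds 3 and 2 in
  \<open>kgain_three_points\<close>.\<close>

lemma norm_rs_Suc: "norm (rs j z) <= 3 / 2 * norm (rs (Suc j) z)"
proof -
 have s: "sc (Suc j) = \<rho> * sc j" by (simp add: sc_def)
 have r: "\<rho> <= 3 / 2" using \<rho> p powr_mono[of 1 "p - 1" \<rho>] by simp
 have "rs j z = (\<rho> *\<^sub>R fst (rs (Suc j) z), (3/2) *\<^sub>R snd (rs (Suc j) z))"
  using sc_pos[of j] \<rho> by (simp add: rs_def s powr_mult del: \<rho>(2)) (simp add: \<rho>(2))
 also have "norm \<dots> <= 3 / 2 * norm (rs (Suc j) z)"
 proof -
  have "(\<rho> * norm (fst (rs (Suc j) z)))^2 <= (3/2 * norm (fst (rs (Suc j) z)))^2"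
   using r \<rho> by (intro power_mono mult_right_mono) auto
  then have "(norm (\<rho> *\<^sub>R fst (rs (Suc j) z), (3/2) *\<^sub>R snd (rs (Suc j) z)))^2 <= (3 / 2 * norm (rs (Suc j) z))^2"
   using \<rho> by (simp add: norm_prod_def power_mult_distrib power_divide algebra_simps)
  then show ?thesis by (rule power2_le_imp_le) simp
 qed
 finally show ?thesis .
qed

text \<open>Take the least scale at which no point exceeds 3, the top scale being always admissible.
  If it is not 0, some point exceeds 3 one scale below, hence 2 at this scale.\<close>

lemma good_scale:
 obtains j where "j <= J" "j = J \<or> (norm (rs j z0) <= 3 & norm (rs j z1) <= 3 & norm (rs j z2) <= 3)"
  "j = 0 \<or> 2 <= norm (rs j z0) \<or> 2 <= norm (rs j z1) \<or> 2 <= norm (rs j z2)"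
proof -
 define P where "P j \<longleftrightarrow> j = J \<or> (norm (rs j z0) <= 3 & norm (rs j z1) <= 3 & norm (rs j z2) <= 3)" for j
 define j where "j = (LEAST j. P j)"
 have "P J" by (simp add: P_def)
 then have j: "P j" "j <= J" unfolding j_def by (auto intro: LeastI Least_le)
 have "j = 0 \<or> 2 <= norm (rs j z0) \<or> 2 <= norm (rs j z1) \<or> 2 <= norm (rs j z2)"
 proof (cases j)
  case (Suc i)
  then have "\<not> P i" using not_less_Least[of i P] by (simp add: j_def)
  then show ?thesis using norm_rs_Suc[of i z0] norm_rs_Suc[of i z1] norm_rs_Suc[of i z2]
   by (auto simp: P_def Suc)
 qed simp
 then show thesis using that j by (auto simp: P_def)
qed

lemma norm_fst_rs: "norm (fst z) <= sc j * norm (rs j z)"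
 using sc_pos[of j] norm_fst_le[of "fst (rs j z)" "snd (rs j z)"]
 by (simp add: rs_def field_simps)

lemma norm_snd_rs: "norm (snd z) <= sc j powr (p - 1) * norm (rs j z)"
 using sc_pos[of j] norm_snd_le[of "snd (rs j z)" "fst (rs j z)"]
 by (simp add: rs_def field_simps)

text \<open>All scales contribute nonnegatively, so the single good scale already carries the
  estimate; by \<open>sc_powr\<close> the product of the two differences rescales exactly by the
  weight of that scale.\<close>

lemma three_points:
 "norm (fst (z1 - z0)) * norm (snd (z2 - z0)) <= 28 * ((GG z1 - GG z0) \<bullet> (z1 - z0) + (GG z2 - GG z0) \<bullet> (z2 - z0))"
proof -
 obtain j where j: "j <= J" "j = J \<or> (norm (rs j z0) <= 3 & norm (rs j z1) <= 3 & norm (rs j z2) <= 3)"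
  "j = 0 \<or> 2 <= norm (rs j z0) \<or> 2 <= norm (rs j z1) \<or> 2 <= norm (rs j z2)"
  by (rule good_scale)
 have "norm (fst (z1 - z0)) * norm (snd (z2 - z0))
  <= (sc j * norm (rs j (z1 - z0))) * (sc j powr (p - 1) * norm (rs j (z2 - z0)))"
  by (intro mult_mono norm_fst_rs norm_snd_rs) (use sc_pos[of j] in auto)
 also have "\<dots> = sc j powr p * (norm (rs j z1 - rs j z0) * norm (rs j z2 - rs j z0))"
  by (simp add: sc_powr rs_diff)
 also have "\<dots> <= sc j powr p * (28 * (kgain (j = 0) (j = J) (rs j z0) (rs j z1) + kgain (j = 0) (j = J) (rs j z0) (rs j z2)))"
  using j by (intro mult_left_mono kgain_three_points) auto
 also have "\<dots> = 28 * (sc j powr p * kgain (j = 0) (j = J) (rs j z0) (rs j z1) + sc j powr p * kgain (j = 0) (j = J) (rs j z0) (rs j z2))"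
  by (simp add: algebra_simps)
 also have "\<dots> <= 28 * ((GG z1 - GG z0) \<bullet> (z1 - z0) + (GG z2 - GG z0) \<bullet> (z2 - z0))"
  unfolding gain_eq
  by (intro mult_left_mono add_mono member_le_sum[of j "{..J}" "%j. sc j powr p * kgain (j = 0) (j = J) (rs j z0) (rs j _)"])
   (use j(1) in \<open>auto intro!: mult_nonneg_nonneg kgain_nonneg\<close>)
 finally show ?thesis .
qed

text \<open>By the inequality between arithmetic and geometric means every scale contributes at
  least twice the product, times \<open>kj\<close>, and at the good scale of \<open>z\<close> the
  factor \<open>kj\<close> is at least 1/2.\<close>

lemma rank_one:
 "\<bar>fst z \<bullet> a\<bar> * \<bar>snd z \<bullet> a\<bar> <= GG z \<bullet> ((fst z \<bullet> a) *\<^sub>R a, (snd z \<bullet> a) *\<^sub>R a)"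
proof -
 let ?h = "((fst z \<bullet> a) *\<^sub>R a, (snd z \<bullet> a) *\<^sub>R a)"
 have rh: "2 * (\<bar>fst z \<bullet> a\<bar> * \<bar>snd z \<bullet> a\<bar>) <= sc j powr p * (rs j z \<bullet> rs j ?h)" for j
 proof -
  let ?x = "\<bar>fst z \<bullet> a\<bar> / sc j" and ?y = "\<bar>snd z \<bullet> a\<bar> / sc j powr (p - 1)"
  have "2 * (\<bar>fst z \<bullet> a\<bar> * \<bar>snd z \<bullet> a\<bar>) = sc j powr p * (2 * ?x * ?y)"
   using sc_pos[of j] by (simp add: sc_powr)
  also have "\<dots> <= sc j powr p * (?x^2 + ?y^2)"
   by (intro mult_left_mono sum_squares_bound) auto
  also have "\<dots> = sc j powr p * (rs j z \<bullet> rs j ?h)"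
   by (simp add: rs_def inner_prod_def power2_eq_square divide_inverse algebra_simps)
  finally show ?thesis .
 qed
 obtain j where j: "j <= J" "j = J \<or> norm (rs j z) <= 3" "j = 0 \<or> 2 <= norm (rs j z)"
  using good_scale[of z z z] by blast
 have k: "1 / 2 <= kj j z"
  using j kf_lo[of "j = J" "norm (rs j z)"] kf_ge[of "j = J" "norm (rs j z)" 2 "j = 0"]
  by (cases "j = 0") (auto simp: kj_def)
 have "\<bar>fst z \<bullet> a\<bar> * \<bar>snd z \<bullet> a\<bar> = 1 / 2 * (2 * (\<bar>fst z \<bullet> a\<bar> * \<bar>snd z \<bullet> a\<bar>))" by simp
 also have "\<dots> <= kj j z * (sc j powr p * (rs j z \<bullet> rs j ?h))"
  using k rh[of j] by (intro mult_mono[of "1/2"]) (auto simp del: mult_le_cancel_left)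
 also have "\<dots> = sc j powr p * (kj j z * (rs j z \<bullet> rs j ?h))" by simp
 also have "\<dots> <= (\<Sum>j\<le>J. sc j powr p * (kj j z * (rs j z \<bullet> rs j ?h)))"
 proof (rule member_le_sum)
  fix i
  have "0 <= sc i powr p * (rs i z \<bullet> rs i ?h)" using rh[of i] by (smt (verit) mult_nonneg_nonneg abs_ge_zero)
  then have "0 <= rs i z \<bullet> rs i ?h" using sc_pos[of i] by (simp add: zero_le_mult_iff)
  then show "0 <= sc i powr p * (kj i z * (rs i z \<bullet> rs i ?h))"
   using kf_bounds(1) by (simp add: kj_def)
 qed (use j in auto)
 also have "\<dots> = GG z \<bullet> ?h" by (simp add: GG_inner)
 finally show ?thesis .
qed

lemma BB_nonneg: "0 <= BB z"
 unfolding BB_def by (intro sum_nonneg mult_nonneg_nonneg hf_nonneg) auto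

lemma BB_zero: "BB 0 = 0"
 by (simp add: BB_def rs_zero hf_zero)

lemma GG_zero: "GG 0 = 0"
 by (simp add: GG_def rs_zero)

text \<open>The scales not exceeding \<open>X\<close> form a geometric progression, dominated by its
  largest member.\<close>

lemma sum_sc_le:
 assumes "0 <= X"
 shows "(\<Sum>j\<le>n. if sc j <= X then sc j else 0) <= X * (\<rho> / (\<rho> - 1))"
proof (induction n)
 case 0
 have "X <= X * (\<rho> / (\<rho> - 1))" using assms \<rho> by (simp add: field_simps)
 then show ?case using assms unfolding atMost_0 by (auto split: if_splits)
next
 case (Suc n)
 show ?case
 proof (cases "sc (Suc n) <= X")
  case True
  have "sc j <= X" if "j <= Suc n" for j
  proof -
   have "sc j <= sc (Suc n)" using l0 \<rho> that by (auto simp: sc_def simp del: power_Suc intro!: power_increasing)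
   then show ?thesis using True by simp
  qed
  then have "(\<Sum>j\<le>Suc n. if sc j <= X then sc j else 0) = (\<Sum>j\<le>Suc n. sc j)"
   by (intro sum.cong) auto
  also have "\<dots> = l0 * ((\<rho> ^ Suc (Suc n) - 1) / (\<rho> - 1))"
   using \<rho> by (simp add: sc_def sum_distrib_left[symmetric] geometric_sum lessThan_Suc_atMost[symmetric] del: power_Suc sum.lessThan_Suc sum.atMost_Suc)
  also have "\<dots> <= l0 * (\<rho> ^ Suc (Suc n) / (\<rho> - 1))"
   using l0 \<rho> by (intro mult_left_mono divide_right_mono) auto
  also have "\<dots> = sc (Suc n) * (\<rho> / (\<rho> - 1))" by (simp add: sc_def)
  also have "\<dots> <= X * (\<rho> / (\<rho> - 1))" using True \<rho> by (intro mult_right_mono) auto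
  finally show ?thesis .
 qed (use Suc in auto)
qed

definition Cup :: real where "Cup = 3 * (2 powr (p - 2) + 1) * (2 * (\<rho> / (\<rho> - 1)))"

text \<open>With \<open>\<Lambda>\<close> the joint magnitude of the pair, only scales up to
  \<open>2 * \<Lambda>\<close> are active, apart from the lowest one. Linear growth of
  \<open>hf\<close> makes each of them cost a multiple of
  \<open>\<Lambda> powr (p - 1) * sc j\<close>, and \<open>sum_sc_le\<close> sums these to a
  multiple of \<open>\<Lambda> powr p\<close>.\<close>

lemma BB_upper:
 fixes z :: "'a::real_inner \<times> 'a"
 assumes top: "norm (rs J z) <= 1" and \<Lambda>: "\<Lambda> \<ge> 0" "norm (fst z) <= \<Lambda>" "norm (snd z) <= \<Lambda> powr (p - 1)"
 shows "BB z <= Cup * \<Lambda> powr p + l0 powr p / 2"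
proof -
 let ?X = "2 * \<Lambda>"
 let ?c = "3 * (2 powr (p - 2) + 1) * \<Lambda> powr (p - 1)"
 have "sc j powr p * hf (j = 0) (j = J) (norm (rs j z)) <= ?c * (if sc j <= ?X then sc j else 0) + (if j = 0 then l0 powr p / 2 else 0)"
  if "j <= J" for j
 proof (cases "norm (rs j z) <= 1")
  case True
  have "sc j powr p * hf (j = 0) (j = J) (norm (rs j z)) <= sc j powr p * (if j = 0 then 1/2 else 0)"
   using hf_small[OF _ True] by (intro mult_left_mono) (auto split: if_splits)
  also have "\<dots> = (if j = 0 then l0 powr p / 2 else 0)" by (simp add: sc_def)
  also have "\<dots> <= ?c * (if sc j <= ?X then sc j else 0) + \<dots>"
   using sc_pos[of j] by (auto intro!: mult_nonneg_nonneg)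
  finally show ?thesis .
 next
  case False
  then have nJ: "j ~= J" using top by auto
  define t where "t = \<Lambda> / sc j"
  have t0: "0 <= t" using sc_pos[of j] \<Lambda> by (simp add: t_def)
  have "norm (rs j z) <= norm (fst z) / sc j + norm (snd z) / sc j powr (p - 1)"
   using norm_Pair_le[of "fst z /\<^sub>R sc j" "snd z /\<^sub>R sc j powr (p - 1)"] sc_pos[of j]
   by (simp add: rs_def divide_inverse mult.commute)
  also have "\<dots> <= t + t powr (p - 1)"
   unfolding t_def using \<Lambda> sc_pos[of j] by (simp add: powr_divide add_mono divide_right_mono)
  finally have n: "norm (rs j z) <= t + t powr (p - 1)" .
  \<comment> \<open>Were \<open>t < 1/2\<close>, then \<open>t powr (p - 1) <= t\<close> because
    \<open>p >= 2\<close>, and the rescaled norm would not exceed 1.\<close>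
  have t: "1 / 2 <= t"
  proof (rule ccontr)
   assume *: "\<not> 1 / 2 <= t"
   have "t powr (p - 1) <= t" using * t0 p powr_mono'[of 1 "p - 1" t] by (cases "t = 0") auto
   then show False using n False * by linarith
  qed
  then have "t > 0" by linarith
  have "t = t powr (2 - p) * t powr (p - 1)" using \<open>t > 0\<close> by (simp add: powr_add[symmetric])
  also have "t powr (2 - p) = (1 / t) powr (p - 2)" using \<open>t > 0\<close> by (simp add: powr_divide powr_diff)
  also have "(1 / t) powr (p - 2) <= 2 powr (p - 2)" using t p \<open>t > 0\<close> by (intro powr_mono2) (auto simp: field_simps)
  finally have tt: "t <= 2 powr (p - 2) * t powr (p - 1)" by (simp add: mult_right_mono)
  have "sc j powr p * hf (j = 0) (j = J) (norm (rs j z)) <= sc j powr p * (3 * norm (rs j z))"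
   using nJ by (intro mult_left_mono hf_linear) auto
  also have "\<dots> <= sc j powr p * (3 * ((2 powr (p - 2) + 1) * t powr (p - 1)))"
   using n tt by (intro mult_left_mono) (auto simp: algebra_simps)
  also have "\<dots> = ?c * sc j" using sc_pos[of j] \<Lambda> by (simp add: t_def powr_divide sc_powr)
  also have "\<dots> <= ?c * (if sc j <= ?X then sc j else 0) + (if j = 0 then l0 powr p / 2 else 0)"
   using t sc_pos[of j] by (auto simp: t_def field_simps)
  finally show ?thesis .
 qed
 then have "BB z <= (\<Sum>j\<le>J. ?c * (if sc j <= ?X then sc j else 0) + (if j = 0 then l0 powr p / 2 else 0))"
  unfolding BB_def by (intro sum_mono) auto
 also have "\<dots> = ?c * (\<Sum>j\<le>J. if sc j <= ?X then sc j else 0) + l0 powr p / 2"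
  by (simp add: sum.distrib sum_distrib_left)
 also have "\<dots> <= ?c * (?X * (\<rho> / (\<rho> - 1))) + l0 powr p / 2"
  using \<Lambda> by (intro add_right_mono mult_left_mono sum_sc_le) auto
 also have "\<dots> = 3 * (2 powr (p - 2) + 1) * (2 * (\<rho> / (\<rho> - 1))) * (\<Lambda> * \<Lambda> powr (p - 1)) + l0 powr p / 2"
  by (simp add: mult_ac)
 also have "\<Lambda> * \<Lambda> powr (p - 1) = \<Lambda> powr p" using \<Lambda> powr_mult_base[of \<Lambda> "p - 1"] by simp
 finally show ?thesis by (simp add: Cup_def)
qed

end

text \<open>\<open>G\<close> stands for the gradient of \<open>B\<close>. The last two clauses are the quantitative convexity: the first controls the
  product of a difference of \<open>u\<close> with a difference of \<open>w\<close>, possibly in different directions, the second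
  controls the contribution of the zero order term \<open>V''\<close>.\<close>

definition bellman :: "('a::real_inner \<times> 'a => real) => ('a \<times> 'a => 'a \<times> 'a) => real => bool" where
 "bellman B G L \<longleftrightarrow> 0 <= L \<and>
   cont B & cont G & B 0 = 0 & G 0 = 0 & (\<forall>z. 0 <= B z) \<and>
   (\<forall>z z'. B z' <= B z + G z \<bullet> (z' - z) + L * (norm (z' - z))^2) \<and>
   (\<forall>z. norm (G z) <= L * norm z) \<and>
   (\<forall>z z'. 0 <= (G z' - G z) \<bullet> (z' - z)) \<and>
   (\<forall>z0 z1 z2. norm (fst (z1 - z0)) * norm (snd (z2 - z0))
     <= 28 * ((G z1 - G z0) \<bullet> (z1 - z0) + (G z2 - G z0) \<bullet> (z2 - z0))) \<and>
   (\<forall>z a. \<bar>fst z \<bullet> a\<bar> * \<bar>snd z \<bullet> a\<bar> <= G z \<bullet> ((fst z \<bullet> a) *\<^sub>R a, (snd z \<bullet> a) *\<^sub>R a))"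

text \<open>The rescalings \<open>\<rho>\<^sup>j\<close> cover all magnitudes up to \<open>R\<close>, so only the untruncated last scale is active above \<open>R\<close>.\<close>

lemma bellman_function:
 fixes p :: real
 assumes "2 <= p"
 obtains C where "0 < C" and
  "!!R \<epsilon>. 0 < R ==> 0 < \<epsilon> ==> \<exists>(B :: 'a::real_inner \<times> 'a => real) G L. bellman B G L \<and>
   (\<forall>u w. norm u <= R --> norm w <= R -->
     B (u, w) <= C * (norm u powr p + norm w powr (p / (p - 1))) + \<epsilon>)"
proof -
 define \<rho> :: real where "\<rho> = (3/2) powr (1 / (p - 1))"
 have \<rho>: "1 < \<rho>" "\<rho> powr (p - 1) = 3 / 2"
  using assms by (auto simp: \<rho>_def powr_powr)
 define C where "C = 3 * (2 powr (p - 2) + 1) * (2 * (\<rho> / (\<rho> - 1)))"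
 have C: "0 < C" using \<rho> by (auto simp: C_def intro!: mult_pos_pos add_pos_pos divide_pos_pos add_nonneg_pos)
 show thesis
 proof (rule that[OF C])
  fix R \<epsilon> :: real assume R: "0 < R" and \<epsilon>: "0 < \<epsilon>"
  \<comment> \<open>The lowest scale contributes at most \<open>l0 powr p / 2\<close> at small
    arguments, and this is to stay below \<open>\<epsilon>\<close>.\<close>
  define l0 where "l0 = \<epsilon> powr (1 / p)"
  have l0: "0 < l0" and l0p: "l0 powr p = \<epsilon>" using \<epsilon> assms by (auto simp: l0_def powr_powr)
  \<comment> \<open>\<open>sc J >= 2 * R + 1\<close> keeps both rescaled components below 1/2, and
    \<open>sc J >= 1\<close> makes \<open>sc J powr (p - 1)\<close> at least as large as
    \<open>sc J\<close>.\<close>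
  obtain J where J: "(2 * R + 1) / l0 + 1 < \<rho> ^ J" using real_arch_pow[OF \<rho>(1)] by blast
  interpret scales p \<rho> l0 J by unfold_locales (use assms \<rho> l0 in auto)
  have CC: "C = Cup" by (simp add: C_def Cup_def)
  have "(2 * R + 1) / l0 <= \<rho> ^ J" using J by linarith
  then have scJ: "2 * R + 1 <= sc J" using l0 by (simp add: sc_def field_simps)
  have scJ': "sc J <= sc J powr (p - 1)"
   using scJ R assms powr_mono[of 1 "p - 1" "sc J"] by simp
  obtain L1 where L1: "0 <= L1" "!!z z' :: 'a \<times> 'a. BB z' <= BB z + GG z \<bullet> (z' - z) + L1 * (norm (z' - z))^2"
   using BB_taylor by blast
  obtain L2 where L2: "0 <= L2" "!!z :: 'a \<times> 'a. norm (GG z) <= L2 * norm z"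
   using GG_bound by blast
  have up: "BB (u, w) <= C * (norm u powr p + norm w powr (p / (p - 1))) + \<epsilon>"
   if "norm u <= R" "norm w <= R" for u w :: 'a
  proof -
   define \<Lambda> where "\<Lambda> = max (norm u) (norm w powr (1 / (p - 1)))"
   have "norm (rs J (u, w)) <= norm u / sc J + norm w / sc J powr (p - 1)"
    using norm_Pair_le[of "u /\<^sub>R sc J" "w /\<^sub>R sc J powr (p - 1)"] sc_pos[of J]
    by (simp add: rs_def divide_inverse mult.commute)
   also have "\<dots> <= R / sc J + R / sc J"
    using that scJ' sc_pos[of J] R by (intro add_mono frac_le) auto
   also have "\<dots> <= 1" using scJ R by (simp add: field_simps)
   finally have 1: "norm (rs J (u, w)) <= 1" .
   have 2: "norm (snd (u, w)) <= \<Lambda> powr (p - 1)"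
    using powr_mono2[of "p - 1" "norm w powr (1 / (p - 1))" \<Lambda>] assms
    by (simp add: \<Lambda>_def powr_powr)
   have "BB (u, w) <= Cup * \<Lambda> powr p + l0 powr p / 2"
    by (rule BB_upper[OF 1 _ _ 2]) (auto simp: \<Lambda>_def le_max_iff_disj)
   also have "\<Lambda> powr p <= norm u powr p + norm w powr (p / (p - 1))"
    by (auto simp: \<Lambda>_def max_def powr_powr)
   finally have "BB (u, w) <= Cup * (norm u powr p + norm w powr (p / (p - 1))) + l0 powr p / 2"
    using C by (simp add: CC mult_left_mono)
   then show ?thesis using l0p \<epsilon> unfolding CC by linarith
  qed
  have T: "BB z' <= BB z + GG z \<bullet> (z' - z) + max L1 L2 * (norm (z' - z))^2" for z z' :: "'a \<times> 'a"
   using L1(2)[of z' z] mult_right_mono[of L1 "max L1 L2" "(norm (z' - z))^2"] by simp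
  have N: "norm (GG z) <= max L1 L2 * norm z" for z :: "'a \<times> 'a"
   using L2(2)[of z] mult_right_mono[of L2 "max L1 L2" "norm z"] by simp
  have T3: "\<forall>z0 z1 z2 :: 'a \<times> 'a. norm (fst (z1 - z0)) * norm (snd (z2 - z0))
     <= 28 * ((GG z1 - GG z0) \<bullet> (z1 - z0) + (GG z2 - GG z0) \<bullet> (z2 - z0))"
   using three_points by blast
  show "\<exists>(B :: 'a \<times> 'a => real) G L. bellman B G L \<and>
   (\<forall>u w. norm u <= R --> norm w <= R -->
     B (u, w) <= C * (norm u powr p + norm w powr (p / (p - 1))) + \<epsilon>)"
   unfolding bellman_def
   by (intro exI[of _ BB] exI[of _ GG] exI[of _ "max L1 L2"] conjI allI impI T3[rule_format])
    (use L1(1) T N up continuous_BB continuous_GG BB_zero GG_zero BB_nonneg gain_nonneg rank_one in auto)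
 qed
qed

section \<open>Finite differences in a weighted space\<close>

text \<open>The discrete fields live in this class: it is stable under translation and under all
  difference operators below, and every weighted integral converges on it.\<close>

definition cc :: "('a::euclidean_space => 'b::real_normed_vector) => bool" where
 "cc f \<longleftrightarrow> cont f & (\<exists>R. \<forall>x. R < norm x --> f x = 0)"

lemma ccI: "cont f ==> (!!x. R < norm x ==> f x = 0) ==> cc f"
 by (auto simp: cc_def)

lemma ccE:
 assumes "cc f" obtains R where "0 < R" "!!x. R < norm x ==> f x = 0"
proof -
 obtain R where R: "!!x. R < norm x ==> f x = 0" using assms by (auto simp: cc_def)
 show ?thesis by (rule that[of "max R 1"]) (auto intro: R)
qed

lemma cc_cont: "cc f ==> continuous_on S f"
 by (auto simp: cc_def intro: continuous_on_subset)

lemma cc_cont_compose: "cc f ==> continuous_on S g ==> continuous_on S (%x. f (g x))"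
 using continuous_on_compose2[of UNIV f S g] by (auto simp: cc_def)

lemma cc_compose:
 assumes "cc f" "cont g" "g 0 = 0"
 shows "cc (%x. g (f x))"
proof -
 obtain R where R: "!!x. R < norm x ==> f x = 0" using ccE[OF assms(1)] by metis
 show ?thesis
  by (rule ccI[of _ R]) (use R assms(3) in \<open>auto intro!: continuous_on_compose2[OF assms(2)] cc_cont[OF assms(1)]\<close>)
qed

lemma cc_compose2:
 assumes "cc f" "cc g" "cont (%x. h (f x) (g x))" "h 0 0 = 0"
 shows "cc (%x. h (f x) (g x))"
proof -
 obtain R where R: "!!x. R < norm x ==> f x = 0" using ccE[OF assms(1)] by metis
 obtain R' where R': "!!x. R' < norm x ==> g x = 0" using ccE[OF assms(2)] by metis
 show ?thesis
  by (rule ccI[of _ "max R R'"]) (use assms R R' in auto)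
qed

named_theorems cc_intros

lemma cc_zero [cc_intros]: "cc (%x. 0)" by (simp add: cc_def)

lemma cc_add [cc_intros]: "cc f ==> cc g ==> cc (%x. f x + g x)"
 by (rule cc_compose2[where h = "(+)"]) (auto intro!: continuous_intros intro: cc_cont)

lemma cc_diff [cc_intros]: "cc f ==> cc g ==> cc (%x. f x - g x)"
 by (rule cc_compose2[where h = "(-)"]) (auto intro!: continuous_intros intro: cc_cont)

lemma cc_minus [cc_intros]: "cc f ==> cc (%x. - f x)"
 by (rule cc_compose) (auto intro!: continuous_intros)

lemma cc_Pair [cc_intros]: "cc f ==> cc g ==> cc (%x. (f x, g x))"
 by (rule cc_compose2[where h = Pair]) (auto intro!: continuous_intros intro: cc_cont simp: zero_prod_def)

lemma cc_scaleR_left: "cont c ==> cc f ==> cc (%x. c x *\<^sub>R f x)"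
 by (auto simp: cc_def intro!: continuous_intros)

lemma cc_scaleR_right: "cc c ==> cont f ==> cc (%x. c x *\<^sub>R f x)"
 by (auto simp: cc_def intro!: continuous_intros)

lemma cc_scaleR_const [cc_intros]: "cc f ==> cc (%x. c *\<^sub>R f x)"
 by (rule cc_scaleR_left[OF continuous_on_const])

lemma cc_cmult [cc_intros]: "cc f ==> cc (%x. c * f x :: real)"
 using cc_scaleR_const[of f c] by simp

lemma cc_mult_left: "cont c ==> cc f ==> cc (%x. c x * f x :: real)"
 using cc_scaleR_left[of c f] by simp

lemma cc_mult_right: "cc c ==> cont f ==> cc (%x. c x * f x :: real)"
 using cc_scaleR_right[of c f] by simp

lemma cc_divide [cc_intros]: "cc f ==> cc (%x. f x / c :: real)"
 using cc_mult_right[of f "%_. inverse c"] by (simp add: divide_inverse)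

lemma cc_inner_left: "cc f ==> cont g ==> cc (%x. f x \<bullet> g x)"
 unfolding cc_def by (metis continuous_on_inner inner_zero_left)

lemma cc_inner_right: "cont f ==> cc g ==> cc (%x. f x \<bullet> g x)"
 unfolding cc_def by (metis continuous_on_inner inner_zero_right)

lemma cc_norm [cc_intros]: "cc f ==> cc (%x. norm (f x))"
 by (rule cc_compose) (auto intro!: continuous_intros)

lemma cc_abs [cc_intros]: "cc f ==> cc (%x. \<bar>f x :: real\<bar>)"
 using cc_norm[of f] by simp

lemma cc_power2 [cc_intros]: "cc f ==> cc (%x. (f x :: real)^2)"
 by (rule cc_compose[where g = "%x. x^2"]) (auto intro!: continuous_intros)

lemma cc_sum [cc_intros]: "(!!i. i \<in> I ==> cc (f i)) ==> cc (%x. \<Sum>i\<in>I. f i x)"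
 by (induction I rule: infinite_finite_induct) (auto intro!: cc_intros)

lemma cc_shift:
 fixes f :: "'a::euclidean_space => 'b::real_normed_vector"
 assumes "cc f" shows "cc (%x. f (x + h))"
proof -
 obtain R where R: "!!x. R < norm x ==> f x = 0" using ccE[OF assms] by metis
 show ?thesis
 proof (rule ccI[of _ "R + norm h"])
  fix x :: 'a assume "R + norm h < norm x"
  then show "f (x + h) = 0" using norm_triangle_ineq4[of "x + h" h] by (intro R) simp
 qed (rule cc_cont_compose[OF assms], intro continuous_intros)
qed

lemma cc_shift_diff: "cc f ==> cc (%x. f (x - h))"
 using cc_shift[of f "- h"] by simp

lemma cc_shift2: "cc f ==> cc (%x. f (x + h - k))"
 using cc_shift[of f "h - k"] by (simp add: add_diff_eq)

lemma cc_integrable: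
 fixes f :: "'a::euclidean_space => 'b::euclidean_space"
 assumes "cc f" shows "integrable lborel f"
proof -
 obtain R where R: "!!x. R < norm x ==> f x = 0" using ccE[OF assms] by metis
 have "integrable lborel (%x. indicator (cball 0 R) x *\<^sub>R f x)"
  by (rule borel_integrable_compact) (auto intro: cc_cont assms)
 also have "(%x. indicator (cball 0 R) x *\<^sub>R f x) = f"
  by (auto simp: indicator_def fun_eq_iff R)
 finally show ?thesis .
qed

lemma cc_bounded:
 fixes f :: "'a::euclidean_space => 'b::real_normed_vector"
 assumes "cc f" obtains B where "0 < B" "!!x. norm (f x) <= B"
proof -
 obtain R where R: "!!x. R < norm x ==> f x = 0" using ccE[OF assms] by metis
 have "bounded (f ` cball 0 R)"
  by (intro compact_imp_bounded compact_continuous_image cc_cont assms) auto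
 then obtain B where B: "0 < B" "!!x. norm x <= R ==> norm (f x) <= B"
  by (auto simp: bounded_pos)
 show ?thesis
 proof (rule that[OF B(1)])
  fix x show "norm (f x) <= B" using B R[of x] by (cases "norm x <= R") auto
 qed
qed

lemma lborel_integral_shift:
 fixes f :: "'a::euclidean_space => 'b::euclidean_space"
 assumes "f \<in> borel_measurable borel"
 shows "(LBINT x. f (x + h)) = (LBINT x. f x)"
proof -
 have "(LBINT x. f x) = (\<integral>x. f x \<partial>distr lborel borel ((+) h))"
  by (simp add: lborel_distr_plus)
 also have "\<dots> = (LBINT x. f (h + x))"
  by (rule integral_distr) (use assms in auto)
 finally show ?thesis by (simp add: add.commute)
qed

text \<open>\<open>m_shift\<close> says that \<open>ln m\<close> is Lipschitz. This one condition
  bounds translations in the weighted space and the ratios \<open>rr\<close>, and thereby all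
  difference operators.\<close>

locale wt =
 fixes m :: "'a::euclidean_space => real" and L :: real
 assumes m_cont: "cont m" and m_pos: "!!x. 0 < m x" and L0: "0 <= L"
  and m_shift: "!!x h. m (x + h) <= exp (L * norm h) * m x"
begin

definition II :: "('a => real) => real" where "II F = (LBINT x. F x * m x)"

definition ip :: "('a => 'b::euclidean_space) => ('a => 'b) => real" where
 "ip f g = II (%x. f x \<bullet> g x)"

lemma m_cont' [continuous_intros]: "continuous_on S g ==> continuous_on S (%x. m (g x))"
 using continuous_on_compose2[OF m_cont, of S g] by auto

lemma II_integrable: "cc F ==> integrable lborel (%x. F x * m x)"
 by (intro cc_integrable cc_mult_right m_cont)

lemma II_add: "cc F ==> cc G ==> II (%x. F x + G x) = II F + II G"
 unfolding II_def by (simp add: distrib_right II_integrable)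

lemma II_diff: "cc F ==> cc G ==> II (%x. F x - G x) = II F - II G"
 unfolding II_def by (simp add: left_diff_distrib II_integrable)

lemma II_cmult: "II (%x. c * F x) = c * II F"
 unfolding II_def by (simp add: mult.assoc)

lemma II_sum: "(!!i. i \<in> I ==> cc (F i)) ==> II (%x. \<Sum>i\<in>I. F i x) = (\<Sum>i\<in>I. II (F i))"
 unfolding II_def by (simp add: sum_distrib_right II_integrable)

lemma II_mono: "cc F ==> cc G ==> (!!x. F x <= G x) ==> II F <= II G"
 unfolding II_def by (intro integral_mono II_integrable mult_right_mono) (auto intro: less_imp_le[OF m_pos])

lemma II_nonneg: "(!!x. 0 <= F x) ==> 0 <= II F"
 unfolding II_def by (intro integral_nonneg_AE) (auto intro!: mult_nonneg_nonneg less_imp_le[OF m_pos])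

lemma II_abs: "cc F ==> \<bar>II F\<bar> <= II (%x. \<bar>F x\<bar>)"
 using II_mono[of F "%x. \<bar>F x\<bar>"] II_mono[of "%x. - F x" "%x. \<bar>F x\<bar>"] II_cmult[of "-1" F]
 by (simp add: abs_le_iff cc_abs cc_minus)

lemma ip_cc: "cc f ==> cc g ==> cc (%x. f x \<bullet> g x)"
 by (rule cc_inner_left[OF _ cc_cont])

lemma ip_commute: "ip f g = ip g f" by (simp add: ip_def inner_commute)

lemma ip_add_left: "cc f ==> cc g ==> cc h ==> ip (%x. f x + g x) h = ip f h + ip g h"
 by (simp add: ip_def inner_add_left II_add ip_cc)

lemma ip_diff_left: "cc f ==> cc g ==> cc h ==> ip (%x. f x - g x) h = ip f h - ip g h"
 by (simp add: ip_def inner_diff_left II_diff ip_cc)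

lemma ip_diff_right: "cc f ==> cc g ==> cc h ==> ip h (%x. f x - g x) = ip h f - ip h g"
 by (simp add: ip_def inner_diff_right II_diff ip_cc)

lemma ip_scaleR_left: "ip (%x. c *\<^sub>R f x) h = c * ip f h"
 by (simp add: ip_def II_cmult)

lemma ip_sum_left: "(!!i. i \<in> I ==> cc (f i)) ==> cc h ==> ip (%x. \<Sum>i\<in>I. f i x) h = (\<Sum>i\<in>I. ip (f i) h)"
 by (simp add: ip_def inner_sum_left II_sum ip_cc)

lemma ip_self: "ip f f = II (%x. (norm (f x))^2)"
 by (simp add: ip_def power2_norm_eq_inner)

lemma ip_self_nonneg: "0 <= ip f f"
 by (simp add: ip_self II_nonneg)

lemma ip_add_self_le:
 assumes "cc f" "cc g" "0 < e"
 shows "ip (%x. f x + g x) (%x. f x + g x) <= (1 + 1 / e) * ip f f + (1 + e) * ip g g"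
proof -
 have "(norm (f x + g x))^2 <= (1 + 1 / e) * (norm (f x))^2 + (1 + e) * (norm (g x))^2" for x
 proof -
  have "2 * (norm (f x) * norm (g x)) <= (norm (f x))^2 / e + e * (norm (g x))^2"
   using sum_squares_bound[of "norm (f x) / sqrt e" "sqrt e * norm (g x)"] \<open>0 < e\<close>
   by (simp add: power_divide power_mult_distrib)
  moreover have "(norm (f x + g x))^2 <= (norm (f x) + norm (g x))^2"
   by (intro power_mono norm_triangle_ineq) auto
  ultimately show ?thesis by (simp add: power2_sum algebra_simps)
 qed
 then have "ip (%x. f x + g x) (%x. f x + g x) <= II (%x. (1 + 1 / e) * (norm (f x))^2 + (1 + e) * (norm (g x))^2)"
  unfolding ip_self by (intro II_mono) (auto intro!: cc_power2 cc_norm cc_add cc_cmult assms)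
 also have "\<dots> = (1 + 1 / e) * ip f f + (1 + e) * ip g g"
  unfolding ip_self by (subst II_add) (auto intro!: cc_power2 cc_norm cc_cmult assms simp: II_cmult)
 finally show ?thesis .
qed

text \<open>\<open>Ds\<close> is the adjoint of the forward difference \<open>Df\<close> (without change of sign), so \<open>LL\<close> is a nonnegative
  operator, and \<open>cK s i j\<close> is a difference approximation of \<open>\<partial>\<^sub>i \<partial>\<^sub>j V\<close> where \<open>m = exp (- V)\<close>.\<close>

definition Df :: "real => 'a => ('a => 'b::real_vector) => 'a => 'b" where
 "Df s i f x = (f (x + s *\<^sub>R i) - f x) /\<^sub>R s"

definition rr :: "real => 'a => 'a => real" where
 "rr s i x = m (x - s *\<^sub>R i) / m x"

definition Ds :: "real => 'a => ('a => 'b::real_vector) => 'a => 'b" where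
 "Ds s i f x = (rr s i x *\<^sub>R f (x - s *\<^sub>R i) - f x) /\<^sub>R s"

definition LL :: "real => ('a => 'b::real_vector) => 'a => 'b" where
 "LL s f x = (\<Sum>i\<in>Basis. Ds s i (Df s i f) x)"

definition cK :: "real => 'a => 'a => 'a => real" where
 "cK s i j x = (rr s i (x + s *\<^sub>R j) - rr s i x) / s^2"

text \<open>The zero order term left over when \<open>dv\<close> is commuted with the Laplacian. It
  evaluates the field at a shifted point, so it is not pointwise multiplication by a matrix.\<close>

definition KK :: "real => ('a => 'a) => 'a => 'a" where
 "KK s U x = (\<Sum>j\<in>Basis. (\<Sum>i\<in>Basis. cK s i j x * (U (x + s *\<^sub>R j - s *\<^sub>R i) \<bullet> i)) *\<^sub>R j)"

definition dv :: "real => ('a => 'a) => 'a => real" where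
 "dv s U x = (\<Sum>j\<in>Basis. Ds s j (%y. U y \<bullet> j) x)"

definition AS :: "real => real => ('a => 'b::real_vector) => 'a => 'b" where
 "AS s lm f x = lm *\<^sub>R f x + LL s f x"

definition AV :: "real => real => ('a => 'a) => 'a => 'a" where
 "AV s lm U x = AS s lm U x + KK s U x"

lemma m_nz: "m x ~= 0" using m_pos[of x] by simp

lemma rr_cont [continuous_intros]: "continuous_on S g ==> continuous_on S (%x. rr s i (g x))"
 unfolding rr_def by (intro continuous_on_divide m_cont' continuous_on_diff continuous_on_const) (simp_all add: m_nz)

lemma cK_cont [continuous_intros]:
 assumes "continuous_on S g" shows "continuous_on S (%x. cK s i j (g x))"
proof -
 have "continuous_on S (%x. (rr s i (g x + s *\<^sub>R j) - rr s i (g x)) * inverse (s^2))"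
  by (intro continuous_on_mult continuous_on_diff rr_cont continuous_on_add continuous_on_const assms)
 then show ?thesis by (simp add: cK_def divide_inverse)
qed

lemma cc_Df [cc_intros]: assumes c: "cc f" shows "cc (Df s i f)"
 unfolding Df_def[abs_def] by (rule cc_scaleR_const[OF cc_diff[OF cc_shift[OF c] c]])

lemma cc_Ds [cc_intros]: assumes c: "cc f" shows "cc (Ds s i f)"
 unfolding Ds_def[abs_def]
 by (rule cc_scaleR_const[OF cc_diff[OF cc_scaleR_left[OF rr_cont[OF continuous_on_id] cc_shift_diff[OF c]] c]])

lemma cc_LL [cc_intros]: assumes c: "cc f" shows "cc (LL s f)"
 unfolding LL_def[abs_def] by (rule cc_sum[OF cc_Ds[OF cc_Df[OF c]]])

lemma cc_KK [cc_intros]: assumes c: "cc U" shows "cc (KK s U)"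
 unfolding KK_def[abs_def]
 by (rule cc_sum[OF cc_scaleR_right[OF cc_sum[OF cc_mult_left[OF cK_cont[OF continuous_on_id]
   cc_inner_left[OF cc_shift2[OF c] continuous_on_const]]] continuous_on_const]])

lemma cc_component: "cc U ==> cc (%x. U x \<bullet> j)"
 by (rule cc_inner_left[OF _ continuous_on_const])

lemma cc_dv [cc_intros]: assumes c: "cc U" shows "cc (dv s U)"
 unfolding dv_def[abs_def] by (rule cc_sum[OF cc_Ds[OF cc_component[OF c]]])

lemma cc_AS [cc_intros]: assumes c: "cc f" shows "cc (AS s lm f)"
 unfolding AS_def[abs_def] by (rule cc_add[OF cc_scaleR_const[OF c] cc_LL[OF c]])

lemma cc_AV [cc_intros]: assumes c: "cc f" shows "cc (AV s lm f)"
 unfolding AV_def[abs_def] by (rule cc_add[OF cc_AS[OF c] cc_KK[OF c]])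

text \<open>A translation of the variable moves the shift from \<open>f\<close> to \<open>g\<close>
  and the weight to \<open>m (x - s *\<^sub>R i)\<close>; \<open>rr\<close> is the ratio that
  restores \<open>m\<close>.\<close>

lemma adjoint:
 fixes f g :: "'a => 'b::euclidean_space"
 assumes "cc f" "cc g"
 shows "ip (Df s i f) g = ip f (Ds s i g)"
proof -
 let ?h = "s *\<^sub>R i"
 have c1: "cc (%x. f (x + ?h) \<bullet> g x)" "cc (%x. f x \<bullet> (rr s i x *\<^sub>R g (x - ?h)))" "cc (%x. f x \<bullet> g x)"
  by (rule ip_cc[OF cc_shift[OF assms(1)] assms(2)] ip_cc[OF assms]
    ip_cc[OF assms(1) cc_scaleR_left[OF rr_cont[OF continuous_on_id] cc_shift_diff[OF assms(2)]]])+
 have "II (%x. f (x + ?h) \<bullet> g x) = (LBINT x. (%y. f y \<bullet> g (y - ?h) * m (y - ?h)) (x + ?h))"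
  by (simp add: II_def)
 also have "\<dots> = (LBINT x. f x \<bullet> g (x - ?h) * m (x - ?h))"
  by (rule lborel_integral_shift)
   (intro borel_measurable_continuous_onI continuous_on_mult continuous_on_inner m_cont' continuous_on_diff
     continuous_on_const continuous_on_id cc_cont[OF assms(1)] cc_cont_compose[OF assms(2)])
 also have "\<dots> = II (%x. f x \<bullet> (rr s i x *\<^sub>R g (x - ?h)))"
  unfolding II_def rr_def by (intro bint_cong refl) (simp add: m_nz)
 finally have 1: "II (%x. f (x + ?h) \<bullet> g x) = II (%x. f x \<bullet> (rr s i x *\<^sub>R g (x - ?h)))" .
 have "ip (Df s i f) g = inverse s * (II (%x. f (x + ?h) \<bullet> g x) - II (%x. f x \<bullet> g x))"
  unfolding ip_def Df_def inner_scaleR_left II_cmult inner_diff_left using c1 by (simp add: II_diff)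
 also have "\<dots> = ip f (Ds s i g)"
  unfolding ip_def Ds_def inner_scaleR_right II_cmult inner_diff_right 1 using c1 by (simp add: II_diff)
 finally show ?thesis .
qed

text \<open>Translations commute, so only the variable factor \<open>rr\<close> fails to; its
  difference in the direction \<open>j\<close> is what \<open>cK\<close> records.\<close>

lemma Df_Ds:
 "Df s j (Ds s i f) x = Ds s i (Df s j f) x + cK s i j x *\<^sub>R f (x + s *\<^sub>R j - s *\<^sub>R i)"
 by (simp add: Df_def Ds_def cK_def algebra_simps power2_eq_square divide_inverse)

text \<open>Both orders produce the ratio of \<open>m\<close> at the doubly shifted point to
  \<open>m x\<close>, the discrete form of the symmetry of mixed derivatives.\<close>

lemma Ds_Ds: "Ds s j (Ds s i f) x = Ds s i (Ds s j f) x"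
proof -
 have "rr s j x * rr s i (x - s *\<^sub>R j) = rr s i x * rr s j (x - s *\<^sub>R i)"
  by (simp add: rr_def m_nz algebra_simps)
 then show ?thesis by (simp add: Ds_def algebra_simps)
qed

lemma Df_add: "Df s i (%y. f y + g y) = (%x. Df s i f x + Df s i g x)"
 by (rule ext) (simp add: Df_def algebra_simps)

lemma Df_diff: "Df s i (%y. f y - g y) = (%x. Df s i f x - Df s i g x)"
 by (rule ext) (simp add: Df_def algebra_simps)

lemma Df_scaleR: "Df s i (%y. c *\<^sub>R f y) = (%x. c *\<^sub>R Df s i f x)"
 by (rule ext) (simp add: Df_def algebra_simps)

lemma Df_sum: "Df s i (%y. \<Sum>k\<in>I. f k y) = (%x. \<Sum>k\<in>I. Df s i (f k) x)"
 by (rule ext) (simp add: Df_def sum_subtractf scaleR_sum_right scaleR_right_diff_distrib sum_distrib_left)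

lemma Ds_add: "Ds s i (%y. f y + g y) = (%x. Ds s i f x + Ds s i g x)"
 by (rule ext) (simp add: Ds_def algebra_simps)

lemma Ds_diff: "Ds s i (%y. f y - g y) = (%x. Ds s i f x - Ds s i g x)"
 by (rule ext) (simp add: Ds_def algebra_simps)

lemma Ds_scaleR: "Ds s i (%y. c *\<^sub>R f y) = (%x. c *\<^sub>R Ds s i f x)"
 by (rule ext) (simp add: Ds_def algebra_simps)

lemma Ds_sum: "Ds s i (%y. \<Sum>k\<in>I. f k y) = (%x. \<Sum>k\<in>I. Ds s i (f k) x)"
 by (rule ext) (simp add: Ds_def sum_subtractf scaleR_sum_right scaleR_right_diff_distrib sum_distrib_left)

lemma LL_lin:
 "LL s (%y. f y + g y) = (%x. LL s f x + LL s g x)"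
 "LL s (%y. f y - g y) = (%x. LL s f x - LL s g x)"
 "LL s (%y. c *\<^sub>R f y) = (%x. c *\<^sub>R LL s f x)"
 "LL s (%y. \<Sum>k\<in>I. h k y) = (%x. \<Sum>k\<in>I. LL s (h k) x)"
proof -
 have "LL s (%y. \<Sum>k\<in>I. h k y) x = (\<Sum>k\<in>I. LL s (h k) x)" for x
  unfolding LL_def Df_sum Ds_sum by (rule sum.swap)
 then show "LL s (%y. \<Sum>k\<in>I. h k y) = (%x. \<Sum>k\<in>I. LL s (h k) x)" by blast
qed (simp_all add: LL_def Df_add Df_diff Df_scaleR Ds_add Ds_diff Ds_scaleR sum.distrib sum_subtractf scaleR_sum_right fun_eq_iff)

lemma dv_lin:
 "dv s (%y. f y - g y) = (%x. dv s f x - dv s g x)"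
 "dv s (%y. c *\<^sub>R f y) = (%x. c * dv s f x)"
 using Ds_scaleR[of s _ c "%y. f y \<bullet> _"]
 by (simp_all add: dv_def fun_eq_iff inner_diff_left Ds_diff sum_subtractf sum_distrib_left)

lemma AS_lin:
 "AS s lm (%y. f y + g y) = (%x. AS s lm f x + AS s lm g x)"
 "AS s lm (%y. f y - g y) = (%x. AS s lm f x - AS s lm g x)"
 "AS s lm (%y. c *\<^sub>R f y) = (%x. c *\<^sub>R AS s lm f x)"
 by (simp_all add: AS_def LL_lin fun_eq_iff algebra_simps)

lemma AV_inner:
 assumes "j \<in> Basis"
 shows "AV s lm U x \<bullet> j = lm * (U x \<bullet> j) + LL s (%y. U y \<bullet> j) x
  + (\<Sum>i\<in>Basis. cK s i j x * (U (x + s *\<^sub>R j - s *\<^sub>R i) \<bullet> i))"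
proof -
 have "LL s U x \<bullet> j = LL s (%y. U y \<bullet> j) x"
  by (simp add: LL_def Ds_def Df_def inner_sum_left inner_diff_left mult.assoc)
 moreover have "KK s U x \<bullet> j = (\<Sum>i\<in>Basis. cK s i j x * (U (x + s *\<^sub>R j - s *\<^sub>R i) \<bullet> i))"
  using assms unfolding KK_def by (subst inner_sum_left_Basis) auto
 ultimately show ?thesis by (simp add: AV_def AS_def inner_add_left)
qed

text \<open>This exact commutation is the discrete form of the argument of Bakry.\<close>

lemma dv_AV: "dv s (AV s lm U) = AS s lm (dv s U)"
proof
 fix x
 let ?U = "%j y. U y \<bullet> j"
 have L: "LL s (Ds s j f) x = Ds s j (LL s f) x + (\<Sum>i\<in>Basis. Ds s i (%y. cK s j i y * f (y + s *\<^sub>R i - s *\<^sub>R j)) x)" for j and f :: "'a => real"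
 proof -
  have "Df s i (Ds s j f) = (%y. Ds s j (Df s i f) y + cK s j i y * f (y + s *\<^sub>R i - s *\<^sub>R j))" for i
   by (simp add: Df_Ds fun_eq_iff)
  then have "LL s (Ds s j f) x = (\<Sum>i\<in>Basis. Ds s i (Ds s j (Df s i f)) x + Ds s i (%y. cK s j i y * f (y + s *\<^sub>R i - s *\<^sub>R j)) x)"
   by (simp add: LL_def Ds_add)
  moreover have "Ds s j (LL s f) x = (\<Sum>i\<in>Basis. Ds s i (Ds s j (Df s i f)) x)"
   unfolding LL_def[abs_def] Ds_sum by (intro sum.cong refl Ds_Ds)
  ultimately show ?thesis by (simp add: sum.distrib)
 qed
 have "dv s (AV s lm U) x = (\<Sum>j\<in>Basis. Ds s j (%y. lm *\<^sub>R ?U j y + LL s (?U j) y + (\<Sum>i\<in>Basis. cK s i j y * ?U i (y + s *\<^sub>R j - s *\<^sub>R i))) x)"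
  unfolding dv_def by (intro sum.cong refl) (simp add: AV_inner cong: sum.cong)
 also have "\<dots> = (\<Sum>j\<in>Basis. lm * Ds s j (?U j) x + Ds s j (LL s (?U j)) x + (\<Sum>i\<in>Basis. Ds s j (%y. cK s i j y * ?U i (y + s *\<^sub>R j - s *\<^sub>R i)) x))"
  unfolding Ds_add Ds_sum Ds_scaleR by simp
 also have "\<dots> = lm * dv s U x + (\<Sum>j\<in>Basis. Ds s j (LL s (?U j)) x) + (\<Sum>j\<in>Basis. \<Sum>i\<in>Basis. Ds s j (%y. cK s i j y * ?U i (y + s *\<^sub>R j - s *\<^sub>R i)) x)"
  by (simp add: dv_def sum.distrib sum_distrib_left)
 also have "(\<Sum>j\<in>Basis. \<Sum>i\<in>Basis. Ds s j (%y. cK s i j y * ?U i (y + s *\<^sub>R j - s *\<^sub>R i)) x)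
   = (\<Sum>j\<in>Basis. \<Sum>i\<in>Basis. Ds s i (%y. cK s j i y * ?U j (y + s *\<^sub>R i - s *\<^sub>R j)) x)"
  by (rule sum.swap)
 also have "lm * dv s U x + (\<Sum>j\<in>Basis. Ds s j (LL s (?U j)) x) + \<dots> = AS s lm (dv s U) x"
  unfolding AS_def dv_def[abs_def] LL_lin(4) L by (simp add: sum.distrib)
 finally show "dv s (AV s lm U) x = AS s lm (dv s U) x" .
qed

text \<open>Moving \<open>Ds s j\<close> to the other side and commuting it past
  \<open>Ds s i\<close> exchanges the indices. The differences of \<open>U\<close> and
  \<open>W\<close> then come in different directions, which is why the convexity of the Bellman
  function is formulated for three points.\<close>

lemma dv_ip:
 assumes "cc U" "cc W"
 shows "ip (dv s U) (dv s W) = (\<Sum>j\<in>Basis. \<Sum>i\<in>Basis. ip (Df s j (%y. U y \<bullet> i)) (Df s i (%y. W y \<bullet> j))) + ip (KK s U) W"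
proof -
 let ?U = "%j y. U y \<bullet> j" and ?W = "%j y. W y \<bullet> j"
 have cU: "cc (?U j)" and cW: "cc (?W j)" for j by (rule cc_component[OF assms(1)] cc_component[OF assms(2)])+
 have cS: "cc (%x. cK s i j x * ?U i (x + s *\<^sub>R j - s *\<^sub>R i))" for i j
  by (rule cc_mult_left[OF cK_cont[OF continuous_on_id] cc_shift2[OF cU]])
 have 1: "ip (Ds s i (?U i)) (Ds s j (?W j)) = ip (Df s j (?U i)) (Df s i (?W j)) + ip (%x. cK s i j x * ?U i (x + s *\<^sub>R j - s *\<^sub>R i)) (?W j)" for i j
 proof -
  have "ip (Ds s i (?U i)) (Ds s j (?W j)) = ip (Df s j (Ds s i (?U i))) (?W j)"
   by (rule adjoint[symmetric]) (intro cc_Ds cU cW)+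
  also have "Df s j (Ds s i (?U i)) = (%x. Ds s i (Df s j (?U i)) x + cK s i j x * ?U i (x + s *\<^sub>R j - s *\<^sub>R i))"
   by (simp add: Df_Ds fun_eq_iff)
  also have "ip \<dots> (?W j) = ip (Ds s i (Df s j (?U i))) (?W j) + ip (%x. cK s i j x * ?U i (x + s *\<^sub>R j - s *\<^sub>R i)) (?W j)"
   by (intro ip_add_left cc_Ds cc_Df cU cW cS)
  also have "ip (Ds s i (Df s j (?U i))) (?W j) = ip (Df s j (?U i)) (Df s i (?W j))"
   by (metis adjoint ip_commute cc_Df cU cW)
  finally show ?thesis .
 qed
 have "ip (dv s U) (dv s W) = (\<Sum>i\<in>Basis. ip (Ds s i (?U i)) (dv s W))"
  unfolding dv_def[of s U, abs_def] by (intro ip_sum_left cc_Ds cc_dv cU assms)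
 also have "\<dots> = (\<Sum>i\<in>Basis. \<Sum>j\<in>Basis. ip (Ds s i (?U i)) (Ds s j (?W j)))"
 proof (intro sum.cong refl)
  fix i
  have "ip (dv s W) (Ds s i (?U i)) = (\<Sum>j\<in>Basis. ip (Ds s j (?W j)) (Ds s i (?U i)))"
   unfolding dv_def[abs_def] by (intro ip_sum_left cc_Ds cU cW)
  then show "ip (Ds s i (?U i)) (dv s W) = (\<Sum>j\<in>Basis. ip (Ds s i (?U i)) (Ds s j (?W j)))"
   by (simp add: ip_commute)
 qed
 also have "\<dots> = (\<Sum>j\<in>Basis. \<Sum>i\<in>Basis. ip (Ds s i (?U i)) (Ds s j (?W j)))" by (rule sum.swap)
 also have "\<dots> = (\<Sum>j\<in>Basis. \<Sum>i\<in>Basis. ip (Df s j (?U i)) (Df s i (?W j)))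
   + (\<Sum>j\<in>Basis. \<Sum>i\<in>Basis. ip (%x. cK s i j x * ?U i (x + s *\<^sub>R j - s *\<^sub>R i)) (?W j))"
  by (simp add: 1 sum.distrib)
 also have "(\<Sum>j\<in>Basis. \<Sum>i\<in>Basis. ip (%x. cK s i j x * ?U i (x + s *\<^sub>R j - s *\<^sub>R i)) (?W j)) = ip (KK s U) W"
 proof -
  have "ip (KK s U) W = II (%x. \<Sum>j\<in>Basis. \<Sum>i\<in>Basis. cK s i j x * ?U i (x + s *\<^sub>R j - s *\<^sub>R i) * ?W j x)"
   by (simp add: ip_def KK_def inner_sum_left sum_distrib_right inner_commute[of "W _"])
  also have "\<dots> = (\<Sum>j\<in>Basis. II (%x. \<Sum>i\<in>Basis. cK s i j x * ?U i (x + s *\<^sub>R j - s *\<^sub>R i) * ?W j x))"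
   by (rule II_sum) (intro cc_sum cc_mult_right cS cc_cont cW)
  also have "\<dots> = (\<Sum>j\<in>Basis. \<Sum>i\<in>Basis. II (%x. cK s i j x * ?U i (x + s *\<^sub>R j - s *\<^sub>R i) * ?W j x))"
   by (intro sum.cong refl II_sum cc_mult_right cS cc_cont cW)
  finally show ?thesis by (simp add: ip_def)
 qed
 finally show ?thesis .
qed

lemma ip_AS:
 fixes f g :: "'a => 'b::euclidean_space"
 assumes "cc f" "cc g"
 shows "ip (AS s lm f) g = lm * ip f g + (\<Sum>i\<in>Basis. ip (Df s i f) (Df s i g))"
proof -
 have "ip (AS s lm f) g = ip (%x. lm *\<^sub>R f x) g + ip (LL s f) g"
  unfolding AS_def[abs_def] by (intro ip_add_left cc_scaleR_const cc_LL assms)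
 also have "ip (LL s f) g = (\<Sum>i\<in>Basis. ip (Ds s i (Df s i f)) g)"
  unfolding LL_def[abs_def] by (intro ip_sum_left cc_Ds cc_Df assms)
 also have "\<dots> = (\<Sum>i\<in>Basis. ip (Df s i f) (Df s i g))"
  by (intro sum.cong refl) (metis adjoint ip_commute cc_Df assms)
 finally show ?thesis by (simp add: ip_scaleR_left)
qed

lemma AS_sym: "cc f ==> cc g ==> ip (AS s lm f) g = ip f (AS s lm g)"
 by (subst ip_commute[of f]) (simp add: ip_AS ip_commute[of g] ip_commute[of "Df s _ g" "Df s _ f"])

end

context wt
begin

lemma II_shift_le:
 assumes F: "cc F" and nn: "!!x. 0 <= F x"
 shows "II (%x. F (x + h)) <= exp (L * norm h) * II F"
proof -
 have "II (%x. F (x + h)) = (LBINT x. (%y. F y * m (y - h)) (x + h))"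
  by (simp add: II_def)
 also have "\<dots> = (LBINT x. F x * m (x - h))"
  by (rule lborel_integral_shift)
   (intro borel_measurable_continuous_onI continuous_on_mult m_cont' continuous_on_diff
     continuous_on_const continuous_on_id cc_cont[OF F])
 also have "\<dots> <= (LBINT x. exp (L * norm h) * (F x * m x))"
 proof (rule integral_mono)
  show "integrable lborel (%x. F x * m (x - h))"
   by (intro cc_integrable cc_mult_right F m_cont' continuous_on_diff continuous_on_const continuous_on_id)
  show "integrable lborel (%x. exp (L * norm h) * (F x * m x))"
   by (intro integrable_mult_right II_integrable F)
  fix x
  show "F x * m (x - h) <= exp (L * norm h) * (F x * m x)"
   using mult_left_mono[OF m_shift[of x "- h"] nn[of x]] by (simp add: mult_ac)
 qed
 finally show ?thesis by (simp add: II_def)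
qed

lemma ip_shift_le:
 assumes "cc f" shows "ip (%x. f (x + h)) (%x. f (x + h)) <= exp (L * norm h) * ip f f"
 unfolding ip_self using II_shift_le[of "%x. (norm (f x))^2" h] by (simp add: cc_power2 cc_norm assms)

lemma ip_axpy:
 assumes "cc f" "cc g"
 shows "ip (%x. f x + c *\<^sub>R g x) (%x. f x + c *\<^sub>R g x) = ip f f + 2 * c * ip f g + c^2 * ip g g"
proof -
 have "ip (%x. f x + c *\<^sub>R g x) (%x. f x + c *\<^sub>R g x)
   = II (%x. (f x \<bullet> f x + 2 * c * (f x \<bullet> g x)) + c^2 * (g x \<bullet> g x))"
  by (simp add: ip_def inner_add_left inner_add_right inner_commute power2_eq_square algebra_simps)
 also have "\<dots> = ip f f + 2 * c * ip f g + c^2 * ip g g"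
  unfolding ip_def by (simp add: II_add II_cmult ip_cc cc_add cc_cmult assms)
 finally show ?thesis .
qed

lemma ip_scaleR_self: "ip (%x. c *\<^sub>R f x) (%x. c *\<^sub>R f x) = c^2 * ip f f"
 by (simp add: ip_self power_mult_distrib II_cmult)

lemma ip_sum_self_le:
 assumes "finite I" "!!i. i \<in> I ==> cc (f i)"
 shows "ip (%x. \<Sum>i\<in>I. f i x) (%x. \<Sum>i\<in>I. f i x) <= card I * (\<Sum>i\<in>I. ip (f i) (f i))"
proof -
 have "(norm (\<Sum>i\<in>I. f i x))^2 <= card I * (\<Sum>i\<in>I. (norm (f i x))^2)" for x
 proof -
  have "(norm (\<Sum>i\<in>I. f i x))^2 <= (\<Sum>i\<in>I. norm (f i x))^2"
   by (intro power_mono norm_sum) auto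
  also have "\<dots> <= card I * (\<Sum>i\<in>I. (norm (f i x))^2)"
   using sum_squared_le_sum_of_squares[of "%i. norm (f i x)" I] by (simp add: mult.commute)
  finally show ?thesis .
 qed
 then have "ip (%x. \<Sum>i\<in>I. f i x) (%x. \<Sum>i\<in>I. f i x) <= II (%x. card I * (\<Sum>i\<in>I. (norm (f i x))^2))"
  unfolding ip_self by (intro II_mono cc_power2 cc_norm cc_sum cc_cmult assms)
 also have "\<dots> = card I * (\<Sum>i\<in>I. ip (f i) (f i))"
  unfolding ip_self II_cmult by (subst II_sum) (auto intro!: cc_power2 cc_norm assms)
 finally show ?thesis .
qed

lemma ip_mult_self_le:
 assumes "cc f" "cont c" "!!x. \<bar>c x\<bar> <= M"
 shows "ip (%x. c x *\<^sub>R f x) (%x. c x *\<^sub>R f x) <= M^2 * ip f f"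
proof -
 have "ip (%x. c x *\<^sub>R f x) (%x. c x *\<^sub>R f x) <= II (%x. M^2 * (norm (f x))^2)"
  unfolding ip_self
 proof (intro II_mono cc_power2 cc_norm cc_scaleR_left cc_cmult assms)
  fix x
  have "(c x)^2 <= M^2" using assms(3)[of x] by (simp add: abs_le_square_iff[symmetric])
  then show "(norm (c x *\<^sub>R f x))^2 <= M^2 * (norm (f x))^2"
   by (simp add: power_mult_distrib mult_right_mono)
 qed
 then show ?thesis by (simp add: II_cmult ip_self)
qed

section \<open>Euler steps and near minimisers\<close>

text \<open>The bounds may depend on the space step \<open>s\<close>, which is kept fixed while the time step tends to \<open>0\<close>.\<close>

definition bop :: "(('a => 'b::euclidean_space) => ('a => 'c::euclidean_space)) => bool" where
 "bop T \<longleftrightarrow> (\<exists>C\<ge>0. \<forall>f. cc f --> cc (T f) & ip (T f) (T f) <= C * ip f f)"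

lemma bop_id: "bop (%f x. f x)"
 unfolding bop_def by (intro exI[of _ 1]) auto

lemma bop_shift: "bop (%f x. f (x + h))"
 unfolding bop_def by (intro exI[of _ "exp (L * norm h)"]) (auto simp: cc_shift ip_shift_le)

lemma bop_comp: "bop S ==> bop T ==> bop (%f. S (T f))"
proof -
 assume "bop S" "bop T"
 then obtain C D where C: "0 <= C" "!!f. cc f ==> cc (S f)" "!!f. cc f ==> ip (S f) (S f) <= C * ip f f"
  and D: "0 <= D" "!!f. cc f ==> cc (T f)" "!!f. cc f ==> ip (T f) (T f) <= D * ip f f"
  unfolding bop_def by metis
 show "bop (%f. S (T f))"
  unfolding bop_def
 proof (intro exI[of _ "C * D"] conjI allI impI)
  fix f :: "'a => 'd" assume f: "cc f"
  show "ip (S (T f)) (S (T f)) <= C * D * ip f f"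
   using C(3)[OF D(2)[OF f]] mult_left_mono[OF D(3)[OF f] C(1)] by simp
 qed (use C D in auto)
qed

lemma bop_sum:
 fixes T :: "'i => ('a => 'b::euclidean_space) => ('a => 'c::euclidean_space)"
 assumes "finite I" "!!i. i \<in> I ==> bop (T i)"
 shows "bop (%f x. \<Sum>i\<in>I. T i f x)"
proof -
 have "\<forall>i. \<exists>C. i \<in> I --> 0 <= C & (\<forall>f. cc f --> cc (T i f) & ip (T i f) (T i f) <= C * ip f f)"
  using assms(2) unfolding bop_def by blast
 then obtain C where C: "!!i. i \<in> I ==> 0 <= C i" "!!i f. i \<in> I ==> cc f ==> cc (T i f)"
  "!!i f. i \<in> I ==> cc f ==> ip (T i f) (T i f) <= C i * ip f f"
  by metis
 show ?thesis
  unfolding bop_def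
 proof (intro exI[of _ "card I * (\<Sum>i\<in>I. C i)"] conjI allI impI cc_sum)
  fix f :: "'a => 'b" assume f: "cc f"
  have "ip (%x. \<Sum>i\<in>I. T i f x) (%x. \<Sum>i\<in>I. T i f x) <= card I * (\<Sum>i\<in>I. ip (T i f) (T i f))"
   by (rule ip_sum_self_le) (use assms C f in auto)
  also have "\<dots> <= card I * (\<Sum>i\<in>I. C i * ip f f)"
   by (intro mult_left_mono sum_mono C f) auto
  finally show "ip (%x. \<Sum>i\<in>I. T i f x) (%x. \<Sum>i\<in>I. T i f x) <= card I * (\<Sum>i\<in>I. C i) * ip f f"
   by (simp add: sum_distrib_right mult.assoc)
 qed (use C in \<open>auto intro!: mult_nonneg_nonneg sum_nonneg\<close>)
qed

lemma bop_add: "bop S ==> bop T ==> bop (%f x. S f x + T f x)"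
 using bop_sum[of "UNIV :: bool set" "%b. if b then S else T"] by (simp add: UNIV_bool add.commute)

lemma bop_mult:
 assumes "cont c" "!!x. \<bar>c x\<bar> <= M" "bop T"
 shows "bop (%f x. c x *\<^sub>R T f x)"
proof -
 have "bop (%f x. c x *\<^sub>R f x)"
  unfolding bop_def by (intro exI[of _ "M^2"]) (auto intro!: cc_scaleR_left ip_mult_self_le assms)
 from bop_comp[OF this assms(3)] show ?thesis by simp
qed

lemma bop_scaleR: "bop T ==> bop (%f x. c *\<^sub>R T f x)"
 by (rule bop_mult[of "%_. c" "\<bar>c\<bar>"]) auto

lemma bop_diff: "bop S ==> bop T ==> bop (%f x. S f x - T f x)"
 using bop_add[OF _ bop_scaleR[of T "-1"], of S] by simp

lemma bop_comp_inner:
 fixes T :: "('a => 'b::euclidean_space) => ('a => 'c::euclidean_space)"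
 assumes T: "bop T" shows "bop (%f x. (T f x \<bullet> i) *\<^sub>R j)"
proof -
 have "bop (%f x. (f x \<bullet> i) *\<^sub>R j)"
  unfolding bop_def
 proof (intro exI[of _ "(norm i * norm j)^2"] conjI allI impI)
  fix f :: "'a => 'c" assume f: "cc f"
  show c: "cc (%x. (f x \<bullet> i) *\<^sub>R j)"
   by (rule cc_scaleR_right[OF cc_component[OF f] continuous_on_const])
  have "ip (%x. (f x \<bullet> i) *\<^sub>R j) (%x. (f x \<bullet> i) *\<^sub>R j) <= II (%x. (norm i * norm j)^2 * (norm (f x))^2)"
   unfolding ip_self
  proof (intro II_mono cc_power2 cc_norm c cc_cmult f)
   fix x
   have "norm ((f x \<bullet> i) *\<^sub>R j) <= norm i * norm j * norm (f x)"
    using mult_right_mono[OF Cauchy_Schwarz_ineq2[of "f x" i] norm_ge_zero[of j]] by (simp add: mult_ac)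
   then show "(norm ((f x \<bullet> i) *\<^sub>R j))^2 <= (norm i * norm j)^2 * (norm (f x))^2"
    using power_mono[of "norm ((f x \<bullet> i) *\<^sub>R j)" "norm i * norm j * norm (f x)" 2] by (simp add: power_mult_distrib)
  qed
  then show "ip (%x. (f x \<bullet> i) *\<^sub>R j) (%x. (f x \<bullet> i) *\<^sub>R j) <= (norm i * norm j)^2 * ip f f"
   by (simp add: II_cmult ip_self)
 qed auto
 from bop_comp[OF this T] show ?thesis by simp
qed

lemma rr_bound: "0 <= rr s i x" "rr s i x <= exp (L * norm (s *\<^sub>R i))"
 using m_pos[of x] m_pos[of "x - s *\<^sub>R i"] m_shift[of x "- (s *\<^sub>R i)"]
 by (auto simp: rr_def pos_divide_le_eq less_imp_le)

lemma cK_bound: "\<bar>cK s i j x\<bar> <= exp (L * norm (s *\<^sub>R i)) / s^2"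
 unfolding cK_def abs_divide using rr_bound[of s i x] rr_bound[of s i "x + s *\<^sub>R j"]
 by (simp add: divide_right_mono)

lemma bop_Df: "bop (Df s i)"
proof -
 have "bop (%f x. inverse s *\<^sub>R (f (x + s *\<^sub>R i) - f x))"
  by (intro bop_scaleR bop_diff bop_shift bop_id)
 then show ?thesis by (simp add: Df_def[abs_def])
qed

lemma bop_Ds: "bop (Ds s i)"
proof -
 have "bop (%f x. inverse s *\<^sub>R (rr s i x *\<^sub>R f (x + (- (s *\<^sub>R i))) - f x))"
  by (intro bop_scaleR bop_diff bop_mult[where M = "exp (L * norm (s *\<^sub>R i))"] bop_shift bop_id rr_cont continuous_on_id)
   (use rr_bound in auto)
 then show ?thesis by (simp add: Ds_def[abs_def])
qed

lemma bop_AS: "bop (AS s lm)"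
proof -
 have "bop (%f x. lm *\<^sub>R f x + (\<Sum>i\<in>Basis. Ds s i (Df s i f) x))"
  by (intro bop_add bop_scaleR bop_id bop_sum bop_comp[OF bop_Ds bop_Df]) auto
 then show ?thesis by (simp add: AS_def[abs_def] LL_def)
qed

lemma bop_KK: "bop (KK s)"
proof -
 have "bop (%U x. \<Sum>j\<in>Basis. \<Sum>i\<in>Basis. cK s i j x *\<^sub>R ((U (x + (s *\<^sub>R j - s *\<^sub>R i)) \<bullet> i) *\<^sub>R j))"
  by (intro bop_sum bop_mult[OF cK_cont[OF continuous_on_id] cK_bound] bop_comp_inner bop_shift) auto
 then show ?thesis by (simp add: KK_def[abs_def] scaleR_sum_left add_diff_eq)
qed

lemma bop_AV: "bop (AV s lm)"
 unfolding AV_def[abs_def] by (intro bop_add bop_AS bop_KK)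

definition EE :: "real => real => real => ('a => real) => 'a => real" where
 "EE t s lm f x = f x - t * AS s lm f x"

definition EV :: "real => real => real => ('a => 'a) => 'a => 'a" where
 "EV t s lm U x = U x - t *\<^sub>R AV s lm U x"

text \<open>Horner form of the sum of the even powers of \<open>EE\<close> applied to
  \<open>g\<close>. As \<open>EE\<close> is 1 minus \<open>t\<close> times \<open>AS\<close>,
  \<open>2 * t\<close> times this sum approximates the inverse of \<open>AS\<close>; even powers can
  be shared equally between the two arguments of \<open>ip\<close>.\<close>

primrec QQ :: "real => real => real => ('a => real) => nat => 'a => real" where
 "QQ t s lm g 0 = (%x. 0)"
| "QQ t s lm g (Suc n) = (%x. g x + EE t s lm (EE t s lm (QQ t s lm g n)) x)"

text \<open>The term \<open>lm * ip f f\<close> replaces the missing spectral gap on the whole space.\<close>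

definition JJ :: "real => real => ('a => 'a) => ('a => real) => real" where
 "JJ s lm u f = lm * ip f f + (\<Sum>i\<in>Basis. ip (%x. Df s i f x - u x \<bullet> i) (%x. Df s i f x - u x \<bullet> i))"

lemma cc_EE: "cc f ==> cc (EE t s lm f)"
 unfolding EE_def[abs_def] by (intro cc_diff cc_cmult cc_AS)

lemma cc_EV: "cc f ==> cc (EV t s lm f)"
 unfolding EV_def[abs_def] by (intro cc_diff cc_scaleR_const cc_AV)

lemma cc_funpow_EE: "cc f ==> cc ((EE t s lm ^^ k) f)"
 by (induction k) (auto intro: cc_EE)

lemma cc_funpow_EV: "cc f ==> cc ((EV t s lm ^^ k) f)"
 by (induction k) (auto intro: cc_EV)

lemma cc_QQ: "cc g ==> cc (QQ t s lm g n)"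
 by (induction n) (auto intro!: cc_zero cc_add cc_EE)

lemma dv_EV: "dv s (EV t s lm U) = EE t s lm (dv s U)"
 by (simp add: EV_def[abs_def] EE_def[abs_def] dv_lin dv_AV)

lemma dv_funpow: "dv s ((EV t s lm ^^ k) U) = (EE t s lm ^^ k) (dv s U)"
 by (induction k) (auto simp: dv_EV)

lemma EE_lin:
 "EE t s lm (%x. f x + g x) = (%x. EE t s lm f x + EE t s lm g x)"
 "EE t s lm (%x. f x - g x) = (%x. EE t s lm f x - EE t s lm g x)"
 by (simp_all add: EE_def fun_eq_iff AS_lin algebra_simps)

lemma EE_sym:
 assumes "cc f" "cc g" shows "ip (EE t s lm f) g = ip f (EE t s lm g)"
proof -
 have "ip (EE t s lm f) g = ip f g - t * ip (AS s lm f) g"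
  unfolding EE_def[abs_def] using assms ip_scaleR_left[of t "AS s lm f" g]
  by (simp add: ip_diff_left cc_cmult cc_AS)
 moreover have "ip f (EE t s lm g) = ip f g - t * ip f (AS s lm g)"
  unfolding EE_def[abs_def] using assms ip_scaleR_left[of t "AS s lm g" f]
  by (simp add: ip_diff_right cc_cmult cc_AS ip_commute[of f "%x. t * AS s lm g x"] ip_commute[of f "AS s lm g"])
 ultimately show ?thesis using AS_sym[OF assms] by simp
qed

text \<open>\<open>EE\<close> is symmetric, so each even power splits into two equal halves, and the
  same iterates of \<open>g\<close> and \<open>h\<close> are paired.\<close>

lemma ip_QQ:
 assumes "cc g" "cc h"
 shows "ip (QQ t s lm g n) h = (\<Sum>k<n. ip ((EE t s lm ^^ k) g) ((EE t s lm ^^ k) h))"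
 using assms(2)
proof (induction n arbitrary: h)
 case 0
 then show ?case by (simp add: ip_def II_def)
next
 case (Suc n)
 let ?E = "EE t s lm"
 note c = cc_QQ[OF assms(1)] cc_EE assms(1) Suc.prems cc_funpow_EE
 have "ip (QQ t s lm g (Suc n)) h = ip g h + ip (QQ t s lm g n) (?E (?E h))"
  by (simp add: ip_add_left EE_sym c)
 also have "ip (QQ t s lm g n) (?E (?E h)) = (\<Sum>k<n. ip ((?E ^^ k) g) ((?E ^^ k) (?E (?E h))))"
  by (rule Suc.IH) (intro c)
 also have "\<dots> = (\<Sum>k<n. ip ((?E ^^ Suc k) g) ((?E ^^ Suc k) h))"
  by (intro sum.cong refl) (simp add: funpow_swap1[symmetric] EE_sym c)
 finally show ?case by (simp add: sum.lessThan_Suc_shift del: sum.lessThan_Suc)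
qed

text \<open>The first order term gains \<open>2 * t * lm\<close> since \<open>AS\<close> is bounded
  below by \<open>lm\<close>, and for small \<open>t\<close> the boundedness of \<open>AS\<close>
  keeps the second order term below half of that gain.\<close>

lemma EE_contraction:
 assumes "0 < s" "0 < lm"
 shows "\<exists>t0>0. \<forall>t. 0 < t & t <= t0 --> t * lm <= 1 & (\<forall>f. cc f --> ip (EE t s lm f) (EE t s lm f) <= (1 - t * lm) * ip f f)"
proof -
 obtain C where C: "0 <= C" "!!f :: 'a => real. cc f ==> ip (AS s lm f) (AS s lm f) <= C * ip f f"
  using bop_AS[of s lm, where 'b = real] unfolding bop_def by metis
 show ?thesis
 proof (intro exI[of _ "min (1 / lm) (lm / (C + 1))"] conjI allI impI)
  fix t assume t: "0 < t & t <= min (1 / lm) (lm / (C + 1))"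
  then show "t * lm <= 1" using assms by (simp add: field_simps)
  have "t * (C + 1) <= lm" using t C by (simp add: field_simps)
  then have tC: "t * C <= lm" using t C by (simp add: distrib_left)
  fix f :: "'a => real" assume f: "cc f"
  have A: "lm * ip f f <= ip (AS s lm f) f"
   using f by (simp add: ip_AS sum_nonneg ip_self_nonneg)
  have "ip (EE t s lm f) (EE t s lm f) = ip f f - 2 * t * ip (AS s lm f) f + t * (t * ip (AS s lm f) (AS s lm f))"
   using ip_axpy[OF f cc_AS[OF f], of "- t" s lm]
   by (simp add: EE_def[abs_def] ip_commute[of f "AS s lm f"] power2_eq_square mult.assoc)
  also have "\<dots> <= ip f f - 2 * t * (lm * ip f f) + t * (t * (C * ip f f))"
   using t A C(2)[OF f] by (intro add_mono diff_mono mult_left_mono) auto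
  also have "\<dots> = ip f f - 2 * t * (lm * ip f f) + t * ip f f * (t * C)" by (simp add: algebra_simps)
  also have "\<dots> <= ip f f - 2 * t * (lm * ip f f) + t * ip f f * lm"
   using t tC ip_self_nonneg[of f] by (intro add_left_mono mult_left_mono) auto
  finally show "ip (EE t s lm f) (EE t s lm f) <= (1 - t * lm) * ip f f" by (simp add: algebra_simps)
 qed (use assms C in auto)
qed

text \<open>The bound must not depend on \<open>n\<close>. The order \<open>1 / \<epsilon>^2\<close>
  is affordable because the squared residual in which it is used carries the factor
  \<open>t^4\<close>.\<close>

lemma QQ_bound:
 assumes con: "!!f. cc f ==> ip (EE t s lm f) (EE t s lm f) <= (1 - \<epsilon>) * ip f f"
  and \<epsilon>: "0 < \<epsilon>" "\<epsilon> <= 1" and g: "cc g"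
 shows "ip (QQ t s lm g n) (QQ t s lm g n) <= 2 / \<epsilon>^2 * ip g g"
proof (induction n)
 case 0
 then show ?case by (simp add: ip_def II_def) (simp add: II_nonneg[unfolded II_def] ip_self_nonneg[unfolded ip_def II_def, simplified])
next
 case (Suc n)
 let ?E = "EE t s lm" and ?Q = "QQ t s lm g n"
 note c = cc_QQ[OF g] cc_EE g
 have e: "ip (?E (?E ?Q)) (?E (?E ?Q)) <= (1 - \<epsilon>)^2 * ip ?Q ?Q"
 proof -
  have "ip (?E (?E ?Q)) (?E (?E ?Q)) <= (1 - \<epsilon>) * ip (?E ?Q) (?E ?Q)" by (intro con c)
  also have "\<dots> <= (1 - \<epsilon>) * ((1 - \<epsilon>) * ip ?Q ?Q)" using \<epsilon> by (intro mult_left_mono con c) auto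
  finally show ?thesis by (simp add: power2_eq_square mult.assoc)
 qed
 have "ip (QQ t s lm g (Suc n)) (QQ t s lm g (Suc n)) <= (1 + 1 / \<epsilon>) * ip g g + (1 + \<epsilon>) * ip (?E (?E ?Q)) (?E (?E ?Q))"
  unfolding QQ.simps by (intro ip_add_self_le c \<epsilon>)
 also have "\<dots> <= (1 + 1 / \<epsilon>) * ip g g + (1 + \<epsilon>) * ((1 - \<epsilon>)^2 * ip ?Q ?Q)"
  using e \<epsilon> by (intro add_left_mono mult_left_mono) auto
 also have "(1 + \<epsilon>) * ((1 - \<epsilon>)^2 * ip ?Q ?Q) <= (1 - \<epsilon>) * ip ?Q ?Q"
 proof -
  have "(1 + \<epsilon>) * (1 - \<epsilon>)^2 = (1 - \<epsilon>^2) * (1 - \<epsilon>)" by (simp add: power2_eq_square algebra_simps)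
  also have "\<dots> <= 1 * (1 - \<epsilon>)" using \<epsilon> by (intro mult_right_mono) auto
  finally show ?thesis using mult_right_mono[OF _ ip_self_nonneg[of ?Q]] by (simp add: mult.assoc[symmetric])
 qed
 also have "(1 - \<epsilon>) * ip ?Q ?Q <= (1 - \<epsilon>) * (2 / \<epsilon>^2 * ip g g)"
  using \<epsilon> Suc.IH by (intro mult_left_mono) auto
 also have "(1 + 1 / \<epsilon>) * ip g g + (1 - \<epsilon>) * (2 / \<epsilon>^2 * ip g g) = ((1 + 1 / \<epsilon>) + (1 - \<epsilon>) * (2 / \<epsilon>^2)) * ip g g"
  by (simp add: algebra_simps)
 also have "\<dots> <= 2 / \<epsilon>^2 * ip g g"
  using \<epsilon> by (intro mult_right_mono ip_self_nonneg) (simp add: field_simps power2_eq_square)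
 finally show ?case by simp
qed

lemma QQ_telescope:
 "QQ t s lm g n x - EE t s lm (EE t s lm (QQ t s lm g n)) x = g x - (EE t s lm ^^ (2 * n)) g x"
proof (induction n arbitrary: x)
 case 0
 then show ?case by (simp add: EE_def AS_def LL_def Ds_def Df_def)
next
 case (Suc n)
 let ?E = "EE t s lm" and ?Q = "QQ t s lm g n"
 have "(%x. ?Q x - ?E (?E ?Q) x) = (%x. g x - (?E ^^ (2 * n)) g x)" using Suc by blast
 then have "?E (?E (%x. ?Q x - ?E (?E ?Q) x)) x = ?E (?E (%x. g x - (?E ^^ (2 * n)) g x)) x" by simp
 then show ?case by (simp add: EE_lin)
qed

text \<open>A quadratic functional has an exact expansion; its linear term is the residual of the
  Euler-Lagrange equation \<open>AS s lm f = dv s u\<close>.\<close>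

lemma JJ_expand:
 assumes "cc u" "cc f" "cc \<eta>"
 defines "\<delta> \<equiv> %x. \<eta> x - f x"
 shows "JJ s lm u \<eta> = JJ s lm u f + lm * ip \<delta> \<delta> + (\<Sum>i\<in>Basis. ip (Df s i \<delta>) (Df s i \<delta>))
  + 2 * ip (%x. AS s lm f x - dv s u x) \<delta>"
proof -
 have d: "cc \<delta>" unfolding \<delta>_def by (intro cc_diff assms)
 have u: "cc (%x. u x \<bullet> i)" for i by (rule cc_component[OF assms(1)])
 have exp: "ip (%x. F x + G x) (%x. F x + G x) = ip F F + 2 * ip F G + ip G G" if "cc F" "cc G" for F G :: "'a => real"
  using ip_axpy[OF that, of 1] by simp
 have e: "\<eta> = (%x. f x + \<delta> x)" by (simp add: \<delta>_def)
 have 1: "ip \<eta> \<eta> = ip f f + 2 * ip f \<delta> + ip \<delta> \<delta>" unfolding e by (rule exp[OF assms(2) d])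
 have 2: "ip (%x. Df s i \<eta> x - u x \<bullet> i) (%x. Df s i \<eta> x - u x \<bullet> i)
  = ip (%x. Df s i f x - u x \<bullet> i) (%x. Df s i f x - u x \<bullet> i)
   + 2 * (ip (Df s i f) (Df s i \<delta>) - ip (Ds s i (%x. u x \<bullet> i)) \<delta>) + ip (Df s i \<delta>) (Df s i \<delta>)" for i
 proof -
  have "(%x. Df s i \<eta> x - u x \<bullet> i) = (%x. (Df s i f x - u x \<bullet> i) + Df s i \<delta> x)"
   unfolding e Df_add by auto
  then have "ip (%x. Df s i \<eta> x - u x \<bullet> i) (%x. Df s i \<eta> x - u x \<bullet> i)
   = ip (%x. Df s i f x - u x \<bullet> i) (%x. Df s i f x - u x \<bullet> i)
   + 2 * ip (%x. Df s i f x - u x \<bullet> i) (Df s i \<delta>) + ip (Df s i \<delta>) (Df s i \<delta>)"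
   using exp[of "%x. Df s i f x - u x \<bullet> i" "Df s i \<delta>"] assms d u by (simp add: cc_diff cc_Df)
  moreover have "ip (%x. Df s i f x - u x \<bullet> i) (Df s i \<delta>) = ip (Df s i f) (Df s i \<delta>) - ip (%x. u x \<bullet> i) (Df s i \<delta>)"
   by (intro ip_diff_left cc_Df assms d u)
  moreover have "ip (%x. u x \<bullet> i) (Df s i \<delta>) = ip (Ds s i (%x. u x \<bullet> i)) \<delta>"
   using adjoint[OF d u, of s i i] by (simp add: ip_commute)
  ultimately show ?thesis by simp
 qed
 have 3: "ip (dv s u) \<delta> = (\<Sum>i\<in>Basis. ip (Ds s i (%x. u x \<bullet> i)) \<delta>)"
  unfolding dv_def[abs_def] by (intro ip_sum_left cc_Ds u d)
 have 4: "ip (%x. AS s lm f x - dv s u x) \<delta> = lm * ip f \<delta> + (\<Sum>i\<in>Basis. ip (Df s i f) (Df s i \<delta>)) - ip (dv s u) \<delta>"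
  using assms d by (simp add: ip_diff_left cc_AS cc_dv ip_AS)
 show ?thesis
  unfolding JJ_def 1 2 4 3 by (simp add: sum.distrib sum_subtractf sum_distrib_left[symmetric] algebra_simps)
qed

text \<open>The residual of the Euler sum has two parts: a high power of the contraction
  \<open>EE\<close>, small for large \<open>N\<close>, and \<open>t^2\<close> times the square of
  \<open>AS\<close> applied to a sum of size \<open>1 / t\<close>. A residual whose square has
  integral at most \<open>e * lm\<close> costs at most \<open>e\<close>, by completing the square
  with the \<open>lm\<close> term.\<close>

lemma euler_sum_near_minimiser:
 assumes "0 < s" "0 < lm" "cc u" "0 < e"
 shows "\<exists>t0>0. \<forall>t. 0 < t & t <= t0 -->
  (\<exists>N. \<forall>\<eta>. cc \<eta> --> JJ s lm u (%x. 2 * t * QQ t s lm (dv s u) N x) <= JJ s lm u \<eta> + e)"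
proof -
 let ?g = "dv s u"
 have g: "cc ?g" by (rule cc_dv[OF assms(3)])
 obtain t1 where t1: "0 < t1" "!!t f. 0 < t ==> t <= t1 ==> t * lm <= 1"
  "!!t f. 0 < t ==> t <= t1 ==> cc f ==> ip (EE t s lm f) (EE t s lm f) <= (1 - t * lm) * ip f f"
  using EE_contraction[OF assms(1,2)] by blast
 obtain C where C: "0 <= C" "!!f :: 'a => real. cc f ==> ip (AS s lm (AS s lm f)) (AS s lm (AS s lm f)) <= C * ip f f"
  using bop_comp[OF bop_AS[of s lm, where 'b = real] bop_AS[of s lm, where 'b = real]] unfolding bop_def by metis
 define X where "X = 4 * C * ip ?g ?g / lm^2"
 have X0: "0 <= X" using C ip_self_nonneg[of ?g] by (simp add: X_def)
 define t0 where "t0 = min t1 (min 1 (e * lm / (2 * (X + 1))))"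
 have "0 < t0" using t1 X0 assms by (simp add: t0_def)
 moreover have "\<exists>N. \<forall>\<eta>. cc \<eta> --> JJ s lm u (%x. 2 * t * QQ t s lm ?g N x) <= JJ s lm u \<eta> + e"
  if t: "0 < t & t <= t0" for t
 proof -
  let ?E = "EE t s lm"
  have tt: "0 < t" "t <= t1" using t by (auto simp: t0_def)
  have con: "ip (?E f) (?E f) <= (1 - t * lm) * ip f f" if "cc f" for f using t1(3)[OF tt that] .
  have "(1 - t * lm) ^ n * ip ?g ?g <= (1 - t * lm) ^ n * (ip ?g ?g + 1)" for n
   using t1(2)[OF tt] by (intro mult_left_mono) auto
  have Epow: "ip ((?E ^^ n) ?g) ((?E ^^ n) ?g) <= (1 - t * lm) ^ n * ip ?g ?g" for n
  proof (induction n)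
   case (Suc n)
   have "ip ((?E ^^ Suc n) ?g) ((?E ^^ Suc n) ?g) <= (1 - t * lm) * ip ((?E ^^ n) ?g) ((?E ^^ n) ?g)"
    by (simp add: con cc_funpow_EE g)
   also have "\<dots> <= (1 - t * lm) * ((1 - t * lm) ^ n * ip ?g ?g)"
    using t1(2)[OF tt] by (intro mult_left_mono Suc) auto
   finally show ?case by (simp add: mult.assoc)
  qed simp
  have "(%n. (1 - t * lm) ^ n) \<longlonglongrightarrow> 0"
   using t1(2)[OF tt] tt assms by (intro LIMSEQ_power_zero) auto
  then have "(%n. (1 - t * lm) ^ n * ip ?g ?g) \<longlonglongrightarrow> 0 * ip ?g ?g" by (intro tendsto_mult tendsto_const)
  then have "eventually (%n. (1 - t * lm) ^ n * ip ?g ?g < e * lm / 4) sequentially"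
   using assms by (intro order_tendstoD(2)[of _ 0]) auto
  then obtain N where N: "!!n. N <= n ==> (1 - t * lm) ^ n * ip ?g ?g < e * lm / 4"
   by (auto simp: eventually_sequentially)
  define Q where "Q = QQ t s lm ?g N"
  have Q: "cc Q" unfolding Q_def by (rule cc_QQ[OF g])
  define f where "f = (%x. 2 * t * Q x)"
  have f: "cc f" unfolding f_def by (rule cc_cmult[OF Q])
  define r1 where "r1 = (?E ^^ (2 * N)) ?g"
  define r2 where "r2 = (%x. t^2 * AS s lm (AS s lm Q) x)"
  have r12: "cc r1" "cc r2" unfolding r1_def r2_def by (intro cc_funpow_EE g cc_cmult cc_AS Q)+
  have res: "AS s lm f x - ?g x = r2 x - r1 x" for x
  proof -
   have "Q x - ?E (?E Q) x = ?g x - r1 x" unfolding Q_def r1_def by (rule QQ_telescope)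
   moreover have "?E (?E Q) x = Q x - 2 * t * AS s lm Q x + r2 x"
    using AS_lin(3)[of s lm t "AS s lm Q"] AS_lin(2)[of s lm Q "%x. t * AS s lm Q x"]
    by (simp add: EE_def[abs_def] r2_def power2_eq_square algebra_simps)
   moreover have "AS s lm f x = 2 * t * AS s lm Q x"
    using AS_lin(3)[of s lm "2 * t" Q] by (simp add: f_def)
   ultimately show ?thesis by simp
  qed
  have b1: "ip r1 r1 <= e * lm / 4" unfolding r1_def
   by (rule order_trans[OF Epow less_imp_le[OF N]]) simp
  have b2: "ip r2 r2 <= t^2 * X / 2 * 1"
  proof -
   have "ip r2 r2 = t^2 * (t^2 * ip (AS s lm (AS s lm Q)) (AS s lm (AS s lm Q)))"
    using ip_scaleR_self[of "t^2" "AS s lm (AS s lm Q)"] by (simp add: r2_def power2_eq_square mult.assoc)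
   also have "\<dots> <= t^2 * (t^2 * (C * (2 / (t * lm)^2 * ip ?g ?g)))"
   proof (intro mult_left_mono order_trans[OF C(2)[OF Q]])
    show "ip Q Q <= 2 / (t * lm)^2 * ip ?g ?g"
     unfolding Q_def by (rule QQ_bound[OF con _ _ g]) (use tt assms t1 in auto)
   qed (use C in auto)
   also have "\<dots> = t^2 * X / 2" using tt assms by (simp add: X_def power_mult_distrib)
   finally show ?thesis by simp
  qed
  have b3: "t^2 * X <= e * lm / 2"
  proof -
   have "t^2 * X <= t * X" using t X0 by (intro mult_right_mono) (auto simp: power2_eq_square t0_def mult_le_one)
   also have "\<dots> <= t * (X + 1)" using tt by (simp add: distrib_left)
   also have "\<dots> <= e * lm / 2" using t X0 by (simp add: t0_def field_simps)
   finally show ?thesis .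
  qed
  have "ip (%x. r2 x - r1 x) (%x. r2 x - r1 x) <= 2 * ip r2 r2 + 2 * ip r1 r1"
  proof -
   have m: "ip (%x. - r1 x) (%x. - r1 x) = ip r1 r1" by (simp add: ip_def)
   show ?thesis using ip_add_self_le[OF r12(2) cc_minus[OF r12(1)], of 1] by (simp add: m)
  qed
  also have "\<dots> <= e * lm" using b1 b2 b3 by simp
  finally have b: "ip (%x. r2 x - r1 x) (%x. r2 x - r1 x) <= e * lm" .
  have "JJ s lm u f <= JJ s lm u \<eta> + e" if \<eta>: "cc \<eta>" for \<eta>
  proof -
   let ?d = "%x. \<eta> x - f x" and ?r = "%x. r2 x - r1 x"
   have cd: "cc ?d" "cc ?r" by (intro cc_diff \<eta> f r12)+
   have "0 <= ip (%x. ?r x + lm * ?d x) (%x. ?r x + lm * ?d x)" by (rule ip_self_nonneg)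
   also have "\<dots> = ip ?r ?r + 2 * lm * ip ?r ?d + lm^2 * ip ?d ?d"
    using ip_axpy[OF cd(2) cd(1), of lm] by simp
   finally have "0 <= lm * e + 2 * lm * ip ?r ?d + lm^2 * ip ?d ?d" using b by (simp add: mult.commute)
   then have "0 <= lm * (e + 2 * ip ?r ?d + lm * ip ?d ?d)" by (simp add: power2_eq_square algebra_simps)
   then have "0 <= e + 2 * ip ?r ?d + lm * ip ?d ?d" using assms by (simp add: zero_le_mult_iff)
   moreover have "0 <= (\<Sum>i\<in>Basis. ip (Df s i ?d) (Df s i ?d))" by (intro sum_nonneg ip_self_nonneg)
   moreover have "JJ s lm u \<eta> = JJ s lm u f + lm * ip ?d ?d + (\<Sum>i\<in>Basis. ip (Df s i ?d) (Df s i ?d)) + 2 * ip ?r ?d"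
    using JJ_expand[OF assms(3) f \<eta>, of s lm] by (simp add: res)
   ultimately show ?thesis by linarith
  qed
  then show ?thesis unfolding f_def Q_def by blast
 qed
 ultimately show ?thesis by blast
qed

end

section \<open>Dissipation of the Bellman energy\<close>

text \<open>The discrete Hessian of \<open>V\<close> is required to be close to a sum of rank one
  matrices with nonnegative coefficients. This is how the convexity of \<open>V\<close> enters, and
  the rank one form matches the last clause of \<open>bellman\<close>.\<close>

locale wtH = wt m L for m :: "'a::euclidean_space => real" and L +
 fixes F :: "'f set" and av :: "'f => 'a" and qv :: "'f => 'a => real" and Qm C1 :: real
 assumes fin: "finite F" and qv_cont: "!!f. cont (qv f)"
  and qv_nonneg: "!!f x. 0 <= qv f x" and qv_le: "!!f x. qv f x <= Qm" and C1: "0 <= C1"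
  and cK_approx: "!!s i j x. 0 < s ==> s <= 1 ==> i \<in> Basis ==> j \<in> Basis ==>
   \<bar>cK s i j x - (\<Sum>f\<in>F. qv f x * (av f \<bullet> i) * (av f \<bullet> j))\<bar> <= C1 * s"
begin

text \<open>In the application this is the exact Hessian \<open>V''\<close>, and \<open>RR\<close> the discretisation error.\<close>

definition HH :: "('a => 'a) => 'a => 'a" where
 "HH U x = (\<Sum>f\<in>F. (qv f x * (U x \<bullet> av f)) *\<^sub>R av f)"

definition Hij :: "'a => 'a => 'a => real" where
 "Hij i j x = (\<Sum>f\<in>F. qv f x * (av f \<bullet> i) * (av f \<bullet> j))"

definition Hm :: real where "Hm = (\<Sum>f\<in>F. Qm * (norm (av f))^2)"

definition RR :: "real => ('a => 'a) => 'a => 'a" where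
 "RR s U x = KK s U x - HH U x"

definition YY :: "real => ('a => 'a) => real" where
 "YY s U = (\<Sum>i\<in>Basis. ip (Df s i U) (Df s i U))"

lemma Qm_nonneg: "0 <= Qm" using qv_nonneg qv_le order_trans by blast

lemma Hm_nonneg: "0 <= Hm" unfolding Hm_def using Qm_nonneg by (intro sum_nonneg) auto

lemma Hij_bound:
 assumes "i \<in> Basis" "j \<in> Basis" shows "\<bar>Hij i j x\<bar> <= Hm"
 unfolding Hij_def Hm_def
proof (rule order_trans[OF sum_abs], rule sum_mono)
 fix f assume "f \<in> F"
 have "\<bar>av f \<bullet> i\<bar> * \<bar>av f \<bullet> j\<bar> <= norm (av f) * norm (av f)"
  by (intro mult_mono Basis_le_norm assms) auto
 then show "\<bar>qv f x * (av f \<bullet> i) * (av f \<bullet> j)\<bar> <= Qm * (norm (av f))^2"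
  using mult_mono[OF qv_le[of f x], of "\<bar>av f \<bullet> i\<bar> * \<bar>av f \<bullet> j\<bar>" "norm (av f) * norm (av f)"] qv_nonneg[of f x] Qm_nonneg
  by (simp add: abs_mult power2_eq_square mult.assoc)
qed

lemma Hij_cont: "cont (Hij i j)"
 unfolding Hij_def[abs_def]
 by (intro continuous_on_sum continuous_on_mult qv_cont continuous_on_const)

lemma HH_expand: "HH U x = (\<Sum>j\<in>Basis. \<Sum>i\<in>Basis. (Hij i j x * (U x \<bullet> i)) *\<^sub>R j)"
proof (rule euclidean_eqI)
 fix j :: 'a assume j: "j \<in> Basis"
 have "HH U x \<bullet> j = (\<Sum>f\<in>F. qv f x * (U x \<bullet> av f) * (av f \<bullet> j))"
  by (simp add: HH_def inner_sum_left)
 also have "\<dots> = (\<Sum>f\<in>F. \<Sum>i\<in>Basis. qv f x * ((U x \<bullet> i) * (av f \<bullet> i)) * (av f \<bullet> j))"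
  by (subst euclidean_inner) (simp add: sum_distrib_left sum_distrib_right)
 also have "\<dots> = (\<Sum>i\<in>Basis. Hij i j x * (U x \<bullet> i))"
  by (subst sum.swap) (simp add: Hij_def sum_distrib_right sum_distrib_left mult_ac)
 also have "\<dots> = (\<Sum>j\<in>Basis. \<Sum>i\<in>Basis. (Hij i j x * (U x \<bullet> i)) *\<^sub>R j) \<bullet> j"
  using j unfolding scaleR_sum_left[symmetric] by (subst inner_sum_left_Basis) auto
 finally show "HH U x \<bullet> j = (\<Sum>j\<in>Basis. \<Sum>i\<in>Basis. (Hij i j x * (U x \<bullet> i)) *\<^sub>R j) \<bullet> j" .
qed

lemma cc_HH: assumes "cc U" shows "cc (HH U)"
 unfolding HH_def[abs_def]
 by (intro cc_sum cc_scaleR_right cc_mult_left qv_cont cc_component assms continuous_on_const)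

lemma cc_RR: "cc U ==> cc (RR s U)"
 unfolding RR_def[abs_def] by (intro cc_diff cc_KK cc_HH)

lemma YY_nonneg: "0 <= YY s U" unfolding YY_def by (intro sum_nonneg ip_self_nonneg)

text \<open>Two discrepancies are of order \<open>s\<close>: the coefficient \<open>cK\<close>
  against \<open>Hij\<close>, and the shifted evaluation point in \<open>KK\<close>, which costs
  \<open>s\<close> times differences of \<open>U\<close> and brings in \<open>YY\<close>.\<close>

lemma RR_bound:
 shows "\<exists>C\<ge>0. \<forall>s U. 0 < s & s <= 1 & cc U --> ip (RR s U) (RR s U) <= C * s^2 * (ip U U + YY s U)"
proof -
 let ?n = "real (card (Basis :: 'a set))"
 define K where "K = 3 * (C1 + Hm)^2 * exp (L * 2)"
 have K0: "0 <= K" by (simp add: K_def)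
 have e1: "1 <= exp (L * 2)" using L0 by simp
 have main: "ip (RR s U) (RR s U) <= (?n * (?n * (?n * (?n * (2 * K))))) * s^2 * (ip U U + YY s U)"
  if s: "0 < s" "s <= 1" and U: "cc U" for s U
 proof -
  let ?h = "%i j. s *\<^sub>R j - s *\<^sub>R i"
  define g where "g j i x = cK s i j x * (U (x + s *\<^sub>R j - s *\<^sub>R i) \<bullet> i) - Hij i j x * (U x \<bullet> i)" for j i x
  have ccg: "cc (g j i)" for j i
   unfolding g_def[abs_def]
   by (intro cc_diff cc_mult_left cK_cont continuous_on_id Hij_cont cc_component[OF U] cc_component[OF cc_shift2[OF U]])
  have RRg: "RR s U = (%x. \<Sum>j\<in>Basis. \<Sum>i\<in>Basis. g j i x *\<^sub>R j)"
   by (simp add: RR_def[abs_def] KK_def HH_expand g_def scaleR_sum_left scaleR_diff_left sum_subtractf)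
  have gb: "ip (%x. g j i x *\<^sub>R j) (%x. g j i x *\<^sub>R j) <= 2 * K * s^2 * (ip U U + YY s U)"
   if ij: "i \<in> Basis" "j \<in> Basis" for i j
  proof -
   define C where "C = C1 + Hm"
   have C: "C1 <= C" "Hm <= C" "0 <= C" using C1 Hm_nonneg by (auto simp: C_def)
   have nh: "norm (?h i j) <= 2"
    using norm_triangle_ineq4[of "s *\<^sub>R j" "s *\<^sub>R i"] ij s by simp
   have eh: "exp (L * norm (?h i j)) <= exp (L * 2)" using nh L0 by (simp add: mult_left_mono)
   have pt: "(norm (g j i x *\<^sub>R j))^2 <= 3 * C^2 * s^2 * ((norm (U (x + ?h i j)))^2
     + (norm (Df s i U (x + ?h i j)))^2 + (norm (Df s j U x))^2)" for x
   proof -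
    let ?a = "norm (U (x + ?h i j))" and ?b = "norm (Df s i U (x + ?h i j))" and ?c = "norm (Df s j U x)"
    \<comment> \<open>The shifted point is reached in two steps, first along \<open>j\<close> and
      then back along \<open>i\<close>.\<close>
    have "U (x + ?h i j) - U x = s *\<^sub>R Df s j U x - s *\<^sub>R Df s i U (x + ?h i j)"
     using s by (simp add: Df_def algebra_simps)
    then have "g j i x = (cK s i j x - Hij i j x) * (U (x + ?h i j) \<bullet> i)
     + Hij i j x * (s * (Df s j U x \<bullet> i)) - Hij i j x * (s * (Df s i U (x + ?h i j) \<bullet> i))"
     unfolding g_def
     by (smt (verit, best) add_diff_eq inner_diff_left inner_scaleR_left left_diff_distrib right_diff_distrib)
    moreover have cb: "\<bar>cK s i j x - Hij i j x\<bar> <= C * s"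
     using cK_approx[OF s ij, of x] mult_right_mono[OF C(1), of s] s unfolding Hij_def by linarith
    ultimately have "\<bar>g j i x\<bar> <= \<bar>(cK s i j x - Hij i j x) * (U (x + ?h i j) \<bullet> i)\<bar>
     + \<bar>Hij i j x * (s * (Df s j U x \<bullet> i))\<bar> + \<bar>Hij i j x * (s * (Df s i U (x + ?h i j) \<bullet> i))\<bar>"
     by linarith
    also have "\<dots> = \<bar>cK s i j x - Hij i j x\<bar> * \<bar>U (x + ?h i j) \<bullet> i\<bar>
     + \<bar>Hij i j x\<bar> * (s * \<bar>Df s j U x \<bullet> i\<bar>) + \<bar>Hij i j x\<bar> * (s * \<bar>Df s i U (x + ?h i j) \<bullet> i\<bar>)"
     using s by (simp only: abs_mult abs_of_pos)
    also have "\<dots> <= (C * s) * ?a + C * (s * ?c) + C * (s * ?b)"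
     using cb Hij_bound[OF ij, of x] C s
     by (intro add_mono mult_mono Basis_le_norm ij mult_left_mono) auto
    also have "\<dots> = C * s * (?a + ?b + ?c)" by (simp add: algebra_simps)
    finally have "(\<bar>g j i x\<bar>)^2 <= (C * s * (?a + ?b + ?c))^2" by (intro power_mono) auto
    also have "\<dots> <= C^2 * s^2 * (3 * (?a^2 + ?b^2 + ?c^2))"
    proof -
     have "(?a + ?b + ?c)^2 <= 3 * (?a^2 + ?b^2 + ?c^2)"
      using sum_squares_bound[of ?a ?b] sum_squares_bound[of ?b ?c] sum_squares_bound[of ?a ?c]
      by (simp add: power2_eq_square algebra_simps)
     then show ?thesis by (simp add: power_mult_distrib mult_left_mono)
    qed
    finally show ?thesis using ij by (simp add: algebra_simps)
   qed
   note cx = cc_power2[OF cc_norm[OF cc_shift[OF U]]] cc_power2[OF cc_norm[OF cc_shift[OF cc_Df[OF U]]]]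
    cc_power2[OF cc_norm[OF cc_Df[OF U]]]
   have "ip (%x. g j i x *\<^sub>R j) (%x. g j i x *\<^sub>R j) <= II (%x. 3 * C^2 * s^2 * ((norm (U (x + ?h i j)))^2
     + (norm (Df s i U (x + ?h i j)))^2 + (norm (Df s j U x))^2))"
    unfolding ip_self
    by (intro II_mono cc_power2 cc_norm cc_scaleR_right ccg continuous_on_const cc_cmult cc_add cx pt)
   also have "\<dots> = 3 * C^2 * s^2 * (ip (%x. U (x + ?h i j)) (%x. U (x + ?h i j))
     + ip (%x. Df s i U (x + ?h i j)) (%x. Df s i U (x + ?h i j)) + ip (Df s j U) (Df s j U))"
    unfolding II_cmult ip_self by (subst II_add, intro cc_add cx, rule cx, subst II_add, rule cx, rule cx, rule refl)
   also have "\<dots> <= 3 * C^2 * s^2 * (exp (L * 2) * ip U U + exp (L * 2) * ip (Df s i U) (Df s i U) + exp (L * 2) * ip (Df s j U) (Df s j U))"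
   proof (intro mult_left_mono add_mono)
    show "ip (%x. U (x + ?h i j)) (%x. U (x + ?h i j)) <= exp (L * 2) * ip U U"
     by (rule order_trans[OF ip_shift_le[OF U] mult_right_mono[OF eh ip_self_nonneg]])
    show "ip (%x. Df s i U (x + ?h i j)) (%x. Df s i U (x + ?h i j)) <= exp (L * 2) * ip (Df s i U) (Df s i U)"
     by (rule order_trans[OF ip_shift_le[OF cc_Df[OF U]] mult_right_mono[OF eh ip_self_nonneg]])
    show "ip (Df s j U) (Df s j U) <= exp (L * 2) * ip (Df s j U) (Df s j U)"
     using mult_right_mono[OF e1 ip_self_nonneg[of "Df s j U"]] by simp
   qed auto
   also have "\<dots> = K * s^2 * (ip U U + ip (Df s i U) (Df s i U) + ip (Df s j U) (Df s j U))"
    by (simp add: K_def C_def algebra_simps)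
   also have "\<dots> <= K * s^2 * (2 * (ip U U + YY s U))"
   proof -
    have "ip (Df s i U) (Df s i U) <= YY s U" "ip (Df s j U) (Df s j U) <= YY s U"
     unfolding YY_def using ij by (auto intro!: member_le_sum ip_self_nonneg)
    then show ?thesis using K0 ip_self_nonneg[of U] by (intro mult_left_mono) auto
   qed
   finally show ?thesis by (simp add: algebra_simps)
  qed
  have ccj: "cc (%x. g j i x *\<^sub>R j)" for i j by (intro cc_scaleR_right ccg continuous_on_const)
  have "ip (RR s U) (RR s U) <= ?n * (\<Sum>j\<in>Basis. ip (%x. \<Sum>i\<in>Basis. g j i x *\<^sub>R j) (%x. \<Sum>i\<in>Basis. g j i x *\<^sub>R j))"
   unfolding RRg by (intro ip_sum_self_le cc_sum ccj) auto
  also have "\<dots> <= ?n * (\<Sum>j\<in>(Basis :: 'a set). ?n * (\<Sum>i\<in>Basis. ip (%x. g j i x *\<^sub>R j) (%x. g j i x *\<^sub>R j)))"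
   by (intro mult_left_mono sum_mono ip_sum_self_le ccj) auto
  also have "\<dots> <= ?n * (\<Sum>j\<in>(Basis :: 'a set). ?n * (\<Sum>i\<in>(Basis :: 'a set). 2 * K * s^2 * (ip U U + YY s U)))"
   by (intro mult_left_mono sum_mono gb) auto
  also have "\<dots> = (?n * (?n * (?n * (?n * (2 * K))))) * s^2 * (ip U U + YY s U)" by simp
  finally show ?thesis .
 qed
 show ?thesis
  by (intro exI[of _ "?n * (?n * (?n * (?n * (2 * K))))"] conjI allI impI) (use main K0 in auto)
qed

lemma ip_young:
 fixes f g :: "'a => 'b::euclidean_space"
 assumes "cc f" "cc g" "0 < s"
 shows "\<bar>ip f g\<bar> <= (s * ip f f + ip g g / s) / 2"
proof -
 have "\<bar>ip f g\<bar> <= II (%x. \<bar>f x \<bullet> g x\<bar>)" unfolding ip_def by (intro II_abs ip_cc assms)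
 also have "\<dots> <= II (%x. s / 2 * (norm (f x))^2 + 1 / (2 * s) * (norm (g x))^2)"
 proof (intro II_mono cc_abs ip_cc cc_add cc_cmult cc_power2 cc_norm assms)
  fix x
  have "\<bar>f x \<bullet> g x\<bar> <= norm (f x) * norm (g x)" by (rule Cauchy_Schwarz_ineq2)
  also have "2 * (norm (f x) * norm (g x)) <= s * (norm (f x))^2 + (norm (g x))^2 / s"
   using sum_squares_bound[of "sqrt s * norm (f x)" "norm (g x) / sqrt s"] \<open>0 < s\<close>
   by (simp add: power_divide power_mult_distrib)
  then have "norm (f x) * norm (g x) <= s / 2 * (norm (f x))^2 + 1 / (2 * s) * (norm (g x))^2"
   using \<open>0 < s\<close> by (simp add: field_simps)
  finally show "\<bar>f x \<bullet> g x\<bar> <= s / 2 * (norm (f x))^2 + 1 / (2 * s) * (norm (g x))^2" .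
 qed
 also have "\<dots> = (s * ip f f + ip g g / s) / 2"
 proof -
  have "II (%x. s / 2 * (norm (f x))^2 + 1 / (2 * s) * (norm (g x))^2)
   = s / 2 * II (%x. (norm (f x))^2) + 1 / (2 * s) * II (%x. (norm (g x))^2)"
   unfolding II_cmult[symmetric] by (intro II_add cc_cmult cc_power2 cc_norm assms)
  then show ?thesis unfolding ip_self using \<open>0 < s\<close> by (simp add: field_simps)
 qed
 finally show ?thesis .
qed

lemma sum_Pair: "(\<Sum>i\<in>A. (f i, g i)) = (sum f A, sum g A)"
 by (simp add: prod_eq_iff fst_sum snd_sum)

text \<open>Up to second order an Euler step lowers the energy by \<open>t\<close> times the pairing
  of its gradient with \<open>AV\<close>. Convexity bounds this pairing below by the products
  occurring in \<open>dv_ip\<close>. The term with \<open>\<delta>\<close> dissipates a multiple of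
  \<open>lm * X + Y\<close>, where \<open>X\<close> and \<open>Y\<close> measure the fields and
  their differences, and so pays for \<open>RR\<close> and for the Taylor remainder.\<close>

lemma bellman_drop:
 fixes B :: "'a \<times> 'a => real"
 assumes bell: "bellman B G Lb" and lm: "0 < lm" and \<delta>: "0 < \<delta>"
 shows "\<exists>s0>0. s0 <= 1 & (\<forall>s. 0 < s & s <= s0 --> (\<exists>t0>0. \<forall>t U W. 0 < t & t <= t0 & cc U & cc W -->
  t * \<bar>ip (dv s U) (dv s W)\<bar> <= 56 * real DIM('a) *
   (II (%x. B (U x, W x) + \<delta> * (norm (U x, W x))^2)
   - II (%x. B (EV t s lm U x, EV t s lm W x) + \<delta> * (norm (EV t s lm U x, EV t s lm W x))^2))))"
proof -
 note bell' = bell[unfolded bellman_def]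
 have Lb: "0 <= Lb" and Bc: "cont B" and Gc: "cont G" and B0: "B 0 = 0" and G0: "G 0 = 0"
  and Tay: "!!z z'. B z' <= B z + G z \<bullet> (z' - z) + Lb * (norm (z' - z))^2"
  and Gb: "!!z. norm (G z) <= Lb * norm z"
  and Gm: "!!z z'. 0 <= (G z' - G z) \<bullet> (z' - z)"
  and T3: "!!z0 z1 z2. norm (fst (z1 - z0)) * norm (snd (z2 - z0)) <= 28 * ((G z1 - G z0) \<bullet> (z1 - z0) + (G z2 - G z0) \<bullet> (z2 - z0))"
  and R1: "!!z a. \<bar>fst z \<bullet> a\<bar> * \<bar>snd z \<bullet> a\<bar> <= G z \<bullet> ((fst z \<bullet> a) *\<^sub>R a, (snd z \<bullet> a) *\<^sub>R a)"
  using bell' by auto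
 obtain CR where CR: "0 <= CR" "!!s U. 0 < s ==> s <= 1 ==> cc U ==> ip (RR s U) (RR s U) <= CR * s^2 * (ip U U + YY s U)"
  using RR_bound by blast
 let ?d = "real DIM('a)"
 have d1: "1 <= ?d" using DIM_positive[where 'a = 'a] by (simp add: Suc_leI)
 \<comment> \<open>The 28 of the three point inequality, doubled because each direction occurs as
   first and as second index of a pair, times the dimension for the free index.\<close>
 define c0 where "c0 = 56 * ?d"
 have c0: "1 <= c0" unfolding c0_def using d1 by linarith
 define \<mu> where "\<mu> = min lm 1"
 have \<mu>: "0 < \<mu>" "\<mu> <= lm" "\<mu> <= 1" using lm by (auto simp: \<mu>_def)
 define k0 where "k0 = (1 + CR + Lb^2) / 2"
 have k0: "0 < k0" using CR Lb by (simp add: k0_def add_pos_nonneg)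
 \<comment> \<open>This makes the errors of order \<open>s\<close> at most half of the extra
   dissipation; the rest is left for the Taylor remainder, which fixes \<open>t0\<close>
   below.\<close>
 define s0 where "s0 = min 1 (\<delta> * \<mu> / (k0 * (2 + 2 * \<delta>)))"
 have s0: "0 < s0" "s0 <= 1" using \<delta> \<mu> k0 by (auto simp: s0_def)
 show ?thesis
 proof (rule exI[of _ s0], intro conjI allI impI s0)
  fix s assume "0 < s & s <= s0"
  then have s: "0 < s" "s <= 1" "s <= \<delta> * \<mu> / (k0 * (2 + 2 * \<delta>))" by (auto simp: s0_def)
  define \<kappa> where "\<kappa> = k0 * s"
  have kk: "0 < k0 * (2 + 2 * \<delta>)" using k0 \<delta> by simp
  have "s * (k0 * (2 + 2 * \<delta>)) <= \<delta> * \<mu>" using s(3) unfolding pos_le_divide_eq[OF kk] .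
  then have \<kappa>: "0 <= \<kappa>" "\<kappa> * (2 + 2 * \<delta>) <= \<delta> * \<mu>"
   using s k0 by (auto simp: \<kappa>_def mult_ac)
  obtain \<Lambda> where \<Lambda>: "0 <= \<Lambda>" "!!U. cc U ==> ip (AV s lm U) (AV s lm U) <= \<Lambda> * ip U U"
   using bop_AV[of s lm] unfolding bop_def by metis
  define t0 where "t0 = \<delta> * \<mu> / ((Lb + \<delta>) * \<Lambda> + 1)"
  have den: "0 < (Lb + \<delta>) * \<Lambda> + 1" using Lb \<delta> \<Lambda> by (simp add: add_nonneg_pos)
  have t0: "0 < t0" using den \<delta> \<mu> by (simp add: t0_def)
  have main: "t * \<bar>ip (dv s U) (dv s W)\<bar> <= c0 *
   (II (%x. B (U x, W x) + \<delta> * (norm (U x, W x))^2)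
   - II (%x. B (EV t s lm U x, EV t s lm W x) + \<delta> * (norm (EV t s lm U x, EV t s lm W x))^2))"
   if t: "0 < t" "t <= t0" and U: "cc U" and W: "cc W" for t U W
  proof -
   define Z where "Z x = (U x, W x)" for x
   define a where "a x = (AV s lm U x, AV s lm W x)" for x
   define HZ where "HZ x = (HH U x, HH W x)" for x
   define RZ where "RZ x = (RR s U x, RR s W x)" for x
   define GZ where "GZ x = G (Z x)" for x
   have cZ: "cc Z" unfolding Z_def[abs_def] by (intro cc_Pair U W)
   have ca: "cc a" unfolding a_def[abs_def] by (intro cc_Pair cc_AV U W)
   have cHZ: "cc HZ" unfolding HZ_def[abs_def] by (intro cc_Pair cc_HH U W)
   have cRZ: "cc RZ" unfolding RZ_def[abs_def] by (intro cc_Pair cc_RR U W)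
   have cGZ: "cc GZ" unfolding GZ_def[abs_def] by (rule cc_compose[OF cZ Gc G0])
   have ip_pair: "ip (%x. (f x, g x)) (%x. (f' x, g' x)) = ip f f' + ip g g'"
    if "cc f" "cc g" "cc f'" "cc g'" for f g f' g' :: "'a => 'a"
    using that by (simp add: ip_def II_add ip_cc)
   have DZ: "Df s i Z x = (Df s i U x, Df s i W x)" for i x by (simp add: Df_def Z_def)
   have aZ: "a x = AS s lm Z x + (HZ x + RZ x)" for x
   proof -
    have "AS s lm Z x = (AS s lm U x, AS s lm W x)"
     by (simp add: AS_def LL_def Ds_def DZ sum_Pair Z_def)
    then show ?thesis by (simp add: a_def AV_def HZ_def RZ_def RR_def)
   qed
   define X where "X = ip U U + ip W W"
   define Y where "Y = YY s U + YY s W"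
   have X0: "0 <= X" and Y0: "0 <= Y" by (auto simp: X_def Y_def intro!: add_nonneg_nonneg ip_self_nonneg YY_nonneg)
   have ZX: "ip Z Z = X" unfolding Z_def[abs_def] X_def by (rule ip_pair[OF U W U W])
   have RX: "ip RZ RZ <= CR * s^2 * (X + Y)"
   proof -
    have "ip RZ RZ = ip (RR s U) (RR s U) + ip (RR s W) (RR s W)"
     unfolding RZ_def[abs_def] by (intro ip_pair cc_RR U W)
    also have "\<dots> <= CR * s^2 * (ip U U + YY s U) + CR * s^2 * (ip W W + YY s W)"
     by (intro add_mono CR s U W)
    finally show ?thesis by (simp add: X_def Y_def algebra_simps)
   qed
   have aX: "ip a a <= \<Lambda> * X"
   proof -
    have "ip a a = ip (AV s lm U) (AV s lm U) + ip (AV s lm W) (AV s lm W)"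
     unfolding a_def[abs_def] by (intro ip_pair cc_AV U W)
    then show ?thesis using \<Lambda>(2)[OF U] \<Lambda>(2)[OF W] by (simp add: X_def distrib_left)
   qed
   have err: "\<bar>ip f g\<bar> <= \<kappa> * (X + Y)" if "cc f" "cc g" "ip f f <= (1 + Lb^2) * X" "ip g g <= CR * s^2 * (X + Y)"
    for f g :: "'a => 'c::euclidean_space"
   proof -
    have "\<bar>ip f g\<bar> <= (s * ip f f + ip g g / s) / 2" by (rule ip_young[OF that(1,2) s(1)])
    also have "\<dots> <= (s * ((1 + Lb^2) * X) + CR * s^2 * (X + Y) / s) / 2"
     using that s by (intro divide_right_mono add_mono mult_left_mono) auto
    also have "\<dots> = (s * ((1 + Lb^2) * X) + s * (CR * (X + Y))) / 2"
     using s by (simp add: power2_eq_square)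
    also have "\<dots> <= (s * ((1 + Lb^2) * (X + Y)) + s * (CR * (X + Y))) / 2"
     using s Y0 by (intro divide_right_mono add_right_mono mult_left_mono) auto
    also have "\<dots> = \<kappa> * (X + Y)" by (simp add: \<kappa>_def k0_def algebra_simps)
    finally show ?thesis .
   qed
   have XX: "X <= (1 + Lb^2) * X" using X0 by (simp add: distrib_right)
   define S1 where "S1 = (\<Sum>i\<in>Basis. ip (Df s i Z) (Df s i GZ))"
   define S2 where "S2 = ip GZ HZ"
   define D1 where "D1 = II (%x. \<Sum>j\<in>Basis. \<Sum>i\<in>Basis. norm (Df s j U x) * norm (Df s i W x))"
   define D2 where "D2 = II (%x. \<bar>HH U x \<bullet> W x\<bar>)"
   \<comment> \<open>The three point inequality is applied at \<open>x\<close> and its neighbours in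
     the directions \<open>j\<close> and \<open>i\<close>.\<close>
   have D1S1: "D1 <= c0 * S1"
   proof -
    define \<gamma> where "\<gamma> i x = Df s i Z x \<bullet> Df s i GZ x" for i x
    have c\<gamma>: "cc (\<gamma> i)" for i unfolding \<gamma>_def[abs_def] by (intro ip_cc cc_Df cZ cGZ)
    have pt: "norm (Df s j U x) * norm (Df s i W x) <= 28 * (\<gamma> j x + \<gamma> i x)" for i j x
    proof -
     let ?z1 = "Z (x + s *\<^sub>R j)" and ?z2 = "Z (x + s *\<^sub>R i)" and ?z0 = "Z x"
     have g: "\<gamma> k x = ((G (Z (x + s *\<^sub>R k)) - G ?z0) \<bullet> (Z (x + s *\<^sub>R k) - ?z0)) / s^2" for k
      by (simp add: \<gamma>_def Df_def GZ_def inner_commute power2_eq_square divide_inverse)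
     have "norm (Df s j U x) * norm (Df s i W x) = norm (fst (?z1 - ?z0)) * norm (snd (?z2 - ?z0)) / s^2"
      using s by (simp add: Df_def Z_def power2_eq_square divide_inverse)
     also have "\<dots> <= 28 * ((G ?z1 - G ?z0) \<bullet> (?z1 - ?z0) + (G ?z2 - G ?z0) \<bullet> (?z2 - ?z0)) / s^2"
      by (intro divide_right_mono T3) auto
     also have "\<dots> = 28 * (\<gamma> j x + \<gamma> i x)" by (simp add: g add_divide_distrib)
     finally show ?thesis .
    qed
    have "D1 <= II (%x. c0 * (\<Sum>i\<in>Basis. \<gamma> i x))"
     unfolding D1_def
    proof (intro II_mono cc_cmult cc_sum c\<gamma>)
     show "cc (%x. norm (Df s j U x) * norm (Df s i W x))" for i j
      by (intro cc_mult_left cc_cont[OF cc_norm] cc_norm cc_Df U W)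
     fix x
     have "(\<Sum>j\<in>Basis. \<Sum>i\<in>Basis. norm (Df s j U x) * norm (Df s i W x)) <= (\<Sum>j\<in>(Basis :: 'a set). \<Sum>i\<in>(Basis :: 'a set). 28 * (\<gamma> j x + \<gamma> i x))"
      by (intro sum_mono pt)
     also have "\<dots> = c0 * (\<Sum>i\<in>Basis. \<gamma> i x)"
      by (simp add: sum.distrib sum_distrib_left[symmetric] c0_def)
     finally show "(\<Sum>j\<in>Basis. \<Sum>i\<in>Basis. norm (Df s j U x) * norm (Df s i W x)) <= c0 * (\<Sum>i\<in>Basis. \<gamma> i x)" .
    qed
    also have "\<dots> = c0 * S1" unfolding II_cmult S1_def ip_def
     by (subst II_sum) (auto intro!: c\<gamma>[unfolded \<gamma>_def[abs_def]] simp: \<gamma>_def[abs_def])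
    finally show ?thesis .
   qed
   \<comment> \<open>The rank one clause of \<open>bellman\<close>, weighted by
     \<open>qv f x\<close> and summed over \<open>F\<close>.\<close>
   have D2S2: "D2 <= S2"
    unfolding D2_def S2_def ip_def
   proof (intro II_mono cc_abs ip_cc cc_HH U W cGZ cHZ)
    fix x
    have "\<bar>HH U x \<bullet> W x\<bar> <= (\<Sum>f\<in>F. \<bar>qv f x * (U x \<bullet> av f) * (av f \<bullet> W x)\<bar>)"
     unfolding HH_def inner_sum_left by (rule order_trans[OF sum_abs]) simp
    also have "\<dots> <= (\<Sum>f\<in>F. qv f x * (GZ x \<bullet> ((U x \<bullet> av f) *\<^sub>R av f, (W x \<bullet> av f) *\<^sub>R av f)))"
    proof (rule sum_mono)
     fix f
     have "\<bar>U x \<bullet> av f\<bar> * \<bar>W x \<bullet> av f\<bar> <= GZ x \<bullet> ((U x \<bullet> av f) *\<^sub>R av f, (W x \<bullet> av f) *\<^sub>R av f)"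
      using R1[of "Z x" "av f"] by (simp add: GZ_def Z_def)
     from mult_left_mono[OF this qv_nonneg[of f x]]
     show "\<bar>qv f x * (U x \<bullet> av f) * (av f \<bullet> W x)\<bar> <= qv f x * (GZ x \<bullet> ((U x \<bullet> av f) *\<^sub>R av f, (W x \<bullet> av f) *\<^sub>R av f))"
      using qv_nonneg[of f x] by (simp add: abs_mult inner_commute[of "W x"] mult.assoc)
    qed
    also have "\<dots> = GZ x \<bullet> HZ x"
    proof -
     have "HZ x = (\<Sum>f\<in>F. qv f x *\<^sub>R ((U x \<bullet> av f) *\<^sub>R av f, (W x \<bullet> av f) *\<^sub>R av f))"
      by (simp add: HZ_def HH_def sum_Pair)
     then show ?thesis by (simp add: inner_sum_right del: scaleR_Pair)
    qed
    finally show "\<bar>HH U x \<bullet> W x\<bar> <= GZ x \<bullet> HZ x" .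
   qed
   have dvb: "\<bar>ip (dv s U) (dv s W)\<bar> <= D1 + D2 + \<kappa> * (X + Y)"
   proof -
    let ?T = "%j i. ip (Df s j (%y. U y \<bullet> i)) (Df s i (%y. W y \<bullet> j))"
    have cU: "cc (%y. U y \<bullet> i)" and cW: "cc (%y. W y \<bullet> i)" for i by (intro cc_component U W)+
    have cn: "cc (%x. norm (Df s j U x) * norm (Df s i W x))" for i j
      by (intro cc_mult_left cc_cont[OF cc_norm] cc_norm cc_Df U W)
    have "\<bar>\<Sum>j\<in>Basis. \<Sum>i\<in>Basis. ?T j i\<bar> <= (\<Sum>j\<in>Basis. \<Sum>i\<in>Basis. II (%x. norm (Df s j U x) * norm (Df s i W x)))"
    proof (rule order_trans[OF sum_abs], rule sum_mono, rule order_trans[OF sum_abs], rule sum_mono)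
     fix i j :: 'a assume ij: "j \<in> Basis" "i \<in> Basis"
     have "\<bar>?T j i\<bar> <= II (%x. \<bar>Df s j (%y. U y \<bullet> i) x \<bullet> Df s i (%y. W y \<bullet> j) x\<bar>)"
      unfolding ip_def by (rule II_abs[OF ip_cc[OF cc_Df[OF cU] cc_Df[OF cW]]])
     also have "\<dots> <= II (%x. norm (Df s j U x) * norm (Df s i W x))"
     proof (intro II_mono cn cc_abs, rule ip_cc[OF cc_Df[OF cU] cc_Df[OF cW]])
      fix x
      have "Df s j (%y. U y \<bullet> i) x = Df s j U x \<bullet> i" "Df s i (%y. W y \<bullet> j) x = Df s i W x \<bullet> j"
       by (simp_all add: Df_def inner_diff_left)
      then show "\<bar>Df s j (%y. U y \<bullet> i) x \<bullet> Df s i (%y. W y \<bullet> j) x\<bar> <= norm (Df s j U x) * norm (Df s i W x)"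
       using ij by (simp add: abs_mult mult_mono Basis_le_norm)
     qed
     finally show "\<bar>?T j i\<bar> <= II (%x. norm (Df s j U x) * norm (Df s i W x))" .
    qed
    also have "\<dots> = D1" unfolding D1_def by (simp add: II_sum cc_sum cn)
    finally have 1: "\<bar>\<Sum>j\<in>Basis. \<Sum>i\<in>Basis. ?T j i\<bar> <= D1" .
    have "ip (KK s U) W = ip (HH U) W + ip (RR s U) W"
     using ip_add_left[OF cc_HH[OF U] cc_RR[OF U, of s] W] by (simp add: RR_def[abs_def])
    moreover have "\<bar>ip (HH U) W\<bar> <= D2"
     unfolding D2_def ip_def by (intro II_abs ip_cc cc_HH U W)
    moreover have "\<bar>ip (RR s U) W\<bar> <= \<kappa> * (X + Y)"
    proof -
     have "ip W W <= (1 + Lb^2) * X" using XX ip_self_nonneg[of U] by (simp add: X_def)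
     moreover have "ip (RR s U) (RR s U) <= CR * s^2 * (X + Y)"
      by (rule order_trans[OF CR(2)[OF s(1,2) U]], rule mult_left_mono)
       (use CR ip_self_nonneg[of W] YY_nonneg[of s W] in \<open>auto simp: X_def Y_def\<close>)
     ultimately show ?thesis using err[OF W cc_RR[OF U, of s]] by (simp add: ip_commute)
    qed
    ultimately show ?thesis using 1 by (simp add: dv_ip[OF U W])
   qed
   have Ga: "S1 + S2 - \<kappa> * (X + Y) <= ip GZ a"
   proof -
    have "ip GZ a = ip a GZ" by (rule ip_commute)
    also have "\<dots> = ip (AS s lm Z) GZ + (ip HZ GZ + ip RZ GZ)"
     using ip_add_left[OF cc_AS[OF cZ] cc_add[OF cHZ cRZ] cGZ] ip_add_left[OF cHZ cRZ cGZ]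
     by (simp add: aZ[abs_def])
    also have "ip (AS s lm Z) GZ = lm * ip Z GZ + S1" unfolding S1_def by (rule ip_AS[OF cZ cGZ])
    also have "ip HZ GZ = S2" by (simp add: S2_def ip_commute)
    finally have e: "ip GZ a = lm * ip Z GZ + S1 + (S2 + ip RZ GZ)" .
    \<comment> \<open>Monotonicity of \<open>G\<close> against the origin, where \<open>G\<close>
      vanishes, gives the \<open>lm\<close> term the right sign.\<close>
    have "0 <= ip Z GZ"
     unfolding ip_def
    proof (rule II_nonneg)
     fix x show "0 <= Z x \<bullet> GZ x" using Gm[of "Z x" 0] by (simp add: G0 GZ_def inner_commute)
    qed
    moreover have "\<bar>ip GZ RZ\<bar> <= \<kappa> * (X + Y)"
    proof (rule err[OF cGZ cRZ _ RX])
     have "ip GZ GZ <= II (%x. Lb^2 * (norm (Z x))^2)"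
      unfolding ip_self
     proof (intro II_mono cc_power2 cc_norm cc_cmult cZ cGZ)
      fix x show "(norm (GZ x))^2 <= Lb^2 * (norm (Z x))^2"
       using power_mono[OF Gb[of "Z x"], of 2] by (simp add: GZ_def power_mult_distrib)
     qed
     also have "\<dots> = Lb^2 * X" by (simp add: II_cmult ip_self[symmetric] ZX)
     also have "\<dots> <= (1 + Lb^2) * X" using X0 by (simp add: distrib_right)
     finally show "ip GZ GZ <= (1 + Lb^2) * X" .
    qed
    ultimately show ?thesis using lm e by (simp add: ip_commute[of RZ] abs_le_iff)
     (smt (verit) mult_nonneg_nonneg)
   qed
   have Za: "lm * X + Y - \<kappa> * (X + Y) <= ip Z a"
   proof -
    have "ip Z a = ip a Z" by (rule ip_commute)
    also have "\<dots> = ip (AS s lm Z) Z + (ip HZ Z + ip RZ Z)"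
     using ip_add_left[OF cc_AS[OF cZ] cc_add[OF cHZ cRZ] cZ] ip_add_left[OF cHZ cRZ cZ]
     by (simp add: aZ[abs_def])
    also have "ip (AS s lm Z) Z = lm * X + (\<Sum>i\<in>Basis. ip (Df s i Z) (Df s i Z))"
     by (simp add: ip_AS cZ ZX)
    also have "(\<Sum>i\<in>Basis. ip (Df s i Z) (Df s i Z)) = Y"
     unfolding Y_def YY_def DZ[abs_def] by (simp add: ip_pair cc_Df U W sum.distrib)
    finally have e: "ip Z a = lm * X + Y + (ip HZ Z + ip RZ Z)" .
    have "0 <= ip HZ Z"
     unfolding ip_def
    proof (rule II_nonneg)
     fix x
     have "HZ x \<bullet> Z x = (\<Sum>f\<in>F. qv f x * (U x \<bullet> av f)^2) + (\<Sum>f\<in>F. qv f x * (W x \<bullet> av f)^2)"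
      by (simp add: HZ_def Z_def HH_def inner_sum_left power2_eq_square inner_commute[of "av _"] mult.assoc)
     also have "0 <= \<dots>" using qv_nonneg by (intro add_nonneg_nonneg sum_nonneg mult_nonneg_nonneg) auto
     finally show "0 <= HZ x \<bullet> Z x" .
    qed
    moreover have "\<bar>ip Z RZ\<bar> <= \<kappa> * (X + Y)" by (rule err[OF cZ cRZ _ RX]) (use XX ZX in simp)
    ultimately show ?thesis using e by (simp add: ip_commute[of RZ])
   qed
   let ?P = "%x. B (Z x) + \<delta> * (norm (Z x))^2"
   let ?Z' = "%x. Z x - t *\<^sub>R a x"
   have cP: "cc (%x. B (f x) + \<delta> * (norm (f x))^2)" if "cc f" for f :: "'a => 'a \<times> 'a"
    by (intro cc_add cc_compose[OF that Bc B0] cc_cmult cc_power2 cc_norm that)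
   have Zp: "?Z' x = (EV t s lm U x, EV t s lm W x)" for x by (simp add: Z_def a_def EV_def)
   have "II (%x. B (?Z' x) + \<delta> * (norm (?Z' x))^2)
    <= II (%x. (?P x + (- t) * (GZ x \<bullet> a x + 2 * \<delta> * (Z x \<bullet> a x))) + t^2 * (Lb + \<delta>) * (a x \<bullet> a x))"
   proof (intro II_mono cP cc_diff cc_add cc_scaleR_const cc_cmult ip_cc cZ ca cGZ)
    fix x
    have "B (?Z' x) <= B (Z x) + GZ x \<bullet> (- (t *\<^sub>R a x)) + Lb * (norm (t *\<^sub>R a x))^2"
     using Tay[of "?Z' x" "Z x"] by (simp add: GZ_def)
    moreover have nz: "(norm (?Z' x))^2 = (norm (Z x))^2 - 2 * t * (Z x \<bullet> a x) + t^2 * (a x \<bullet> a x)"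
     unfolding power2_norm_eq_inner by (simp add: inner_diff_left inner_diff_right inner_commute power2_eq_square)
    moreover have "(norm (t *\<^sub>R a x))^2 = t^2 * (a x \<bullet> a x)" by (simp add: power_mult_distrib power2_norm_eq_inner)
    moreover have "\<delta> * (norm (?Z' x))^2 = \<delta> * (norm (Z x))^2 - t * (2 * \<delta> * (Z x \<bullet> a x)) + t^2 * \<delta> * (a x \<bullet> a x)"
     unfolding nz by (simp add: algebra_simps)
    ultimately show "B (?Z' x) + \<delta> * (norm (?Z' x))^2 <=
     (?P x + (- t) * (GZ x \<bullet> a x + 2 * \<delta> * (Z x \<bullet> a x))) + t^2 * (Lb + \<delta>) * (a x \<bullet> a x)"
     by (simp add: distrib_left distrib_right mult.assoc mult.left_commute[of Lb])
   qed
   also have "\<dots> = II ?P - t * (ip GZ a + 2 * \<delta> * ip Z a) + t^2 * (Lb + \<delta>) * ip a a"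
    unfolding ip_def
    by (subst II_add, intro cP cc_add cc_cmult ip_cc cZ ca cGZ, intro cc_cmult ip_cc ca,
      subst II_add, intro cP cZ, intro cc_add cc_cmult ip_cc cZ ca cGZ,
      unfold II_cmult, subst II_add, intro ip_cc cZ ca cGZ, intro cc_cmult ip_cc cZ ca, unfold II_cmult, simp)
   finally have dec: "II (%x. B (?Z' x) + \<delta> * (norm (?Z' x))^2) <= II ?P - t * (ip GZ a + 2 * \<delta> * ip Z a) + t^2 * (Lb + \<delta>) * ip a a" .
   have tl: "t^2 * (Lb + \<delta>) * ip a a <= t * (\<delta> * \<mu> * X)"
   proof -
    have "t * ((Lb + \<delta>) * \<Lambda>) <= t * ((Lb + \<delta>) * \<Lambda> + 1)" using t by (simp add: distrib_left)
    also have "\<dots> <= \<delta> * \<mu>" using t den by (simp add: t0_def field_simps)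
    finally have "t * ((Lb + \<delta>) * \<Lambda>) * X <= \<delta> * \<mu> * X" using X0 by (rule mult_right_mono)
    then have *: "t * (t * ((Lb + \<delta>) * \<Lambda>) * X) <= t * (\<delta> * \<mu> * X)" using t by simp
    have "t^2 * (Lb + \<delta>) * ip a a <= t^2 * (Lb + \<delta>) * (\<Lambda> * X)" using aX Lb \<delta> by (intro mult_left_mono) auto
    then show ?thesis using * by (simp add: power2_eq_square mult_ac)
   qed
   have "\<bar>ip (dv s U) (dv s W)\<bar> <= c0 * (S1 + S2) + \<kappa> * (X + Y)"
   proof -
    have "0 <= S2" using D2S2 II_nonneg[of "%x. \<bar>HH U x \<bullet> W x\<bar>"] by (simp add: D2_def)
    then have "S2 <= c0 * S2" using c0 mult_right_mono[of 1 c0 S2] by simp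
    then show ?thesis using dvb D1S1 D2S2 by (simp add: distrib_left)
   qed
   also have "\<kappa> * (X + Y) <= c0 * (\<kappa> * (X + Y))"
    using c0 \<kappa> X0 Y0 mult_right_mono[of 1 c0 "\<kappa> * (X + Y)"] by simp
   also have "c0 * (S1 + S2) + c0 * (\<kappa> * (X + Y)) <= c0 * (ip GZ a + 2 * \<delta> * ip Z a - \<delta> * \<mu> * X)"
   proof -
    have "S1 + S2 + \<kappa> * (X + Y) <= ip GZ a + 2 * (\<kappa> * (X + Y))" using Ga by simp
    moreover have "2 * \<delta> * (lm * X + Y - \<kappa> * (X + Y)) <= 2 * \<delta> * ip Z a" using Za \<delta> by simp
    moreover have "\<kappa> * (2 + 2 * \<delta>) * (X + Y) <= \<delta> * \<mu> * (X + Y)"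
     using \<kappa> X0 Y0 by (intro mult_right_mono) auto
    moreover have "\<delta> * (\<mu> * X) <= \<delta> * (lm * X)" "\<delta> * (\<mu> * Y) <= \<delta> * (1 * Y)"
     using \<mu> \<delta> X0 Y0 mult_right_mono[of \<mu> 1 Y] by (auto intro!: mult_left_mono mult_right_mono)
    moreover have "0 <= \<delta> * Y" using \<delta> Y0 by simp
    ultimately have "S1 + S2 + \<kappa> * (X + Y) <= ip GZ a + 2 * \<delta> * ip Z a - \<delta> * \<mu> * X"
     by (simp add: algebra_simps)
    from mult_left_mono[OF this, of c0] show ?thesis using c0 by (simp add: distrib_left)
   qed
   finally have "t * \<bar>ip (dv s U) (dv s W)\<bar> <= t * (c0 * (ip GZ a + 2 * \<delta> * ip Z a - \<delta> * \<mu> * X))"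
    using t by simp
   also have "\<dots> = c0 * (t * (ip GZ a + 2 * \<delta> * ip Z a) - t * (\<delta> * \<mu> * X))" by (simp add: algebra_simps)
   also have "\<dots> <= c0 * (II ?P - II (%x. B (?Z' x) + \<delta> * (norm (?Z' x))^2))"
    using dec tl c0 by (intro mult_left_mono) auto
   finally show ?thesis unfolding Zp by (simp add: Z_def)
  qed
  show "\<exists>t0>0. \<forall>t U W. 0 < t & t <= t0 & cc U & cc W -->
   t * \<bar>ip (dv s U) (dv s W)\<bar> <= 56 * real DIM('a) *
   (II (%x. B (U x, W x) + \<delta> * (norm (U x, W x))^2)
   - II (%x. B (EV t s lm U x, EV t s lm W x) + \<delta> * (norm (EV t s lm U x, EV t s lm W x))^2))"
  proof (intro exI[of _ t0] conjI allI impI t0)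
   fix t and U W :: "'a => 'a" assume "0 < t & t <= t0 & cc U & cc W"
   then show "t * \<bar>ip (dv s U) (dv s W)\<bar> <= 56 * real DIM('a) *
    (II (%x. B (U x, W x) + \<delta> * (norm (U x, W x))^2)
    - II (%x. B (EV t s lm U x, EV t s lm W x) + \<delta> * (norm (EV t s lm U x, EV t s lm W x))^2))"
    using main[of t U W] unfolding c0_def by simp
  qed
 qed
qed

text \<open>Along the Euler iterates of \<open>u\<close> and \<open>w\<close> the drops of the
  energy telescope, and by \<open>dv_funpow\<close> the sum of the pairings is that of
  \<open>dv s w\<close> with the Euler sum \<open>QQ\<close>. The factor \<open>2 * t\<close> of the
  potential turns 56 into 112.\<close>

lemma discrete_near_projection:
 fixes u w :: "'a => 'a" and C p q :: real
 assumes bell: "!!R \<epsilon>. 0 < R ==> 0 < \<epsilon> ==> \<exists>(B :: 'a \<times> 'a => real) G L. bellman B G L \<and>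
   (\<forall>u w. norm u <= R --> norm w <= R --> B (u, w) <= C * (norm u powr p + norm w powr q) + \<epsilon>)"
  and pq: "0 < p" "0 < q" and C: "0 <= C" and u: "cc u" and w: "cc w" and lm: "0 < lm" and e: "0 < e"
 shows "\<exists>s0>0. s0 <= 1 & (\<forall>s. 0 < s & s <= s0 --> (\<exists>\<phi>. cc \<phi> \<and>
  (\<forall>\<eta>. cc \<eta> --> JJ s lm u \<phi> <= JJ s lm u \<eta> + e) \<and>
  \<bar>\<Sum>i\<in>Basis. ip (Df s i \<phi>) (%x. w x \<bullet> i)\<bar>
   <= 112 * real DIM('a) * C * II (%x. norm (u x) powr p + norm (w x) powr q) + e))"
proof -
 let ?d = "real DIM('a)"
 obtain R1 where R1: "0 < R1" "!!x. norm (u x) <= R1" using cc_bounded[OF u] by blast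
 obtain R2 where R2: "0 < R2" "!!x. norm (w x) <= R2" using cc_bounded[OF w] by blast
 obtain r1 where r1: "0 < r1" "!!x. r1 < norm x ==> u x = 0" using ccE[OF u] by blast
 obtain r2 where r2: "0 < r2" "!!x. r2 < norm x ==> w x = 0" using ccE[OF w] by blast
 \<comment> \<open>The additive \<open>\<epsilon>\<close> of the Bellman bound has to be confined to
   a bounded set before it is integrated; \<open>hx\<close> is a cut-off equal to 1 wherever
   \<open>u\<close> or \<open>w\<close> can be nonzero.\<close>
 define hx where "hx x = max 0 (min 1 (max r1 r2 + 1 - norm x))" for x :: 'a
 have chx: "cc hx"
 proof (rule ccI[of _ "max r1 r2 + 1"])
  show "cont hx" unfolding hx_def by (intro continuous_intros)
 qed (auto simp: hx_def)
 define X where "X = ip u u + ip w w"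
 have X0: "0 <= X" using ip_self_nonneg[of u] ip_self_nonneg[of w] by (simp add: X_def)
 have I0: "0 <= II hx" by (rule II_nonneg) (simp add: hx_def)
 have d1: "1 <= ?d" using DIM_positive[where 'a = 'a] by (simp add: Suc_leI)
 \<comment> \<open>Each of the two errors is to contribute at most \<open>e / 2\<close> after
   multiplication by \<open>112 * ?d\<close>.\<close>
 define \<epsilon> where "\<epsilon> = e / (224 * ?d * (II hx + 1))"
 define \<delta> where "\<delta> = e / (224 * ?d * (X + 1))"
 have \<epsilon>: "0 < \<epsilon>" and \<delta>: "0 < \<delta>" using e d1 X0 I0 by (auto simp: \<epsilon>_def \<delta>_def)
 obtain B :: "'a \<times> 'a => real" and G Lb where B: "bellman B G Lb"
  "!!u w. norm u <= max R1 R2 ==> norm w <= max R1 R2 ==> B (u, w) <= C * (norm u powr p + norm w powr q) + \<epsilon>"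
  using bell[of "max R1 R2" \<epsilon>] R1 \<epsilon> by fastforce
 have B': "cont B" "B 0 = 0" "!!z. 0 <= B z" using B(1) by (auto simp: bellman_def)
 obtain s0 where s0: "0 < s0" "s0 <= 1" "!!s. 0 < s ==> s <= s0 ==> \<exists>t0>0. \<forall>t U W. 0 < t & t <= t0 & cc U & cc W -->
  t * \<bar>ip (dv s U) (dv s W)\<bar> <= 56 * real DIM('a) *
   (II (%x. B (U x, W x) + \<delta> * (norm (U x, W x))^2)
   - II (%x. B (EV t s lm U x, EV t s lm W x) + \<delta> * (norm (EV t s lm U x, EV t s lm W x))^2))"
  using bellman_drop[OF B(1) lm \<delta>] by blast
 have cpu: "cc (%x. norm (u x) powr p)" and cpw: "cc (%x. norm (w x) powr q)"
  by (rule cc_compose[OF u, where g = "%y. norm y powr p"], use pq in \<open>auto intro!: continuous_on_powr' continuous_on_norm_id continuous_on_const\<close>,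
    rule cc_compose[OF w, where g = "%y. norm y powr q"], use pq in \<open>auto intro!: continuous_on_powr' continuous_on_norm_id continuous_on_const\<close>)
 have cBZ: "cc (%x. B (U x, W x) + \<delta> * (norm (U x, W x))^2)" if "cc U" "cc W" for U W
  using B'(2) by (intro cc_add cc_compose[where g = B] B' cc_cmult cc_power2 cc_norm cc_Pair that)
 have B0: "II (%x. B (u x, w x) + \<delta> * (norm (u x, w x))^2) <= C * II (%x. norm (u x) powr p + norm (w x) powr q) + \<epsilon> * II hx + \<delta> * X"
 proof -
  have "II (%x. B (u x, w x) + \<delta> * (norm (u x, w x))^2)
   <= II (%x. C * (norm (u x) powr p + norm (w x) powr q) + (\<epsilon> * hx x + \<delta> * (norm (u x, w x))^2))"
  proof (intro II_mono cBZ u w cc_add cc_cmult cpu cpw chx cc_power2 cc_norm cc_Pair)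
   fix x
   have "B (u x, w x) <= C * (norm (u x) powr p + norm (w x) powr q) + \<epsilon> * hx x"
   proof (cases "norm x <= max r1 r2")
    case True
    then have "hx x = 1" by (auto simp: hx_def)
    then show ?thesis using B(2)[of "u x" "w x"] R1(2)[of x] R2(2)[of x] by (simp add: le_max_iff_disj)
   next
    case False
    then have "u x = 0" "w x = 0" using r1(2)[of x] r2(2)[of x] by auto
    then show ?thesis using B'(2) C \<epsilon> pq by (simp add: zero_prod_def[symmetric] hx_def)
   qed
   then show "B (u x, w x) + \<delta> * (norm (u x, w x))^2 <= C * (norm (u x) powr p + norm (w x) powr q) + (\<epsilon> * hx x + \<delta> * (norm (u x, w x))^2)"
    by simp
  qed
  also have "\<dots> = C * II (%x. norm (u x) powr p + norm (w x) powr q) + (\<epsilon> * II hx + \<delta> * II (%x. (norm (u x, w x))^2))"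
  proof -
   have a: "cc (%x. C * (norm (u x) powr p + norm (w x) powr q))" by (rule cc_cmult[OF cc_add[OF cpu cpw]])
   have b: "cc (%x. \<epsilon> * hx x)" by (rule cc_cmult[OF chx])
   have c: "cc (%x. \<delta> * (norm (u x, w x))^2)" by (rule cc_cmult[OF cc_power2[OF cc_norm[OF cc_Pair[OF u w]]]])
   show ?thesis using II_add[OF a cc_add[OF b c]] II_add[OF b c] by (simp only: II_cmult)
  qed
  also have "II (%x. (norm (u x, w x))^2) = X"
  proof -
   have "II (%x. (norm (u x, w x))^2) = II (%x. (norm (u x))^2 + (norm (w x))^2)" by (simp add: norm_Pair)
   also have "\<dots> = X" unfolding X_def ip_self by (intro II_add cc_power2 cc_norm u w)
   finally show ?thesis .
  qed
  finally show ?thesis by simp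
 qed
 have small: "112 * ?d * (\<epsilon> * II hx + \<delta> * X) <= e"
 proof -
  have sm: "112 * ?d * (e / (224 * ?d * (Y + 1)) * Y) <= e / 2" if "0 <= Y" for Y
  proof -
   have nz: "Y + 1 ~= 0" "?d ~= 0" using that d1 by auto
   have "112 * ?d * (e / (224 * ?d * (Y + 1)) * Y) = e / 2 * (Y / (Y + 1))" using nz by (simp add: divide_simps)
   also have "\<dots> <= e / 2 * 1" using e that by (intro mult_left_mono) (auto simp: divide_simps)
   finally show ?thesis by simp
  qed
  show ?thesis using sm[OF I0] sm[OF X0] by (simp add: distrib_left \<epsilon>_def \<delta>_def)
 qed
 show ?thesis
 proof (rule exI[of _ s0], intro conjI allI impI s0)
  fix s assume s: "0 < s & s <= s0"
  obtain t1 where t1: "0 < t1" "!!t U W. 0 < t ==> t <= t1 ==> cc U ==> cc W ==>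
   t * \<bar>ip (dv s U) (dv s W)\<bar> <= 56 * real DIM('a) *
   (II (%x. B (U x, W x) + \<delta> * (norm (U x, W x))^2)
   - II (%x. B (EV t s lm U x, EV t s lm W x) + \<delta> * (norm (EV t s lm U x, EV t s lm W x))^2))"
   using s0(3)[of s] s by blast
  obtain t2 where t2: "0 < t2" "!!t. 0 < t ==> t <= t2 ==>
   (\<exists>N. \<forall>\<eta>. cc \<eta> --> JJ s lm u (%x. 2 * t * QQ t s lm (dv s u) N x) <= JJ s lm u \<eta> + e)"
   using euler_sum_near_minimiser[of s lm u e] s lm u e by blast
  define t where "t = min t1 t2"
  have t: "0 < t" "t <= t1" "t <= t2" using t1 t2 by (auto simp: t_def)
  obtain N where N: "!!\<eta>. cc \<eta> ==> JJ s lm u (%x. 2 * t * QQ t s lm (dv s u) N x) <= JJ s lm u \<eta> + e"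
   using t2(2)[OF t(1,3)] by blast
  define \<phi> where "\<phi> = (%x. 2 * t * QQ t s lm (dv s u) N x)"
  have c\<phi>: "cc \<phi>" unfolding \<phi>_def by (intro cc_cmult cc_QQ cc_dv u)
  let ?U = "%k. (EV t s lm ^^ k) u" and ?W = "%k. (EV t s lm ^^ k) w"
  define V where "V k = II (%x. B (?U k x, ?W k x) + \<delta> * (norm (?U k x, ?W k x))^2)" for k
  have "(\<Sum>i\<in>Basis. ip (Df s i \<phi>) (%x. w x \<bullet> i)) = (\<Sum>i\<in>Basis. ip (Ds s i (%x. w x \<bullet> i)) \<phi>)"
   by (intro sum.cong refl) (simp add: adjoint c\<phi> cc_component w ip_commute)
  also have "\<dots> = ip (dv s w) \<phi>"
   unfolding dv_def[abs_def] by (intro ip_sum_left[symmetric] cc_Ds cc_component w c\<phi>)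
  also have "\<dots> = 2 * t * ip (QQ t s lm (dv s u) N) (dv s w)"
   using ip_scaleR_left[of "2 * t" "QQ t s lm (dv s u) N" "dv s w"] by (simp add: \<phi>_def ip_commute[of "dv s w"])
  also have "ip (QQ t s lm (dv s u) N) (dv s w) = (\<Sum>k<N. ip (dv s (?U k)) (dv s (?W k)))"
   by (simp add: ip_QQ cc_dv u w dv_funpow)
  finally have eq: "(\<Sum>i\<in>Basis. ip (Df s i \<phi>) (%x. w x \<bullet> i)) = 2 * t * (\<Sum>k<N. ip (dv s (?U k)) (dv s (?W k)))" .
  have "t * \<bar>\<Sum>k<N. ip (dv s (?U k)) (dv s (?W k))\<bar> <= (\<Sum>k<N. t * \<bar>ip (dv s (?U k)) (dv s (?W k))\<bar>)"
   using t by (simp add: sum_distrib_left[symmetric] sum_abs)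
  also have "\<dots> <= (\<Sum>k<N. 56 * real DIM('a) * (V k - V (Suc k)))"
  proof (rule sum_mono)
   fix k
   show "t * \<bar>ip (dv s (?U k)) (dv s (?W k))\<bar> <= 56 * real DIM('a) * (V k - V (Suc k))"
    using t1(2)[OF t(1,2) cc_funpow_EV[OF u, where t = t and s = s and lm = lm and k = k] cc_funpow_EV[OF w, where t = t and s = s and lm = lm and k = k]] by (simp add: V_def)
  qed
  also have "\<dots> = 56 * real DIM('a) * (V 0 - V N)"
   by (simp add: sum_distrib_left[symmetric] sum_lessThan_telescope')
  also have "\<dots> <= 56 * real DIM('a) * V 0"
  proof -
   have "0 <= V N" unfolding V_def using B' \<delta> by (intro II_nonneg) auto
   then show ?thesis by (intro mult_left_mono) auto
  qed
  finally have "t * \<bar>\<Sum>k<N. ip (dv s (?U k)) (dv s (?W k))\<bar> <= 56 * real DIM('a) * V 0" .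
  then have "\<bar>\<Sum>i\<in>Basis. ip (Df s i \<phi>) (%x. w x \<bullet> i)\<bar> <= 112 * ?d * V 0"
   unfolding eq using t by (simp add: abs_mult mult_ac)
  also have "\<dots> <= 112 * ?d * (C * II (%x. norm (u x) powr p + norm (w x) powr q) + \<epsilon> * II hx + \<delta> * X)"
   using B0 by (intro mult_left_mono) (auto simp: V_def)
  also have "\<dots> = 112 * ?d * C * II (%x. norm (u x) powr p + norm (w x) powr q) + 112 * ?d * (\<epsilon> * II hx + \<delta> * X)"
   by (simp add: algebra_simps)
  also have "\<dots> <= 112 * ?d * C * II (%x. norm (u x) powr p + norm (w x) powr q) + e"
   using small by simp
  finally show "\<exists>\<phi>. cc \<phi> & (\<forall>\<eta>. cc \<eta> --> JJ s lm u \<phi> <= JJ s lm u \<eta> + e) \<and>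
   \<bar>\<Sum>i\<in>Basis. ip (Df s i \<phi>) (%x. w x \<bullet> i)\<bar> <= 112 * real DIM('a) * C * II (%x. norm (u x) powr p + norm (w x) powr q) + e"
   using N c\<phi> unfolding \<phi>_def by blast
 qed
qed

end

section \<open>Weights approximating a convex set\<close>

text \<open>The logistic function, which is the derivative of \<open>ln (1 + exp t)\<close>.\<close>

definition sg :: "real => real" where "sg t = exp t / (1 + exp t)"

lemma sg_bounds: "0 < sg t" "sg t < 1"
 by (auto simp: sg_def add_pos_pos)

lemma DERIV_sg: "(sg has_real_derivative sg t * (1 - sg t)) (at t)"
proof -
 have "1 + exp t ~= 0" using exp_gt_zero[of t] by linarith
 then show ?thesis
  unfolding sg_def[abs_def] by (auto intro!: derivative_eq_intros simp: divide_simps power2_eq_square algebra_simps)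
qed

lemma DERIV_sp: "((%t. ln (1 + exp t)) has_real_derivative sg t) (at t)"
 unfolding sg_def by (auto intro!: derivative_eq_intros simp: add_pos_pos)

lemma sg_lip: "\<bar>sg x - sg y\<bar> <= \<bar>x - y\<bar>"
proof -
 have "norm (sg x - sg y) <= 1 * norm (x - y)"
 proof (rule field_differentiable_bound[of UNIV sg "%t. sg t * (1 - sg t)"])
  fix t :: real show "norm (sg t * (1 - sg t)) <= 1"
   using sg_bounds[of t] mult_mono[of "sg t" 1 "1 - sg t" 1] by simp
 qed (auto intro: DERIV_sg)
 then show ?thesis by simp
qed

lemma sp_lip: "\<bar>ln (1 + exp x) - ln (1 + exp y)\<bar> <= \<bar>x - y :: real\<bar>"
proof -
 have "norm (ln (1 + exp x) - ln (1 + exp y)) <= 1 * norm (x - y)"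
  by (rule field_differentiable_bound[of UNIV "%t. ln (1 + exp t)" sg])
   (use sg_bounds in \<open>auto intro: DERIV_sp simp: less_imp_le abs_le_iff less_le_trans[OF neg_less_0_iff_less[THEN iffD2]]\<close>)
 then show ?thesis by simp
qed

definition dsg :: "real => real" where "dsg t = sg t * (1 - sg t)"

lemma dsg_bounds: "0 <= dsg t" "dsg t <= 1"
 using sg_bounds[of t] mult_mono[of "sg t" 1 "1 - sg t" 1] by (auto simp: dsg_def)

lemma dsg_lip: "\<bar>dsg x - dsg y\<bar> <= \<bar>x - y\<bar>"
proof -
 have "dsg x - dsg y = (sg x - sg y) * (1 - sg x - sg y)" by (simp add: dsg_def algebra_simps)
 then have "\<bar>dsg x - dsg y\<bar> = \<bar>sg x - sg y\<bar> * \<bar>1 - sg x - sg y\<bar>" by (simp add: abs_mult)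
 also have "\<dots> <= \<bar>sg x - sg y\<bar> * 1" using sg_bounds[of x] sg_bounds[of y] by (intro mult_left_mono) auto
 finally show ?thesis using sg_lip[of x y] by simp
qed

text \<open>Mean value theorem for the difference, then the Lipschitz bound for \<open>dsg\<close>.
  The base point \<open>T\<close> may differ from \<open>y\<close>, since the other difference in
  \<open>cK\<close> has moved the argument as well.\<close>

lemma sg_taylor: "\<bar>sg y - sg (y - d) - d * dsg T\<bar> <= \<bar>d\<bar> * (\<bar>d\<bar> + \<bar>y - T\<bar>)"
proof (cases "d = 0")
 case False
 obtain z where z: "sg y - sg (y - d) = d * dsg z" "\<bar>z - y\<bar> <= \<bar>d\<bar>"
 proof (cases "d > 0")
  case True
  then obtain z where "y - d < z" "z < y" "sg y - sg (y - d) = (y - (y - d)) * dsg z"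
   using MVT2[of "y - d" y sg dsg] DERIV_sg by (auto simp: dsg_def)
  then show ?thesis using that[of z] by auto
 next
  case False
  then have "y < y - d" using \<open>d ~= 0\<close> by simp
  then obtain z where "y < z" "z < y - d" "sg (y - d) - sg y = (y - d - y) * dsg z"
   using MVT2[of y "y - d" sg dsg] DERIV_sg by (auto simp: dsg_def)
  then show ?thesis using that[of z] by (auto simp: algebra_simps)
 qed
 have "\<bar>sg y - sg (y - d) - d * dsg T\<bar> = \<bar>d\<bar> * \<bar>dsg z - dsg T\<bar>"
  by (simp add: z abs_mult[symmetric] right_diff_distrib)
 also have "\<dots> <= \<bar>d\<bar> * (\<bar>d\<bar> + \<bar>y - T\<bar>)"
  using dsg_lip[of z T] z(2) by (intro mult_left_mono) auto
 finally show ?thesis .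
qed simp

text \<open>A pair \<open>(a, b)\<close> encodes the half space \<open>a \<bullet> x \<le> b\<close>, and the weight is a product of logistic functions of it.\<close>

definition Vf :: "('a::euclidean_space \<times> real) set => 'a => real" where
 "Vf F x = (\<Sum>f\<in>F. ln (1 + exp (fst f \<bullet> x - snd f)))"

definition hsw :: "('a::euclidean_space \<times> real) set => 'a => real" where
 "hsw F x = exp (- Vf F x)"

definition Lf :: "('a::euclidean_space \<times> real) set => real" where
 "Lf F = (\<Sum>f\<in>F. norm (fst f))"

lemma Lf_nonneg: "0 <= Lf F" by (simp add: Lf_def sum_nonneg)

lemma Vf_lip: "\<bar>Vf F (x + h) - Vf F x\<bar> <= Lf F * norm h"
proof -
 have "\<bar>Vf F (x + h) - Vf F x\<bar> <= (\<Sum>f\<in>F. \<bar>ln (1 + exp (fst f \<bullet> (x + h) - snd f)) - ln (1 + exp (fst f \<bullet> x - snd f))\<bar>)"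
  unfolding Vf_def sum_subtractf[symmetric] by (rule sum_abs)
 also have "\<dots> <= (\<Sum>f\<in>F. norm (fst f) * norm h)"
 proof (rule sum_mono)
  fix f :: "'a \<times> real"
  have "\<bar>ln (1 + exp (fst f \<bullet> (x + h) - snd f)) - ln (1 + exp (fst f \<bullet> x - snd f))\<bar> <= \<bar>fst f \<bullet> h\<bar>"
   using sp_lip[of "fst f \<bullet> (x + h) - snd f" "fst f \<bullet> x - snd f"] by (simp add: inner_add_right)
  also have "\<dots> <= norm (fst f) * norm h" by (rule Cauchy_Schwarz_ineq2)
  finally show "\<bar>ln (1 + exp (fst f \<bullet> (x + h) - snd f)) - ln (1 + exp (fst f \<bullet> x - snd f))\<bar> <= norm (fst f) * norm h" .
 qed
 finally show ?thesis by (simp add: Lf_def sum_distrib_right)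
qed

lemma wt_hsw: "wt (hsw F) (Lf F)"
proof
 have "1 + exp (a \<bullet> x - b) ~= 0" for a x :: 'a and b :: real using exp_gt_zero[of "a \<bullet> x - b"] by linarith
 then show "cont (hsw F)"
  unfolding hsw_def[abs_def] Vf_def by (intro continuous_intros) auto
 fix x h
 show "hsw F (x + h) <= exp (Lf F * norm h) * hsw F x"
  unfolding hsw_def exp_add[symmetric] using Vf_lip[of F x h] by simp
qed (auto simp: hsw_def Lf_nonneg)

text \<open>The exact Hessian of \<open>Vf F\<close> is the sum of \<open>dsg\<close> times rank one
  matrices. The mixed difference \<open>cK\<close> is compared with it by the mean value theorem in
  the direction \<open>j\<close> and by \<open>sg_taylor\<close> in the direction
  \<open>i\<close>.\<close>

lemma wtH_hsw:
 fixes F :: "('a::euclidean_space \<times> real) set"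
 assumes fin: "finite F"
 shows "\<exists>C1. wtH (hsw F) (Lf F) F fst (%f x. dsg (fst f \<bullet> x - snd f)) 1 C1"
proof -
 interpret wt "hsw F" "Lf F" by (rule wt_hsw)
 let ?L = "Lf F"
 define A2 where "A2 = (\<Sum>f\<in>F. (norm (fst f))^2)"
 define A3 where "A3 = (\<Sum>f\<in>F. 2 * norm (fst f) ^ 3)"
 define C1 where "C1 = ?L * exp ?L * A2 + exp ?L * A3"
 have A: "0 <= A2" "0 <= A3" by (auto simp: A2_def A3_def intro!: sum_nonneg)
 have C1: "0 <= C1" using A L0 by (simp add: C1_def)
 have main: "\<bar>cK s i j x - (\<Sum>f\<in>F. dsg (fst f \<bullet> x - snd f) * (fst f \<bullet> i) * (fst f \<bullet> j))\<bar> <= C1 * s"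
  if s: "0 < s" "s <= 1" and ij: "i \<in> Basis" "j \<in> Basis" for s i j x
 proof -
  define T where "T f = fst f \<bullet> x - snd f" for f :: "'a \<times> real"
  define y where "y f t = T f + t * (fst f \<bullet> j)" for f t
  \<comment> \<open>The ratio \<open>rr s i\<close> along the line in direction \<open>j\<close>;
    \<open>P\<close> is its logarithmic derivative.\<close>
  define ps where "ps t = exp (Vf F (x + t *\<^sub>R j) - Vf F (x + t *\<^sub>R j - s *\<^sub>R i))" for t
  define P where "P t = (\<Sum>f\<in>F. (fst f \<bullet> j) * (sg (y f t) - sg (y f t - s * (fst f \<bullet> i))))" for t
  have V1: "Vf F (x + t *\<^sub>R j) = (\<Sum>f\<in>F. ln (1 + exp (y f t)))" for t
   unfolding Vf_def by (intro sum.cong refl) (simp add: y_def T_def inner_add_right algebra_simps)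
  have V2: "Vf F (x + t *\<^sub>R j - s *\<^sub>R i) = (\<Sum>f\<in>F. ln (1 + exp (y f t - s * (fst f \<bullet> i))))" for t
   unfolding Vf_def by (intro sum.cong refl) (simp add: y_def T_def inner_add_right inner_diff_right algebra_simps)
  have D: "(ps has_real_derivative ps t * P t) (at t)" for t
   unfolding ps_def[abs_def] V1 V2 P_def y_def
   by (auto intro!: derivative_eq_intros simp: add_pos_pos) (simp add: sg_def sum_subtractf algebra_simps)
  have "rr s i (x + t *\<^sub>R j) = ps t" for t
   by (simp add: rr_def ps_def hsw_def exp_diff[symmetric] exp_minus[symmetric] divide_inverse exp_add[symmetric])
  from this[of s] this[of 0] have cKe: "cK s i j x = (ps s - ps 0) / s^2" by (simp add: cK_def)
  obtain z where z: "0 < z" "z < s" "ps s - ps 0 = s * (ps z * P z)"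
   using MVT2[OF s(1), of ps "%t. ps t * P t"] D by auto
  have cK: "cK s i j x = ps z * (P z / s)" using s by (simp add: cKe z power2_eq_square)
  have psb: "\<bar>ps z - 1\<bar> <= ?L * exp ?L * s" "ps z <= exp ?L"
  proof -
   define v where "v = Vf F (x + z *\<^sub>R j) - Vf F (x + z *\<^sub>R j - s *\<^sub>R i)"
   have "\<bar>v\<bar> <= ?L * norm (s *\<^sub>R i)"
    using Vf_lip[of F "x + z *\<^sub>R j - s *\<^sub>R i" "s *\<^sub>R i"] by (simp add: v_def)
   then have v: "\<bar>v\<bar> <= ?L * s" using ij s by simp
   have Ls: "?L * s <= ?L" using s L0 by (simp add: mult_left_le)
   have pz: "ps z = exp v" by (simp add: ps_def v_def)
   show "ps z <= exp ?L" using v Ls by (simp add: pz)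
   have "norm (exp v - exp 0) <= exp ?L * norm (v - 0)"
   proof (rule field_differentiable_bound[of "{-?L..?L}" exp exp])
    fix w assume "w \<in> {-?L..?L}" then show "norm (exp w) <= exp ?L" by simp
   qed (use v Ls L0 in \<open>auto intro!: derivative_eq_intros\<close>)
   also have "\<dots> <= exp ?L * (?L * s)" using v by simp
   finally show "\<bar>ps z - 1\<bar> <= ?L * exp ?L * s" by (simp add: pz mult_ac)
  qed
  define S where "S = (\<Sum>f\<in>F. dsg (T f) * (fst f \<bullet> i) * (fst f \<bullet> j))"
  have Sb: "\<bar>S\<bar> <= A2"
   unfolding S_def A2_def
  proof (rule order_trans[OF sum_abs], rule sum_mono)
   fix f :: "'a \<times> real"
   have "\<bar>fst f \<bullet> i\<bar> * \<bar>fst f \<bullet> j\<bar> <= norm (fst f) * norm (fst f)" by (intro mult_mono Basis_le_norm ij) auto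
   then show "\<bar>dsg (T f) * (fst f \<bullet> i) * (fst f \<bullet> j)\<bar> <= (norm (fst f))^2"
    using mult_mono[OF dsg_bounds(2)[of "T f"], of "\<bar>fst f \<bullet> i\<bar> * \<bar>fst f \<bullet> j\<bar>" "norm (fst f) * norm (fst f)"] dsg_bounds(1)[of "T f"]
    by (simp add: abs_mult power2_eq_square mult.assoc)
  qed
  have Pb: "\<bar>P z / s - S\<bar> <= A3 * s"
  proof -
   have "P z / s - S = (\<Sum>f\<in>F. (fst f \<bullet> j) * (sg (y f z) - sg (y f z - s * (fst f \<bullet> i)) - s * (fst f \<bullet> i) * dsg (T f)) / s)"
    unfolding P_def S_def sum_divide_distrib sum_subtractf[symmetric]
    using s by (intro sum.cong refl) (simp add: field_simps)
   also have "\<bar>\<dots>\<bar> <= (\<Sum>f\<in>F. 2 * norm (fst f) ^ 3 * s)"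
   proof (rule order_trans[OF sum_abs], rule sum_mono)
    fix f :: "'a \<times> real"
    let ?n = "norm (fst f)" and ?d = "s * (fst f \<bullet> i)"
    have i': "\<bar>fst f \<bullet> i\<bar> <= ?n" "\<bar>fst f \<bullet> j\<bar> <= ?n" using ij by (auto intro: Basis_le_norm)
    have d: "\<bar>?d\<bar> <= s * ?n" using i' s by (simp add: abs_mult)
    have yT: "\<bar>y f z - T f\<bar> <= s * ?n" using i' z s by (simp add: y_def abs_mult mult_mono)
    have "\<bar>sg (y f z) - sg (y f z - ?d) - ?d * dsg (T f)\<bar> <= \<bar>?d\<bar> * (\<bar>?d\<bar> + \<bar>y f z - T f\<bar>)" by (rule sg_taylor)
    also have "\<dots> <= (s * ?n) * (s * ?n + s * ?n)" using d yT s by (intro mult_mono add_mono) auto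
    finally have "\<bar>fst f \<bullet> j\<bar> * \<bar>sg (y f z) - sg (y f z - ?d) - ?d * dsg (T f)\<bar> <= ?n * ((s * ?n) * (s * ?n + s * ?n))"
     using i' s by (intro mult_mono) auto
    then have "\<bar>fst f \<bullet> j\<bar> * \<bar>sg (y f z) - sg (y f z - ?d) - ?d * dsg (T f)\<bar> / s <= ?n * ((s * ?n) * (s * ?n + s * ?n)) / s"
     using s by (intro divide_right_mono) auto
    also have "\<dots> = 2 * ?n ^ 3 * s" using s by (simp add: power3_eq_cube)
    finally show "\<bar>(fst f \<bullet> j) * (sg (y f z) - sg (y f z - ?d) - ?d * dsg (T f)) / s\<bar> <= 2 * ?n ^ 3 * s"
     using s by (simp add: abs_mult)
   qed
   finally show ?thesis by (simp add: A3_def sum_distrib_right)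
  qed
  have "cK s i j x - S = (ps z - 1) * S + ps z * (P z / s - S)" by (simp add: cK algebra_simps)
  also have "\<bar>\<dots>\<bar> <= \<bar>ps z - 1\<bar> * \<bar>S\<bar> + ps z * \<bar>P z / s - S\<bar>"
   by (rule order_trans[OF abs_triangle_ineq]) (simp add: abs_mult ps_def)
  also have "\<dots> <= (?L * exp ?L * s) * A2 + exp ?L * (A3 * s)"
   using psb Sb Pb L0 s by (intro add_mono mult_mono) auto
  also have "\<dots> = C1 * s" by (simp add: C1_def algebra_simps)
  finally show ?thesis unfolding S_def T_def .
 qed
 have dc: "cont dsg"
 proof -
  have "1 + exp t ~= 0" for t :: real using exp_gt_zero[of t] by linarith
  then show ?thesis unfolding dsg_def[abs_def] sg_def by (intro continuous_intros) auto
 qed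
 have "wtH (hsw F) (Lf F) F fst (%f x. dsg (fst f \<bullet> x - snd f)) 1 C1"
  by unfold_locales
   (use fin main C1 dsg_bounds in \<open>auto intro!: continuous_on_compose2[OF dc] continuous_intros\<close>)
 then show ?thesis by blast
qed

lemma hsw_prod: "finite F ==> hsw F x = (\<Prod>f\<in>F. 1 / (1 + exp (fst f \<bullet> x - snd f)))"
 by (simp add: hsw_def Vf_def sum_negf[symmetric] exp_sum exp_minus add_pos_pos inverse_eq_divide)

lemma hsw_le_1: "finite F ==> hsw F x <= 1"
 unfolding hsw_def Vf_def by (auto intro!: sum_nonneg)

text \<open>Most of \<open>K - closure \<Omega>\<close> is taken up by a compact set, covered by
  finitely many open half spaces that stay away from \<open>closure \<Omega>\<close>. Multiplying
  their affine functions by a large \<open>n\<close> drives the weight to 1 on the closure and to 0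
  on that set; the frontier of a convex set is null.\<close>

lemma weight_exists:
 fixes \<Omega> K :: "'a::euclidean_space set"
 assumes \<Omega>: "open \<Omega>" "bounded \<Omega>" "convex \<Omega>" "\<Omega> ~= {}" and K: "compact K" and \<epsilon>: "0 < \<epsilon>" "\<epsilon> < 1"
 shows "\<exists>F. finite F & (\<forall>x\<in>closure \<Omega>. 1 - \<epsilon> <= hsw F x) & (LINT x:(K - \<Omega>)|lebesgue. hsw F x) <= \<epsilon>"
proof -
 have cO: "compact (closure \<Omega>)" using \<Omega>(2) by simp
 have K0: "K - closure \<Omega> \<in> sets lebesgue" using K by (intro sets.Diff) (auto simp: lebesgue_closedin compact_imp_closed borel_closed)
 obtain K1 where K1: "closed K1" "K1 \<subseteq> K - closure \<Omega>" "(K - closure \<Omega>) - K1 \<in> lmeasurable"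
   "emeasure lebesgue ((K - closure \<Omega>) - K1) < ennreal (\<epsilon> / 2)"
  using sets_lebesgue_inner_closed[OF K0, of "\<epsilon> / 2"] \<epsilon> by auto
 have cK1: "compact K1" using K K1 by (metis Diff_subset bounded_subset compact_eq_bounded_closed subset_trans)
 \<comment> \<open>Separation with a margin \<open>c\<close> on both sides, so that a common margin
   survives the passage to finitely many half spaces.\<close>
 have "\<exists>a b c. 0 < c & b + c < a \<bullet> x & (\<forall>y\<in>closure \<Omega>. a \<bullet> y <= b - c)" if x: "x \<in> K1" for x
 proof -
  have "x \<notin> closure \<Omega>" using K1 x by auto
  then obtain a b where ab: "a \<bullet> x < b" "!!y. y \<in> closure \<Omega> ==> b < a \<bullet> y"
   using separating_hyperplane_closed_point[of "closure \<Omega>" x] \<Omega> by (auto simp: convex_closure)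
  obtain y0 where y0: "y0 \<in> closure \<Omega>" "!!y. y \<in> closure \<Omega> ==> a \<bullet> y0 <= a \<bullet> y"
  proof -
   have "\<exists>x\<in>closure \<Omega>. \<forall>y\<in>closure \<Omega>. a \<bullet> x <= a \<bullet> y"
    by (rule continuous_attains_inf[OF cO]) (use \<Omega> in \<open>auto intro!: continuous_intros\<close>)
   then show ?thesis using that by blast
  qed
  have lt: "a \<bullet> x < a \<bullet> y0" using ab y0 by fastforce
  let ?c = "(a \<bullet> y0 - a \<bullet> x) / 3" and ?b = "- (a \<bullet> x + a \<bullet> y0) / 2"
  show ?thesis
  proof (rule exI[of _ "- a"], rule exI[of _ ?b], rule exI[of _ ?c], intro conjI ballI)
   fix y assume "y \<in> closure \<Omega>"
   then have "a \<bullet> y0 <= a \<bullet> y" by (rule y0)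
   then show "- a \<bullet> y <= ?b - ?c" using lt by (simp add: field_simps)
  qed (use lt in \<open>auto simp: field_simps\<close>)
 qed
 then obtain a b c where abc: "!!x. x \<in> K1 ==> 0 < c x" "!!x. x \<in> K1 ==> b x + c x < a x \<bullet> x"
  "!!x y. x \<in> K1 ==> y \<in> closure \<Omega> ==> a x \<bullet> y <= b x - c x"
  by metis
 obtain X where X: "X \<subseteq> K1" "finite X" "K1 \<subseteq> (\<Union>x\<in>X. {y. b x + c x < a x \<bullet> y})"
 proof (rule compactE_image[OF cK1, of K1 "%x. {y. b x + c x < a x \<bullet> y}"])
  show "open {y. b x + c x < a x \<bullet> y}" for x by (rule open_halfspace_gt)
 qed (use abc in auto)
 define c0 where "c0 = Min (insert 1 (c ` X))"
 have c0: "0 < c0" "!!x. x \<in> X ==> c0 <= c x"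
  using X abc(1) by (auto simp: c0_def)
 have mK1: "K1 \<in> lmeasurable" using cK1 by (rule lmeasurable_compact)
 define N where "N = real (card X) + measure lebesgue K1 + 1"
 have N: "0 < N" by (simp add: N_def add_nonneg_pos)
 obtain n :: nat where n: "exp (- c0) ^ n < \<epsilon> / (2 * N)"
  using real_arch_pow_inv[of "\<epsilon> / (2 * N)" "exp (- c0)"] c0 \<epsilon> N by auto
 define \<delta> where "\<delta> = exp (- (real n * c0))"
 have \<delta>: "0 < \<delta>" "\<delta> * N <= \<epsilon> / 2" using n N by (auto simp: \<delta>_def exp_of_nat_mult[symmetric] field_simps)
 have "\<delta> * real (card X) <= \<delta> * N" "\<delta> * measure lebesgue K1 <= \<delta> * N" "\<delta> * 1 <= \<delta> * N"
  using \<delta> by (auto intro!: mult_left_mono simp: N_def)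
 then have \<delta>': "\<delta> * real (card X) <= \<epsilon> / 2" "\<delta> * measure lebesgue K1 <= \<epsilon> / 2" "\<delta> <= 1" using \<delta> \<epsilon> by linarith+
 define F where "F = (%x. (real n *\<^sub>R a x, real n * b x)) ` X"
 have fF: "finite F" using X by (simp add: F_def)
 have low: "1 - \<epsilon> <= hsw F y" if y: "y \<in> closure \<Omega>" for y
 proof -
  \<comment> \<open>Every factor of the weight will be at least \<open>1 - \<delta>\<close> on the
    closure, and Bernoulli's inequality bounds the product of at most \<open>card X\<close> of
    them.\<close>
  have "1 - \<epsilon> <= 1 + real (card F) * (- \<delta>)"
  proof -
   have "real (card F) <= real (card X)" using X by (simp add: F_def card_image_le)
   then have "\<delta> * real (card F) <= \<delta> * real (card X)" using \<delta> by simp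
   then show ?thesis using \<delta>' \<epsilon> by (simp add: mult.commute)
  qed
  also have "\<dots> <= (1 + (- \<delta>)) ^ card F" by (rule Bernoulli_inequality) (use \<delta>' in simp)
  also have "\<dots> = (\<Prod>f\<in>F. 1 - \<delta>)" by simp
  also have "\<dots> <= (\<Prod>f\<in>F. 1 / (1 + exp (fst f \<bullet> y - snd f)))"
  proof (rule prod_mono, intro conjI)
   fix f assume "f \<in> F"
   then obtain x where x: "x \<in> X" "f = (real n *\<^sub>R a x, real n * b x)" by (auto simp: F_def)
   have "a x \<bullet> y - b x <= - c0" using abc(3)[of x y] c0(2)[OF x(1)] X(1) x(1) y by fastforce
   from mult_left_mono[OF this, of "real n"] have "fst f \<bullet> y - snd f <= - (real n * c0)" by (simp add: x right_diff_distrib)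
   then have e: "exp (fst f \<bullet> y - snd f) <= \<delta>" by (simp add: \<delta>_def)
   let ?e = "exp (fst f \<bullet> y - snd f)"
   have "(1 - \<delta>) * (1 + ?e) <= (1 - ?e) * (1 + ?e)" using e by (intro mult_right_mono) (auto simp: add_nonneg_nonneg)
   also have "\<dots> <= 1" by (simp add: algebra_simps)
   finally show "1 - \<delta> <= 1 / (1 + ?e)" by (simp add: pos_le_divide_eq add_pos_pos)
  qed (use \<delta>' in simp)
  also have "\<dots> = hsw F y" by (simp add: hsw_prod fF)
  finally show ?thesis .
 qed
 \<comment> \<open>One factor of the product is already below \<open>\<delta>\<close>, and the
   others are at most 1.\<close>
 have up: "hsw F y <= \<delta>" if y: "y \<in> K1" for y
 proof -
  obtain x where x: "x \<in> X" "b x + c x < a x \<bullet> y" using X(3) y by auto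
  define f where "f = (real n *\<^sub>R a x, real n * b x)"
  have f: "f \<in> F" unfolding F_def f_def using x(1) by blast
  have "c0 <= a x \<bullet> y - b x" using c0(2)[OF x(1)] x(2) by linarith
  from mult_left_mono[OF this, of "real n"] have *: "real n * c0 <= fst f \<bullet> y - snd f" by (simp add: f_def right_diff_distrib)
  have "hsw F y = 1 / (1 + exp (fst f \<bullet> y - snd f)) * hsw (F - {f}) y"
   using f fF by (simp add: hsw_prod prod.remove[of F f])
  also have "\<dots> <= 1 / (1 + exp (fst f \<bullet> y - snd f)) * 1"
   using fF by (intro mult_left_mono hsw_le_1) (auto simp: add_nonneg_nonneg)
  also have "\<dots> <= 1 / exp (fst f \<bullet> y - snd f)" by (simp add: frac_le)
  also have "\<dots> <= \<delta>" using * by (simp add: \<delta>_def exp_minus[symmetric] inverse_eq_divide[symmetric])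
  finally show ?thesis .
 qed
 let ?D = "(K - closure \<Omega>) - K1"
 have neg: "negligible (frontier \<Omega>)" by (rule negligible_convex_frontier[OF \<Omega>(3)])
 have sK: "K - \<Omega> \<in> lmeasurable"
  using K \<Omega> by (intro bounded_set_imp_lmeasurable) (auto intro: bounded_subset compact_imp_bounded simp: compact_imp_closed borel_closed)
 interpret wt "hsw F" "Lf F" by (rule wt_hsw)
 have w0: "0 <= hsw F y" for y by (simp add: hsw_def)
 have "(LINT x:(K - \<Omega>)|lebesgue. hsw F x) <= (LINT x|lebesgue. indicator ?D x + \<delta> * indicator K1 x)"
  unfolding set_lebesgue_integral_def
 proof (rule integral_mono_AE)
  have hm: "hsw F \<in> borel_measurable lebesgue" using m_cont by (simp add: borel_measurable_continuous_onI measurable_completion)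
  show "integrable lebesgue (%x. indicator (K - \<Omega>) x *\<^sub>R hsw F x)"
  proof (rule bintegrable_bound[of _ "indicator (K - \<Omega>) :: 'a => real"])
   show "integrable lebesgue (indicator (K - \<Omega>) :: 'a => real)"
    using sK by (intro integrable_real_indicator) (auto simp: fmeasurable_def)
   show "(%x. indicator (K - \<Omega>) x *\<^sub>R hsw F x) \<in> borel_measurable lebesgue"
    by (intro borel_measurable_scaleR borel_measurable_indicator fmeasurableD[OF sK] hm)
   have "norm (indicator (K - \<Omega>) x *\<^sub>R hsw F x) <= norm (indicator (K - \<Omega>) x :: real)" for x
    using w0[of x] hsw_le_1[OF fF, of x] by (simp add: indicator_def)
   then show "AE x in lebesgue. norm (indicator (K - \<Omega>) x *\<^sub>R hsw F x) <= norm (indicator (K - \<Omega>) x :: real)" by simp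
  qed
  show "integrable lebesgue (%x. indicator ?D x + \<delta> * indicator K1 x :: real)"
   using K1(3) mK1
   by (intro bintegrable_add integrable_mult_right integrable_real_indicator) (auto simp: fmeasurable_def)
  show "AE x in lebesgue. indicator (K - \<Omega>) x *\<^sub>R hsw F x <= indicator ?D x + \<delta> * indicator K1 x"
  proof (rule AE_I'[of "frontier \<Omega>"])
   show "frontier \<Omega> \<in> null_sets lebesgue" using neg by (simp add: negligible_iff_null_sets)
   show "{x \<in> space lebesgue. \<not> indicator (K - \<Omega>) x *\<^sub>R hsw F x <= indicator ?D x + \<delta> * indicator K1 x} \<subseteq> frontier \<Omega>"
    using up \<delta> hsw_le_1[OF fF] \<Omega>(1) by (auto simp: indicator_def frontier_def interior_open split: if_splits)
  qed
 qed
 also have "\<dots> = measure lebesgue ?D + \<delta> * measure lebesgue K1"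
  using K1(3) mK1
  by (subst bint_add) (auto simp: fmeasurable_def intro!: integrable_real_indicator)
 also have "\<dots> <= \<epsilon> / 2 + \<epsilon> / 2"
 proof (intro add_mono \<delta>')
  show "measure lebesgue ?D <= \<epsilon> / 2"
   using K1(3,4) \<epsilon> by (simp add: emeasure_eq_measure2 ennreal_less_iff)
 qed
 finally show ?thesis using low fF by (intro exI[of _ F]) auto
qed

section \<open>Mollification\<close>

lemma GDERIV_imp_line:
 assumes "GDERIV f (x + t *\<^sub>R h) :> G"
 shows "((%t. f (x + t *\<^sub>R h)) has_real_derivative (G \<bullet> h)) (at t)"
proof -
 have "(f has_derivative (%k. k \<bullet> G)) (at (x + t *\<^sub>R h))"
  using assms by (simp add: gderiv_def inner_commute)
 moreover have "((%t. x + t *\<^sub>R h) has_derivative (%k. k *\<^sub>R h)) (at t)"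
  by (auto intro!: derivative_eq_intros)
 ultimately have "((%t. f (x + t *\<^sub>R h)) has_derivative (%k. (k *\<^sub>R h) \<bullet> G)) (at t)"
  by (rule has_derivative_compose[rotated])
 then show ?thesis
  by (simp add: has_field_derivative_def inner_commute mult.commute[of "G \<bullet> h"] fun_eq_iff)
   (simp add: mult_commute_abs)
qed

lemma C1_mvt:
 assumes "C1_gradient f G"
 obtains t where "0 < t" "t < 1" "f (x + h) - f x = G (x + t *\<^sub>R h) \<bullet> h"
proof -
 have "\<exists>t. 0 < t & t < 1 & (%t. f (x + t *\<^sub>R h)) 1 - (%t. f (x + t *\<^sub>R h)) 0 = (1 - 0) * (G (x + t *\<^sub>R h) \<bullet> h)"
  by (rule MVT2) (use assms in \<open>auto simp: C1_gradient_def intro!: GDERIV_imp_line\<close>)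
 then show ?thesis using that by auto
qed

lemma C1_continuous: "C1_gradient f G ==> continuous_on S f"
 unfolding C1_gradient_def gderiv_def
 by (metis continuous_at_imp_continuous_on has_derivative_continuous)

lemma C1_gradient_cont: "C1_gradient f G ==> continuous_on S G"
 unfolding C1_gradient_def by (metis continuous_on_subset subset_UNIV)

lemma cc_uniformly_continuous:
 fixes f :: "'a::euclidean_space => 'b::real_normed_vector"
 assumes "cc f" "0 < e"
 obtains d where "0 < d" "!!x y. norm (x - y) <= d ==> norm (f x - f y) <= e"
proof -
 obtain R where R: "0 < R" "!!x. R < norm x ==> f x = 0" using ccE[OF assms(1)] by blast
 have "uniformly_continuous_on (cball 0 (R + 1)) f"
  by (rule compact_uniformly_continuous[OF cc_cont[OF assms(1)]]) simp
 then obtain d where d: "0 < d" "!!x y. norm x <= R + 1 ==> norm y <= R + 1 ==> dist y x < d ==> dist (f y) (f x) < e"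
  using \<open>0 < e\<close> unfolding uniformly_continuous_on_def by (auto; metis)
 show ?thesis
 proof (rule that[of "min (d / 2) 1"])
  fix x y :: 'a assume xy: "norm (x - y) <= min (d / 2) 1"
  show "norm (f x - f y) <= e"
  proof (cases "norm x <= R + 1 & norm y <= R + 1")
   case True
   then show ?thesis using d(2)[of y x] xy \<open>0 < d\<close> by (simp add: dist_norm less_imp_le)
  next
   case False
   moreover have "norm x <= norm y + 1" "norm y <= norm x + 1"
    using xy norm_triangle_ineq2[of x y] norm_triangle_ineq2[of y x] by (auto simp: norm_minus_commute)
   ultimately have "R < norm x" "R < norm y" by auto
   then show ?thesis using R assms by simp
  qed
 qed (use d in auto)
qed

lemma C1_gradient_zero_outside:
 fixes f :: "'a::euclidean_space => real"
 assumes "C1_gradient f G" "open S" "!!x. x \<in> S ==> f x = 0" "x \<in> S"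
 shows "G x = 0"
proof -
 have "(f has_derivative (%h. G x \<bullet> h)) (at x)" using assms(1) by (simp add: C1_gradient_def gderiv_def inner_commute)
 moreover have "(f has_derivative (%h. 0)) (at x)"
  by (rule has_derivative_transform_within_open[of "%_. 0" _ x UNIV S]) (use assms in auto)
 ultimately have "(%h. G x \<bullet> h) = (%h. 0)" by (rule has_derivative_unique)
 then have "G x \<bullet> G x = 0" by meson
 then show ?thesis by simp
qed

lemma cc_C1_gradient:
 fixes f :: "'a::euclidean_space => real"
 assumes "C1_gradient f G" "cc f" shows "cc G"
proof -
 obtain R where R: "!!x. R < norm x ==> f x = 0" using ccE[OF assms(2)] by blast
 show ?thesis
 proof (rule ccI[of _ R])
  fix x :: 'a assume "R < norm x"
  then show "G x = 0"
   using R by (intro C1_gradient_zero_outside[OF assms(1), of "{x. R < norm x}"])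
    (auto intro!: open_Collect_less continuous_intros)
 qed (rule C1_gradient_cont[OF assms(1)])
qed

text \<open>The mean value theorem evaluates the quotient as \<open>G\<close> at a nearby point, and
  \<open>G\<close> is uniformly continuous.\<close>

lemma diff_quot_uniform:
 fixes f :: "'a::euclidean_space => real"
 assumes "C1_gradient f G" "cc f" "0 < e"
 obtains s0 where "0 < s0" "!!s i x. 0 < s ==> s <= s0 ==> norm i = 1 ==> \<bar>(f (x + s *\<^sub>R i) - f x) / s - G x \<bullet> i\<bar> <= e"
proof -
 obtain d where d: "0 < d" "!!x y. norm (x - y) <= d ==> norm (G x - G y) <= e"
  using cc_uniformly_continuous[OF cc_C1_gradient[OF assms(1,2)] assms(3)] by blast
 show ?thesis
 proof (rule that[OF d(1)])
  fix s :: real and i x :: 'a assume s: "0 < s" "s <= d" "norm i = 1"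
  obtain t where t: "0 < t" "t < 1" "f (x + s *\<^sub>R i) - f x = G (x + t *\<^sub>R s *\<^sub>R i) \<bullet> (s *\<^sub>R i)"
   using C1_mvt[OF assms(1)] by blast
  have "(f (x + s *\<^sub>R i) - f x) / s - G x \<bullet> i = (G (x + t *\<^sub>R s *\<^sub>R i) - G x) \<bullet> i"
   using s by (simp add: t inner_diff_left)
  also have "\<bar>\<dots>\<bar> <= norm (G (x + t *\<^sub>R s *\<^sub>R i) - G x)"
   using Cauchy_Schwarz_ineq2[of "G (x + t *\<^sub>R s *\<^sub>R i) - G x" i] s by simp
  also have "\<dots> <= e"
   using s t mult_mono[of t 1 s d] by (intro d) (simp add: abs_mult)
  finally show "\<bar>(f (x + s *\<^sub>R i) - f x) / s - G x \<bullet> i\<bar> <= e" .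
 qed
qed

text \<open>Only class C1 is asked for, as for the test functions, and the gradient is carried along
  explicitly. Symmetry makes the convolution self-adjoint.\<close>

definition mollifier :: "real => ('a::euclidean_space => real) => ('a => 'a) => bool" where
 "mollifier d \<rho> g \<longleftrightarrow> C1_gradient \<rho> g & (\<forall>x. 0 <= \<rho> x) & (\<forall>x. d <= norm x --> \<rho> x = 0 & g x = 0) \<and>
  (\<forall>x. \<rho> (- x) = \<rho> x) & (LBINT x. \<rho> x) = 1"

lemma mollifier_cc: "mollifier d \<rho> g ==> cc \<rho>" "mollifier d \<rho> g ==> cc g"
 by (rule ccI[of _ d]; auto simp: mollifier_def intro: C1_continuous C1_gradient_cont)+

lemma mollifier_exists:
 assumes d: "0 < d" obtains \<rho> :: "'a::euclidean_space => real" and g where "mollifier d \<rho> g"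
proof -
 \<comment> \<open>The squared positive part is continuously differentiable across 0, so a
   normalised multiple of \<open>\<theta> (d^2 - x \<bullet> x)\<close> can serve as the
   kernel.\<close>
 define \<theta> where "\<theta> t = (if t <= 0 then 0 else t^2)" for t :: real
 have \<theta>': "(\<theta> has_real_derivative 2 * max 0 t) (at t)" for t
 proof -
  consider "t < 0" | "t = 0" | "0 < t" by linarith
  then show ?thesis
  proof cases
   case 1
   then have "((%_. 0) has_real_derivative 2 * max 0 t) (at t)" by simp
   then show ?thesis
    by (rule has_field_derivative_transform_within_open[where S = "{..<0}"]) (use 1 in \<open>auto simp: \<theta>_def\<close>)
  next
   case 3
   then have "((%t. t^2) has_real_derivative 2 * max 0 t) (at t)" by (auto intro!: derivative_eq_intros)
   then show ?thesis
    by (rule has_field_derivative_transform_within_open[where S = "{0<..}"]) (use 3 in \<open>auto simp: \<theta>_def\<close>)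
  next
   case 2
   have "((%h. (\<theta> (0 + h) - \<theta> 0) / h) \<longlongrightarrow> 0) (at 0)"
   proof (rule tendsto_norm_zero_cancel, rule tendsto_sandwich[of "%_. 0" _ _ "%h. \<bar>h\<bar>"])
    show "\<forall>\<^sub>F h in at 0. norm ((\<theta> (0 + h) - \<theta> 0) / h) <= \<bar>h\<bar>"
     by (auto simp: \<theta>_def power2_eq_square intro!: always_eventually)
   qed (auto intro!: tendsto_eq_intros)
   then show ?thesis using 2 by (simp add: DERIV_def)
  qed
 qed
 define k where "k x = \<theta> (d^2 - x \<bullet> x)" for x :: 'a
 define kg where "kg x = (- 4 * max 0 (d^2 - x \<bullet> x)) *\<^sub>R x" for x :: 'a
 have kD: "GDERIV k x :> kg x" for x
 proof -
  have "((%x. d^2 - x \<bullet> x) has_derivative (%h. - (2 * (x \<bullet> h)))) (at x)"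
   by (auto intro!: derivative_eq_intros simp: inner_commute)
  then have "(k has_derivative (%h. 2 * max 0 (d^2 - x \<bullet> x) * (- (2 * (x \<bullet> h))))) (at x)"
   unfolding k_def[abs_def] using has_derivative_compose[OF _ \<theta>'[unfolded has_field_derivative_def]] by blast
  then show ?thesis by (simp add: gderiv_def kg_def mult.assoc inner_commute)
 qed
 have k0: "k x = 0 & kg x = 0" if "d <= norm x" for x
 proof -
  have "d^2 <= x \<bullet> x" using that d by (simp add: power2_norm_eq_inner[symmetric] power_mono)
  then show ?thesis by (simp add: k_def kg_def \<theta>_def max_def)
 qed
 have kcont: "cont kg" unfolding kg_def[abs_def] by (intro continuous_intros)
 have kC: "C1_gradient k kg" using kD kcont by (simp add: C1_gradient_def)
 have cck: "cc k" by (rule ccI[of _ d]) (use k0 C1_continuous[OF kC] in auto)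
 have kn: "0 <= k x" for x by (simp add: k_def \<theta>_def)
 have ik: "integrable lborel k" by (rule cc_integrable[OF cck])
 define c where "c = (LBINT x. k x)"
 have "c ~= 0"
 proof
  assume "c = 0"
  then have aek: "AE x in lborel. k x = 0"
   using integral_nonneg_eq_0_iff_AE[OF ik] kn by (simp add: c_def)
  have kp: "k x > 0" if "x \<in> ball 0 d" for x
  proof -
   have "norm x < d" using that by simp
   then have "x \<bullet> x < d^2" by (metis norm_ge_zero power2_norm_eq_inner power_strict_mono zero_less_numeral)
   then show ?thesis by (simp add: k_def \<theta>_def)
  qed
  have "AE x in lborel. x \<notin> ball (0::'a) d"
  proof (rule eventually_mono[OF aek])
   fix x assume "k x = 0"
   then show "x \<notin> ball (0::'a) d" using kp[of x] by auto
  qed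
  moreover have "(AE x in lborel. x \<notin> ball (0::'a) d) \<longleftrightarrow> emeasure lborel (ball (0::'a) d) = 0"
   by (rule AE_iff_measurable) auto
  ultimately have "ball (0::'a) d \<in> null_sets lborel" by auto
  then have "negligible (ball (0::'a) d)" by (simp add: negligible_iff_null_sets null_sets_completionI)
  then show False using open_not_negligible[of "ball (0::'a) d"] d by auto
 qed
 moreover have "0 <= c" unfolding c_def by (rule integral_nonneg_AE) (simp add: kn)
 ultimately have c: "0 < c" by simp
 have "mollifier d (%x. k x / c) (%x. kg x /\<^sub>R c)"
  unfolding mollifier_def C1_gradient_def
 proof (intro conjI allI impI)
  fix x
  show "GDERIV (%x. k x / c) x :> kg x /\<^sub>R c"
  proof -
   have "((%x. k x * inverse c) has_derivative (%h. (h \<bullet> kg x) * inverse c)) (at x)"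
    using kD[of x] unfolding gderiv_def by (rule has_derivative_mult_left)
   then show ?thesis by (simp add: gderiv_def divide_inverse mult.commute)
  qed
  show "0 <= k x / c" using kn c by simp
  show "k (- x) / c = k x / c" by (simp add: k_def)
  assume "d <= norm x"
  then show "k x / c = 0" "kg x /\<^sub>R c = 0" using k0 by auto
 next
  show "(LBINT x. k x / c) = 1" using c by (simp add: c_def[symmetric])
 qed (intro continuous_intros kcont)
 then show ?thesis by (rule that)
qed

definition conv :: "('a::euclidean_space => real) => ('a => 'b::euclidean_space) => 'a => 'b" where
 "conv \<rho> f x = (LBINT z. \<rho> (x - z) *\<^sub>R f z)"

lemma cc_reflect:
 fixes \<rho> :: "'a::euclidean_space => 'b::real_normed_vector"
 shows "cc \<rho> ==> cc (%z. \<rho> (x - z))"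
proof -
 assume r: "cc \<rho>"
 obtain R where R: "!!x. R < norm x ==> \<rho> x = 0" using ccE[OF r] by blast
 show ?thesis
 proof (rule ccI[of _ "R + norm x"])
  fix z :: 'a assume "R + norm x < norm z"
  then have "R < norm (x - z)" using norm_triangle_ineq2[of z x] by (simp add: norm_minus_commute)
  then show "\<rho> (x - z) = 0" by (rule R)
 qed (rule cc_cont_compose[OF r], intro continuous_intros)
qed

lemma conv_integrable:
 fixes f :: "'a::euclidean_space => 'b::euclidean_space"
 assumes f: "integrable lborel f" and r: "cc \<rho>"
 shows "integrable lborel (%z. \<rho> (x - z) *\<^sub>R f z)"
proof -
 obtain B where B: "!!x. norm (\<rho> x) <= B" "0 < B" using cc_bounded[OF r] by metis
 show ?thesis
 proof (rule bintegrable_bound[of _ "%z. B *\<^sub>R f z"])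
  show "(%z. \<rho> (x - z) *\<^sub>R f z) \<in> borel_measurable lborel"
  proof -
   have [measurable]: "f \<in> borel_measurable borel" using f by simp
   have [measurable]: "(%z. \<rho> (x - z)) \<in> borel_measurable borel"
    by (rule borel_measurable_continuous_onI[OF cc_cont[OF cc_reflect[OF r]]])
   show ?thesis by measurable
  qed
  show "AE z in lborel. norm (\<rho> (x - z) *\<^sub>R f z) <= norm (B *\<^sub>R f z)"
   using B by (auto intro!: mult_right_mono)
 qed (use f in auto)
qed

lemma conv_vec_integrable:
 fixes f :: "'a::euclidean_space => real" and g :: "'a => 'b::euclidean_space"
 assumes f: "integrable lborel f" and r: "cc g"
 shows "integrable lborel (%z. f z *\<^sub>R g (x - z))"
proof -
 obtain B where B: "!!x. norm (g x) <= B" "0 < B" using cc_bounded[OF r] by metis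
 show ?thesis
 proof (rule bintegrable_bound[of _ "%z. B *\<^sub>R f z"])
  show "(%z. f z *\<^sub>R g (x - z)) \<in> borel_measurable lborel"
  proof -
   have [measurable]: "f \<in> borel_measurable borel" using f by simp
   have [measurable]: "(%z. g (x - z)) \<in> borel_measurable borel"
    by (rule borel_measurable_continuous_onI[OF cc_cont[OF cc_reflect[OF r]]])
   show ?thesis by measurable
  qed
  have "norm (f z *\<^sub>R g (x - z)) <= norm (B *\<^sub>R f z)" for z
   using mult_left_mono[OF B(1)[of "x - z"], of "\<bar>f z\<bar>"] B(2) by (simp add: abs_mult mult.commute[of B])
  then show "AE z in lborel. norm (f z *\<^sub>R g (x - z)) <= norm (B *\<^sub>R f z)" by simp
 qed (use f in auto)
qed

text \<open>Differentiation falls on the kernel; the mean value theorem and the uniform continuity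
  of \<open>g\<close> bound the remainder uniformly in \<open>z\<close>, so integrability of
  \<open>f\<close> suffices.\<close>

lemma conv_C1:
 fixes f :: "'a::euclidean_space => real"
 assumes f: "integrable lborel f" and \<rho>: "mollifier d \<rho> g"
 shows "C1_gradient (conv \<rho> f) (%x. (LBINT z. f z *\<^sub>R g (x - z)))"
proof -
 note r = mollifier_cc[OF \<rho>]
 have C1: "C1_gradient \<rho> g" using \<rho> by (simp add: mollifier_def)
 let ?G = "%x. (LBINT z. f z *\<^sub>R g (x - z))"
 define N where "N = (LBINT z. norm (f z))"
 have N: "0 <= N" unfolding N_def by (rule integral_nonneg_AE) auto
 have G: "norm (?G y - ?G x) <= e * N" if "!!z. norm (g (y - z) - g (x - z)) <= e" for x y e
 proof -
  have "?G y - ?G x = (LBINT z. f z *\<^sub>R (g (y - z) - g (x - z)))"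
   by (simp add: scaleR_diff_right conv_vec_integrable[OF f r(2)])
  also have "norm \<dots> <= (LBINT z. e * norm (f z))"
  proof (rule bint_norm_bound)
   show "integrable lborel (%z. f z *\<^sub>R (g (y - z) - g (x - z)))"
    unfolding scaleR_diff_right by (intro bintegrable_diff conv_vec_integrable[OF f r(2)])
   fix z show "norm (f z *\<^sub>R (g (y - z) - g (x - z))) <= e * norm (f z)"
    using mult_right_mono[OF that[of z], of "\<bar>f z\<bar>"] by (simp add: mult.commute)
  qed (use f in auto)
  finally show ?thesis by (simp add: N_def)
 qed
 have cont: "cont ?G"
 proof (rule continuous_onI)
  fix x :: 'a and e :: real assume e: "0 < e"
  define e' where "e' = e / (N + 1)"
  have e': "0 < e'" "e' * N <= e" using e N by (auto simp: e'_def divide_simps add_nonneg_pos)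
  obtain \<delta> where d: "0 < \<delta>" "!!x y. norm (x - y) <= \<delta> ==> norm (g x - g y) <= e'"
   using cc_uniformly_continuous[OF r(2) e'(1)] by blast
  show "\<exists>\<delta>>0. \<forall>x'\<in>UNIV. dist x' x < \<delta> --> dist (?G x') (?G x) <= e"
   by (intro exI[of _ \<delta>] conjI ballI impI)
    (use d e' in \<open>auto simp: dist_norm intro!: order_trans[OF G e'(2)]\<close>)
 qed
 moreover have "(conv \<rho> f has_derivative (%h. ?G x \<bullet> h)) (at x)" for x
 proof (rule has_derivativeI)
  show "bounded_linear (%h. ?G x \<bullet> h)" by (rule bounded_linear_inner_right)
  show "((%y. (conv \<rho> f y - conv \<rho> f x - ?G x \<bullet> (y - x)) /\<^sub>R norm (y - x)) \<longlongrightarrow> 0) (at x)"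
   unfolding tendsto_iff
  proof (intro allI impI)
   fix e :: real assume e: "0 < e"
   define e' where "e' = e / (2 * (N + 1))"
   have e': "0 < e'" "e' * N < e" using e N by (auto simp: e'_def divide_simps add_nonneg_pos)
   obtain \<delta> where d: "0 < \<delta>" "!!x y. norm (x - y) <= \<delta> ==> norm (g x - g y) <= e'"
    using cc_uniformly_continuous[OF r(2) e'(1)] by blast
   have "dist ((conv \<rho> f y - conv \<rho> f x - ?G x \<bullet> (y - x)) /\<^sub>R norm (y - x)) 0 < e" if y: "y ~= x" "dist y x < \<delta>" for y
   proof -
    have "conv \<rho> f y - conv \<rho> f x - ?G x \<bullet> (y - x)
     = (LBINT z. f z * (\<rho> (y - z) - \<rho> (x - z) - g (x - z) \<bullet> (y - x)))"
    proof -
     have 1: "integrable lborel (%z. f z * (g (x - z) \<bullet> (y - x)))"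
      using integrable_inner_left[OF conv_vec_integrable[OF f r(2), of x], of "y - x"] by simp
     have "?G x \<bullet> (y - x) = (LBINT z. f z * (g (x - z) \<bullet> (y - x)))"
      using integral_inner_left[OF conv_vec_integrable[OF f r(2), of x], of "y - x"] by simp
     then show ?thesis
      using conv_integrable[OF f r(1), of y] conv_integrable[OF f r(1), of x] 1
      by (simp add: conv_def right_diff_distrib mult.commute[of _ "f _"])
    qed
    also have "norm \<dots> <= (LBINT z. (e' * norm (y - x)) * norm (f z))"
    proof (rule bint_norm_bound)
     show "integrable lborel (%z. f z * (\<rho> (y - z) - \<rho> (x - z) - g (x - z) \<bullet> (y - x)))"
      using conv_integrable[OF f r(1), of y] conv_integrable[OF f r(1), of x]
       integrable_inner_left[OF conv_vec_integrable[OF f r(2), of x], of "y - x"]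
      by (simp add: right_diff_distrib mult.commute[of _ "f _"])
     fix z
     obtain t where t: "0 < t" "t < 1" "\<rho> ((x - z) + (y - x)) - \<rho> (x - z) = g ((x - z) + t *\<^sub>R (y - x)) \<bullet> (y - x)"
      using C1_mvt[OF C1, of "x - z" "y - x"] by blast
     have "\<rho> (y - z) - \<rho> (x - z) - g (x - z) \<bullet> (y - x) = (g ((x - z) + t *\<^sub>R (y - x)) - g (x - z)) \<bullet> (y - x)"
      using t(3) by (simp add: inner_diff_left)
     then have "\<bar>\<rho> (y - z) - \<rho> (x - z) - g (x - z) \<bullet> (y - x)\<bar> <= norm (g ((x - z) + t *\<^sub>R (y - x)) - g (x - z)) * norm (y - x)"
      by (simp add: Cauchy_Schwarz_ineq2)
     also have "\<dots> <= e' * norm (y - x)"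
     proof (intro mult_right_mono d(2))
      show "norm ((x - z) + t *\<^sub>R (y - x) - (x - z)) <= \<delta>"
       using t y mult_mono[of t 1 "norm (y - x)" \<delta>] by (simp add: dist_norm)
     qed simp
     finally have "\<bar>\<rho> (y - z) - \<rho> (x - z) - g (x - z) \<bullet> (y - x)\<bar> <= e' * norm (y - x)" .
     from mult_left_mono[OF this abs_ge_zero[of "f z"]]
     show "norm (f z * (\<rho> (y - z) - \<rho> (x - z) - g (x - z) \<bullet> (y - x))) <= (e' * norm (y - x)) * norm (f z)"
      by (simp add: abs_mult mult.commute)
    qed (use f in auto)
    also have "\<dots> = e' * N * norm (y - x)" by (simp add: N_def)
    finally have "norm (conv \<rho> f y - conv \<rho> f x - ?G x \<bullet> (y - x)) / norm (y - x) <= e' * N"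
     using y by (simp add: pos_divide_le_eq)
    then show ?thesis using e'(2) by (simp add: dist_norm divide_inverse mult.commute abs_mult)
   qed
   then show "\<forall>\<^sub>F y in at x. dist ((conv \<rho> f y - conv \<rho> f x - ?G x \<bullet> (y - x)) /\<^sub>R norm (y - x)) 0 < e"
    using d(1) by (auto simp: eventually_at)
  qed
 qed
 ultimately show ?thesis by (simp add: C1_gradient_def gderiv_def inner_commute)
qed

lemma conv_zero_outside:
 assumes \<rho>: "!!x. d <= norm x ==> \<rho> x = 0" and f: "!!z. norm (z - x) < d ==> f z = 0"
 shows "conv \<rho> f x = 0"
proof -
 have "(%z. \<rho> (x - z) *\<^sub>R f z) = (%z. 0)"
  using \<rho> f by (auto simp: fun_eq_iff norm_minus_commute) (metis norm_minus_commute not_le)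
 then show ?thesis by (simp add: conv_def)
qed

lemma conv_cong:
 assumes \<rho>: "!!x. d <= norm x ==> \<rho> x = 0" and f: "!!z. norm (z - x) < d ==> f z = g z"
 shows "conv \<rho> f x = conv \<rho> g x"
proof -
 have "(%z. \<rho> (x - z) *\<^sub>R f z) = (%z. \<rho> (x - z) *\<^sub>R g z)"
  using \<rho> f by (auto simp: fun_eq_iff) (metis norm_minus_commute not_le)
 then show ?thesis by (simp add: conv_def)
qed

lemma integral_reflect:
 fixes f :: "'a::euclidean_space => 'b::euclidean_space"
 assumes "f \<in> borel_measurable borel"
 shows "(LBINT z. f (x - z)) = (LBINT z. f z)"
proof -
 have "lborel = density (distr lborel borel (%z. x + (-1) *\<^sub>R z)) (%_. ennreal (\<bar>- 1\<bar> ^ DIM('a)))"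
  by (rule lborel_affine) simp
 then have "lborel = distr lborel borel (%z. x - z)" by (simp add: density_1)
 then have "(LBINT z. f z) = (\<integral>z. f z \<partial>distr lborel borel (%z. x - z))" by simp
 also have "\<dots> = (LBINT z. f (x - z))"
  by (rule integral_distr) (use assms in auto)
 finally show ?thesis by simp
qed

lemma mollifier_int:
 fixes \<rho> :: "'a::euclidean_space => real"
 assumes "mollifier d \<rho> g" shows "(LBINT z. \<rho> (x - z)) = 1"
 using integral_reflect[of \<rho> x] assms C1_continuous[of \<rho> g UNIV]
 by (auto simp: mollifier_def borel_measurable_continuous_onI)

text \<open>The convolution is an average, with a probability density, of the values of
  \<open>f\<close> at distance less than \<open>d\<close>.\<close>

lemma conv_close:
 fixes f :: "'a::euclidean_space => 'b::euclidean_space"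
 assumes \<rho>: "mollifier d \<rho> g" and f: "integrable lborel f" and e: "!!z. norm (z - x) < d ==> norm (f z - y) <= e"
 shows "norm (conv \<rho> f x - y) <= e"
proof -
 note r = mollifier_cc[OF \<rho>]
 have ir: "integrable lborel (%z. \<rho> (x - z))" by (rule cc_integrable[OF cc_reflect[OF r(1)]])
 have "conv \<rho> f x - y = (LBINT z. \<rho> (x - z) *\<^sub>R (f z - y))"
  using mollifier_int[OF \<rho>, of x] conv_integrable[OF f r(1), of x] ir
  by (simp add: conv_def scaleR_diff_right)
 also have "norm \<dots> <= (LBINT z. e * \<rho> (x - z))"
 proof (rule bint_norm_bound)
  show "integrable lborel (%z. \<rho> (x - z) *\<^sub>R (f z - y))"
   using conv_integrable[OF f r(1), of x] ir by (simp add: scaleR_diff_right)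
  fix z
  have "0 <= \<rho> (x - z)" "d <= norm (z - x) ==> \<rho> (x - z) = 0"
   using \<rho> by (auto simp: mollifier_def norm_minus_commute)
  then show "norm (\<rho> (x - z) *\<^sub>R (f z - y)) <= e * \<rho> (x - z)"
   using mult_left_mono[OF e[of z], of "\<rho> (x - z)"] by (cases "norm (z - x) < d") (auto simp: mult.commute)
 qed (use ir in auto)
 finally show ?thesis using mollifier_int[OF \<rho>, of x] by simp
qed

text \<open>Read off from Young's inequality for \<open>a * t powr (r - 1)\<close> instead of a
  derivative, which also covers \<open>t = 0\<close>.\<close>

lemma powr_tangent:
 fixes a t r :: real
 assumes "1 <= r" "0 <= a" "0 <= t"
 shows "t powr r + r * t powr (r - 1) * (a - t) <= a powr r"
proof (cases "r = 1")
 case True then show ?thesis using assms by (cases "t = 0") auto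
next
 case False
 then have r: "1 < r" using assms by simp
 define q where "q = r / (r - 1)"
 have q: "1 < q" "1 / r + 1 / q = 1" using r by (auto simp: q_def field_simps)
 have "a * t powr (r - 1) <= a powr r / r + (t powr (r - 1)) powr q / q"
  by (rule Youngs_inequality) (use assms r q in auto)
 also have "(t powr (r - 1)) powr q = t powr r" using r by (simp add: powr_powr q_def)
 finally have "r * (a * t powr (r - 1)) <= r * (a powr r / r + t powr r / q)" using r by (intro mult_left_mono) auto
 also have "\<dots> = a powr r + (r - 1) * t powr r" using r by (simp add: q_def field_simps)
 finally have "r * (a * t powr (r - 1)) <= a powr r + (r - 1) * t powr r" .
 moreover have "t * t powr (r - 1) = t powr r" using assms powr_mult_base[of t "r - 1"] by simp
 then have "r * t powr (r - 1) * (a - t) = r * (a * t powr (r - 1)) - r * t powr r" by (simp add: algebra_simps)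
 moreover have "(r - 1) * t powr r = r * t powr r - t powr r" by (simp add: algebra_simps)
 ultimately show ?thesis by linarith
qed

text \<open>Jensen's inequality: \<open>powr_tangent\<close> at the mean value \<open>t\<close> of
  \<open>norm (f z)\<close> is averaged against the kernel, and the linear terms cancel.\<close>

lemma conv_jensen:
 fixes f :: "'a::euclidean_space => 'b::euclidean_space"
 assumes \<rho>: "mollifier d \<rho> g" and f: "integrable lborel f" "integrable lborel (%z. norm (f z) powr r)" and r1: "1 <= r"
 shows "norm (conv \<rho> f x) powr r <= conv \<rho> (%z. norm (f z) powr r) x"
proof -
 note r = mollifier_cc[OF \<rho>]
 have \<rho>0: "0 <= \<rho> y" for y using \<rho> by (simp add: mollifier_def)
 define t where "t = (LBINT z. \<rho> (x - z) * norm (f z))"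
 have i1: "integrable lborel (%z. \<rho> (x - z) * norm (f z))" using conv_integrable[OF integrable_norm[OF f(1)] r(1), of x] by simp
 have i2: "integrable lborel (%z. \<rho> (x - z) * norm (f z) powr r)" using conv_integrable[OF f(2) r(1), of x] by simp
 have ir: "integrable lborel (%z. \<rho> (x - z))" by (rule cc_integrable[OF cc_reflect[OF r(1)]])
 have t0: "0 <= t" unfolding t_def by (rule integral_nonneg_AE) (auto intro!: mult_nonneg_nonneg \<rho>0)
 have "norm (conv \<rho> f x) <= t"
  unfolding conv_def t_def
  by (rule order_trans[OF integral_norm_bound]) (simp add: \<rho>0)
 then have "norm (conv \<rho> f x) powr r <= t powr r" using r1 by (intro powr_mono2) auto
 also have "t powr r = (LBINT z. \<rho> (x - z) * (t powr r + r * t powr (r - 1) * (norm (f z) - t)))"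
 proof -
  have "(LBINT z. \<rho> (x - z) * (t powr r + r * t powr (r - 1) * (norm (f z) - t)))
   = (LBINT z. (t powr r - r * t powr (r - 1) * t) * \<rho> (x - z) + r * t powr (r - 1) * (\<rho> (x - z) * norm (f z)))"
   by (intro bint_cong refl) (simp add: algebra_simps)
  also have "\<dots> = (t powr r - r * t powr (r - 1) * t) * 1 + r * t powr (r - 1) * t"
   using i1 ir mollifier_int[OF \<rho>, of x] by (simp add: t_def[symmetric])
  finally show ?thesis by simp
 qed
 also have "\<dots> <= (LBINT z. \<rho> (x - z) * norm (f z) powr r)"
 proof (rule integral_mono)
  have "integrable lborel (%z. (t powr r - r * t powr (r - 1) * t) * \<rho> (x - z) + r * t powr (r - 1) * (\<rho> (x - z) * norm (f z)))"
   using i1 ir by (intro bintegrable_add integrable_mult_right)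
  then show "integrable lborel (%z. \<rho> (x - z) * (t powr r + r * t powr (r - 1) * (norm (f z) - t)))"
   by (rule Bochner_Integration.integrable_cong[THEN iffD1, rotated 2]) (auto simp: algebra_simps)
  fix z show "\<rho> (x - z) * (t powr r + r * t powr (r - 1) * (norm (f z) - t)) <= \<rho> (x - z) * norm (f z) powr r"
   by (intro mult_left_mono powr_tangent r1 t0 \<rho>0) auto
 qed (rule i2)
 finally show ?thesis by (simp add: conv_def)
qed

lemma nn_integral_shift:
 fixes f :: "'a::euclidean_space => ennreal"
 assumes "f \<in> borel_measurable borel"
 shows "(\<integral>\<^sup>+x. f (x + h) \<partial>lborel) = (\<integral>\<^sup>+x. f x \<partial>lborel)"
proof -
 have "(\<integral>\<^sup>+x. f x \<partial>lborel) = (\<integral>\<^sup>+x. f x \<partial>distr lborel borel ((+) h))"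
  by (simp add: lborel_distr_plus)
 also have "\<dots> = (\<integral>\<^sup>+x. f (h + x) \<partial>lborel)"
  by (rule nn_integral_distr) (use assms in auto)
 finally show ?thesis by (simp add: add.commute)
qed

lemma conv_nn_mass:
 fixes F :: "'a::euclidean_space => real"
 assumes \<rho>: "mollifier d \<rho> g" and F: "integrable lborel F" "!!x. 0 <= F x"
 shows "(\<integral>\<^sup>+x. ennreal (conv \<rho> F x) \<partial>lborel) = (\<integral>\<^sup>+x. ennreal (F x) \<partial>lborel)"
proof -
 note r = mollifier_cc[OF \<rho>]
 have \<rho>0: "0 <= \<rho> y" for y using \<rho> by (simp add: mollifier_def)
 have [measurable]: "\<rho> \<in> borel_measurable borel" by (rule borel_measurable_continuous_onI[OF cc_cont[OF r(1)]])
 have [measurable]: "F \<in> borel_measurable borel" using F by simp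
 have "(\<integral>\<^sup>+x. ennreal (conv \<rho> F x) \<partial>lborel) = (\<integral>\<^sup>+x. (\<integral>\<^sup>+z. ennreal (\<rho> (x - z) * F z) \<partial>lborel) \<partial>lborel)"
 proof (rule nn_integral_cong)
  fix x
  show "ennreal (conv \<rho> F x) = (\<integral>\<^sup>+z. ennreal (\<rho> (x - z) * F z) \<partial>lborel)"
   using nn_integral_eq_integral[of lborel "%z. \<rho> (x - z) * F z"] conv_integrable[OF F(1) r(1), of x] \<rho>0 F(2)
   by (simp add: conv_def)
 qed
 also have "\<dots> = (\<integral>\<^sup>+z. (\<integral>\<^sup>+x. ennreal (\<rho> (x - z) * F z) \<partial>lborel) \<partial>lborel)"
  by (rule lborel_pair.Fubini') measurable
 also have "\<dots> = (\<integral>\<^sup>+z. ennreal (F z) \<partial>lborel)"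
 proof (rule nn_integral_cong)
  fix z
  have "(\<integral>\<^sup>+x. ennreal (\<rho> (x - z) * F z) \<partial>lborel) = (\<integral>\<^sup>+x. ennreal (\<rho> (x + (- z))) * ennreal (F z) \<partial>lborel)"
   using \<rho>0 F(2) by (intro nn_integral_cong) (simp add: ennreal_mult)
  also have "\<dots> = (\<integral>\<^sup>+x. ennreal (\<rho> (x + (- z))) \<partial>lborel) * ennreal (F z)"
   by (rule nn_integral_multc) measurable
  also have "(\<integral>\<^sup>+x. ennreal (\<rho> (x + (- z))) \<partial>lborel) = (\<integral>\<^sup>+x. ennreal (\<rho> x) \<partial>lborel)"
   by (rule nn_integral_shift[of "%x. ennreal (\<rho> x)"]) measurable
  also have "\<dots> = 1"
   using nn_integral_eq_integral[OF cc_integrable[OF r(1)]] \<rho>0 \<rho> by (simp add: mollifier_def)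
  finally show "(\<integral>\<^sup>+x. ennreal (\<rho> (x - z) * F z) \<partial>lborel) = ennreal (F z)" by simp
 qed
 finally show ?thesis .
qed

lemma conv_cont:
 fixes f :: "'a::euclidean_space => 'b::euclidean_space"
 assumes f: "integrable lborel f" and \<rho>: "mollifier d \<rho> g"
 shows "cont (conv \<rho> f)"
proof -
 note r = mollifier_cc[OF \<rho>]
 have "conv \<rho> f x = (\<Sum>i\<in>Basis. conv \<rho> (%z. f z \<bullet> i) x *\<^sub>R i)" for x
 proof (rule euclidean_eqI)
  fix i :: 'b assume "i \<in> Basis"
  then show "conv \<rho> f x \<bullet> i = (\<Sum>i\<in>Basis. conv \<rho> (%z. f z \<bullet> i) x *\<^sub>R i) \<bullet> i"
   using integral_inner_left[OF conv_integrable[OF f r(1), of x], of i] by (simp add: conv_def)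
 qed
 moreover have "cont (%x. \<Sum>i\<in>Basis. conv \<rho> (%z. f z \<bullet> i) x *\<^sub>R i)"
  by (intro continuous_intros C1_continuous[OF conv_C1[OF _ \<rho>]] integrable_inner_left f)
 ultimately show ?thesis by simp
qed

lemma conv_Lr:
 fixes f :: "'a::euclidean_space => 'b::euclidean_space"
 assumes \<rho>: "mollifier d \<rho> g" and f: "integrable lborel f" "integrable lborel (%z. norm (f z) powr r)" and r1: "1 <= r"
 shows "integrable lborel (%x. norm (conv \<rho> f x) powr r)"
  "(LBINT x. norm (conv \<rho> f x) powr r) <= (LBINT x. norm (f x) powr r)"
proof -
 let ?F = "%z. norm (f z) powr r"
 have [measurable]: "conv \<rho> f \<in> borel_measurable borel" by (rule borel_measurable_continuous_onI[OF conv_cont[OF f(1) \<rho>]])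
 have le: "(\<integral>\<^sup>+x. ennreal (norm (conv \<rho> f x) powr r) \<partial>lborel) <= (\<integral>\<^sup>+x. ennreal (?F x) \<partial>lborel)"
  unfolding conv_nn_mass[OF \<rho> f(2), symmetric, simplified]
  by (intro nn_integral_mono ennreal_leI conv_jensen[OF \<rho> f r1])
 also have fin: "\<dots> = ennreal (LBINT x. ?F x)" by (rule nn_integral_eq_integral[OF f(2)]) auto
 finally have le': "(\<integral>\<^sup>+x. ennreal (norm (conv \<rho> f x) powr r) \<partial>lborel) <= ennreal (LBINT x. ?F x)" .
 show i: "integrable lborel (%x. norm (conv \<rho> f x) powr r)"
  by (rule integrableI_bounded) (use le' in \<open>auto simp: top.extremum_strict intro: le_less_trans\<close>)
 have "0 <= (LBINT x. ?F x)" by (rule integral_nonneg_AE) auto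
 then show "(LBINT x. norm (conv \<rho> f x) powr r) <= (LBINT x. ?F x)"
  using le' nn_integral_eq_integral[OF i] by simp
qed

text \<open>Fubini's theorem for a continuous integrand with bounded support, combined with the
  symmetry of the kernel.\<close>

lemma conv_adjoint:
 fixes f g :: "'a::euclidean_space => 'b::euclidean_space"
 assumes \<rho>: "mollifier d \<rho> k" and f: "cc f" and g: "cc g"
 shows "(LBINT x. conv \<rho> f x \<bullet> g x) = (LBINT x. f x \<bullet> conv \<rho> g x)"
proof -
 note r = mollifier_cc[OF \<rho>]
 have sym: "\<rho> (x - z) = \<rho> (z - x)" for x z
 proof -
  have "\<rho> (- (z - x)) = \<rho> (z - x)" using \<rho> unfolding mollifier_def by blast
  then show ?thesis by simp
 qed
 obtain Rf where Rf: "0 < Rf" "!!x. Rf < norm x ==> f x = 0" using ccE[OF f] by blast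
 obtain Rg where Rg: "0 < Rg" "!!x. Rg < norm x ==> g x = 0" using ccE[OF g] by blast
 define h where "h y = \<rho> (fst y - snd y) * (f (snd y) \<bullet> g (fst y))" for y :: "'a \<times> 'a"
 have "cc h"
 proof (rule ccI[of _ "Rf + Rg"])
  show "cont h"
   unfolding h_def[abs_def]
   by (intro continuous_on_mult continuous_on_inner cc_cont_compose[OF r(1)] cc_cont_compose[OF f] cc_cont_compose[OF g] continuous_intros)
  fix y :: "'a \<times> 'a" assume y: "Rf + Rg < norm y"
  have "norm y <= norm (fst y) + norm (snd y)" using norm_Pair_le[of "fst y" "snd y"] by simp
  then have "Rf < norm (snd y) \<or> Rg < norm (fst y)" using y by linarith
  then show "h y = 0" using Rf Rg by (auto simp: h_def)
 qed
 then have ih: "integrable (lborel \<Otimes>\<^sub>M lborel) (%(x, z). h (x, z))"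
  using cc_integrable[of h] by (simp add: lborel_prod case_prod_unfold)
 have "(LBINT x. conv \<rho> f x \<bullet> g x) = (LBINT x. (LBINT z. h (x, z)))"
  unfolding conv_def h_def
  by (intro bint_cong refl)
   (simp add: integral_inner_left[OF conv_integrable[OF cc_integrable[OF f] r(1)], symmetric])
 also have "\<dots> = (LBINT z. (LBINT x. h (x, z)))"
  by (rule lborel_pair.Fubini_integral[symmetric, OF ih, simplified])
 also have "\<dots> = (LBINT z. f z \<bullet> conv \<rho> g z)"
  unfolding conv_def h_def
  by (intro bint_cong refl)
   (simp add: integral_inner_right[OF conv_integrable[OF cc_integrable[OF g] r(1)], symmetric] sym)
 finally show ?thesis .
qed

lemma cont_set_integrable:
 fixes f :: "'a::euclidean_space => 'b::euclidean_space"
 assumes "cont f" "bounded S" "S \<in> sets borel"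
 shows "set_integrable lborel S f"
proof (rule set_integrable_subset)
 show "set_integrable lborel (closure S) f"
  unfolding set_integrable_def
  by (rule borel_integrable_compact) (use assms in \<open>auto intro: continuous_on_subset\<close>)
qed (use assms closure_subset in auto)

section \<open>From the weighted discrete problem to the domain\<close>

definition nb :: "'a::metric_space set => real => 'a set" where
 "nb S d = (\<Union>x\<in>S. ball x d)"

lemma nb_open: "open (nb S d)" by (auto simp: nb_def)

lemma nb_bounded:
 fixes S :: "'a::real_normed_vector set"
 assumes "bounded S" shows "bounded (nb S d)"
proof -
 obtain B where B: "!!x. x \<in> S ==> norm x <= B" using assms by (auto simp: bounded_iff)
 have "norm y <= B + d" if y: "y \<in> nb S d" for y
 proof -
  obtain x where x: "x \<in> S" "norm (x - y) < d" using y by (auto simp: nb_def dist_norm)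
  have "norm y <= norm x + norm (x - y)" using norm_triangle_ineq4[of x "x - y"] by simp
  then show ?thesis using x B[OF x(1)] by simp
 qed
 then show ?thesis by (auto simp: bounded_iff)
qed

lemma nb_borel [simp]: "nb S d \<in> sets borel" using nb_open by (rule borel_open)

lemma nb_mono: "d <= d' ==> nb S d \<subseteq> nb S d'"
 by (force simp: nb_def)

lemma sum_Basis_sq: "(\<Sum>i\<in>Basis. (x \<bullet> i)^2) = (norm (x :: 'a::euclidean_space))^2"
proof -
 have "(norm x)^2 = (\<Sum>i\<in>Basis. (x \<bullet> i) * (x \<bullet> i))" unfolding power2_norm_eq_inner by (rule euclidean_inner)
 then show ?thesis by (simp add: power2_eq_square[of "_ \<bullet> _"])
qed

lemma set_int_nonneg:
 fixes f :: "'a => real"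
 shows "(!!x. x \<in> S ==> 0 <= f x) ==> 0 <= (LINT x:S|M. f x)"
 unfolding set_lebesgue_integral_def by (rule integral_nonneg_AE) (auto simp: indicator_def)

text \<open>The discrete potential \<open>\<phi>\<close> is mollified at scale
  \<open>\<delta>\<close> into \<open>\<eta>\<close>. The order of the choices matters: a near
  minimiser \<open>\<zeta>\<close> on the domain, then the weight, which must suppress the gradient
  of \<open>\<zeta>\<close> outside \<open>\<Omega>\<close>, then \<open>lm\<close>, then
  \<open>\<delta>\<close>, on whose scale the weight hardly changes, and last the space step
  \<open>s\<close>, small even relative to the kernel.\<close>

lemma near_projection:
 fixes \<Omega> :: "'a::euclidean_space set" and u w :: "'a => 'a" and C p q :: real
 assumes \<Omega>: "open \<Omega>" "bounded \<Omega>" "convex \<Omega>" "\<Omega> ~= {}"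
  and bell: "!!R \<epsilon>. 0 < R ==> 0 < \<epsilon> ==> \<exists>(B :: 'a \<times> 'a => real) G L. bellman B G L \<and>
   (\<forall>u w. norm u <= R --> norm w <= R --> B (u, w) <= C * (norm u powr p + norm w powr q) + \<epsilon>)"
  and pq: "0 < p" "0 < q" and C: "0 <= C" and u: "cc u" and w: "cc w"
  and u0: "!!x. x \<notin> \<Omega> ==> u x = 0" and w0: "!!x. x \<notin> \<Omega> ==> w x = 0" and e: "0 < e"
 shows "\<exists>\<eta> G. C1_gradient \<eta> G \<and>
  (\<forall>\<zeta> Z. C1_gradient \<zeta> Z & cc \<zeta> -->
   (LINT x:\<Omega>|lborel. (norm (G x - u x))^2) <= (LINT x:\<Omega>|lborel. (norm (Z x - u x))^2) + e) \<and>
  \<bar>LINT x:\<Omega>|lborel. G x \<bullet> w x\<bar> <= 112 * real DIM('a) * C * (LBINT x. norm (u x) powr p + norm (w x) powr q) + e"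
proof -
 let ?d = "real DIM('a)"
 let ?SI = "%f :: 'a => real. LINT x:\<Omega>|lborel. f x"
 have Ob: "\<Omega> \<in> sets borel" using \<Omega> by auto
 have SIint: "set_integrable lborel \<Omega> f" if "cont f" for f :: "'a => real"
  by (rule cont_set_integrable[OF that \<Omega>(2) Ob])
 have SI_mono: "?SI f <= ?SI g" if "cont f" "cont g" "!!x. x \<in> \<Omega> ==> f x <= g x" for f g
  by (rule set_integral_mono) (use SIint that in auto)
 have uc: "cont u" by (rule cc_cont[OF u])
 define D0 where "D0 = ?SI (%x. (norm (u x))^2)"
 have D0: "0 <= D0" unfolding D0_def by (rule set_int_nonneg) auto
 obtain Wm where Wm: "0 < Wm" "!!x. norm (w x) <= Wm" using cc_bounded[OF w] by blast
 define Iw where "Iw = (LBINT x. norm (w x))"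
 have Iw: "0 <= Iw" unfolding Iw_def by (rule integral_nonneg_AE) auto
 have nbf: "nb \<Omega> r \<in> lmeasurable" for r using nb_open nb_bounded[OF \<Omega>(2)] by (rule lmeasurable_open[rotated])
 define n1 where "n1 = measure lborel (nb \<Omega> 1)"
 define Q where "Q = n1 + 4 * (D0 + 6) + 2 * D0"
 have Q: "0 <= Q" using D0 by (simp add: Q_def n1_def)
 \<comment> \<open>One small parameter governs all errors; the denominator collects the coefficients
   with which \<open>t\<close> enters the two final estimates.\<close>
 define t where "t = min (1 / 4) (e / (7 * D0 + 42 + 2 * Q + Iw))"
 have den: "0 < 7 * D0 + 42 + 2 * Q + Iw" using D0 Q Iw by (simp add: add_nonneg_pos add_pos_nonneg)
 have t: "0 < t" "t <= 1 / 4" unfolding t_def using e den by (simp, intro min.cobounded1)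
 have te: "t * (7 * D0 + 42 + 2 * Q + Iw) <= e"
 proof -
  have "t <= e / (7 * D0 + 42 + 2 * Q + Iw)" by (simp add: t_def)
  then show ?thesis unfolding pos_le_divide_eq[OF den] .
 qed
 \<comment> \<open>Near minimality on the domain is measured against the infimum of this set, which
   \<open>\<zeta>\<close> below approaches within \<open>t\<close>.\<close>
 define S where "S = {?SI (%x. (norm (Z x - u x))^2) |\<zeta> Z. C1_gradient \<zeta> Z & cc \<zeta>}"
 define ds where "ds = Inf S"
 have Snn: "0 <= y" if "y \<in> S" for y using that by (auto simp: S_def intro!: set_int_nonneg)
 have bdd: "bdd_below S" using Snn by (auto simp: bdd_below_def)
 have "C1_gradient (%_ :: 'a. 0) (%_. 0)" by (simp add: C1_gradient_def GDERIV_const)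
 then have S0: "D0 \<in> S" unfolding S_def D0_def by (auto intro!: exI[of _ "%_. 0"] cc_zero)
 have dsD: "ds <= D0" unfolding ds_def by (rule cInf_lower[OF S0 bdd])
 have ds0: "0 <= ds" unfolding ds_def by (rule cInf_greatest) (use S0 Snn in auto)
 have dsle: "ds <= ?SI (%x. (norm (Z x - u x))^2)" if "C1_gradient \<zeta> Z" "cc \<zeta>" for \<zeta> Z
  unfolding ds_def by (rule cInf_lower[OF _ bdd]) (use that in \<open>auto simp: S_def\<close>)
 obtain \<zeta> Z where \<zeta>: "C1_gradient \<zeta> Z" "cc \<zeta>" "?SI (%x. (norm (Z x - u x))^2) <= ds + t"
 proof -
  have "Inf S < ds + t" using t by (simp add: ds_def)
  then obtain y where "y \<in> S" "y < ds + t" using cInf_lessD[of S "ds + t"] S0 by blast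
  then show ?thesis using that by (auto simp: S_def)
 qed
 have cZ: "cc Z" by (rule cc_C1_gradient[OF \<zeta>(1,2)])
 obtain Bz where Bz: "0 < Bz" "!!x. norm (Z x) <= Bz" using cc_bounded[OF cZ] by blast
 obtain Bu where Bu: "0 < Bu" "!!x. norm (u x) <= Bu" using cc_bounded[OF u] by blast
 obtain R1 where R1: "0 < R1" "!!x. R1 < norm x ==> \<zeta> x = 0" using ccE[OF \<zeta>(2)] by blast
 obtain R2 where R2: "0 < R2" "!!x. R2 < norm x ==> Z x = 0" using ccE[OF cZ] by blast
 obtain R3 where R3: "0 < R3" "!!x. R3 < norm x ==> u x = 0" using ccE[OF u] by blast
 define K where "K = cball (0::'a) R2"
 \<comment> \<open>Small against \<open>Bz^2\<close> because the weight is integrated against the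
   square of \<open>Z\<close> off the domain, and against \<open>Wm\<close> because
   \<open>w x\<close> is later compared with \<open>hsw F x\<close> times
   \<open>w x\<close>.\<close>
 define \<epsilon> where "\<epsilon> = t / (Bz^2 + Wm + 1)"
 have de: "0 < Bz^2 + Wm + 1" using Wm by (simp add: add_nonneg_pos)
 have \<epsilon>0: "0 < \<epsilon>" using t de by (simp add: \<epsilon>_def)
 have "\<epsilon> * (Bz^2 + Wm + 1) = t" using de by (simp add: \<epsilon>_def)
 moreover have "0 <= \<epsilon> * Bz^2" "0 <= \<epsilon> * Wm" using \<epsilon>0 Wm by auto
 ultimately have \<epsilon>: "\<epsilon> * Bz^2 <= t" "\<epsilon> * Wm <= t" "\<epsilon> <= t" using \<epsilon>0 by (auto simp: distrib_left)
 obtain F where F: "finite F" "!!x. x \<in> closure \<Omega> ==> 1 - \<epsilon> <= hsw F x" "(LINT x:(K - \<Omega>)|lebesgue. hsw F x) <= \<epsilon>"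
  using weight_exists[OF \<Omega>, of K \<epsilon>] \<epsilon>0 \<epsilon> t by (auto simp: K_def)
 obtain C1 where "wtH (hsw F) (Lf F) F fst (%f x. dsg (fst f \<bullet> x - snd f)) 1 C1" using wtH_hsw[OF F(1)] by blast
 then interpret wtH "hsw F" "Lf F" F fst "%f x. dsg (fst f \<bullet> x - snd f)" 1 C1 .
 let ?m = "hsw F" and ?L = "Lf F"
 have m1: "?m x <= 1" for x by (rule hsw_le_1[OF F(1)])
 \<comment> \<open>The weight is almost 1 on the domain, and its Lipschitz logarithm carries this to
   the neighbourhood of radius \<open>r\<close>.\<close>
 have mnb: "1 - t <= exp (?L * r) * ?m x" if x: "x \<in> nb \<Omega> r" for x r
 proof -
  obtain y where y: "y \<in> \<Omega>" "norm (y - x) < r" using x by (auto simp: nb_def dist_norm)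
  have "1 - t <= ?m (x + (y - x))" using F(2)[of y] y \<epsilon>(3) closure_subset by force
  also have "\<dots> <= exp (?L * norm (y - x)) * ?m x" by (rule m_shift)
  also have "\<dots> <= exp (?L * r) * ?m x" using y L0 m_pos[of x] by (intro mult_right_mono) (auto intro!: mult_left_mono)
  finally show ?thesis .
 qed
 have nbint: "(LINT x:nb \<Omega> r|lborel. f x) <= exp (?L * r) / (1 - t) * II f" if f: "cc f" "!!x. 0 <= f x" for f r
 proof -
  have "(LINT x:nb \<Omega> r|lborel. f x) <= (LBINT x. exp (?L * r) / (1 - t) * (f x * ?m x))"
   unfolding set_lebesgue_integral_def
  proof (rule integral_mono)
   show "integrable lborel (%x. indicator (nb \<Omega> r) x *\<^sub>R f x)"
    using cont_set_integrable[OF cc_cont[OF f(1)] nb_bounded[OF \<Omega>(2)], of r] nb_open by (simp add: set_integrable_def)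
   fix x
   show "indicator (nb \<Omega> r) x *\<^sub>R f x <= exp (?L * r) / (1 - t) * (f x * ?m x)"
   proof (cases "x \<in> nb \<Omega> r")
    case True
    have "f x * (1 - t) <= f x * (exp (?L * r) * ?m x)" by (intro mult_left_mono mnb True f)
    then show ?thesis using True t by (simp add: field_simps)
   qed (use f m_pos[of x] t in \<open>auto intro!: mult_nonneg_nonneg simp: less_imp_le\<close>)
  qed (intro integrable_mult_right II_integrable f)
  then show ?thesis by (simp add: II_def)
 qed
 define I0 where "I0 = ip \<zeta> \<zeta>"
 have I0: "0 <= I0" by (simp add: I0_def ip_self_nonneg)
 \<comment> \<open>This makes the regularising term of the functional at most \<open>t\<close> at
   the competitor \<open>\<zeta>\<close>.\<close>
 define lm where "lm = t / (I0 + 1)"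
 have lm: "0 < lm" "lm * I0 <= t" using t I0 by (auto simp: lm_def field_simps)
 obtain s1 where s1: "0 < s1" "s1 <= 1" "!!s. 0 < s ==> s <= s1 ==> (\<exists>\<phi>. cc \<phi> \<and>
  (\<forall>\<eta>. cc \<eta> --> JJ s lm u \<phi> <= JJ s lm u \<eta> + t) \<and>
  \<bar>\<Sum>i\<in>Basis. ip (Df s i \<phi>) (%x. w x \<bullet> i)\<bar> <= 112 * ?d * C * II (%x. norm (u x) powr p + norm (w x) powr q) + t)"
  using discrete_near_projection[OF bell pq C u w lm(1) t(1)] by blast
 define hx where "hx x = max 0 (min 1 (max R1 (max R2 R3) + 2 - norm x))" for x :: 'a
 have chx: "cc hx"
 proof (rule ccI[of _ "max R1 (max R2 R3) + 2"])
  show "cont hx" unfolding hx_def by (intro continuous_intros)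
 qed (auto simp: hx_def)
 have hx0: "0 <= hx x" for x by (simp add: hx_def)
 define e3 where "e3 = min 1 (t / (?d * ((2 * (Bz + Bu) + 1) * (II hx + 1))))"
 have II0: "0 <= II hx" by (rule II_nonneg) (rule hx0)
 have d1: "1 <= ?d" using DIM_positive[where 'a = 'a] by (simp add: Suc_leI)
 have den3: "0 < ?d * ((2 * (Bz + Bu) + 1) * (II hx + 1))" using d1 II0 Bz Bu by (intro mult_pos_pos) auto
 have e3: "0 < e3" "e3 <= 1" using den3 t by (auto simp: e3_def)
 have e3t: "?d * (e3 * (2 * (Bz + Bu) + 1) * II hx) <= t"
 proof -
  have "e3 <= t / (?d * ((2 * (Bz + Bu) + 1) * (II hx + 1)))" by (simp add: e3_def)
  then have "e3 * (?d * ((2 * (Bz + Bu) + 1) * (II hx + 1))) <= t" unfolding pos_le_divide_eq[OF den3] .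
  moreover have "0 <= e3 * (?d * (2 * (Bz + Bu) + 1))" using e3 d1 Bz Bu by auto
  ultimately show ?thesis by (simp add: algebra_simps)
 qed
 obtain s2 where s2: "0 < s2" "!!s i x. 0 < s ==> s <= s2 ==> norm i = 1 ==> \<bar>(\<zeta> (x + s *\<^sub>R i) - \<zeta> x) / s - Z x \<bullet> i\<bar> <= e3"
  using diff_quot_uniform[OF \<zeta>(1,2) e3(1)] by blast
 have IIZ: "II (%x. (norm (Z x - u x))^2) <= ds + 2 * t"
 proof -
  have i1: "integrable lborel (%x. indicator \<Omega> x *\<^sub>R (norm (Z x - u x))^2)"
   using SIint[OF cc_cont[OF cc_power2[OF cc_norm[OF cc_diff[OF cZ u]]]]] unfolding set_integrable_def .
  have KO: "K - \<Omega> \<in> sets borel" using \<Omega> by (auto simp: K_def)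
  have i2: "integrable lborel (%x. indicator (K - \<Omega>) x *\<^sub>R ?m x)"
   using cont_set_integrable[OF m_cont _ KO] bounded_subset[of K "K - \<Omega>"] unfolding set_integrable_def by (auto simp: K_def)
  have "II (%x. (norm (Z x - u x))^2) <= (LBINT x. indicator \<Omega> x *\<^sub>R (norm (Z x - u x))^2 + Bz^2 * (indicator (K - \<Omega>) x *\<^sub>R ?m x))"
   unfolding II_def
  proof (rule integral_mono)
   show "integrable lborel (%x. (norm (Z x - u x))^2 * ?m x)" by (intro II_integrable cc_power2 cc_norm cc_diff cZ u)
   fix x
   show "(norm (Z x - u x))^2 * ?m x <= indicator \<Omega> x *\<^sub>R (norm (Z x - u x))^2 + Bz^2 * (indicator (K - \<Omega>) x *\<^sub>R ?m x)"
   proof (cases "x \<in> \<Omega>")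
    case True
    then show ?thesis using m1[of x] mult_left_mono[of "?m x" 1 "(norm (Z x - u x))^2"] by simp
   next
    case False
    have "(norm (Z x))^2 <= Bz^2" using Bz(2)[of x] by (intro power_mono) auto
    then show ?thesis using False u0[OF False] R2(2)[of x] m_pos[of x]
     by (auto simp: K_def intro!: mult_right_mono split: split_indicator)
   qed
  qed (intro bintegrable_add integrable_mult_right i1 i2)
  also have "\<dots> = ?SI (%x. (norm (Z x - u x))^2) + Bz^2 * (LINT x:(K - \<Omega>)|lborel. ?m x)"
   unfolding set_lebesgue_integral_def using i1 i2 by simp
  also have "(LINT x:(K - \<Omega>)|lborel. ?m x) = (LINT x:(K - \<Omega>)|lebesgue. ?m x)"
   unfolding set_lebesgue_integral_def using i2 by (simp add: integral_completion)
  also have "?SI (%x. (norm (Z x - u x))^2) + Bz^2 * (LINT x:(K - \<Omega>)|lebesgue. ?m x) <= (ds + t) + Bz^2 * \<epsilon>"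
   by (intro add_mono \<zeta>(3) mult_left_mono F(3)) auto
  finally show ?thesis using \<epsilon>(1) by (simp add: mult.commute)
 qed
 \<comment> \<open>\<open>\<zeta>\<close> is also a competitor for the discrete functional, since
   its difference quotients are uniformly close to \<open>Z\<close>; \<open>hx\<close> confines the
   error to a bounded set.\<close>
 have JJz: "JJ s lm u \<zeta> <= ds + 4 * t" if s: "0 < s" "s <= s2" "s <= 1" for s
 proof -
  have "ip (%x. Df s i \<zeta> x - u x \<bullet> i) (%x. Df s i \<zeta> x - u x \<bullet> i) <= II (%x. ((Z x - u x) \<bullet> i)^2 + e3 * (2 * (Bz + Bu) + 1) * hx x)" (is "?l <= _")
   if i: "i \<in> Basis" for i
  proof -
   have cd: "cc (%x. Df s i \<zeta> x - u x \<bullet> i)" by (rule cc_diff[OF cc_Df[OF \<zeta>(2)] cc_component[OF u]])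
   have "?l = II (%x. (Df s i \<zeta> x - u x \<bullet> i)^2)" by (simp add: ip_self)
   also have "\<dots> <= II (%x. ((Z x - u x) \<bullet> i)^2 + e3 * (2 * (Bz + Bu) + 1) * hx x)"
   proof (intro II_mono cc_power2 cd cc_add cc_component cc_diff cZ u cc_cmult chx)
    fix x
    let ?a = "Df s i \<zeta> x - Z x \<bullet> i" and ?b = "(Z x - u x) \<bullet> i"
    have a: "\<bar>?a\<bar> <= e3" using s2(2)[OF s(1,2), of i x] i s(1) by (simp add: Df_def divide_inverse mult.commute)
    have b: "\<bar>?b\<bar> <= Bz + Bu"
     using Basis_le_norm[OF i, of "Z x - u x"] norm_triangle_ineq4[of "Z x" "u x"] Bz(2)[of x] Bu(2)[of x] by linarith
    show "(Df s i \<zeta> x - u x \<bullet> i)^2 <= ?b^2 + e3 * (2 * (Bz + Bu) + 1) * hx x"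
    proof (cases "norm x <= max R1 (max R2 R3) + 1")
     case True
     then have "hx x = 1" by (simp add: hx_def)
     have "(Df s i \<zeta> x - u x \<bullet> i)^2 = ?b^2 + (2 * (?a * ?b) + ?a * ?a)"
      by (simp add: inner_diff_left power2_eq_square algebra_simps)
     also have "2 * (?a * ?b) + ?a * ?a <= 2 * (e3 * (Bz + Bu)) + e3 * e3"
     proof (intro add_mono mult_left_mono)
      have "?a * ?b <= \<bar>?a\<bar> * \<bar>?b\<bar>" by (simp add: abs_mult[symmetric])
      also have "\<dots> <= e3 * (Bz + Bu)" using a b e3 by (intro mult_mono) auto
      finally show "?a * ?b <= e3 * (Bz + Bu)" .
      have "?a * ?a <= \<bar>?a\<bar> * \<bar>?a\<bar>" by simp
      also have "\<dots> <= e3 * e3" using a e3 by (intro mult_mono) auto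
      finally show "?a * ?a <= e3 * e3" .
     qed auto
     also have "\<dots> <= 2 * (e3 * (Bz + Bu)) + e3 * 1" using e3 by (intro add_left_mono mult_left_mono) auto
     finally show ?thesis using \<open>hx x = 1\<close> by (simp add: algebra_simps)
    next
     case False
     then have "R1 < norm x" "R2 < norm x" "R3 < norm x" by auto
     moreover have "R1 < norm (x + s *\<^sub>R i)"
      using False norm_triangle_ineq4[of "x + s *\<^sub>R i" "s *\<^sub>R i"] i s by simp
     ultimately have "Df s i \<zeta> x = 0" "u x = 0" using R1 R3 by (auto simp: Df_def)
     then show ?thesis using e3 Bz Bu hx0[of x] by simp
    qed
   qed
   finally show ?thesis .
  qed
  then have "JJ s lm u \<zeta> <= lm * I0 + (\<Sum>i\<in>Basis. II (%x. ((Z x - u x) \<bullet> i)^2 + e3 * (2 * (Bz + Bu) + 1) * hx x))"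
   unfolding JJ_def I0_def by (intro add_left_mono sum_mono) auto
  also have "(\<Sum>i\<in>Basis. II (%x. ((Z x - u x) \<bullet> i)^2 + e3 * (2 * (Bz + Bu) + 1) * hx x))
   = (\<Sum>i\<in>Basis. II (%x. ((Z x - u x) \<bullet> i)^2)) + ?d * (e3 * (2 * (Bz + Bu) + 1) * II hx)"
  proof -
   have "II (%x. ((Z x - u x) \<bullet> i)^2 + e3 * (2 * (Bz + Bu) + 1) * hx x) = II (%x. ((Z x - u x) \<bullet> i)^2) + e3 * (2 * (Bz + Bu) + 1) * II hx" for i
    unfolding II_cmult[symmetric] by (rule II_add[OF cc_power2[OF cc_component[OF cc_diff[OF cZ u]]] cc_cmult[OF chx]])
   then show ?thesis by (simp add: sum.distrib)
  qed
  also have "(\<Sum>i\<in>Basis. II (%x. ((Z x - u x) \<bullet> i)^2)) = II (%x. (norm (Z x - u x))^2)"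
   unfolding sum_Basis_sq[symmetric] by (rule II_sum[symmetric, OF cc_power2[OF cc_component[OF cc_diff[OF cZ u]]]])
  finally show ?thesis using lm(2) e3t IIZ by linarith
 qed
 \<comment> \<open>Within the distance \<open>\<delta>0\<close> the weight changes at most by the
   factor \<open>1 + t\<close>.\<close>
 define \<delta>0 where "\<delta>0 = ln (1 + t) / (?L + 1)"
 have \<delta>0: "0 < \<delta>0" using t L0 by (simp add: \<delta>0_def)
 define nO where "nO = measure lborel \<Omega>"
 have nO: "0 <= nO" by (simp add: nO_def)
 define e2 where "e2 = min t (t / (8 * (nO + 1)))"
 have e2: "0 < e2" "e2 <= t" using t nO by (auto simp: e2_def)
 have e2t: "(1 + 1 / t) * (2 * e2)^2 * nO <= t"
 proof -
  have "(1 + 1 / t) * (2 * e2)^2 * nO = (4 * (t + 1)) * nO * (e2 / t) * e2" using t by (simp add: power2_eq_square field_simps)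
  also have "\<dots> <= (4 * 2) * (nO + 1) * 1 * e2" using t e2 nO by (intro mult_mono mult_nonneg_nonneg) auto
  also have "\<dots> <= (4 * 2) * (nO + 1) * 1 * (t / (8 * (nO + 1)))" using nO by (intro mult_left_mono) (auto simp: e2_def)
  also have "\<dots> = t" using nO by simp
  finally show ?thesis .
 qed
 obtain \<delta>1 where \<delta>1: "0 < \<delta>1" "!!x y. norm (x - y) <= \<delta>1 ==> norm (u x - u y) <= e2"
  using cc_uniformly_continuous[OF u e2(1)] by blast
 obtain \<delta>2 where \<delta>2: "0 < \<delta>2" "!!x y. norm (x - y) <= \<delta>2 ==> norm (w x - w y) <= t"
  using cc_uniformly_continuous[OF w t(1)] by blast
 define \<delta> where "\<delta> = min (min 1 \<delta>0) (min \<delta>1 \<delta>2)"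
 have \<delta>: "0 < \<delta>" "\<delta> <= 1" "\<delta> <= \<delta>0" "\<delta> <= \<delta>1" "\<delta> <= \<delta>2" using \<delta>0 \<delta>1 \<delta>2 by (auto simp: \<delta>_def)
 have eL: "exp (?L * \<delta>) <= 1 + t"
 proof -
  have "?L * \<delta> <= (?L + 1) * \<delta>0" using \<delta> L0 by (intro mult_mono) auto
  also have "\<dots> = ln (1 + t)" using L0 by (simp add: \<delta>0_def)
  finally have "exp (?L * \<delta>) <= exp (ln (1 + t))" by simp
  then show ?thesis using t by simp
 qed
 have eLt: "exp (?L * \<delta>) / (1 - t) <= 1 + 3 * t"
 proof -
  have "1 + t <= (1 + 3 * t) * (1 - t)"
   using t mult_left_mono[of t "1/4" t] by (simp add: algebra_simps)
  then have "exp (?L * \<delta>) <= (1 + 3 * t) * (1 - t)" using eL by simp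
  then show ?thesis using t by (simp add: pos_divide_le_eq)
 qed
 obtain \<rho> :: "'a => real" and gr where \<rho>: "mollifier \<delta> \<rho> gr" using mollifier_exists[OF \<delta>(1)] by blast
 note r = mollifier_cc[OF \<rho>]
 have \<rho>C: "C1_gradient \<rho> gr" and \<rho>z: "!!x. \<delta> <= norm x ==> \<rho> x = 0 & gr x = 0" using \<rho> by (auto simp: mollifier_def)
 \<comment> \<open>An a priori bound for the integral of \<open>\<bar>\<phi>\<bar>\<close> over a
   neighbourhood of the domain, available before \<open>s\<close> and \<open>\<phi>\<close> are
   chosen: near minimality will bound \<open>lm * ip \<phi> \<phi>\<close> by
   \<open>D0 + 6\<close>.\<close>
 define K\<phi> where "K\<phi> = measure lborel (nb \<Omega> 2) + exp (?L * 2) / (1 - t) * ((D0 + 6) / lm)"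
 have K\<phi>: "0 <= K\<phi>" using D0 lm t by (auto simp: K\<phi>_def intro!: add_nonneg_nonneg mult_nonneg_nonneg divide_nonneg_nonneg)
 define e4 where "e4 = e2 / (?d * (K\<phi> + 1))"
 have e4: "0 < e4" "?d * (e4 * K\<phi>) <= e2"
 proof -
  show "0 < e4" using e2 d1 K\<phi> by (simp add: e4_def)
  have nz: "?d ~= 0" "K\<phi> + 1 ~= 0" using d1 K\<phi> by auto
  have "?d * (e4 * K\<phi>) = e2 * (K\<phi> / (K\<phi> + 1))" using nz by (simp add: e4_def divide_simps)
  also have "\<dots> <= e2 * 1" using e2 K\<phi> by (intro mult_left_mono) (auto simp: divide_simps)
  finally show "?d * (e4 * K\<phi>) <= e2" by simp
 qed
 obtain s3 where s3: "0 < s3" "!!s i x. 0 < s ==> s <= s3 ==> norm i = 1 ==> \<bar>(\<rho> (x + s *\<^sub>R i) - \<rho> x) / s - gr x \<bullet> i\<bar> <= e4"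
  using diff_quot_uniform[OF \<rho>C r(1) e4(1)] by blast
 define s where "s = min s1 (min s2 s3)"
 have s: "0 < s" "s <= s1" "s <= s2" "s <= s3" "s <= 1" using s1 s2 s3 by (auto simp: s_def)
 obtain \<phi> where \<phi>: "cc \<phi>" "!!\<eta>. cc \<eta> ==> JJ s lm u \<phi> <= JJ s lm u \<eta> + t"
  "\<bar>\<Sum>i\<in>Basis. ip (Df s i \<phi>) (%x. w x \<bullet> i)\<bar> <= 112 * ?d * C * II (%x. norm (u x) powr p + norm (w x) powr q) + t"
  using s1(3)[OF s(1,2)] by blast
 have J\<phi>: "JJ s lm u \<phi> <= ds + 5 * t" using \<phi>(2)[OF \<zeta>(2)] JJz[OF s(1,3,5)] by simp
 have J6: "ds + 5 * t <= D0 + 6" using dsD t by simp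
 define DV where "DV x = (\<Sum>i\<in>Basis. Df s i \<phi> x *\<^sub>R i)" for x
 have cDV: "cc DV" unfolding DV_def[abs_def] by (intro cc_sum cc_scaleR_right cc_Df \<phi>(1) continuous_on_const)
 have DVi: "DV x \<bullet> i = Df s i \<phi> x" if "i \<in> Basis" for x i using that by (simp add: DV_def)
 have sumip: "(\<Sum>i\<in>Basis. ip (%x. Df s i \<phi> x - u x \<bullet> i) (%x. Df s i \<phi> x - u x \<bullet> i)) = II (%x. (norm (DV x - u x))^2)"
 proof -
  have "(\<Sum>i\<in>Basis. ip (%x. Df s i \<phi> x - u x \<bullet> i) (%x. Df s i \<phi> x - u x \<bullet> i)) = (\<Sum>i\<in>Basis. II (%x. ((DV x - u x) \<bullet> i)^2))"
   by (intro sum.cong refl) (simp add: ip_self DVi inner_diff_left)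
  also have "\<dots> = II (%x. (norm (DV x - u x))^2)"
   unfolding sum_Basis_sq[symmetric] by (rule II_sum[symmetric, OF cc_power2[OF cc_component[OF cc_diff[OF cDV u]]]])
  finally show ?thesis .
 qed
 have DVu: "II (%x. (norm (DV x - u x))^2) <= ds + 5 * t"
  using J\<phi> lm ip_self_nonneg[of \<phi>] unfolding JJ_def sumip by (smt (verit) mult_nonneg_nonneg)
 have ip\<phi>: "ip \<phi> \<phi> <= (D0 + 6) / lm"
 proof -
  have "0 <= II (%x. (norm (DV x - u x))^2)" by (rule II_nonneg) auto
  then have "lm * ip \<phi> \<phi> <= D0 + 6" using J\<phi> J6 unfolding JJ_def sumip by linarith
  then show ?thesis using lm by (simp add: pos_le_divide_eq mult.commute)
 qed
 have nb\<delta>: "(LINT x:nb \<Omega> \<delta>|lborel. (norm (DV x - u x))^2) <= (1 + 3 * t) * (ds + 5 * t)"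
 proof -
  have "(LINT x:nb \<Omega> \<delta>|lborel. (norm (DV x - u x))^2) <= exp (?L * \<delta>) / (1 - t) * II (%x. (norm (DV x - u x))^2)"
   by (rule nbint) (auto intro!: cc_power2 cc_norm cc_diff cDV u)
  also have "\<dots> <= (1 + 3 * t) * (ds + 5 * t)" using eLt DVu t by (intro mult_mono II_nonneg) auto
  finally show ?thesis .
 qed
 define \<eta> where "\<eta> = conv \<rho> \<phi>"
 define G where "G x = (LBINT z. \<phi> z *\<^sub>R gr (x - z))" for x
 have GC: "C1_gradient \<eta> G" unfolding \<eta>_def G_def[abs_def] by (rule conv_C1[OF cc_integrable[OF \<phi>(1)] \<rho>])
 have Gc: "cont G" by (rule C1_gradient_cont[OF GC])
 have convDVc: "cont (conv \<rho> f)" if "cc f" for f :: "'a => 'a"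
  by (rule conv_cont[OF cc_integrable[OF that] \<rho>])
 \<comment> \<open>Both fields are integrals of \<open>\<phi>\<close>, one against the gradient of
   the kernel and, after moving the difference onto \<open>\<rho>\<close>, the other against a
   difference quotient of the kernel.\<close>
 have T3: "norm (G x - conv \<rho> DV x) <= e2" if x: "x \<in> \<Omega>" for x
 proof -
  have comp: "\<bar>(G x - conv \<rho> DV x) \<bullet> i\<bar> <= e4 * K\<phi>" if i: "i \<in> Basis" for i
  proof -
   have G1: "G x \<bullet> i = (LBINT z. \<phi> z * (gr (x - z) \<bullet> i))"
    unfolding G_def using integral_inner_left[OF conv_vec_integrable[OF cc_integrable[OF \<phi>(1)] r(2), of x], of i] by simp
   have c1: "cc (%z. \<rho> (x - z) * \<phi> (z + s *\<^sub>R i))"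
    by (intro cc_mult_left cc_cont[OF cc_reflect[OF r(1)]] cc_shift \<phi>(1))
   have c2: "cc (%z. \<rho> (x - z) * \<phi> z)" by (intro cc_mult_left cc_cont[OF cc_reflect[OF r(1)]] \<phi>(1))
   have c3: "cc (%z. \<rho> (x - z + s *\<^sub>R i) * \<phi> z)"
    by (intro cc_mult_left \<phi>(1) cc_cont_compose[OF r(1)] continuous_intros)
   have c4: "cc (%z. \<phi> z * (gr (x - z) \<bullet> i))"
    by (intro cc_mult_right \<phi>(1) cc_cont[OF cc_component[OF cc_reflect[OF r(2)]]])
   have "conv \<rho> DV x \<bullet> i = (LBINT z. \<rho> (x - z) * Df s i \<phi> z)"
    unfolding conv_def using integral_inner_left[OF conv_integrable[OF cc_integrable[OF cDV] r(1), of x], of i] DVi[OF i] by simp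
   also have "\<dots> = (LBINT z. inverse s * (\<rho> (x - z) * \<phi> (z + s *\<^sub>R i) - \<rho> (x - z) * \<phi> z))"
    by (intro bint_cong refl) (simp add: Df_def algebra_simps)
   also have "\<dots> = inverse s * ((LBINT z. \<rho> (x - z) * \<phi> (z + s *\<^sub>R i)) - (LBINT z. \<rho> (x - z) * \<phi> z))"
    using cc_integrable[OF c1] cc_integrable[OF c2] by simp
   also have "(LBINT z. \<rho> (x - z) * \<phi> (z + s *\<^sub>R i)) = (LBINT z. \<rho> (x - z + s *\<^sub>R i) * \<phi> z)"
    using lborel_integral_shift[of "%z. \<rho> (x - z + s *\<^sub>R i) * \<phi> z" "s *\<^sub>R i"] cc_cont[OF c3, of UNIV]
    by (simp add: borel_measurable_continuous_onI algebra_simps)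
   finally have G2: "conv \<rho> DV x \<bullet> i = (LBINT z. inverse s * (\<rho> (x - z + s *\<^sub>R i) * \<phi> z - \<rho> (x - z) * \<phi> z))"
    using cc_integrable[OF c3] cc_integrable[OF c2] by simp
   have "(G x - conv \<rho> DV x) \<bullet> i = (LBINT z. \<phi> z * (gr (x - z) \<bullet> i) - inverse s * (\<rho> (x - z + s *\<^sub>R i) * \<phi> z - \<rho> (x - z) * \<phi> z))"
    unfolding inner_diff_left G1 G2
    by (subst bint_diff[OF cc_integrable[OF c4] integrable_mult_right[OF bintegrable_diff[OF cc_integrable[OF c3] cc_integrable[OF c2]]]]) simp
   also have "norm \<dots> <= (LBINT z. e4 * (indicator (nb \<Omega> 2) z *\<^sub>R \<bar>\<phi> z\<bar>))"
   proof (rule bint_norm_bound)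
    show "integrable lborel (%z. \<phi> z * (gr (x - z) \<bullet> i) - inverse s * (\<rho> (x - z + s *\<^sub>R i) * \<phi> z - \<rho> (x - z) * \<phi> z))"
     by (intro bintegrable_diff integrable_mult_right cc_integrable c2 c3 c4)
    show "integrable lborel (%z. e4 * (indicator (nb \<Omega> 2) z *\<^sub>R \<bar>\<phi> z\<bar>))"
     using cont_set_integrable[OF cc_cont[OF cc_abs[OF \<phi>(1)]] nb_bounded[OF \<Omega>(2)], of 2] nb_open
     by (simp add: set_integrable_def)
    fix z
    have eq: "\<phi> z * (gr (x - z) \<bullet> i) - inverse s * (\<rho> (x - z + s *\<^sub>R i) * \<phi> z - \<rho> (x - z) * \<phi> z)
     = - (\<phi> z * ((\<rho> (x - z + s *\<^sub>R i) - \<rho> (x - z)) / s - gr (x - z) \<bullet> i))"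
     by (simp add: divide_inverse algebra_simps)
    show "norm (\<phi> z * (gr (x - z) \<bullet> i) - inverse s * (\<rho> (x - z + s *\<^sub>R i) * \<phi> z - \<rho> (x - z) * \<phi> z))
     <= e4 * (indicator (nb \<Omega> 2) z *\<^sub>R \<bar>\<phi> z\<bar>)"
    proof (cases "z \<in> nb \<Omega> 2")
     case True
     have "\<bar>\<phi> z\<bar> * \<bar>(\<rho> (x - z + s *\<^sub>R i) - \<rho> (x - z)) / s - gr (x - z) \<bullet> i\<bar> <= \<bar>\<phi> z\<bar> * e4"
      using i by (intro mult_left_mono s3(2) s) auto
     then show ?thesis unfolding eq using True by (simp add: abs_mult mult.commute)
    next
     case False
     then have "2 <= norm (x - z)" using x by (force simp: nb_def dist_norm)
     moreover have "norm (x - z) <= norm (x - z + s *\<^sub>R i) + s" using norm_triangle_ineq4[of "x - z + s *\<^sub>R i" "s *\<^sub>R i"] i s by simp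
     ultimately have "\<delta> <= norm (x - z)" "\<delta> <= norm (x - z + s *\<^sub>R i)" using \<delta> s by auto
     then show ?thesis using \<rho>z False by simp
    qed
   qed
   also have "\<dots> = e4 * (LINT z:nb \<Omega> 2|lborel. \<bar>\<phi> z\<bar>)" by (simp add: set_lebesgue_integral_def)
   also have "\<dots> <= e4 * K\<phi>"
   proof (intro mult_left_mono less_imp_le[OF e4(1)])
    have si: "set_integrable lborel (nb \<Omega> 2) f" if "cont f" for f :: "'a => real"
     using cont_set_integrable[OF that nb_bounded[OF \<Omega>(2)], of 2] nb_open by simp
    have "(LINT z:nb \<Omega> 2|lborel. \<bar>\<phi> z\<bar>) <= (LINT z:nb \<Omega> 2|lborel. 1 + (norm (\<phi> z))^2)"
    proof (rule set_integral_mono)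
     fix z
     have "0 <= (\<bar>\<phi> z\<bar> - 1)^2" by simp
     then show "\<bar>\<phi> z\<bar> <= 1 + (norm (\<phi> z))^2" by (simp add: power2_diff)
    qed (intro si continuous_intros cc_cont \<phi>(1))+
    also have "\<dots> = (LINT z:nb \<Omega> 2|lborel. 1) + (LINT z:nb \<Omega> 2|lborel. (norm (\<phi> z))^2)"
     by (intro set_integral_add(2) si continuous_intros cc_cont \<phi>(1))
    also have "(LINT z:nb \<Omega> 2|lborel. 1) = measure lborel (nb \<Omega> 2)"
     by (simp add: set_lebesgue_integral_def nb_open)
    also have "(LINT z:nb \<Omega> 2|lborel. (norm (\<phi> z))^2) <= exp (?L * 2) / (1 - t) * II (%z. (norm (\<phi> z))^2)"
     by (rule nbint) (auto intro!: cc_power2 cc_abs \<phi>(1))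
    also have "II (%z. (norm (\<phi> z))^2) = ip \<phi> \<phi>" by (simp add: ip_self)
    also have "exp (?L * 2) / (1 - t) * ip \<phi> \<phi> <= exp (?L * 2) / (1 - t) * ((D0 + 6) / lm)"
     using t by (intro mult_left_mono ip\<phi>) auto
    finally show "(LINT z:nb \<Omega> 2|lborel. \<bar>\<phi> z\<bar>) <= K\<phi>" by (simp add: K\<phi>_def)
   qed
   finally show ?thesis by simp
  qed
  have "norm (G x - conv \<rho> DV x) <= (\<Sum>i\<in>Basis. \<bar>(G x - conv \<rho> DV x) \<bullet> i\<bar>)" by (rule norm_le_l1)
  also have "\<dots> <= (\<Sum>i\<in>(Basis :: 'a set). e4 * K\<phi>)" by (intro sum_mono comp)
  also have "\<dots> <= e2" using e4(2) by simp
  finally show ?thesis .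
 qed
 define v where "v = (%x. DV x - u x)"
 have cv: "cc v" unfolding v_def by (intro cc_diff cDV u)
 have convv: "conv \<rho> v x = conv \<rho> DV x - conv \<rho> u x" for x
  unfolding conv_def v_def scaleR_diff_right
  by (intro bint_diff conv_integrable cc_integrable cDV u r)
 \<comment> \<open>On \<open>\<Omega>\<close> the mollification only sees the neighbourhood of
   radius \<open>\<delta>\<close>; truncating there makes the contraction property of the
   convolution in L2 applicable.\<close>
 have T1: "?SI (%x. (norm (conv \<rho> v x))^2) <= (1 + 3 * t) * (ds + 5 * t)"
 proof -
  define f where "f x = indicator (nb \<Omega> \<delta>) x *\<^sub>R v x" for x
  have nbb: "nb \<Omega> \<delta> \<in> sets borel" using nb_open by auto
  have fi: "integrable lborel f"
   using cont_set_integrable[OF cc_cont[OF cv] nb_bounded[OF \<Omega>(2)] nbb] by (simp add: f_def[abs_def] set_integrable_def)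
  have f2: "norm (f x) powr 2 = indicator (nb \<Omega> \<delta>) x *\<^sub>R (norm (v x))^2" for x
   by (simp add: f_def indicator_def)
  have fi2: "integrable lborel (%x. norm (f x) powr 2)"
   unfolding f2 using cont_set_integrable[OF cc_cont[OF cc_power2[OF cc_norm[OF cv]]] nb_bounded[OF \<Omega>(2)] nbb]
   by (simp add: set_integrable_def)
  have cf: "conv \<rho> v x = conv \<rho> f x" if "x \<in> \<Omega>" for x
   by (rule conv_cong[of \<delta>]) (use that \<rho>z in \<open>auto simp: f_def nb_def dist_norm indicator_def norm_minus_commute\<close>)
  have "?SI (%x. (norm (conv \<rho> v x))^2) <= (LBINT x. norm (conv \<rho> f x) powr 2)"
   unfolding set_lebesgue_integral_def
  proof (rule integral_mono)
   show "integrable lborel (%x. indicator \<Omega> x *\<^sub>R (norm (conv \<rho> v x))^2)"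
    using SIint[OF continuous_on_power[OF continuous_on_norm[OF convDVc[OF cv]]]] unfolding set_integrable_def .
   show "indicator \<Omega> x *\<^sub>R (norm (conv \<rho> v x))^2 <= norm (conv \<rho> f x) powr 2" for x
    using cf[of x] by (auto simp: indicator_def)
  qed (rule conv_Lr(1)[OF \<rho> fi fi2], simp)
  also have "\<dots> <= (LBINT x. norm (f x) powr 2)" by (rule conv_Lr(2)[OF \<rho> fi fi2]) simp
  also have "\<dots> = (LINT x:nb \<Omega> \<delta>|lborel. (norm (DV x - u x))^2)" unfolding f2 by (simp add: set_lebesgue_integral_def v_def)
  finally show ?thesis using nb\<delta> by simp
 qed
 \<comment> \<open>The error splits into the mollified discrete error, the commutation error
   \<open>T3\<close>, and the oscillation of \<open>u\<close> at scale
   \<open>\<delta>\<close>.\<close>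
 have A: "?SI (%x. (norm (G x - u x))^2) <= ds + t * (7 * D0 + 41)"
 proof -
  have "?SI (%x. (norm (G x - u x))^2) <= ?SI (%x. (1 + t) * (norm (conv \<rho> v x))^2 + (1 + 1 / t) * (2 * e2)^2)"
  proof (rule SI_mono)
   show "cont (%x. (norm (G x - u x))^2)" by (intro continuous_intros Gc uc)
   show "cont (%x. (1 + t) * (norm (conv \<rho> v x))^2 + (1 + 1 / t) * (2 * e2)^2)"
    by (intro continuous_on_add continuous_on_mult continuous_on_const continuous_on_power continuous_on_norm convDVc cv)
   fix x assume x: "x \<in> \<Omega>"
   have T2: "norm (conv \<rho> u x - u x) <= e2"
    by (rule conv_close[OF \<rho> cc_integrable[OF u]]) (use \<delta> \<delta>1 in auto)
   have "G x - u x = (G x - conv \<rho> DV x) + conv \<rho> v x + (conv \<rho> u x - u x)" by (simp add: convv)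
   then have "norm (G x - u x) = norm ((G x - conv \<rho> DV x) + conv \<rho> v x + (conv \<rho> u x - u x))" by (rule arg_cong)
   then have n: "norm (G x - u x) <= norm (conv \<rho> v x) + 2 * e2"
    using norm_triangle_ineq[of "(G x - conv \<rho> DV x) + conv \<rho> v x" "conv \<rho> u x - u x"]
     norm_triangle_ineq[of "G x - conv \<rho> DV x" "conv \<rho> v x"] T3[OF x] T2 by linarith
   let ?a = "norm (conv \<rho> v x)" and ?b = "2 * e2"
   have "2 * (?a * ?b) <= t * ?a^2 + ?b^2 / t"
    using sum_squares_bound[of "sqrt t * ?a" "?b / sqrt t"] t by (simp add: power_divide power_mult_distrib)
   moreover have "(norm (G x - u x))^2 <= (?a + ?b)^2" using n by (intro power_mono) auto
   ultimately show "(norm (G x - u x))^2 <= (1 + t) * ?a^2 + (1 + 1 / t) * ?b^2"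
    by (simp add: power2_sum distrib_right)
  qed
  also have "\<dots> = (1 + t) * ?SI (%x. (norm (conv \<rho> v x))^2) + (1 + 1 / t) * (2 * e2)^2 * nO"
  proof -
   have "?SI (%x. (1 + t) * (norm (conv \<rho> v x))^2 + (1 + 1 / t) * (2 * e2)^2)
    = ?SI (%x. (1 + t) * (norm (conv \<rho> v x))^2) + ?SI (%x. (1 + 1 / t) * (2 * e2)^2)"
    by (intro set_integral_add(2) SIint continuous_on_mult continuous_on_const continuous_on_power continuous_on_norm convDVc cv)
   moreover have "?SI (%x. (1 + 1 / t) * (2 * e2)^2) = (1 + 1 / t) * (2 * e2)^2 * nO"
    using Ob by (simp add: set_lebesgue_integral_def nO_def)
   ultimately show ?thesis by simp
  qed
  also have "\<dots> <= (1 + t) * ((1 + 3 * t) * (ds + 5 * t)) + t"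
   using T1 e2t t by (intro add_mono mult_left_mono) auto
  also have "\<dots> <= (1 + 7 * t) * (ds + 5 * t) + t"
  proof -
   have "(1 + t) * (1 + 3 * t) <= 1 + 7 * t" using t mult_left_mono[of t "1/4" t] by (simp add: algebra_simps)
   then have "(1 + t) * (1 + 3 * t) * (ds + 5 * t) <= (1 + 7 * t) * (ds + 5 * t)" using ds0 t by (intro mult_right_mono) auto
   then show ?thesis by (simp add: mult.assoc)
  qed
  also have "\<dots> = ds + t * (7 * ds + 6 + 35 * t)" by (simp add: algebra_simps)
  also have "\<dots> <= ds + t * (7 * D0 + 41)" using t dsD by (intro add_left_mono mult_left_mono) auto
  finally show ?thesis .
 qed
 \<comment> \<open>The mollifier is moved onto \<open>w\<close> by symmetry, and then
   \<open>conv \<rho> w\<close> is replaced by the weighted field, so that the discrete bilinear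
   bound applies.\<close>
 have B: "\<bar>?SI (%x. G x \<bullet> w x)\<bar> <= 112 * ?d * C * (LBINT x. norm (u x) powr p + norm (w x) powr q) + t * (1 + 2 * Q + Iw)"
 proof -
  have cGw: "cc (%x. G x \<bullet> w x)" by (rule cc_inner_right[OF Gc w])
  have cDw: "cc (%x. conv \<rho> DV x \<bullet> w x)" by (rule cc_inner_right[OF convDVc[OF cDV] w])
  have "?SI (%x. G x \<bullet> w x) = (LBINT x. G x \<bullet> w x)"
   unfolding set_lebesgue_integral_def by (intro bint_cong refl) (use w0 in \<open>auto simp: indicator_def\<close>)
  moreover have "\<bar>(LBINT x. G x \<bullet> w x) - (LBINT x. conv \<rho> DV x \<bullet> w x)\<bar> <= t * Iw"
  proof -
   have "(LBINT x. G x \<bullet> w x) - (LBINT x. conv \<rho> DV x \<bullet> w x) = (LBINT x. G x \<bullet> w x - conv \<rho> DV x \<bullet> w x)"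
    by (rule bint_diff[symmetric]) (intro cc_integrable cGw cDw)+
   also have "norm \<dots> <= (LBINT x. t * norm (w x))"
   proof (rule bint_norm_bound)
    fix x
    show "norm (G x \<bullet> w x - conv \<rho> DV x \<bullet> w x) <= t * norm (w x)"
    proof (cases "x \<in> \<Omega>")
     case True
     have "\<bar>(G x - conv \<rho> DV x) \<bullet> w x\<bar> <= norm (G x - conv \<rho> DV x) * norm (w x)" by (rule Cauchy_Schwarz_ineq2)
     also have "\<dots> <= t * norm (w x)" using T3[OF True] e2(2) by (intro mult_right_mono) auto
     finally show ?thesis by (simp add: inner_diff_left)
    qed (use w0 in auto)
   qed (intro bintegrable_diff integrable_mult_right cc_integrable cGw cDw cc_norm w)+
   finally show ?thesis by (simp add: Iw_def)
  qed
  moreover have "(LBINT x. conv \<rho> DV x \<bullet> w x) = (LBINT x. DV x \<bullet> conv \<rho> w x)" by (rule conv_adjoint[OF \<rho> cDV w])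
  moreover have "\<bar>(LBINT x. DV x \<bullet> conv \<rho> w x) - II (%x. DV x \<bullet> w x)\<bar> <= 2 * t * Q"
  proof -
   have ci1: "cc (%x. DV x \<bullet> conv \<rho> w x)" by (rule cc_inner_left[OF cDV convDVc[OF w]])
   have ci2: "cc (%x. (DV x \<bullet> w x) * ?m x)" by (rule cc_mult_right[OF ip_cc[OF cDV w] m_cont])
   have nbb: "nb \<Omega> \<delta> \<in> sets borel" using nb_open by auto
   have si: "set_integrable lborel (nb \<Omega> \<delta>) f" if "cont f" for f :: "'a => real"
    by (rule cont_set_integrable[OF that nb_bounded[OF \<Omega>(2)] nbb])
   have "(LBINT x. DV x \<bullet> conv \<rho> w x) - II (%x. DV x \<bullet> w x) = (LBINT x. DV x \<bullet> conv \<rho> w x - (DV x \<bullet> w x) * ?m x)"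
    unfolding II_def by (rule bint_diff[symmetric]) (intro cc_integrable ci1 ci2)+
   also have "norm \<dots> <= (LBINT x. 2 * t * (indicator (nb \<Omega> \<delta>) x *\<^sub>R norm (DV x)))"
   proof (rule bint_norm_bound)
    show "integrable lborel (%x. 2 * t * (indicator (nb \<Omega> \<delta>) x *\<^sub>R norm (DV x)))"
     using si[OF cc_cont[OF cc_norm[OF cDV]]] unfolding set_integrable_def by (rule integrable_mult_right)
    fix x
    have eq: "DV x \<bullet> conv \<rho> w x - (DV x \<bullet> w x) * ?m x = DV x \<bullet> (conv \<rho> w x - ?m x *\<^sub>R w x)"
     by (simp add: inner_diff_right mult.commute)
    show "norm (DV x \<bullet> conv \<rho> w x - (DV x \<bullet> w x) * ?m x) <= 2 * t * (indicator (nb \<Omega> \<delta>) x *\<^sub>R norm (DV x))"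
    proof (cases "x \<in> nb \<Omega> \<delta>")
     case True
     have c: "norm (conv \<rho> w x - w x) <= t"
      by (rule conv_close[OF \<rho> cc_integrable[OF w]]) (use \<delta> \<delta>2 in auto)
     have "norm ((1 - ?m x) *\<^sub>R w x) <= t"
     proof (cases "x \<in> \<Omega>")
      case xO: True
      have "1 - ?m x <= \<epsilon>" using F(2)[of x] xO closure_subset by force
      then have "(1 - ?m x) * norm (w x) <= \<epsilon> * Wm" using Wm(2)[of x] m1[of x] \<epsilon>0 by (intro mult_mono) auto
      then show ?thesis using \<epsilon>(2) m1[of x] by simp
     qed (use w0 t in auto)
     moreover have "norm (conv \<rho> w x - ?m x *\<^sub>R w x) = norm ((conv \<rho> w x - w x) + (1 - ?m x) *\<^sub>R w x)" by (simp add: algebra_simps)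
     ultimately have "norm (conv \<rho> w x - ?m x *\<^sub>R w x) <= 2 * t" using c norm_triangle_ineq[of "conv \<rho> w x - w x" "(1 - ?m x) *\<^sub>R w x"] by linarith
     then have "norm (DV x) * norm (conv \<rho> w x - ?m x *\<^sub>R w x) <= norm (DV x) * (2 * t)" by (intro mult_left_mono) auto
     then show ?thesis unfolding eq using True Cauchy_Schwarz_ineq2[of "DV x" "conv \<rho> w x - ?m x *\<^sub>R w x"] by (simp add: mult.commute)
    next
     case False
     have "conv \<rho> w x = 0"
     proof (rule conv_zero_outside[of \<delta>])
      fix z assume "norm (z - x) < \<delta>"
      then have "z \<notin> \<Omega>" using False by (auto simp: nb_def dist_norm)
      then show "w z = 0" by (rule w0)
     qed (use \<rho>z in auto)
     moreover have "x \<notin> \<Omega>" using False \<delta>(1) by (auto simp: nb_def)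
     ultimately show ?thesis using w0 t by simp
    qed
   qed (intro bintegrable_diff cc_integrable ci1 ci2)
   also have "\<dots> = 2 * t * (LINT x:nb \<Omega> \<delta>|lborel. norm (DV x))" by (simp add: set_lebesgue_integral_def)
   also have "\<dots> <= 2 * t * Q"
   proof (intro mult_left_mono)
    have nbself: "x \<in> nb \<Omega> \<delta>" if "x \<in> \<Omega>" for x
     using that \<delta>(1) by (auto simp: nb_def intro!: bexI[of _ x])
    have "(LINT x:nb \<Omega> \<delta>|lborel. norm (DV x)) <= (LINT x:nb \<Omega> \<delta>|lborel. 1 + (2 * (norm (DV x - u x))^2 + 2 * (norm (u x))^2))"
    proof (rule set_integral_mono)
     fix x
     have "0 <= (norm (DV x) - 1)^2" "0 <= (norm (DV x - u x) - norm (u x))^2" "0 <= (norm (DV x))^2" by simp_all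
     moreover have "(norm (DV x))^2 <= (norm (DV x - u x) + norm (u x))^2"
      using norm_triangle_ineq[of "DV x - u x" "u x"] by (intro power_mono) auto
     ultimately show "norm (DV x) <= 1 + (2 * (norm (DV x - u x))^2 + 2 * (norm (u x))^2)"
      unfolding power2_diff power2_sum one_power2 mult_1_right by linarith
    qed (intro si continuous_intros cc_cont cDV u)+
    also have "\<dots> = (LINT x:nb \<Omega> \<delta>|lborel. 1) + (2 * (LINT x:nb \<Omega> \<delta>|lborel. (norm (DV x - u x))^2) + 2 * (LINT x:nb \<Omega> \<delta>|lborel. (norm (u x))^2))"
     by (subst set_integral_add(2), intro si continuous_intros, intro si continuous_intros cc_cont cDV u,
       subst set_integral_add(2), intro si continuous_intros cc_cont cDV u, intro si continuous_intros cc_cont u) simp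
    also have "(LINT x:nb \<Omega> \<delta>|lborel. 1) <= n1"
     unfolding n1_def using nbb nb_mono[OF \<delta>(2), of \<Omega>] nbf[of 1] nb_open
     by (simp add: set_lebesgue_integral_def) (intro measure_mono_fmeasurable, auto simp: fmeasurable_def)
    also have "(LINT x:nb \<Omega> \<delta>|lborel. (norm (u x))^2) = D0"
     unfolding D0_def set_lebesgue_integral_def
     using nbself u0 by (intro bint_cong refl) (fastforce simp: indicator_def)
    also have "(LINT x:nb \<Omega> \<delta>|lborel. (norm (DV x - u x))^2) <= 2 * (D0 + 6)"
     by (rule order_trans[OF nb\<delta>]) (use t J6 ds0 D0 in \<open>intro mult_mono, auto\<close>)
    finally show "(LINT x:nb \<Omega> \<delta>|lborel. norm (DV x)) <= Q" by (simp add: Q_def)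
   qed (use t in auto)
   finally show ?thesis by simp
  qed
  moreover have "\<bar>II (%x. DV x \<bullet> w x)\<bar> <= 112 * ?d * C * (LBINT x. norm (u x) powr p + norm (w x) powr q) + t"
  proof -
   have "II (%x. DV x \<bullet> w x) = II (%x. \<Sum>i\<in>Basis. Df s i \<phi> x * (w x \<bullet> i))"
    by (simp add: DV_def inner_sum_left inner_commute[of "w _"])
   also have "\<dots> = (\<Sum>i\<in>Basis. ip (Df s i \<phi>) (%x. w x \<bullet> i))"
    unfolding ip_def inner_real_def by (rule II_sum) (intro cc_mult_right cc_Df \<phi>(1) cc_cont[OF cc_component[OF w]])
   finally have "\<bar>II (%x. DV x \<bullet> w x)\<bar> <= 112 * ?d * C * II (%x. norm (u x) powr p + norm (w x) powr q) + t" using \<phi>(3) by simp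
   also have "II (%x. norm (u x) powr p + norm (w x) powr q) <= (LBINT x. norm (u x) powr p + norm (w x) powr q)"
   proof -
    have cpw: "cc (%x. norm (u x) powr p + norm (w x) powr q)"
     by (rule cc_add, rule cc_compose[OF u, where g = "%y. norm y powr p"], use pq in \<open>auto intro!: continuous_on_powr' continuous_on_norm_id continuous_on_const\<close>,
       rule cc_compose[OF w, where g = "%y. norm y powr q"], use pq in \<open>auto intro!: continuous_on_powr' continuous_on_norm_id continuous_on_const\<close>)
    show ?thesis
     unfolding II_def
    proof (intro integral_mono II_integrable cc_integrable cpw)
     show "(norm (u x) powr p + norm (w x) powr q) * ?m x <= norm (u x) powr p + norm (w x) powr q" for x
      using mult_left_mono[OF m1[of x], of "norm (u x) powr p + norm (w x) powr q"] by simp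
    qed
   qed
   finally show ?thesis using C by (simp add: mult_left_mono)
  qed
  ultimately show ?thesis by (simp add: algebra_simps) 
 qed
 have te1: "t * (7 * D0 + 41) <= e" "t * (1 + 2 * Q + Iw) <= e"
  by (rule order_trans[OF mult_left_mono te]; use t D0 Q Iw in simp)+
 show ?thesis
  by (intro exI[of _ \<eta>] exI[of _ G] conjI allI impI GC) (use A B te1 dsle in force)+
qed

section \<open>Lebesgue spaces on a convex domain\<close>

lemma powr_norm_add:
 fixes a b :: "'a::real_normed_vector"
 assumes "0 <= p"
 shows "norm (a + b) powr p <= 2 powr p * (norm a powr p + norm b powr p)"
proof -
 have "norm (a + b) powr p <= (2 * max (norm a) (norm b)) powr p"
  using norm_triangle_ineq[of a b] assms by (intro powr_mono2) auto
 also have "\<dots> = 2 powr p * max (norm a) (norm b) powr p" by (simp add: powr_mult)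
 also have "\<dots> <= 2 powr p * (norm a powr p + norm b powr p)"
  by (intro mult_left_mono) (auto simp: max_def)
 finally show ?thesis .
qed

lemma powr_norm_diff:
 fixes a b :: "'a::real_normed_vector"
 assumes "0 <= p"
 shows "norm (a - b) powr p <= 2 powr p * (norm a powr p + norm b powr p)"
 using powr_norm_add[OF assms, of a "- b"] by simp

text \<open>Young's inequality with a free parameter \<open>s\<close>, which can make either term
  small; the factors \<open>1 / p\<close> and \<open>1 / q\<close> are discarded.\<close>

lemma young_scaled:
 fixes a b s p q :: real
 assumes p: "1 < p" "q = p / (p - 1)" and s: "0 < s" and ab: "0 <= a" "0 <= b"
 shows "a * b <= (1 / s) powr p * a powr p + s powr q * b powr q"
proof -
 have q: "1 < q" "1 / p + 1 / q = 1" unfolding p(2) using p(1) by (simp_all add: less_divide_eq diff_divide_distrib)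
 have "a * b = ((1 / s) * a) * (s * b)" using s by simp
 also have "\<dots> <= ((1 / s) * a) powr p / p + (s * b) powr q / q"
  by (rule Youngs_inequality) (use p q s ab in auto)
 also have "\<dots> <= ((1 / s) * a) powr p / 1 + (s * b) powr q / 1"
  using p q by (intro add_mono divide_left_mono) auto
 also have "\<dots> = (1 / s) powr p * a powr p + s powr q * b powr q" using s ab powr_mult[of "1 / s" a p] powr_mult[of s b q] by simp
 finally show ?thesis .
qed

lemma LIMSEQ_zero_less:
 fixes a :: "nat => real"
 assumes "a \<longlonglongrightarrow> 0" "0 < e" shows "\<exists>n. a n < e"
 using order_tendstoD(2)[OF assms] by (auto simp: eventually_sequentially)

text \<open>No root is taken: the weak triangle inequality with factor \<open>2\<^sup>p\<close> suffices throughout.\<close>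

definition NP :: "real => ('a::euclidean_space => 'b::euclidean_space) => real" where
 "NP p f = (LBINT x. norm (f x) powr p)"

lemma NP_nonneg: "0 <= NP p f"
 by (simp add: NP_def)

lemma fatou_bound:
 fixes h :: "nat => 'a => real"
 assumes h: "!!k. integrable M (h k)" "!!k x. 0 <= h k x" and f[measurable]: "f \<in> borel_measurable M" and f0: "!!x. 0 <= f x"
  and lim: "AE x in M. (%k. h k x) \<longlonglongrightarrow> f x" and le: "!!k. K <= k ==> (\<integral>x. h k x \<partial>M) <= c"
 shows "integrable M f" "(\<integral>x. f x \<partial>M) <= c"
proof -
 note [measurable] = borel_measurable_integrable[OF h(1)]
 have "0 <= (\<integral>x. h K x \<partial>M)" by (rule integral_nonneg_AE) (simp add: h(2))
 then have c: "0 <= c" using le[of K] by linarith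
 have "(\<integral>\<^sup>+x. ennreal (f x) \<partial>M) = (\<integral>\<^sup>+x. liminf (%k. ennreal (h k x)) \<partial>M)"
 proof (rule nn_integral_cong_AE)
  show "AE x in M. ennreal (f x) = liminf (%k. ennreal (h k x))"
   using lim
  proof eventually_elim
   case (elim x)
   then have "(%k. ennreal (h k x)) \<longlonglongrightarrow> ennreal (f x)" by (rule tendsto_ennrealI)
   then show ?case by (metis lim_imp_Liminf sequentially_bot)
  qed
 qed
 also have "\<dots> <= liminf (%k. \<integral>\<^sup>+x. ennreal (h k x) \<partial>M)"
  by (rule nn_integral_liminf) simp
 also have "\<dots> <= liminf (%k. ennreal c)"
 proof (rule Liminf_mono)
  show "\<forall>\<^sub>F k in sequentially. (\<integral>\<^sup>+x. ennreal (h k x) \<partial>M) <= ennreal c"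
   using eventually_ge_at_top[of K]
   by eventually_elim (simp add: nn_integral_eq_integral[OF h(1)] h(2) le ennreal_leI)
 qed
 also have "\<dots> = ennreal c" by (simp add: lim_imp_Liminf)
 finally have nn: "(\<integral>\<^sup>+x. ennreal (f x) \<partial>M) <= ennreal c" .
 then show int: "integrable M f"
  by (intro integrableI_nonneg) (use f0 in \<open>auto simp: top_unique less_top[symmetric]\<close>)
 show "(\<integral>x. f x \<partial>M) <= c"
  using nn c by (simp add: nn_integral_eq_integral[OF int] f0)
qed

locale dom =
 fixes \<Omega> :: "'a::euclidean_space set"
 assumes op: "open \<Omega>" and bd: "bounded \<Omega>" and cv: "convex \<Omega>" and ne: "\<Omega> ~= {}"
begin

abbreviation ch :: "'a => 'c::zero_neq_one" where "ch x \<equiv> indicator \<Omega> x"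

lemma Ob [simp, measurable]: "\<Omega> \<in> sets borel" using op by simp

text \<open>Borel functions vanishing outside \<open>\<Omega>\<close>: integrals over
  \<open>\<Omega>\<close> become integrals with respect to \<open>lborel\<close> over the whole
  space, where Fubini's theorem and convolution are at hand. The link with \<open>Lp\<close> is made
  later by \<open>rp\<close>.\<close>

definition lp :: "real => ('a => 'b::euclidean_space) => bool" where
 "lp p f \<longleftrightarrow> f \<in> borel_measurable borel & (\<forall>x. x \<notin> \<Omega> --> f x = 0) & integrable lborel (%x. norm (f x) powr p)"

lemma lpD:
 assumes "lp p f"
 shows "f \<in> borel_measurable borel" "x \<notin> \<Omega> ==> f x = 0" "integrable lborel (%x. norm (f x) powr p)"
 using assms by (auto simp: lp_def)

lemma lpI:
 fixes f :: "'a => 'b::euclidean_space"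
 assumes "f \<in> borel_measurable borel" "!!x. x \<notin> \<Omega> ==> f x = 0" "integrable lborel g" "!!x. norm (f x) powr p <= g x"
 shows "lp p f"
 unfolding lp_def
proof (intro conjI allI impI assms(1,2))
 have [measurable]: "f \<in> borel_measurable lborel" using assms(1) by simp
 have m: "(%x. norm (f x) powr p) \<in> borel_measurable lborel" by measurable
 show "integrable lborel (%x. norm (f x) powr p)"
  by (rule bintegrable_bound[OF assms(3) m], rule AE_I2) (use assms(4) abs_ge_self order_trans in \<open>fastforce\<close>)
qed

lemma ind_integrable: "integrable lborel (indicator \<Omega> :: 'a => real)"
 using emeasure_bounded_finite[OF bd] by (auto simp: integrable_indicator_iff)

lemma lp_zero: "0 < p ==> lp p (%x. 0)"
 by (simp add: lp_def)

lemma lp_add: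
 assumes "lp p f" "lp p g" "0 <= p"
 shows "lp p (%x. f x + g x)" "NP p (%x. f x + g x) <= 2 powr p * (NP p f + NP p g)"
proof -
 note f = lpD[OF assms(1)] and g = lpD[OF assms(2)]
 have i: "integrable lborel (%x. 2 powr p * (norm (f x) powr p + norm (g x) powr p))"
  using f(3) g(3) by auto
 show l: "lp p (%x. f x + g x)"
  by (rule lpI[OF _ _ i]) (use f g powr_norm_add[OF assms(3)] in auto)
 have "NP p (%x. f x + g x) <= (LBINT x. 2 powr p * (norm (f x) powr p + norm (g x) powr p))"
  unfolding NP_def by (rule integral_mono[OF lpD(3)[OF l] i]) (rule powr_norm_add[OF assms(3)])
 also have "\<dots> = 2 powr p * (NP p f + NP p g)" using f(3) g(3) by (simp add: NP_def)
 finally show "NP p (%x. f x + g x) <= 2 powr p * (NP p f + NP p g)" .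
qed

lemma NP_minus: "NP p (%x. - f x) = NP p f" by (simp add: NP_def)

lemma lp_minus: "lp p f ==> lp p (%x. - f x)" by (simp add: lp_def)

lemma lp_diff:
 assumes "lp p f" "lp p g" "0 <= p"
 shows "lp p (%x. f x - g x)" "NP p (%x. f x - g x) <= 2 powr p * (NP p f + NP p g)"
 using lp_add[OF assms(1) lp_minus[OF assms(2)] assms(3)] NP_minus[of p g] by simp_all

lemma lp_scale:
 assumes "lp p f"
 shows "lp p (%x. c *\<^sub>R f x)" "NP p (%x. c *\<^sub>R f x) = \<bar>c\<bar> powr p * NP p f"
 using lpD[OF assms] by (auto simp: lp_def NP_def powr_mult)

lemma NP_swap: "NP p (%x. f x - g x) = NP p (%x. g x - f x)"
 by (simp add: NP_def norm_minus_commute)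

lemma NP_tri:
 assumes "lp p f" "lp p g" "lp p h" "0 <= p"
 shows "NP p (%x. f x - h x) <= 2 powr p * (NP p (%x. f x - g x) + NP p (%x. g x - h x))"
 using lp_add(2)[OF lp_diff(1)[OF assms(1,2,4)] lp_diff(1)[OF assms(2,3,4)] assms(4)] by simp

lemma lp_bounded:
 fixes f :: "'a => 'b::euclidean_space"
 assumes "f \<in> borel_measurable borel" "!!x. x \<notin> \<Omega> ==> f x = 0" "!!x. norm (f x) <= B" "0 < p"
 shows "lp p f"
proof (rule lpI[OF assms(1,2)])
 show "integrable lborel (%x. B powr p * ch x)" using ind_integrable by simp
 show "norm (f x) powr p <= B powr p * ch x" for x
  using assms by (cases "x \<in> \<Omega>") (auto intro: powr_mono2)
qed

lemma lp_cont:
 fixes f :: "'a => 'b::euclidean_space"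
 assumes "cont f" "0 < p"
 shows "lp p (%x. ch x *\<^sub>R f x)"
proof -
 have "compact (closure \<Omega>)" using bd by simp
 then have "bounded (f ` closure \<Omega>)"
  by (intro compact_imp_bounded compact_continuous_image) (rule continuous_on_subset[OF assms(1)], auto)
 then obtain B where B: "!!x. x \<in> \<Omega> ==> norm (f x) <= B" using closure_subset[of \<Omega>] by (force simp: bounded_iff)
 have [measurable]: "f \<in> borel_measurable borel" using assms(1) by (rule borel_measurable_continuous_onI)
 show ?thesis
  by (rule lp_bounded[of _ "max B 0"]) (use B assms(2) in \<open>auto simp: indicator_def le_max_iff_disj\<close>)
qed

lemma lp_cc: "cc f ==> (!!x. x \<notin> \<Omega> ==> f x = 0) ==> 0 < p ==> lp p (f :: 'a => 'b::euclidean_space)"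
 using cc_bounded[of f] lp_bounded[of f] borel_measurable_continuous_onI[OF cc_cont[of f UNIV]] by metis

lemma lp_inner:
 fixes f g :: "'a => 'b::euclidean_space"
 assumes "lp p f" "lp q g" and p: "1 < p" "q = p / (p - 1)"
 shows "integrable lborel (%x. f x \<bullet> g x)"
  "0 < s ==> \<bar>(LBINT x. f x \<bullet> g x)\<bar> <= (1 / s) powr p * NP p f + s powr q * NP q g"
proof -
 note f = lpD[OF assms(1)] and g = lpD[OF assms(2)]
 have y: "norm (f x \<bullet> g x) <= (1 / s) powr p * norm (f x) powr p + s powr q * norm (g x) powr q" if "0 < s" for s x
  using young_scaled[OF p that, of "norm (f x)" "norm (g x)"] Cauchy_Schwarz_ineq2[of "f x" "g x"] by simp
 have i: "integrable lborel (%x. (1 / s) powr p * norm (f x) powr p + s powr q * norm (g x) powr q)" for s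
  using f(3) g(3) by simp
 have [measurable]: "f \<in> borel_measurable lborel" "g \<in> borel_measurable lborel" using f g by auto
 have m: "(%x. f x \<bullet> g x) \<in> borel_measurable lborel" by measurable
 show int: "integrable lborel (%x. f x \<bullet> g x)"
  by (rule bintegrable_bound[OF i[of 1] m], rule AE_I2)
   (use y[of 1] in \<open>auto intro: order_trans\<close>)
 show "\<bar>(LBINT x. f x \<bullet> g x)\<bar> <= (1 / s) powr p * NP p f + s powr q * NP q g" if s: "0 < s"
 proof -
  have "norm (LBINT x. f x \<bullet> g x) <= (LBINT x. (1 / s) powr p * norm (f x) powr p + s powr q * norm (g x) powr q)"
   by (rule bint_norm_bound[OF int i]) (rule y[OF s])
  also have "\<dots> = (1 / s) powr p * NP p f + s powr q * NP q g" using f(3) g(3) by (simp add: NP_def)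
  finally show ?thesis by simp
 qed
qed

lemma choose_s:
 fixes A e q :: real
 assumes "0 < e" "0 < q" "0 <= A" obtains s where "0 < s" "s powr q * A <= e"
proof
 show "0 < (e / (A + 1)) powr (1 / q)" using assms by simp
 have "((e / (A + 1)) powr (1 / q)) powr q * A = e / (A + 1) * A" using assms by (simp add: powr_powr)
 also have "\<dots> <= e" using assms by (simp add: field_simps)
 finally show "((e / (A + 1)) powr (1 / q)) powr q * A <= e" .
qed

text \<open>Continuity of the pairing in epsilon-delta form, as suits \<open>NP\<close>: the
  parameter of Young's inequality first makes the term with \<open>g\<close> small, then
  \<open>d\<close> handles the other.\<close>

lemma small_pairing:
 fixes g :: "'a => 'b::euclidean_space"
 assumes g: "lp q g" and p: "1 < p" "q = p / (p - 1)" and e: "0 < e"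
 obtains d where "0 < d" "!!f. lp p f ==> NP p f <= d ==> \<bar>(LBINT x. f x \<bullet> g x)\<bar> <= e"
proof -
 have q0: "0 < q" using p by simp
 obtain s where s: "0 < s" "s powr q * NP q g <= e / 2"
  using choose_s[of "e / 2" q "NP q g"] e q0 NP_nonneg by (metis half_gt_zero)
 show ?thesis
 proof (rule that[of "e / 2 / (1 / s) powr p"])
  show "0 < e / 2 / (1 / s) powr p" using e s by simp
  fix f :: "'a => 'b" assume f: "lp p f" "NP p f <= e / 2 / (1 / s) powr p"
  have "(1 / s) powr p * NP p f <= e / 2" using f(2) s(1) by (simp add: field_simps)
  then show "\<bar>(LBINT x. f x \<bullet> g x)\<bar> <= e" using lp_inner(2)[OF f(1) g p s(1)] s(2) by linarith
 qed
qed

lemma lp_lower: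
 fixes f :: "'a => 'b::euclidean_space"
 assumes f: "lp p f" and r: "0 < r" "r <= p"
 shows "lp r f"
proof (rule lpI)
 show "integrable lborel (%x. ch x + norm (f x) powr p)" using ind_integrable lpD(3)[OF f] by simp
 show "norm (f x) powr r <= ch x + norm (f x) powr p" for x
 proof (cases "x \<in> \<Omega>")
  case True
  show ?thesis
  proof (cases "norm (f x) <= 1")
   case True
   then have "norm (f x) powr r <= 1 powr r" using r by (intro powr_mono2) auto
   then show ?thesis using \<open>x \<in> \<Omega>\<close> by (simp add: add_increasing2)
  next
   case False
   then show ?thesis using r by (intro add_increasing powr_mono) auto
  qed
 qed (use lpD(2)[OF f] in simp)
qed (use lpD[OF f] in auto)

text \<open>Young's inequality with the constant 1 as second factor, on a set of finite measure;
  this replaces the embedding of Lebesgue spaces by Hoelder's inequality.\<close>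

lemma small_lower:
 assumes r: "0 < r" "r <= p" and e: "0 < e"
 obtains d where "0 < d" "!!f :: 'a => 'b::euclidean_space. lp p f ==> NP p f <= d ==> NP r f <= e"
proof (cases "r = p")
 case True then show ?thesis using that[of e] e by auto
next
 case False
 define P Q where "P = p / r" and "Q = P / (P - 1)"
 have P: "1 < P" using False r by (simp add: P_def)
 have Q: "0 < Q" using P by (simp add: Q_def)
 have A0: "0 <= measure lborel \<Omega>" by simp
 obtain s where s: "0 < s" "s powr Q * measure lborel \<Omega> <= e / 2"
  using choose_s[OF half_gt_zero[OF e] Q A0] by blast
 show ?thesis
 proof (rule that[of "e / 2 / (1 / s) powr P"])
  show "0 < e / 2 / (1 / s) powr P" using e s by simp
  fix f :: "'a => 'b" assume f: "lp p f" "NP p f <= e / 2 / (1 / s) powr P"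
  have i: "integrable lborel (%x. (1 / s) powr P * norm (f x) powr p + s powr Q * ch x)"
   using lpD(3)[OF f(1)] ind_integrable by simp
  have "NP r f <= (LBINT x. (1 / s) powr P * norm (f x) powr p + s powr Q * ch x)"
   unfolding NP_def
  proof (rule integral_mono[OF lpD(3)[OF lp_lower[OF f(1) r]] i])
   fix x
   show "norm (f x) powr r <= (1 / s) powr P * norm (f x) powr p + s powr Q * ch x"
    using young_scaled[OF P Q_def s(1), of "norm (f x) powr r" 1] lpD(2)[OF f(1), of x] r
    by (cases "x \<in> \<Omega>") (auto simp: powr_powr P_def)
  qed
  also have "\<dots> = (1 / s) powr P * NP p f + s powr Q * measure lborel \<Omega>"
   using lpD(3)[OF f(1)] ind_integrable by (simp add: NP_def)
  also have "(1 / s) powr P * NP p f <= e / 2" using f(2) s(1) by (simp add: field_simps)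
  finally show "NP r f <= e" using s(2) by linarith
 qed
qed

lemma NP_1: "NP 1 f = (LBINT x. norm (f x))" by (simp add: NP_def)

lemma lp_1: "lp 1 f ==> integrable lborel f"
 using lpD[of 1 f] by (simp add: integrable_norm_iff)

lemma lp_integrable: "lp p f ==> 1 <= p ==> integrable lborel f"
 by (rule lp_1[OF lp_lower]) auto

lemma NP_zero_AE: "lp p f ==> NP p f = 0 ==> AE x in lborel. f x = 0"
 unfolding NP_def by (subst (asm) integral_nonneg_eq_0_iff_AE) (auto simp: lp_def)

text \<open>On a bounded set the sequence is also Cauchy in L1, hence has an almost everywhere
  convergent subsequence; Fatou's lemma bounds the distance to its limit.\<close>

lemma riesz_fischer:
 fixes f :: "nat => 'a => 'b::euclidean_space"
 assumes f: "!!n. lp p (f n)" and p: "1 <= p"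
  and ca: "!!e. 0 < e ==> \<exists>N. \<forall>m\<ge>N. \<forall>n\<ge>N. NP p (%x. f m x - f n x) <= e"
 obtains g where "lp p g" "(%n. NP p (%x. f n x - g x)) \<longlonglongrightarrow> 0"
proof -
 have p0: "0 <= p" using p by simp
 have "\<exists>N. \<forall>i\<ge>N. \<forall>j\<ge>N. (LINT x|lborel. norm (f i x - f j x)) < e" if e: "0 < e" for e
 proof -
  obtain d where d: "0 < d" "!!f :: 'a => 'b. lp p f ==> NP p f <= d ==> NP 1 f <= e / 2"
   using small_lower[of 1 p "e / 2"] e p by (metis half_gt_zero zero_less_one)
  obtain N where N: "!!m n. N <= m ==> N <= n ==> NP p (%x. f m x - f n x) <= d" using ca[OF d(1)] by blast
  show ?thesis
  proof (intro exI[of _ N] allI impI)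
   fix i j assume "N <= i" "N <= j"
   then have "NP 1 (%x. f i x - f j x) <= e / 2" by (intro d(2) lp_diff(1) f p0 N)
   then show "(LINT x|lborel. norm (f i x - f j x)) < e" using e by (simp add: NP_1)
  qed
 qed
 then obtain r where r: "strict_mono r" "AE x in lborel. Cauchy (%i. f (r i) x)"
  using cauchy_L1_AE_cauchy_subseq[of lborel f] lp_integrable[OF f p] by blast
 define g where "g x = lim (%i. f (r i) x)" for x
 have [measurable]: "f n \<in> borel_measurable borel" for n by (rule lpD[OF f])
 have gm[measurable]: "g \<in> borel_measurable borel" unfolding g_def[abs_def] by measurable
 have g0: "g x = 0" if "x \<notin> \<Omega>" for x using lpD(2)[OF f that] by (simp add: g_def)
 have glim: "AE x in lborel. (%i. f (r i) x) \<longlonglongrightarrow> g x"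
  using r(2) by eventually_elim (simp add: g_def Cauchy_convergent_iff convergent_LIMSEQ_iff)
 have key: "integrable lborel (%x. norm (f n x - g x) powr p) & (LBINT x. norm (f n x - g x) powr p) <= e"
  if N: "!!k. N <= k ==> NP p (%x. f n x - f k x) <= e" for n N e
 proof -
  have lim: "AE x in lborel. (%i. norm (f n x - f (r i) x) powr p) \<longlonglongrightarrow> norm (f n x - g x) powr p"
   using glim
  proof eventually_elim
   case (elim x)
   show ?case by (intro tendsto_powr' tendsto_norm tendsto_diff tendsto_const elim) (use p in auto)
  qed
  have h: "integrable lborel (%x. norm (f n x - f (r k) x) powr p)" for k by (rule lpD(3)[OF lp_diff(1)[OF f f p0]])
  have le: "(LBINT x. norm (f n x - f (r k) x) powr p) <= e" if "N <= k" for k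
   using N[of "r k"] that seq_suble[OF r(1), of k] by (simp add: NP_def)
  show ?thesis
   by (intro conjI; rule fatou_bound[of lborel "%k x. norm (f n x - f (r k) x) powr p" _ N]) (use h le lim in auto)
 qed
 obtain N1 where N1: "!!m n. N1 <= m ==> N1 <= n ==> NP p (%x. f m x - f n x) <= 1" using ca[of 1] by auto
 have "lp p (%x. f N1 x - g x)"
  unfolding lp_def using key[of N1 N1 1] N1 lpD(2)[OF f] g0 by simp
 then have g: "lp p g" using lp_diff(1)[OF f[of N1] _ p0] by force
 show ?thesis
 proof (rule that[OF g], rule LIMSEQ_I)
  fix e :: real assume e: "0 < e"
  obtain N where N: "!!m n. N <= m ==> N <= n ==> NP p (%x. f m x - f n x) <= e / 2" using ca[OF half_gt_zero[OF e]] by blast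
  show "\<exists>no. \<forall>n\<ge>no. norm (NP p (%x. f n x - g x) - 0) < e"
   using key[OF N] e NP_nonneg by (intro exI[of _ N]) (force simp: NP_def)
 qed
qed

lemma riesz_fischer_rate:
 fixes f :: "nat => 'a => 'b::euclidean_space"
 assumes f: "!!n. lp p (f n)" and p: "1 <= p" and c: "0 <= c"
  and rate: "!!m n. NP p (%x. f m x - f n x) <= c * (1 / real (Suc m) + 1 / real (Suc n))"
 obtains g where "lp p g" "(%n. NP p (%x. f n x - g x)) \<longlonglongrightarrow> 0"
proof (rule riesz_fischer[OF f p])
 fix e :: real assume e: "0 < e"
 obtain N where N: "2 * c / e < real N" using reals_Archimedean2 by blast
 show "\<exists>N. \<forall>m\<ge>N. \<forall>n\<ge>N. NP p (%x. f m x - f n x) <= e"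
 proof (intro exI[of _ N] allI impI)
  fix m n assume mn: "N <= m" "N <= n"
  have N1: "0 < real (Suc N)" by simp
  note rate[of m n]
  also have "c * (1 / real (Suc m) + 1 / real (Suc n)) <= c * (1 / real (Suc N) + 1 / real (Suc N))"
   using mn c by (intro mult_left_mono add_mono divide_left_mono) auto
  also have "\<dots> = (2 * c) / real (Suc N)" by simp
  also have "\<dots> <= e"
  proof -
   have "2 * c < e * real N" using N e by (simp add: field_simps)
   also have "\<dots> <= e * real (Suc N)" using e by simp
   finally show ?thesis unfolding pos_divide_le_eq[OF N1] by simp
  qed
  finally show "NP p (%x. f m x - f n x) <= e" .
 qed
qed (rule that)

definition clip :: "real => 'b::real_normed_vector => 'b" where
 "clip T v = (T / max T (norm v)) *\<^sub>R v"

lemma clip_norm: "0 < T ==> norm (clip T v) <= T" "0 < T ==> norm (clip T v) <= norm v"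
 by (auto simp: clip_def field_simps max_def mult_left_mono)

lemma clip_id: "0 < T ==> norm v <= T ==> clip T v = v"
 by (auto simp: clip_def max_def)

lemma clip_cont: "0 < T ==> continuous_on S f ==> continuous_on S (%x. clip T (f x))"
 unfolding clip_def by (intro continuous_intros) (auto simp: max_def)

lemma clip_zero: "clip T 0 = 0" by (simp add: clip_def)

text \<open>Measurability supplies continuous functions converging almost everywhere; clipping
  restores the bound, and a cut-off by the distance to the complement restores the support.\<close>

lemma bounded_approx:
 fixes f :: "'a => 'b::euclidean_space"
 assumes fm: "f \<in> borel_measurable borel" and f0: "!!x. x \<notin> \<Omega> ==> f x = 0" and fb: "!!x. norm (f x) <= T" and T: "0 < T"
 obtains w where "!!n. cc (w n)" "!!n x. x \<notin> \<Omega> ==> w n x = 0" "!!n x. norm (w n x) <= T"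
  "AE x in lborel. (%n. w n x) \<longlonglongrightarrow> f x"
proof -
 have "f \<in> borel_measurable lebesgue" using fm by (simp add: measurable_completion)
 then have "f measurable_on UNIV" by (simp add: measurable_on_iff_borel_measurable)
 then obtain N g where N: "negligible N" and gc: "!!n. cont (g n)" and gl: "!!x. x \<notin> N ==> (%n. g n x) \<longlonglongrightarrow> f x"
  unfolding measurable_on_def by auto
 have cne: "- \<Omega> ~= {}" using bd by (metis Compl_empty_eq double_compl not_bounded_UNIV)
 have ccl: "closed (- \<Omega>)" using op by (simp add: closed_Compl)
 define c where "c n x = min 1 (real n * infdist x (- \<Omega>))" for n and x :: 'a
 have c01: "0 <= c n x" "c n x <= 1" for n x by (auto simp: c_def infdist_nonneg)
 have cc0: "cont (c n)" for n unfolding c_def by (intro continuous_intros)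
 define w where "w n x = c n x *\<^sub>R clip T (g n x)" for n x
 obtain R where R: "!!x. x \<in> \<Omega> ==> norm x <= R" using bd by (auto simp: bounded_iff)
 have w0: "w n x = 0" if "x \<notin> \<Omega>" for n x using that by (simp add: w_def c_def)
 show ?thesis
 proof (rule that[of w])
  show "cc (w n)" for n
  proof (rule ccI[of _ R])
   show "cont (w n)" unfolding w_def by (intro continuous_on_scaleR cc0 clip_cont T gc)
  qed (use w0 R in force)
  show "w n x = 0" if "x \<notin> \<Omega>" for n x by (rule w0[OF that])
  show "norm (w n x) <= T" for n x
  proof -
   have "norm (w n x) = c n x * norm (clip T (g n x))" using c01 by (simp add: w_def)
   also have "\<dots> <= 1 * T" using c01 clip_norm(1)[OF T] by (intro mult_mono) auto
   finally show ?thesis by simp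
  qed
  have "(%n. w n x) \<longlonglongrightarrow> f x" if x: "x \<notin> N" for x
  proof (cases "x \<in> \<Omega>")
   case True
   have "0 < infdist x (- \<Omega>)" using True ccl cne by (metis ComplD in_closed_iff_infdist_zero infdist_nonneg less_eq_real_def)
   then obtain n0 where n0: "1 < real n0 * infdist x (- \<Omega>)" using reals_Archimedean3 by metis
   have "\<forall>\<^sub>F n in sequentially. c n x = 1"
    using eventually_ge_at_top[of n0]
   proof eventually_elim
    case (elim n)
    have "real n0 * infdist x (- \<Omega>) <= real n * infdist x (- \<Omega>)" using elim by (intro mult_right_mono) (auto simp: infdist_nonneg)
    then show ?case using n0 by (simp add: c_def)
   qed
   then have 1: "(%n. c n x) \<longlonglongrightarrow> 1" by (rule tendsto_eventually)
   have "(%n. clip T (g n x)) \<longlonglongrightarrow> clip T (f x)"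
    unfolding clip_def by (intro tendsto_intros gl[OF x]) (use T in \<open>auto simp: max_def\<close>)
   then have "(%n. clip T (g n x)) \<longlonglongrightarrow> f x" by (simp add: clip_id[OF T fb])
   from tendsto_scaleR[OF 1 this] show ?thesis by (simp add: w_def)
  qed (simp add: w0 f0)
  moreover have "AE x in lebesgue. x \<notin> N" by (rule AE_not_in) (use N in \<open>simp add: negligible_iff_null_sets\<close>)
  then have "AE x in lborel. x \<notin> N" by (simp only: AE_completion_iff)
  ultimately show "AE x in lborel. (%n. w n x) \<longlonglongrightarrow> f x" by auto
 qed
qed

lemma lp_dct:
 fixes f :: "'a => 'b::euclidean_space"
 assumes w: "!!n. w n \<in> borel_measurable borel" "f \<in> borel_measurable borel" and p: "0 < p"
  and G: "lp p (G :: 'a => 'c::euclidean_space)" "!!n x. norm (w n x) <= norm (G x)" "!!x. norm (f x) <= norm (G x)"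
  and lim: "AE x in lborel. (%n. w n x) \<longlonglongrightarrow> f x"
 shows "(%n. NP p (%x. w n x - f x)) \<longlonglongrightarrow> 0"
proof -
 have [measurable]: "w n \<in> borel_measurable borel" "f \<in> borel_measurable borel" for n by (rule w)+
 have "(%n. (LBINT x. norm (w n x - f x) powr p)) \<longlonglongrightarrow> (\<integral>x. 0 \<partial>(lborel :: 'a measure))"
 proof (rule integral_dominated_convergence[where w = "%x. 2 powr p * (norm (G x) powr p + norm (G x) powr p)"])
  show "integrable lborel (%x. 2 powr p * (norm (G x) powr p + norm (G x) powr p))" using lpD(3)[OF G(1)] by auto
  show "AE x in lborel. (%n. norm (w n x - f x) powr p) \<longlonglongrightarrow> 0"
   using lim
  proof eventually_elim
   case (elim x)
   have "(%n. norm (w n x - f x) powr p) \<longlonglongrightarrow> norm (f x - f x) powr p"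
    by (intro tendsto_powr' tendsto_norm tendsto_diff tendsto_const elim) (use p in auto)
   then show ?case using p by simp
  qed
  fix n
  show "AE x in lborel. norm (norm (w n x - f x) powr p) <= 2 powr p * (norm (G x) powr p + norm (G x) powr p)"
  proof (rule AE_I2)
   fix x
   have "norm (w n x - f x) powr p <= 2 powr p * (norm (w n x) powr p + norm (f x) powr p)" by (rule powr_norm_diff) (use p in simp)
   also have "\<dots> <= 2 powr p * (norm (G x) powr p + norm (G x) powr p)"
    using G p by (intro mult_left_mono add_mono powr_mono2) auto
   finally show "norm (norm (w n x - f x) powr p) <= 2 powr p * (norm (G x) powr p + norm (G x) powr p)" by simp
  qed
 qed measurable
 then show ?thesis by (simp add: NP_def)
qed

text \<open>First \<open>f\<close> is clipped, then the bounded function is approximated by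
  \<open>bounded_approx\<close>; both limits are dominated.\<close>

lemma lp_density:
 fixes f :: "'a => 'b::euclidean_space"
 assumes f: "lp p f" and p: "0 < p" and e: "0 < e"
 obtains w where "cc w" "!!x. x \<notin> \<Omega> ==> w x = 0" "NP p (%x. w x - f x) <= e"
proof -
 have fm[measurable]: "f \<in> borel_measurable borel" by (rule lpD[OF f])
 have cm: "(%x. clip T (f x)) \<in> borel_measurable borel" for T unfolding clip_def by measurable
 have cl: "(%n. NP p (%x. clip (real (Suc n)) (f x) - f x)) \<longlonglongrightarrow> 0"
 proof (rule lp_dct[OF cm fm p f])
  show "norm (clip (real (Suc n)) (f x)) <= norm (f x)" for n x by (rule clip_norm) simp
  have "(%n. clip (real (Suc n)) (f x)) \<longlonglongrightarrow> f x" for x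
  proof (rule tendsto_eventually)
   obtain N where N: "norm (f x) <= real N" using real_arch_simple by blast
   show "\<forall>\<^sub>F n in sequentially. clip (real (Suc n)) (f x) = f x"
    using eventually_ge_at_top[of N] by eventually_elim (rule clip_id, use N in auto)
  qed
  then show "AE x in lborel. (%n. clip (real (Suc n)) (f x)) \<longlonglongrightarrow> f x" by simp
 qed simp
 define c where "c = 2 powr p"
 have c: "0 < c" by (simp add: c_def)
 have e': "0 < e / (2 * c)" using e c by simp
 obtain n where n: "NP p (%x. clip (real (Suc n)) (f x) - f x) < e / (2 * c)"
  using LIMSEQ_zero_less[OF cl e'] by blast
 let ?T = "real (Suc n)" and ?h = "%x. clip (real (Suc n)) (f x)"
 have T: "0 < ?T" by simp
 have h0: "?h x = 0" if "x \<notin> \<Omega>" for x using lpD(2)[OF f that] by (simp add: clip_zero)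
 have h: "lp p ?h" by (rule lp_bounded[OF cm h0 clip_norm(1)[OF T] p])
 obtain w where w: "!!n. cc (w n)" "!!n x. x \<notin> \<Omega> ==> w n x = 0" "!!n x. norm (w n x) <= ?T"
  "AE x in lborel. (%n. w n x) \<longlonglongrightarrow> ?h x"
  using bounded_approx[OF cm h0 clip_norm(1)[OF T] T] by blast
 have "(%k. NP p (%x. w k x - ?h x)) \<longlonglongrightarrow> 0"
 proof (rule lp_dct[OF _ cm p _ _ _ w(4)])
  show "lp p (%x. ch x *\<^sub>R ?T)" by (rule lp_cont[OF continuous_on_const p])
  show "w k \<in> borel_measurable borel" for k using w(1) by (intro borel_measurable_continuous_onI cc_cont)
  show "norm (w k x) <= norm (ch x *\<^sub>R ?T)" for k x using w(2)[of x] w(3)[of k x] by (auto simp: indicator_def)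
  show "norm (?h x) <= norm (ch x *\<^sub>R ?T)" for x using h0[of x] clip_norm(1)[OF T, of "f x"] by (auto simp: indicator_def)
 qed
 from LIMSEQ_zero_less[OF this e'] obtain k where k: "NP p (%x. w k x - ?h x) < e / (2 * c)" by blast
 have "NP p (%x. w k x - f x) <= 2 powr p * (NP p (%x. w k x - ?h x) + NP p (%x. ?h x - f x))"
  by (rule NP_tri[OF lp_cc[OF w(1,2) p] h f]) (use p in auto)
 also have "\<dots> <= c * (e / (2 * c) + e / (2 * c))" unfolding c_def[symmetric] using c n k by (intro mult_left_mono add_mono) auto
 also have "\<dots> = e" using c by simp
 finally show ?thesis using that[of "w k"] w by blast
qed

end

section \<open>Approximation by smooth functions\<close>

lemma lborel_dilation:
 fixes F :: "'a::euclidean_space => real"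
 assumes F: "integrable lborel F" "!!x. 0 <= F x" and r: "0 < r"
 shows "integrable lborel (%x. F (t + r *\<^sub>R x))"
  "(LBINT x. F (t + r *\<^sub>R x)) = (1 / r) ^ DIM('a) * (LBINT x. F x)"
proof -
 have [measurable]: "F \<in> borel_measurable borel" using borel_measurable_integrable[OF F(1)] by simp
 let ?D = "density (distr lborel borel (%x. t + r *\<^sub>R x)) (%_. ennreal (r ^ DIM('a)))"
 have D: "lborel = ?D" using lborel_affine[of r t] r by simp
 have "(\<integral>\<^sup>+x. ennreal (F x) \<partial>lborel) = (\<integral>\<^sup>+x. ennreal (F x) \<partial>?D)" using D by (rule arg_cong)
 also have "\<dots> = ennreal (r ^ DIM('a)) * (\<integral>\<^sup>+x. ennreal (F (t + r *\<^sub>R x)) \<partial>lborel)"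
  by (simp add: nn_integral_density nn_integral_distr nn_integral_cmult)
 finally have nn: "ennreal (LBINT x. F x) = ennreal (r ^ DIM('a)) * (\<integral>\<^sup>+x. ennreal (F (t + r *\<^sub>R x)) \<partial>lborel)"
  by (simp add: nn_integral_eq_integral[OF F(1)] F(2))
 have fin: "(\<integral>\<^sup>+x. ennreal (F (t + r *\<^sub>R x)) \<partial>lborel) < \<infinity>"
 proof (rule ccontr)
  assume "\<not> ?thesis"
  then have "(\<integral>\<^sup>+x. ennreal (F (t + r *\<^sub>R x)) \<partial>lborel) = top" by (simp add: less_top[symmetric])
  then show False using nn r by (simp add: ennreal_mult_top)
 qed
 show int: "integrable lborel (%x. F (t + r *\<^sub>R x))"
  by (rule integrableI_nonneg) (use F(2) fin in auto)
 have "ennreal (LBINT x. F x) = ennreal (r ^ DIM('a) * (LBINT x. F (t + r *\<^sub>R x)))"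
  using nn r by (simp add: nn_integral_eq_integral[OF int] F(2) ennreal_mult integral_nonneg_AE)
 moreover have "0 <= (LBINT x. F x)" "0 <= (LBINT x. F (t + r *\<^sub>R x))"
  by (rule integral_nonneg_AE, simp add: F(2))+
 ultimately have "(LBINT x. F x) = r ^ DIM('a) * (LBINT x. F (t + r *\<^sub>R x))"
  using r by (simp add: ennreal_inj)
 then show "(LBINT x. F (t + r *\<^sub>R x)) = (1 / r) ^ DIM('a) * (LBINT x. F x)"
  using r by (simp add: power_one_over)
qed

lemma conv_diff:
 fixes f g :: "'a::euclidean_space => 'b::euclidean_space"
 assumes "integrable lborel f" "integrable lborel g" "cc \<rho>"
 shows "conv \<rho> f x - conv \<rho> g x = conv \<rho> (%z. f z - g z) x"
 unfolding conv_def scaleR_diff_right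
 by (rule bint_diff[symmetric]) (intro conv_integrable assms)+

lemma C1_affine:
 fixes f :: "'a::euclidean_space => real"
 assumes "C1_gradient f G" shows "C1_gradient (%x. f (t + r *\<^sub>R x)) (%x. r *\<^sub>R G (t + r *\<^sub>R x))"
 unfolding C1_gradient_def
proof (intro conjI allI)
 have c: "cont G" by (rule C1_gradient_cont[OF assms])
 show "cont (%x. r *\<^sub>R G (t + r *\<^sub>R x))"
  by (intro continuous_on_scaleR continuous_on_const continuous_on_compose2[OF c] continuous_intros) auto
 fix x
 have "((%x. t + r *\<^sub>R x) has_derivative (%h. r *\<^sub>R h)) (at x)" by (auto intro!: derivative_eq_intros)
 moreover have "(f has_derivative (%h. h \<bullet> G (t + r *\<^sub>R x))) (at (t + r *\<^sub>R x))"
  using assms by (simp add: C1_gradient_def gderiv_def)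
 ultimately have "((%x. f (t + r *\<^sub>R x)) has_derivative (%h. r *\<^sub>R h \<bullet> G (t + r *\<^sub>R x))) (at x)"
  by (rule has_derivative_compose)
 then show "GDERIV (%x. f (t + r *\<^sub>R x)) x :> r *\<^sub>R G (t + r *\<^sub>R x)" by (simp add: gderiv_def)
qed

lemma C1_mult:
 assumes "C1_gradient f F" "C1_gradient g G"
 shows "C1_gradient (%x. f x * g x) (%x. f x *\<^sub>R G x + g x *\<^sub>R F x)"
 using assms C1_continuous[OF assms(1)] C1_continuous[OF assms(2)]
 unfolding C1_gradient_def by (auto intro!: GDERIV_mult continuous_intros)

lemma C1_diff:
 assumes "C1_gradient f F" "C1_gradient g G"
 shows "C1_gradient (%x. f x - g x) (%x. F x - G x)"
 using assms unfolding C1_gradient_def by (auto intro!: GDERIV_diff continuous_intros)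

lemma C1_diff_const: "C1_gradient f F ==> C1_gradient (%x. f x - c) F"
 using C1_diff[of f F "%_. c" "%_. 0"] by (simp add: C1_gradient_def GDERIV_const)

text \<open>A mollified indicator of a ball is constant further inside, so its gradient vanishes
  there.\<close>

lemma plateau_exists:
 fixes R :: real
 obtains th :: "'a::euclidean_space => real" and H where "C1_gradient th H" "cc th"
  "!!x. norm x < R ==> th x = 1" "!!x. norm x < R ==> H x = 0"
proof -
 define f where "f = (indicator (ball 0 (R + 1)) :: 'a => real)"
 have f: "integrable lborel f" unfolding f_def
  using emeasure_bounded_finite[of "ball (0::'a) (R + 1)"] by (auto simp: integrable_indicator_iff)
 obtain \<rho> :: "'a => real" and gr where \<rho>: "mollifier 1 \<rho> gr" using mollifier_exists[of 1] by auto
 have \<rho>z: "1 <= norm x ==> \<rho> x = 0" for x using \<rho> by (auto simp: mollifier_def)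
 have nt: "norm z <= norm x + norm (z - x)" "norm x <= norm z + norm (z - x)" for x z :: 'a
  using norm_triangle_ineq[of x "z - x"] norm_triangle_ineq4[of z "z - x"] by simp_all
 have one: "conv \<rho> f x = 1" if "norm x < R" for x
 proof -
  have "norm (conv \<rho> f x - 1) <= 0"
  proof (rule conv_close[OF \<rho> f])
   fix z assume "norm (z - x) < 1"
   then show "norm (f z - 1) <= 0" using that nt(1)[of z x] by (simp add: f_def)
  qed
  then show ?thesis by simp
 qed
 define H where "H x = (LBINT z. f z *\<^sub>R gr (x - z))" for x
 have C1: "C1_gradient (conv \<rho> f) H" unfolding H_def[abs_def] by (rule conv_C1[OF f \<rho>])
 have "cc (conv \<rho> f)"
 proof (rule ccI[of _ "R + 2"])
  fix x :: 'a assume x: "R + 2 < norm x"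
  show "conv \<rho> f x = 0"
  proof (rule conv_zero_outside[of 1])
   fix z assume "norm (z - x) < 1"
   then show "f z = 0" using nt(2)[of x z] x by (simp add: f_def)
  qed (rule \<rho>z)
 qed (rule C1_continuous[OF C1])
 moreover have "H x = 0" if "norm x < R" for x
 proof (rule C1_gradient_zero_outside[OF C1_diff_const[OF C1, of 1], of "ball 0 R"])
  show "conv \<rho> f x - 1 = 0" if "x \<in> ball 0 R" for x using one[of x] that by simp
 qed (use that in auto)
 ultimately show ?thesis using that[of "conv \<rho> f" H] C1 one by blast
qed

lemma cutoff:
 fixes \<zeta> :: "'a::euclidean_space => real"
 assumes "C1_gradient \<zeta> Z" "bounded S"
 obtains \<xi> X where "C1_gradient \<xi> X" "cc \<xi>" "!!x. x \<in> S ==> \<xi> x = \<zeta> x" "!!x. x \<in> S ==> X x = Z x"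
proof -
 obtain R where R: "!!x. x \<in> S ==> norm x <= R" using assms(2) by (auto simp: bounded_iff)
 obtain th :: "'a => real" and H where th: "C1_gradient th H" "cc th"
  "!!x. norm x < R + 1 ==> th x = 1" "!!x. norm x < R + 1 ==> H x = 0" using plateau_exists[of "R + 1"] by blast
 show ?thesis
 proof (rule that[OF C1_mult[OF th(1) assms(1)]])
  show "cc (%x. th x * \<zeta> x)" by (rule cc_mult_right[OF th(2) C1_continuous[OF assms(1)]])
 qed (use R th in force)+
qed

text \<open>Difference quotients have integral zero by translation invariance and converge uniformly
  to \<open>G x \<bullet> i\<close>, with supports in a common ball.\<close>

lemma integral_gradient_zero:
 fixes f :: "'a::euclidean_space => real"
 assumes "C1_gradient f G" "cc f" shows "(LBINT x. G x) = 0"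
proof (rule euclidean_eqI)
 fix i :: 'a assume i: "i \<in> Basis"
 have cG: "cc G" by (rule cc_C1_gradient[OF assms])
 have cGi: "cc (%x. G x \<bullet> i)" by (rule cc_inner_left[OF cG continuous_on_const])
 obtain R where R: "0 < R" "!!x. R < norm x ==> f x = 0" using ccE[OF assms(2)] by blast
 obtain R' where R': "0 < R'" "!!x. R' < norm x ==> G x = 0" using ccE[OF cG] by blast
 define B where "B = cball (0::'a) (max R R' + 1)"
 have B: "integrable lborel (indicator B :: 'a => real)" unfolding B_def
  using emeasure_bounded_finite[of "cball (0::'a) (max R R' + 1)"] by (auto simp: integrable_indicator_iff)
 have small: "\<bar>(LBINT x. G x \<bullet> i)\<bar> <= e * measure lborel B" if e: "0 < e" for e
 proof -
  obtain s0 where s0: "0 < s0" "!!s i x. 0 < s ==> s <= s0 ==> norm i = 1 ==> \<bar>(f (x + s *\<^sub>R i) - f x) / s - G x \<bullet> i\<bar> <= e"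
   using diff_quot_uniform[OF assms e] by blast
  define s where "s = min s0 1"
  have s: "0 < s" "s <= s0" "s <= 1" using s0 by (auto simp: s_def)
  define q where "q x = (f (x + s *\<^sub>R i) - f x) / s" for x
  have cq: "cc q" unfolding q_def[abs_def] by (intro cc_divide cc_diff cc_shift assms)
  have "(LBINT x. q x) = ((LBINT x. f (x + s *\<^sub>R i)) - (LBINT x. f x)) / s"
   unfolding q_def using cc_integrable[OF assms(2)] cc_integrable[OF cc_shift[OF assms(2), of "s *\<^sub>R i"]] by simp
  also have "\<dots> = 0" using lborel_integral_shift[of f "s *\<^sub>R i"] C1_continuous[OF assms(1)]
   by (simp add: borel_measurable_continuous_onI)
  finally have q0: "(LBINT x. q x) = 0" .
  have "(LBINT x. G x \<bullet> i) = (LBINT x. G x \<bullet> i - q x)"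
   using q0 cc_integrable[OF cGi] cc_integrable[OF cq] by simp
  also have "norm \<dots> <= (LBINT x. e * indicator B x)"
  proof (rule bint_norm_bound)
   fix x
   show "norm (G x \<bullet> i - q x) <= e * indicator B x"
   proof (cases "x \<in> B")
    case True
    then show ?thesis using s0(2)[OF s(1,2), of i x] i by (simp add: q_def abs_minus_commute)
   next
    case False
    then have n: "max R R' + 1 < norm x" by (simp add: B_def)
    moreover have "norm x <= norm (x + s *\<^sub>R i) + 1" using norm_triangle_ineq4[of "x + s *\<^sub>R i" "s *\<^sub>R i"] i s by simp
    ultimately have "R < norm (x + s *\<^sub>R i)" "R < norm x" "R' < norm x" by auto
    then show ?thesis using R R' e by (simp add: q_def)
   qed
  qed (use B cc_integrable[OF cGi] cc_integrable[OF cq] in auto)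
  also have "\<dots> = e * measure lborel B" using B by simp
  finally show ?thesis by simp
 qed
 have "\<bar>(LBINT x. G x \<bullet> i)\<bar> <= 0 + e" if e: "0 < e" for e
 proof -
  have d: "0 < measure lborel B + 1" by (simp add: add_nonneg_pos)
  have "\<bar>(LBINT x. G x \<bullet> i)\<bar> <= e / (measure lborel B + 1) * measure lborel B" by (rule small) (use e d in simp)
  also have "\<dots> <= e" using e d by (simp add: field_simps)
  finally show ?thesis by simp
 qed
 then have "(LBINT x. G x \<bullet> i) = 0" using field_le_epsilon[of "\<bar>(LBINT x. G x \<bullet> i)\<bar>" 0] by simp
 then show "(LBINT x. G x) \<bullet> i = 0 \<bullet> i" using cc_integrable[OF cG] by simp
qed

lemma integration_by_parts:
 fixes f h :: "'a::euclidean_space => real"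
 assumes f: "C1_gradient f F" and h: "C1_gradient h H" "cc h"
 shows "(LBINT x. f x *\<^sub>R H x) = - (LBINT x. h x *\<^sub>R F x)"
proof -
 have c: "cc (%x. f x * h x)" by (rule cc_mult_left[OF C1_continuous[OF f] h(2)])
 have "integrable lborel (%x. f x *\<^sub>R H x)"
  by (intro cc_integrable cc_scaleR_left[OF C1_continuous[OF f] cc_C1_gradient[OF h]])
 moreover have "integrable lborel (%x. h x *\<^sub>R F x)"
  by (intro cc_integrable cc_scaleR_right[OF h(2) C1_gradient_cont[OF f]])
 ultimately show ?thesis
  using integral_gradient_zero[OF C1_mult[OF f h(1)] c] by (simp add: eq_neg_iff_add_eq_0)
qed

lemma powr_mean_le:
 fixes a :: "nat => real"
 assumes p: "1 <= p" and a: "!!k. 0 <= a k" and n: "0 < n"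
 shows "((\<Sum>k<n. a k) / real n) powr p <= (\<Sum>k<n. a k powr p) / real n"
proof -
 define t where "t = (\<Sum>k<n. a k) / real n"
 have t: "0 <= t" "(\<Sum>k<n. a k) = real n * t" using a n by (auto simp: t_def sum_nonneg)
 have "real n * t powr p = (\<Sum>k<n. t powr p + p * t powr (p - 1) * (a k - t))"
  by (simp add: sum.distrib sum_subtractf sum_distrib_left[symmetric] t(2))
 also have "\<dots> <= (\<Sum>k<n. a k powr p)" by (intro sum_mono powr_tangent p a t)
 finally show ?thesis using n unfolding t_def[symmetric] by (simp add: field_simps)
qed

context dom
begin

definition vol :: real where "vol = measure lborel \<Omega>"

lemma vol: "0 < vol"
proof -
 obtain x e where e: "0 < e" "ball x e \<subseteq> \<Omega>" using ne op by (meson ex_in_conv open_contains_ball)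
 have "\<Omega> \<in> lmeasurable" by (rule lmeasurable_open[OF bd op])
 then have "measure lborel (ball x e) <= measure lebesgue \<Omega>"
  using measure_mono_fmeasurable[OF e(2), of lebesgue] by simp
 moreover have "0 < measure lborel (ball x e)" by (rule content_ball_pos[OF e(1)])
 moreover have "measure lebesgue \<Omega> = measure lborel \<Omega>" by simp
 ultimately show ?thesis unfolding vol_def by linarith
qed

lemma SI_int: "cont f ==> integrable lborel (%x. ch x *\<^sub>R (f x :: 'b::euclidean_space))"
 using cont_set_integrable[of f \<Omega>] bd by (simp add: set_integrable_def)

text \<open>Mollifying and composing with a dilation about \<open>x0\<close> is bounded uniformly in
  \<open>r\<close> and \<open>\<delta>\<close>, since \<open>r >= 1/2\<close> costs at most the
  factor \<open>2 ^ DIM('a)\<close>. So convergence only has to be checked on a dense class, where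
  uniform continuity gives it.\<close>

lemma conv_dil_approx:
 fixes f :: "'a => 'b::euclidean_space"
 assumes f: "lp p f" and p: "1 <= p" and e: "0 < e" and x0: "x0 \<in> \<Omega>"
 obtains t where "0 < t" "!!r \<delta> \<rho> gr. 1 - t < r ==> r <= 1 ==> \<delta> < t ==> mollifier \<delta> \<rho> gr ==>
  lp p (%x. ch x *\<^sub>R conv \<rho> f ((x0 - r *\<^sub>R x0) + r *\<^sub>R x)) \<and>
  NP p (%x. ch x *\<^sub>R conv \<rho> f ((x0 - r *\<^sub>R x0) + r *\<^sub>R x) - f x) <= e"
proof -
 have p0: "0 < p" "0 <= p" using p by auto
 define a where "a = 2 powr p"
 define b where "b = (2::real) ^ DIM('a)"
 have ab: "0 < a" "0 < b" by (auto simp: a_def b_def)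
 define e1 where "e1 = e / (2 * (a * b + a * a))"
 have den: "0 < 2 * (a * b + a * a)" using ab by (simp add: add_pos_pos)
 have e1: "0 < e1" using e den by (simp add: e1_def)
 obtain w where w: "cc w" "!!x. x \<notin> \<Omega> ==> w x = 0" "NP p (%x. w x - f x) <= e1"
  using lp_density[OF f p0(1) e1] by blast
 have lw: "lp p w" by (rule lp_cc[OF w(1,2) p0(1)])
 obtain s where s: "0 < s" "s powr p * vol <= e / (2 * (a * a))"
  using choose_s[of "e / (2 * (a * a))" p vol] e ab p0 vol by (metis divide_pos_pos less_imp_le mult_pos_pos zero_less_numeral)
 obtain d where d: "0 < d" "!!x y. norm (x - y) <= d ==> norm (w x - w y) <= s"
  using cc_uniformly_continuous[OF w(1) s(1)] by blast
 obtain D where D: "!!x. x \<in> \<Omega> ==> norm (x - x0) <= D" "0 < D"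
 proof -
  obtain B where "!!x. x \<in> \<Omega> ==> norm x <= B" using bd by (auto simp: bounded_iff)
  then show ?thesis using that[of "max 1 (B + norm x0)"] by (metis add_mono_thms_linordered_semiring(3) le_max_iff_disj max.strict_coboundedI1 norm_triangle_ineq4 order_trans zero_less_one)
 qed
 define t where "t = min (1 / 2) (min (d / 2) (d / (2 * D)))"
 have t: "0 < t" "t <= 1 / 2" "t <= d / 2" "t * D <= d / 2" using d D by (auto simp: t_def min_def field_simps)
 show ?thesis
 proof (rule that[OF t(1)])
  fix r \<delta> :: real and \<rho> :: "'a => real" and gr
  assume r: "1 - t < r" "r <= 1" and \<delta>: "\<delta> < t" and \<rho>: "mollifier \<delta> \<rho> gr"
  have r0: "1 / 2 <= r" "0 < r" using r t by auto
  let ?y = "%x. (x0 - r *\<^sub>R x0) + r *\<^sub>R x"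
  define S where "S h x = ch x *\<^sub>R conv \<rho> h (?y x)" for h :: "'a => 'b" and x
  have Slp: "lp p (S h)" if "integrable lborel h" for h
   unfolding S_def[abs_def]
   by (intro lp_cont p0 continuous_on_compose2[OF conv_cont[OF that \<rho>]] continuous_intros) auto
  note fi = lp_integrable[OF f p] and wi = lp_integrable[OF lw p]
  let ?h = "%x. w x - f x"
  have lh: "lp p ?h" by (rule lp_diff(1)[OF lw f p0(2)])
  note hi = lp_integrable[OF lh p]
  have 1: "NP p (%x. S f x - S w x) <= b * e1"
  proof -
   have "NP p (%x. S f x - S w x) = NP p (%x. S w x - S f x)" by (rule NP_swap)
   also have "(%x. S w x - S f x) = S ?h"
    by (simp add: fun_eq_iff S_def conv_diff[OF wi fi mollifier_cc(1)[OF \<rho>], symmetric] scaleR_diff_right)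
   also have "NP p (S ?h) <= (LBINT x. norm (conv \<rho> ?h (?y x)) powr p)"
    unfolding NP_def
   proof (rule integral_mono)
    show "integrable lborel (%x. norm (S ?h x) powr p)" by (rule lpD(3)[OF Slp[OF hi]])
    show "integrable lborel (%x. norm (conv \<rho> ?h (?y x)) powr p)"
     by (rule lborel_dilation(1)[OF conv_Lr(1)[OF \<rho> hi lpD(3)[OF lh] p] _ r0(2)]) simp
    show "norm (S ?h x) powr p <= norm (conv \<rho> ?h (?y x)) powr p" for x
     using p0 by (auto simp: S_def indicator_def)
   qed
   also have "\<dots> = (1 / r) ^ DIM('a) * NP p (conv \<rho> ?h)"
    unfolding NP_def by (rule lborel_dilation(2)[OF conv_Lr(1)[OF \<rho> hi lpD(3)[OF lh] p] _ r0(2)]) simp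
   also have "\<dots> <= b * e1"
   proof (rule mult_mono)
    have "1 / r <= 2" using r0 by (simp add: field_simps)
    then show "(1 / r) ^ DIM('a) <= b" unfolding b_def using r0 by (intro power_mono) auto
    have "NP p (conv \<rho> ?h) <= NP p ?h" unfolding NP_def by (rule conv_Lr(2)[OF \<rho> hi lpD(3)[OF lh] p])
    then show "NP p (conv \<rho> ?h) <= e1" using w(3) by simp
   qed (use ab NP_nonneg in auto)
   finally show ?thesis .
  qed
  have 2: "NP p (%x. S w x - w x) <= e / (2 * (a * a))"
  proof -
   have "NP p (%x. S w x - w x) <= (LBINT x. s powr p * ch x)"
    unfolding NP_def
   proof (rule integral_mono)
    show "integrable lborel (%x. norm (S w x - w x) powr p)" by (rule lpD(3)[OF lp_diff(1)[OF Slp[OF wi] lw p0(2)]])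
    show "integrable lborel (%x. s powr p * ch x)" using ind_integrable by simp
    fix x
    show "norm (S w x - w x) powr p <= s powr p * ch x"
    proof (cases "x \<in> \<Omega>")
     case True
     have "norm (conv \<rho> w (?y x) - w x) <= s"
     proof (rule conv_close[OF \<rho> wi])
      fix z assume z: "norm (z - ?y x) < \<delta>"
      have "z - x = (z - ?y x) + (1 - r) *\<^sub>R (x0 - x)" by (simp add: algebra_simps)
      then have "norm (z - x) <= norm (z - ?y x) + norm ((1 - r) *\<^sub>R (x0 - x))" by (metis norm_triangle_ineq)
      also have "\<dots> <= d / 2 + t * D"
      proof (rule add_mono)
       show "norm (z - ?y x) <= d / 2" using z \<delta> t by linarith
       have "norm ((1 - r) *\<^sub>R (x0 - x)) = (1 - r) * norm (x - x0)" using r by (simp add: norm_minus_commute)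
       also have "\<dots> <= t * D" using D(1)[OF True] r by (intro mult_mono) auto
       finally show "norm ((1 - r) *\<^sub>R (x0 - x)) <= t * D" .
      qed
      finally have "norm (z - x) <= d" using t by linarith
      then show "norm (w z - w x) <= s" by (rule d(2))
     qed
     then show ?thesis using True p0 by (simp add: S_def powr_mono2)
    qed (use w(2) in \<open>simp add: S_def\<close>)
   qed
   also have "\<dots> = s powr p * vol" using ind_integrable by (simp add: vol_def)
   finally show ?thesis using s(2) by linarith
  qed
  have "NP p (%x. S f x - f x) <= a * (NP p (%x. S f x - S w x) + NP p (%x. S w x - f x))"
   unfolding a_def by (rule NP_tri[OF Slp[OF fi] Slp[OF wi] f p0(2)])
  also have "\<dots> <= a * (b * e1 + a * (e / (2 * (a * a)) + e1))"
  proof (intro mult_left_mono add_mono 1)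
   have "NP p (%x. S w x - f x) <= a * (NP p (%x. S w x - w x) + NP p (%x. w x - f x))"
    unfolding a_def by (rule NP_tri[OF Slp[OF wi] lw f p0(2)])
   also have "\<dots> <= a * (e / (2 * (a * a)) + e1)" using 2 w(3) ab by (intro mult_left_mono add_mono) auto
   finally show "NP p (%x. S w x - f x) <= a * (e / (2 * (a * a)) + e1)" .
  qed (use ab in auto)
  also have "\<dots> = e1 * (a * b + a * a) + e / 2" using ab by (simp add: field_simps)
  also have "e1 * (a * b + a * a) = e / 2"
  proof -
   have "e1 * (2 * (a * b + a * a)) = e" unfolding e1_def using den by (metis less_irrefl nonzero_eq_divide_eq)
   then show ?thesis by (simp add: algebra_simps)
  qed
  finally have "NP p (%x. S f x - f x) <= e" by simp
  then show "lp p (%x. ch x *\<^sub>R conv \<rho> f (?y x)) & NP p (%x. ch x *\<^sub>R conv \<rho> f (?y x) - f x) <= e"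
   using Slp[OF fi] by (simp add: S_def[abs_def])
 qed
qed

text \<open>The dilated point is a convex combination of \<open>x\<close> and \<open>x0\<close>, so
  displacing it by \<open>v\<close> amounts to displacing \<open>x0\<close> by
  \<open>v / (1 - r)\<close>, which stays in the ball.\<close>

lemma dil_ball:
 assumes "ball x0 R \<subseteq> \<Omega>" "x \<in> \<Omega>" "0 < r" "r < 1" "norm (z - ((x0 - r *\<^sub>R x0) + r *\<^sub>R x)) < (1 - r) * R"
 shows "z \<in> \<Omega>"
proof -
 define v where "v = z - ((x0 - r *\<^sub>R x0) + r *\<^sub>R x)"
 define y where "y = x0 + (1 / (1 - r)) *\<^sub>R v"
 have "norm ((1 / (1 - r)) *\<^sub>R v) = norm v / (1 - r)" using assms(4) by simp
 then have "norm ((1 / (1 - r)) *\<^sub>R v) < R" using assms(4,5) unfolding v_def[symmetric] by (simp add: pos_divide_less_eq mult.commute)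
 then have "y \<in> ball x0 R" by (simp add: y_def dist_norm)
 then have "r *\<^sub>R x + (1 - r) *\<^sub>R y \<in> \<Omega>" using assms by (intro convexD[OF cv]) auto
 also have "r *\<^sub>R x + (1 - r) *\<^sub>R y = r *\<^sub>R x + ((1 - r) *\<^sub>R x0 + v)" using assms(4) by (simp add: y_def scaleR_add_right)
 also have "\<dots> = z" by (simp add: v_def algebra_simps)
 finally show ?thesis .
qed

definition wg :: "('a => real) => ('a => 'a) => bool" where
 "wg \<phi> g \<longleftrightarrow> (\<forall>\<eta> G. C1_gradient \<eta> G & compact (closure {x. \<eta> x ~= 0}) & closure {x. \<eta> x ~= 0} \<subseteq> \<Omega> -->
  (LBINT x. \<phi> x *\<^sub>R G x) = - (LBINT x. \<eta> x *\<^sub>R g x))"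

lemma mollifier_test:
 assumes \<rho>: "mollifier \<delta> \<rho> gr" and b: "cball y \<delta> \<subseteq> S"
 shows "C1_gradient (%z. \<rho> (y - z)) (%z. - gr (y - z))" "compact (closure {z. \<rho> (y - z) ~= 0})"
  "closure {z. \<rho> (y - z) ~= 0} \<subseteq> S"
proof -
 show "C1_gradient (%z. \<rho> (y - z)) (%z. - gr (y - z))"
  using C1_affine[of \<rho> gr y "-1"] \<rho> by (simp add: mollifier_def)
 have "{z. \<rho> (y - z) ~= 0} \<subseteq> cball y \<delta>"
  using \<rho> by (auto simp: mollifier_def dist_norm) (metis linear)
 then have c: "closure {z. \<rho> (y - z) ~= 0} \<subseteq> cball y \<delta>" by (simp add: closure_minimal)
 then show "compact (closure {z. \<rho> (y - z) ~= 0})"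
  by (meson bounded_cball bounded_subset closed_closure compact_eq_bounded_closed)
 show "closure {z. \<rho> (y - z) ~= 0} \<subseteq> S" using c b by auto
qed

text \<open>Mollification commutes with the weak gradient only where the kernel is supported in
  \<open>\<Omega>\<close>. Dilating towards an interior point of the convex set brings all
  evaluation points far enough inside, at the price of the factor \<open>r\<close> from the chain
  rule.\<close>

lemma smooth_approx:
 assumes wg: "wg \<phi> g" and \<phi>: "lp 1 \<phi>" and g: "lp p g" and p: "1 <= p" and e: "0 < e"
 obtains \<eta> G where "C1_gradient \<eta> G" "NP p (%x. ch x *\<^sub>R G x - g x) <= e"
  "NP 1 (%x. ch x *\<^sub>R \<eta> x - \<phi> x) <= e"
proof -
 have p0: "0 < p" "0 <= p" using p by auto
 obtain x0 R where x0: "x0 \<in> \<Omega>" "0 < R" "ball x0 R \<subseteq> \<Omega>" using ne op by (meson ex_in_conv open_contains_ball)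
 define a where "a = 2 powr p"
 have a: "0 < a" by (simp add: a_def)
 obtain t1 where t1: "0 < t1" "!!r \<delta> \<rho> gr. 1 - t1 < r ==> r <= 1 ==> \<delta> < t1 ==> mollifier \<delta> \<rho> gr ==>
  lp p (%x. ch x *\<^sub>R conv \<rho> g ((x0 - r *\<^sub>R x0) + r *\<^sub>R x)) \<and>
  NP p (%x. ch x *\<^sub>R conv \<rho> g ((x0 - r *\<^sub>R x0) + r *\<^sub>R x) - g x) <= e / (2 * a)"
  using conv_dil_approx[OF g p _ x0(1), of "e / (2 * a)"] e a by auto
 obtain t2 where t2: "0 < t2" "!!r \<delta> \<rho> gr. 1 - t2 < r ==> r <= 1 ==> \<delta> < t2 ==> mollifier \<delta> \<rho> gr ==>
  lp 1 (%x. ch x *\<^sub>R conv \<rho> \<phi> ((x0 - r *\<^sub>R x0) + r *\<^sub>R x)) \<and>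
  NP 1 (%x. ch x *\<^sub>R conv \<rho> \<phi> ((x0 - r *\<^sub>R x0) + r *\<^sub>R x) - \<phi> x) <= e"
  using conv_dil_approx[OF \<phi> order_refl e x0(1)] by blast
 obtain s where s: "0 < s" "s powr p * NP p g <= e / (2 * a)"
  using choose_s[of "e / (2 * a)" p "NP p g"] e a p0 NP_nonneg by (metis divide_pos_pos mult_pos_pos zero_less_numeral)
 define u where "u = min (min t1 t2) (min s 1) / 2"
 have u: "0 < u" "u < t1" "u < t2" "u <= s" "u < 1" using t1(1) t2(1) s(1) by (auto simp: u_def)
 define r where "r = 1 - u"
 have r: "1 - t1 < r" "1 - t2 < r" "r <= 1" "0 < r" "r < 1" "1 - r <= s" using u by (auto simp: r_def)
 define m where "m = min u (u * R)"
 define \<delta> where "\<delta> = m / 2"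
 have uR: "m <= u" "m <= u * R" "0 < m" using u x0(2) by (auto simp: m_def)
 have \<delta>: "0 < \<delta>" "\<delta> < t1" "\<delta> < t2" "\<delta> < (1 - r) * R"
  using u uR unfolding \<delta>_def r_def by (simp_all add: algebra_simps)
 obtain \<rho> :: "'a => real" and gr where \<rho>: "mollifier \<delta> \<rho> gr" using mollifier_exists[OF \<delta>(1)] by blast
 let ?y = "%x. (x0 - r *\<^sub>R x0) + r *\<^sub>R x"
 define \<eta> where "\<eta> x = conv \<rho> \<phi> (?y x)" for x
 define G where "G x = r *\<^sub>R (LBINT z. \<phi> z *\<^sub>R gr (?y x - z))" for x
 define A where "A x = ch x *\<^sub>R conv \<rho> g (?y x)" for x
 have A: "lp p A" "NP p (%x. A x - g x) <= e / (2 * a)" unfolding A_def[abs_def] using t1(2)[OF r(1,3) \<delta>(2) \<rho>] by auto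
 have GA: "ch x *\<^sub>R G x = r *\<^sub>R A x" for x
 proof (cases "x \<in> \<Omega>")
  case True
  \<comment> \<open>This inclusion makes the kernel centred at the dilated point an admissible test
    function.\<close>
  have "cball (?y x) \<delta> \<subseteq> \<Omega>"
  proof
   fix z assume "z \<in> cball (?y x) \<delta>"
   then have "norm (z - ?y x) < (1 - r) * R" using \<delta>(4) by (simp add: dist_norm norm_minus_commute)
   then show "z \<in> \<Omega>" by (rule dil_ball[OF x0(3) True r(4,5)])
  qed
  note mt = mollifier_test[OF \<rho> this]
  have "(LBINT z. \<phi> z *\<^sub>R (- gr (?y x - z))) = - (LBINT z. \<rho> (?y x - z) *\<^sub>R g z)"
   using wg mt unfolding wg_def by blast
  then have "(LBINT z. \<phi> z *\<^sub>R gr (?y x - z)) = conv \<rho> g (?y x)" by (simp add: conv_def)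
  then show ?thesis using True by (simp add: G_def A_def)
 qed (simp add: A_def)
 show ?thesis
 proof (rule that)
  show "C1_gradient \<eta> G" unfolding \<eta>_def[abs_def] G_def[abs_def]
   by (rule C1_affine[OF conv_C1[OF lp_1[OF \<phi>] \<rho>]])
  show "NP 1 (%x. ch x *\<^sub>R \<eta> x - \<phi> x) <= e" unfolding \<eta>_def by (rule t2(2)[OF r(2,3) \<delta>(3) \<rho>, THEN conjunct2])
  have "NP p (%x. ch x *\<^sub>R G x - g x) = NP p (%x. r *\<^sub>R (A x - g x) - (1 - r) *\<^sub>R g x)"
   unfolding GA by (simp add: algebra_simps)
  also have "\<dots> <= a * (NP p (%x. r *\<^sub>R (A x - g x)) + NP p (%x. (1 - r) *\<^sub>R g x))"
   unfolding a_def by (intro lp_diff(2) lp_scale(1) lp_diff(1) A(1) g p0)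
  also have "\<dots> = a * (\<bar>r\<bar> powr p * NP p (%x. A x - g x) + \<bar>1 - r\<bar> powr p * NP p g)"
   using lp_scale(2)[OF lp_diff(1)[OF A(1) g p0(2)], of r] lp_scale(2)[OF g, of "1 - r"] by simp
  also have "\<dots> <= a * (1 * (e / (2 * a)) + s powr p * NP p g)"
  proof (intro mult_left_mono add_mono mult_mono A(2))
   show "\<bar>r\<bar> powr p <= 1" using r p0 powr_mono2[of p r 1] by simp
   show "\<bar>1 - r\<bar> powr p <= s powr p" using r p0 by (intro powr_mono2) auto
  qed (use a NP_nonneg in auto)
  also have "\<dots> <= a * (e / (2 * a) + e / (2 * a))" using s(2) a by (intro mult_left_mono) auto
  also have "\<dots> = e" using a by simp
  finally show "NP p (%x. ch x *\<^sub>R G x - g x) <= e" .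
 qed
qed

text \<open>\<open>conv_dil_approx\<close> with \<open>r = 1\<close> says that mollifications
  converge in L1, and here they vanish on \<open>K\<close>.\<close>

lemma conv_zero_imp_zero:
 fixes h :: "'a => 'b::euclidean_space"
 assumes h: "lp 1 h" and d: "0 < d" and K: "K \<subseteq> \<Omega>" "K \<in> sets borel"
  and z: "!!\<delta> \<rho> gr y. \<delta> < d ==> mollifier \<delta> \<rho> gr ==> y \<in> K ==> conv \<rho> h y = 0"
 shows "AE x in lborel. x \<in> K --> h x = 0"
proof -
 obtain x0 where x0: "x0 \<in> \<Omega>" using ne by blast
 let ?k = "%x. indicator K x *\<^sub>R h x"
 have k: "lp 1 ?k"
 proof (rule lpI)
  show "integrable lborel (%x. norm (h x) powr 1)" by (rule lpD(3)[OF h])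
  show "?k \<in> borel_measurable borel" using lpD(1)[OF h] K(2) by measurable
 qed (use lpD(2)[OF h] in \<open>auto simp: indicator_def\<close>)
 have "NP 1 ?k <= 0 + e" if e: "0 < e" for e
 proof -
  obtain t where t: "0 < t" "!!r \<delta> \<rho> gr. 1 - t < r ==> r <= 1 ==> \<delta> < t ==> mollifier \<delta> \<rho> gr ==>
   lp 1 (%x. ch x *\<^sub>R conv \<rho> h ((x0 - r *\<^sub>R x0) + r *\<^sub>R x)) \<and>
   NP 1 (%x. ch x *\<^sub>R conv \<rho> h ((x0 - r *\<^sub>R x0) + r *\<^sub>R x) - h x) <= e"
   using conv_dil_approx[OF h _ e x0] by auto
  define \<delta> where "\<delta> = min t d / 2"
  have \<delta>: "0 < \<delta>" "\<delta> < t" "\<delta> < d" using t(1) d by (auto simp: \<delta>_def)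
  obtain \<rho> :: "'a => real" and gr where \<rho>: "mollifier \<delta> \<rho> gr" using mollifier_exists[OF \<delta>(1)] by blast
  have 1: "lp 1 (%x. ch x *\<^sub>R conv \<rho> h x)" "NP 1 (%x. ch x *\<^sub>R conv \<rho> h x - h x) <= e"
   using t(2)[of 1, OF _ _ \<delta>(2) \<rho>] t(1) by auto
  have "NP 1 ?k <= NP 1 (%x. ch x *\<^sub>R conv \<rho> h x - h x)"
   unfolding NP_def
  proof (rule integral_mono)
   show "integrable lborel (%x. norm (?k x) powr 1)" by (rule lpD(3)[OF k])
   show "integrable lborel (%x. norm (ch x *\<^sub>R conv \<rho> h x - h x) powr 1)"
    by (rule lpD(3)[OF lp_diff(1)[OF 1(1) h]]) simp
   show "norm (?k x) powr 1 <= norm (ch x *\<^sub>R conv \<rho> h x - h x) powr 1" for x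
    using z[OF \<delta>(3) \<rho>, of x] K(1) by (cases "x \<in> K") auto
  qed
  then show ?thesis using 1(2) by simp
 qed
 then have "NP 1 ?k = 0" using field_le_epsilon[of "NP 1 ?k" 0] NP_nonneg[of 1 ?k] by auto
 from NP_zero_AE[OF k this] show ?thesis by eventually_elim (auto simp: indicator_def)
qed

end

section \<open>The Poincare inequality and limits of gradients\<close>

lemma continuous_on_abs_powr:
 "continuous_on S f ==> 0 < p ==> continuous_on S (%x. \<bar>f x :: real\<bar> powr p)"
 by (rule continuous_on_powr'[OF continuous_on_rabs continuous_on_const]) auto

context dom
begin

definition mean :: "('a => real) => real" where
 "mean f = (LBINT x. ch x *\<^sub>R f x) / vol"

lemma mean_diff:
 assumes "integrable lborel (%x. ch x *\<^sub>R f x)" "integrable lborel (%x. ch x *\<^sub>R g x)"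
 shows "mean (%x. f x - g x) = mean f - mean g"
 using assms by (simp add: mean_def diff_divide_distrib right_diff_distrib)

lemma average_powr_le:
 assumes c: "cont f" and p: "1 <= p"
 shows "(\<bar>(LBINT x. ch x *\<^sub>R f x)\<bar> / vol) powr p <= (LBINT x. ch x *\<^sub>R (\<bar>f x\<bar> powr p)) / vol"
proof -
 define t where "t = (LBINT x. ch x *\<^sub>R \<bar>f x\<bar>) / vol"
 have i1: "integrable lborel (%x. ch x *\<^sub>R \<bar>f x\<bar>)" by (rule SI_int) (intro continuous_intros c)
 have i2: "integrable lborel (%x. ch x *\<^sub>R (\<bar>f x\<bar> powr p))"
  by (rule SI_int[OF continuous_on_abs_powr[OF c]]) (use p in simp)
 have t0: "0 <= t" unfolding t_def using vol by (intro divide_nonneg_pos integral_nonneg_AE) auto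
 have "\<bar>(LBINT x. ch x *\<^sub>R f x)\<bar> <= (LBINT x. norm (ch x *\<^sub>R f x))"
  unfolding real_norm_def[symmetric] by (rule integral_norm_bound)
 also have "\<dots> = t * vol" using vol by (simp add: t_def abs_mult)
 finally have le: "\<bar>(LBINT x. ch x *\<^sub>R f x)\<bar> / vol <= t" using vol by (simp add: field_simps)
 have "t powr p * vol = (LBINT x. (t powr p - p * t powr (p - 1) * t) * ch x + p * t powr (p - 1) * (ch x *\<^sub>R \<bar>f x\<bar>))"
 proof -
  have "(LBINT x. (t powr p - p * t powr (p - 1) * t) * ch x + p * t powr (p - 1) * (ch x *\<^sub>R \<bar>f x\<bar>))
   = (t powr p - p * t powr (p - 1) * t) * vol + p * t powr (p - 1) * (LBINT x. ch x *\<^sub>R \<bar>f x\<bar>)"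
   using i1 ind_integrable by (simp add: vol_def)
  also have "(LBINT x. ch x *\<^sub>R \<bar>f x\<bar>) = t * vol" using vol by (simp add: t_def)
  finally show ?thesis by (simp add: algebra_simps)
 qed
 also have "\<dots> <= (LBINT x. ch x *\<^sub>R (\<bar>f x\<bar> powr p))"
 proof (rule integral_mono[OF _ i2])
  show "integrable lborel (%x. (t powr p - p * t powr (p - 1) * t) * ch x + p * t powr (p - 1) * (ch x *\<^sub>R \<bar>f x\<bar>))"
   using i1 ind_integrable by simp
  fix x
  show "(t powr p - p * t powr (p - 1) * t) * ch x + p * t powr (p - 1) * (ch x *\<^sub>R \<bar>f x\<bar>) <= ch x *\<^sub>R (\<bar>f x\<bar> powr p)"
   using powr_tangent[OF p _ t0, of "\<bar>f x\<bar>"] by (cases "x \<in> \<Omega>") (auto simp: algebra_simps)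
 qed
 finally have "t powr p <= (LBINT x. ch x *\<^sub>R (\<bar>f x\<bar> powr p)) / vol" using vol by (simp add: field_simps)
 moreover have "(\<bar>(LBINT x. ch x *\<^sub>R f x)\<bar> / vol) powr p <= t powr p"
  using le vol p by (intro powr_mono2) auto
 ultimately show ?thesis by linarith
qed

text \<open>The segment from \<open>(x + y) / 2\<close> to \<open>x\<close> stays away from \<open>y\<close>, so each map \<open>x \<mapsto> y + t (x - y)\<close> that occurs shrinks
  volumes by at most \<open>2\<^sup>d\<close>.\<close>

lemma poincare_midpoint:
 assumes \<eta>: "C1_gradient \<eta> G" "cc \<eta>" and p: "1 <= p" and y: "y \<in> \<Omega>"
  and D: "!!x x'. x \<in> \<Omega> ==> x' \<in> \<Omega> ==> norm (x - x') <= D" "0 < D"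
 shows "(LBINT x. ch x *\<^sub>R (\<bar>\<eta> x - \<eta> ((1/2) *\<^sub>R (x + y))\<bar> powr p))
  <= D powr p * 2 ^ DIM('a) * NP p (%x. ch x *\<^sub>R G x)"
proof (rule field_le_epsilon)
 fix e :: real assume e: "0 < e"
 have p0: "0 < p" "0 <= p" using p by auto
 let ?N = "NP p (%x. ch x *\<^sub>R G x)"
 obtain s where s: "0 < s" "s powr p * (D powr p * vol) <= e"
  using choose_s[OF e p0(1), of "D powr p * vol"] vol by (metis mult_nonneg_nonneg less_imp_le powr_ge_zero)
 have cG: "cc G" by (rule cc_C1_gradient[OF \<eta>])
 obtain d where d: "0 < d" "!!x y. norm (x - y) <= d ==> norm (G x - G y) <= s"
  using cc_uniformly_continuous[OF cG s(1)] by blast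
 \<comment> \<open>A subdivision of the segment so fine that the gradient varies by at most
   \<open>s\<close> along each piece.\<close>
 obtain n where n: "D / (2 * d) < real n" using reals_Archimedean2 by blast
 have n0: "0 < n" using n D d by (metis divide_pos_pos less_trans mult_pos_pos of_nat_0_less_iff zero_less_numeral)
 have nd: "D / (2 * real n) <= d" using n n0 d by (simp add: field_simps)
 define t where "t k = 1 / 2 + real k / (2 * real n)" for k
 have t1: "1 / 2 <= t k" for k using n0 by (simp add: t_def)
 have t2: "t k <= 1" if "k <= n" for k using that n0 by (simp add: t_def field_simps)
 define z where "z k x = (y - t k *\<^sub>R y) + t k *\<^sub>R x" for k x
 have zO: "z k x \<in> \<Omega>" if "x \<in> \<Omega>" "k <= n" for k x
 proof -
  have "(1 - t k) *\<^sub>R y + t k *\<^sub>R x \<in> \<Omega>" using t1[of k] t2[OF that(2)] that(1) y by (intro convexD[OF cv]) auto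
  then show ?thesis by (simp add: z_def scaleR_diff_left)
 qed
 define F where "F x = norm (ch x *\<^sub>R G x) powr p" for x
 have lG: "lp p (%x. ch x *\<^sub>R G x)" by (rule lp_cont[OF cc_cont[OF cG] p0(1)])
 have F: "integrable lborel F" "!!x. 0 <= F x" unfolding F_def using lpD(3)[OF lG] by auto
 have tp: "0 < t k" for k using t1[of k] by linarith
 have Fz: "integrable lborel (%x. F (z k x))" "(LBINT x. F (z k x)) <= 2 ^ DIM('a) * ?N" for k
 proof -
  show "integrable lborel (%x. F (z k x))" unfolding z_def by (rule lborel_dilation(1)[OF F tp])
  have "(LBINT x. F (z k x)) = (1 / t k) ^ DIM('a) * (LBINT x. F x)" unfolding z_def by (rule lborel_dilation(2)[OF F tp])
  also have "(LBINT x. F x) = ?N" by (simp add: F_def NP_def)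
  also have "(1 / t k) ^ DIM('a) * ?N <= 2 ^ DIM('a) * ?N"
  proof (rule mult_right_mono[OF power_mono NP_nonneg])
   show "1 / t k <= 2" using t1[of k] tp[of k] by (simp add: field_simps)
  qed (use tp[of k] in simp)
  finally show "(LBINT x. F (z k x)) <= 2 ^ DIM('a) * ?N" .
 qed
 have pt: "\<bar>\<eta> x - \<eta> ((1/2) *\<^sub>R (x + y))\<bar> powr p <= (\<Sum>k<n. D powr p * (F (z k x) + s powr p)) / real n" if x: "x \<in> \<Omega>" for x
 proof -
  define a where "a k = (D / 2) * (norm (G (z k x)) + s)" for k
  have step: "\<bar>\<eta> (z (Suc k) x) - \<eta> (z k x)\<bar> <= a k / real n" if k: "k < n" for k
  proof -
   define h where "h = (1 / (2 * real n)) *\<^sub>R (x - y)"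
   have zs: "z (Suc k) x = z k x + h"
    by (simp add: z_def h_def t_def add_divide_distrib scaleR_add_left scaleR_diff_right)
   have nh: "norm h <= D / (2 * real n)" using D(1)[OF x y] n0 by (simp add: h_def divide_right_mono)
   obtain \<theta> where \<theta>: "0 < \<theta>" "\<theta> < 1" "\<eta> (z k x + h) - \<eta> (z k x) = G (z k x + \<theta> *\<^sub>R h) \<bullet> h" using C1_mvt[OF \<eta>(1)] by blast
   have "norm (\<theta> *\<^sub>R h) <= 1 * norm h" using \<theta> by (simp add: mult_left_le_one_le)
   then have "norm ((z k x + \<theta> *\<^sub>R h) - z k x) <= d" using nh nd by simp
   then have "norm (G (z k x + \<theta> *\<^sub>R h) - G (z k x)) <= s" by (rule d(2))
   then have g: "norm (G (z k x + \<theta> *\<^sub>R h)) <= norm (G (z k x)) + s" using norm_triangle_ineq2[of "G (z k x + \<theta> *\<^sub>R h)" "G (z k x)"] by linarith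
   have "\<bar>\<eta> (z (Suc k) x) - \<eta> (z k x)\<bar> <= norm (G (z k x + \<theta> *\<^sub>R h)) * norm h" unfolding zs \<theta>(3) by (rule Cauchy_Schwarz_ineq2)
   also have "\<dots> <= (norm (G (z k x)) + s) * (D / (2 * real n))" using g nh s by (intro mult_mono) auto
   also have "\<dots> = a k / real n" by (simp add: a_def)
   finally show ?thesis .
  qed
  have zn: "z n x = x" using n0 by (simp add: z_def t_def)
  have z0: "z 0 x = (1/2) *\<^sub>R (x + y)"
  proof -
   have "z 0 x = (1 - 1/2) *\<^sub>R y + (1/2) *\<^sub>R x" unfolding z_def t_def scaleR_diff_left by simp
   then show ?thesis by (simp add: scaleR_add_right)
  qed
  have "\<eta> x - \<eta> ((1/2) *\<^sub>R (x + y)) = (\<Sum>k<n. \<eta> (z (Suc k) x) - \<eta> (z k x))"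
   using sum_lessThan_telescope[of "%k. \<eta> (z k x)" n] zn z0 by simp
  also have "\<bar>\<dots>\<bar> <= (\<Sum>k<n. a k / real n)" using step by (intro order_trans[OF sum_abs] sum_mono) auto
  finally have "\<bar>\<eta> x - \<eta> ((1/2) *\<^sub>R (x + y))\<bar> <= (\<Sum>k<n. a k) / real n" by (simp add: sum_divide_distrib)
  then have "\<bar>\<eta> x - \<eta> ((1/2) *\<^sub>R (x + y))\<bar> powr p <= ((\<Sum>k<n. a k) / real n) powr p" using p0 by (intro powr_mono2) auto
  also have "\<dots> <= (\<Sum>k<n. a k powr p) / real n"
   using D(2) s(1) by (intro powr_mean_le p n0) (auto simp: a_def)
  also have "\<dots> <= (\<Sum>k<n. D powr p * (F (z k x) + s powr p)) / real n"
  proof (intro divide_right_mono sum_mono)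
   fix k assume "k \<in> {..<n}"
   then have F1: "F (z k x) = norm (G (z k x)) powr p" using zO[OF x, of k] by (simp add: F_def)
   have "a k powr p = (D / 2) powr p * norm (norm (G (z k x)) + s) powr p" unfolding a_def using D s by (subst powr_mult) auto
   also have "\<dots> <= (D / 2) powr p * (2 powr p * (norm (norm (G (z k x))) powr p + norm s powr p))"
    by (intro mult_left_mono powr_norm_add p0) auto
   also have "\<dots> = ((D / 2) * 2) powr p * (norm (G (z k x)) powr p + s powr p)" using D(2) s(1) by (subst powr_mult) auto
   finally show "a k powr p <= D powr p * (F (z k x) + s powr p)" using F1 by simp
  qed simp
  finally show ?thesis .
 qed
 have c1: "cont (%x. \<bar>\<eta> x - \<eta> ((1/2) *\<^sub>R (x + y))\<bar> powr p)"
  by (intro continuous_on_abs_powr continuous_on_diff cc_cont_compose[OF \<eta>(2)] continuous_intros p0)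
 have "(LBINT x. ch x *\<^sub>R (\<bar>\<eta> x - \<eta> ((1/2) *\<^sub>R (x + y))\<bar> powr p))
  <= (LBINT x. (\<Sum>k<n. D powr p * (F (z k x) + s powr p * ch x)) / real n)"
 proof (rule integral_mono[OF SI_int[OF c1]])
  show "integrable lborel (%x. (\<Sum>k<n. D powr p * (F (z k x) + s powr p * ch x)) / real n)"
   using Fz(1) ind_integrable by auto
  fix x
  show "ch x *\<^sub>R (\<bar>\<eta> x - \<eta> ((1/2) *\<^sub>R (x + y))\<bar> powr p) <= (\<Sum>k<n. D powr p * (F (z k x) + s powr p * ch x)) / real n"
   using pt[of x] F(2) by (cases "x \<in> \<Omega>") (auto intro!: divide_nonneg_nonneg sum_nonneg)
 qed
 also have "\<dots> = (\<Sum>k<n. D powr p * ((LBINT x. F (z k x)) + s powr p * vol)) / real n"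
  using Fz(1) ind_integrable by (simp add: vol_def)
 also have "\<dots> <= (\<Sum>k<n. D powr p * (2 ^ DIM('a) * ?N + s powr p * vol)) / real n"
  by (intro divide_right_mono sum_mono mult_left_mono add_right_mono Fz) auto
 also have "\<dots> = D powr p * (2 ^ DIM('a) * ?N + s powr p * vol)" using n0 by simp
 also have "\<dots> = D powr p * 2 ^ DIM('a) * ?N + s powr p * (D powr p * vol)" by (simp add: algebra_simps)
 finally show "(LBINT x. ch x *\<^sub>R (\<bar>\<eta> x - \<eta> ((1/2) *\<^sub>R (x + y))\<bar> powr p)) <= D powr p * 2 ^ DIM('a) * ?N + e"
  using s(2) by linarith
qed

text \<open>The values at \<open>x\<close> and \<open>y\<close> are compared through the midpoint.
  One part is controlled by integrating in one variable with the other fixed, the second with the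
  roles exchanged; averaging over \<open>y\<close> and Fubini's theorem combine them.\<close>

lemma poincare_cc:
 assumes \<eta>: "C1_gradient \<eta> G" "cc \<eta>" and p: "1 <= p"
  and D: "!!x x'. x \<in> \<Omega> ==> x' \<in> \<Omega> ==> norm (x - x') <= D" "0 < D"
 shows "NP p (%x. ch x *\<^sub>R (\<eta> x - mean \<eta>))
  <= 2 powr p * (2 * (D powr p * 2 ^ DIM('a))) * NP p (%x. ch x *\<^sub>R G x)"
proof -
 have p0: "0 < p" "0 <= p" using p by auto
 let ?N = "NP p (%x. ch x *\<^sub>R G x)"
 define K0 where "K0 = D powr p * 2 ^ DIM('a) * ?N"
 define A where "A x y = \<bar>\<eta> x - \<eta> ((1/2) *\<^sub>R (x + y))\<bar> powr p" for x y
 have cA1: "cont (%x. A x y)" for y unfolding A_def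
  by (intro continuous_on_abs_powr continuous_on_diff cc_cont_compose[OF \<eta>(2)] continuous_intros p0)
 have cA2: "cont (%y. A x y)" for x unfolding A_def
  by (intro continuous_on_abs_powr continuous_on_diff cc_cont_compose[OF \<eta>(2)] continuous_intros p0)
 have A1: "(LBINT x. ch x *\<^sub>R A x y) <= K0" if "y \<in> \<Omega>" for y
  unfolding A_def K0_def by (rule poincare_midpoint[OF \<eta> p that D])
 define al where "al x = (LBINT y. ch y *\<^sub>R A x y)" for x
 have "set_integrable lborel (\<Omega> \<times> \<Omega>) (%z. A (fst z) (snd z))"
 proof (rule cont_set_integrable)
  show "cont (%z. A (fst z) (snd z))" unfolding A_def
   by (intro continuous_on_abs_powr continuous_on_diff cc_cont_compose[OF \<eta>(2)] continuous_intros p0)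
 qed (use bd op in \<open>auto intro!: bounded_Times borel_open open_Times\<close>)
 then have ip: "integrable (lborel \<Otimes>\<^sub>M lborel) (%(x, y). ch x *\<^sub>R (ch y *\<^sub>R A x y))"
  unfolding set_integrable_def lborel_prod
  by (rule back_subst[of "integrable lborel"]) (auto simp: fun_eq_iff indicator_def)
 have iO: "integrable lborel (%x. ch x *\<^sub>R al x)"
  using lborel_pair.integrable_fst[OF ip] by (simp add: al_def)
 have alK: "(LBINT x. ch x *\<^sub>R al x) <= vol * K0"
 proof -
  have "(LBINT x. ch x *\<^sub>R al x) = (LBINT x. (LBINT y. ch x *\<^sub>R (ch y *\<^sub>R A x y)))"
   by (simp add: al_def)
  also have "\<dots> = (LBINT y. (LBINT x. ch x *\<^sub>R (ch y *\<^sub>R A x y)))"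
   by (rule lborel_pair.Fubini_integral[symmetric, OF ip])
  also have "\<dots> <= (LBINT y. ch y *\<^sub>R K0)"
  proof (rule integral_mono)
   show "integrable lborel (%y. (LBINT x. ch x *\<^sub>R (ch y *\<^sub>R A x y)))"
    by (rule lborel_pair.integrable_snd[OF ip])
   fix y
   show "(LBINT x. ch x *\<^sub>R (ch y *\<^sub>R A x y)) <= ch y *\<^sub>R K0"
    using A1[of y] by (cases "y \<in> \<Omega>") auto
  qed (use ind_integrable in simp)
  also have "\<dots> = vol * K0" using ind_integrable by (simp add: vol_def)
  finally show ?thesis .
 qed
 have pt: "\<bar>\<eta> x - mean \<eta>\<bar> powr p <= (2 powr p * (al x + K0)) / vol" if x: "x \<in> \<Omega>" for x
 proof -
  have c: "cont (%y. \<eta> x - \<eta> y)" by (intro continuous_intros cc_cont[OF \<eta>(2)])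
  have i\<eta>: "integrable lborel (%y. ch y *\<^sub>R \<eta> y)" by (rule SI_int[OF cc_cont[OF \<eta>(2)]])
  have "(LBINT y. ch y *\<^sub>R (\<eta> x - \<eta> y)) = \<eta> x * vol - mean \<eta> * vol"
   using i\<eta> ind_integrable vol by (simp add: right_diff_distrib mean_def vol_def)
  then have "\<bar>\<eta> x - mean \<eta>\<bar> = \<bar>(LBINT y. ch y *\<^sub>R (\<eta> x - \<eta> y))\<bar> / vol"
   using vol by (simp add: left_diff_distrib[symmetric] abs_mult)
  then have "\<bar>\<eta> x - mean \<eta>\<bar> powr p <= (LBINT y. ch y *\<^sub>R (\<bar>\<eta> x - \<eta> y\<bar> powr p)) / vol"
   using average_powr_le[OF c p] by simp
  also have "\<dots> <= (2 powr p * (al x + K0)) / vol"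
  proof (rule divide_right_mono)
   have iA: "integrable lborel (%y. ch y *\<^sub>R A x y)" "integrable lborel (%y. ch y *\<^sub>R A y x)"
    by (intro SI_int cA1 cA2)+
   have "(LBINT y. ch y *\<^sub>R (\<bar>\<eta> x - \<eta> y\<bar> powr p))
    <= (LBINT y. 2 powr p * (ch y *\<^sub>R A x y + ch y *\<^sub>R A y x))"
   proof (rule integral_mono)
    show "integrable lborel (%y. ch y *\<^sub>R (\<bar>\<eta> x - \<eta> y\<bar> powr p))"
     by (rule SI_int[OF continuous_on_abs_powr[OF c p0(1)]])
    fix y
    have "\<bar>\<eta> x - \<eta> y\<bar> powr p <= 2 powr p * (A x y + A y x)"
     using powr_norm_diff[OF p0(2), of "\<eta> x - \<eta> ((1/2) *\<^sub>R (x + y))" "\<eta> y - \<eta> ((1/2) *\<^sub>R (x + y))"]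
     by (simp add: A_def add.commute)
    then show "ch y *\<^sub>R (\<bar>\<eta> x - \<eta> y\<bar> powr p) <= 2 powr p * (ch y *\<^sub>R A x y + ch y *\<^sub>R A y x)"
     by (auto simp: indicator_def)
   qed (use iA in simp)
   also have "\<dots> = 2 powr p * (al x + (LBINT y. ch y *\<^sub>R A y x))" using iA by (simp add: al_def)
   also have "\<dots> <= 2 powr p * (al x + K0)" using A1[OF x] by (intro mult_left_mono add_left_mono) auto
   finally show "(LBINT y. ch y *\<^sub>R (\<bar>\<eta> x - \<eta> y\<bar> powr p)) <= 2 powr p * (al x + K0)" .
  qed (use vol in simp)
  finally show ?thesis .
 qed
 have "NP p (%x. ch x *\<^sub>R (\<eta> x - mean \<eta>))
  <= (LBINT x. (2 powr p * (ch x *\<^sub>R al x + K0 * ch x)) / vol)"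
  unfolding NP_def
 proof (rule integral_mono)
  show "integrable lborel (%x. norm (ch x *\<^sub>R (\<eta> x - mean \<eta>)) powr p)"
   by (rule lpD(3)[OF lp_cont[OF _ p0(1)]]) (intro continuous_intros cc_cont[OF \<eta>(2)])
  fix x
  show "norm (ch x *\<^sub>R (\<eta> x - mean \<eta>)) powr p <= (2 powr p * (ch x *\<^sub>R al x + K0 * ch x)) / vol"
   using pt[of x] p0 by (cases "x \<in> \<Omega>") auto
 qed (use iO ind_integrable in simp)
 also have "\<dots> = (2 powr p * ((LBINT x. ch x *\<^sub>R al x) + K0 * vol)) / vol"
  using iO ind_integrable by (simp add: vol_def)
 also have "\<dots> <= (2 powr p * (vol * K0 + K0 * vol)) / vol"
  using vol by (intro divide_right_mono mult_left_mono add_right_mono alK) auto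
 also have "\<dots> = 2 powr p * (2 * K0)" using vol by simp
 finally show ?thesis by (simp add: K0_def algebra_simps)
qed

lemma poincare:
 assumes p: "1 <= p"
 obtains K where "0 <= K" "!!\<eta> G. C1_gradient \<eta> G ==>
  NP p (%x. ch x *\<^sub>R (\<eta> x - mean \<eta>)) <= K * NP p (%x. ch x *\<^sub>R G x)"
proof -
 obtain B where B: "!!x. x \<in> \<Omega> ==> norm x <= B" using bd by (auto simp: bounded_iff)
 define D where "D = max 1 (2 * B)"
 have D: "norm (x - x') <= D" if "x \<in> \<Omega>" "x' \<in> \<Omega>" for x x'
  using B[OF that(1)] B[OF that(2)] norm_triangle_ineq4[of x x'] by (simp add: D_def)
 have D0: "0 < D" by (simp add: D_def)
 let ?K = "2 powr p * (2 * (D powr p * 2 ^ DIM('a)))"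
 show ?thesis
 proof (rule that[of ?K])
  fix \<eta> :: "'a => real" and G assume \<eta>: "C1_gradient \<eta> G"
  obtain \<xi> X where \<xi>: "C1_gradient \<xi> X" "cc \<xi>" "!!x. x \<in> \<Omega> ==> \<xi> x = \<eta> x" "!!x. x \<in> \<Omega> ==> X x = G x"
   using cutoff[OF \<eta> bd] by blast
  have e1: "(%x. ch x *\<^sub>R X x) = (%x. ch x *\<^sub>R G x)" using \<xi>(4) by (auto simp: fun_eq_iff indicator_def)
  have e2: "(%x. ch x *\<^sub>R \<xi> x) = (%x. ch x *\<^sub>R \<eta> x)" using \<xi>(3) by (auto simp: fun_eq_iff indicator_def)
  have e3: "mean \<xi> = mean \<eta>" unfolding mean_def e2 ..
  have e4: "(%x. ch x *\<^sub>R (\<xi> x - mean \<xi>)) = (%x. ch x *\<^sub>R (\<eta> x - mean \<eta>))"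
   unfolding e3 using \<xi>(3) by (auto simp: fun_eq_iff indicator_def)
  show "NP p (%x. ch x *\<^sub>R (\<eta> x - mean \<eta>)) <= ?K * NP p (%x. ch x *\<^sub>R G x)"
   using poincare_cc[OF \<xi>(1,2) p D D0] unfolding e1 e4 .
 qed simp
qed

lemma lp_grad: "C1_gradient \<eta> G ==> 0 < p ==> lp p (%x. ch x *\<^sub>R G x)"
 by (rule lp_cont[OF C1_gradient_cont])

lemma test_zero_outside:
 fixes \<psi> :: "'a => real"
 assumes "C1_gradient \<psi> H" "compact (closure {x. \<psi> x ~= 0})" "closure {x. \<psi> x ~= 0} \<subseteq> S"
 shows "cc \<psi>" "cc H" "x \<notin> S ==> \<psi> x = 0" "x \<notin> S ==> H x = 0"
proof -
 have sub: "\<psi> x = 0" if "x \<notin> closure {x. \<psi> x ~= 0}" for x using that closure_subset[of "{x. \<psi> x ~= 0}"] by auto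
 obtain B where B: "!!x. x \<in> closure {x. \<psi> x ~= 0} ==> norm x <= B" using compact_imp_bounded[OF assms(2)] by (auto simp: bounded_iff)
 show c: "cc \<psi>"
 proof (rule ccI[of _ B])
  show "cont \<psi>" by (rule C1_continuous[OF assms(1)])
  fix x :: 'a assume "B < norm x"
  then show "\<psi> x = 0" using sub[of x] B[of x] by fastforce
 qed
 show "cc H" by (rule cc_C1_gradient[OF assms(1) c])
 show "x \<notin> S ==> \<psi> x = 0" using sub assms(3) by blast
 show "H x = 0" if "x \<notin> S"
 proof (rule C1_gradient_zero_outside[OF assms(1)])
  show "open (- closure {x. \<psi> x ~= 0})" by (rule open_Compl[OF closed_closure])
  show "\<psi> y = 0" if "y \<in> - closure {x. \<psi> x ~= 0}" for y by (rule sub) (use that in blast)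
  show "x \<in> - closure {x. \<psi> x ~= 0}" using that assms(3) by blast
 qed
qed

lemma cc_product_integrable:
 fixes g :: "'a => 'b::euclidean_space"
 assumes "integrable lborel f" "cc H" shows "integrable lborel (%x. f x *\<^sub>R (H x :: 'b))"
 using conv_vec_integrable[OF assms(1) cc_reflect[OF assms(2), of 0], of 0] by simp

lemma cc_product_integrable':
 fixes g :: "'a => 'b::euclidean_space"
 assumes "integrable lborel g" "cc \<psi>" shows "integrable lborel (%x. \<psi> x *\<^sub>R g x)"
 using conv_integrable[OF assms(1) cc_reflect[OF assms(2), of 0], of 0] by simp

text \<open>After subtraction of the means the Poincare inequality makes the approximating
  potentials a Cauchy sequence. Their limit inherits the integration by parts formula because both
  sides are continuous against a fixed test function.\<close>

lemma gradient_limit: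
 assumes g: "lp p g" and p: "1 < p"
  and ap: "!!e. 0 < e ==> \<exists>\<eta> G. C1_gradient \<eta> G & NP p (%x. ch x *\<^sub>R G x - g x) <= e"
 obtains \<phi> where "lp p \<phi>" "wg \<phi> g"
proof -
 have p0: "0 < p" "0 <= p" "1 <= p" using p by auto
 obtain K where K: "0 <= K" "!!\<eta> G. C1_gradient \<eta> G ==>
  NP p (%x. ch x *\<^sub>R (\<eta> x - mean \<eta>)) <= K * NP p (%x. ch x *\<^sub>R G x)" using poincare[OF p0(3)] by blast
 have "\<exists>E. C1_gradient (fst E) (snd E) & NP p (%x. ch x *\<^sub>R snd E x - g x) <= 1 / real (Suc n)" for n
  using ap[of "1 / real (Suc n)"] by auto
 then obtain E where E: "!!n. C1_gradient (fst (E n)) (snd (E n))" "!!n. NP p (%x. ch x *\<^sub>R snd (E n) x - g x) <= 1 / real (Suc n)"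
  by metis
 define \<eta> where "\<eta> n = fst (E n)" for n
 define G where "G n = snd (E n)" for n
 have C1: "C1_gradient (\<eta> n) (G n)" and Gn: "NP p (%x. ch x *\<^sub>R G n x - g x) <= 1 / real (Suc n)" for n
  using E by (auto simp: \<eta>_def G_def)
 define f where "f n x = ch x *\<^sub>R (\<eta> n x - mean (\<eta> n))" for n x
 have f: "lp p (f n)" for n unfolding f_def[abs_def]
  by (intro lp_cont p0 continuous_intros C1_continuous[OF C1])
 define a where "a = 2 powr p"
 have a: "0 < a" by (simp add: a_def)
 have lG: "lp p (%x. ch x *\<^sub>R G n x)" for n by (rule lp_grad[OF C1 p0(1)])
 have fd: "NP p (%x. f m x - f n x) <= K * a * (1 / real (Suc m) + 1 / real (Suc n))" for m n
 proof -
  have i: "integrable lborel (%x. ch x *\<^sub>R \<eta> k x)" for k by (rule SI_int[OF C1_continuous[OF C1]])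
  have "NP p (%x. f m x - f n x) = NP p (%x. ch x *\<^sub>R ((\<eta> m x - \<eta> n x) - mean (%x. \<eta> m x - \<eta> n x)))"
   by (simp add: f_def mean_diff[OF i i] algebra_simps)
  also have "\<dots> <= K * NP p (%x. ch x *\<^sub>R (G m x - G n x))" by (rule K(2)[OF C1_diff[OF C1 C1]])
  also have "NP p (%x. ch x *\<^sub>R (G m x - G n x)) <= a * (NP p (%x. ch x *\<^sub>R G m x - g x) + NP p (%x. g x - ch x *\<^sub>R G n x))"
   using NP_tri[OF lG g lG p0(2), of m n] by (simp add: a_def scaleR_diff_right)
  also have "\<dots> <= a * (1 / real (Suc m) + 1 / real (Suc n))"
   using Gn[of m] Gn[of n] a NP_swap[of p g] by (intro mult_left_mono add_mono) auto
  finally show ?thesis using K(1) by (simp add: mult_left_mono mult.assoc)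
 qed
 obtain \<phi> where \<phi>: "lp p \<phi>" "(%n. NP p (%x. f n x - \<phi> x)) \<longlonglongrightarrow> 0"
  using riesz_fischer_rate[OF f p0(3) mult_nonneg_nonneg[OF K(1) less_imp_le[OF a]] fd] by blast
 have "wg \<phi> g"
  unfolding wg_def
 proof (intro allI impI, elim conjE)
  fix \<psi> :: "'a => real" and H assume \<psi>: "C1_gradient \<psi> H" and t: "compact (closure {x. \<psi> x ~= 0})" "closure {x. \<psi> x ~= 0} \<subseteq> \<Omega>"
  note z = test_zero_outside[OF \<psi> t]
  define q where "q = p / (p - 1)"
  have q0: "0 < q" using p by (simp add: q_def)
  note \<phi>i = lp_integrable[OF \<phi>(1) p0(3)] and gi = lp_integrable[OF g p0(3)]
  show "(LBINT x. \<phi> x *\<^sub>R H x) = - (LBINT x. \<psi> x *\<^sub>R g x)"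
  proof (rule euclidean_eqI)
   fix i :: 'a assume i: "i \<in> Basis"
   have h1: "lp q (%x. H x \<bullet> i)" by (rule lp_cc[OF cc_inner_left[OF z(2) continuous_on_const] _ q0]) (simp add: z(4))
   have h2: "lp q (%x. \<psi> x *\<^sub>R i)" by (rule lp_cc[OF cc_scaleR_right[OF z(1) continuous_on_const] _ q0]) (simp add: z(3))
   have "\<bar>(LBINT x. \<phi> x \<bullet> (H x \<bullet> i)) + (LBINT x. g x \<bullet> (\<psi> x *\<^sub>R i))\<bar> <= 0 + e" if e: "0 < e" for e
   proof -
    obtain d1 where d1: "0 < d1" "!!f. lp p f ==> NP p f <= d1 ==> \<bar>(LBINT x. f x \<bullet> (H x \<bullet> i))\<bar> <= e / 2"
     using small_pairing[OF h1 p q_def half_gt_zero[OF e]] by blast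
    obtain d2 where d2: "0 < d2" "!!f. lp p f ==> NP p f <= d2 ==> \<bar>(LBINT x. f x \<bullet> (\<psi> x *\<^sub>R i))\<bar> <= e / 2"
     using small_pairing[OF h2 p q_def half_gt_zero[OF e]] by blast
    have "\<forall>\<^sub>F n in sequentially. NP p (%x. f n x - \<phi> x) < d1" by (rule order_tendstoD(2)[OF \<phi>(2) d1(1)])
    then obtain n1 where n1: "!!n. n1 <= n ==> NP p (%x. f n x - \<phi> x) < d1" by (auto simp: eventually_sequentially)
    obtain n2 where n2: "inverse (real (Suc n2)) < d2" using reals_Archimedean[OF d2(1)] by blast
    define n where "n = max n1 n2"
    have "1 / real (Suc n) <= 1 / real (Suc n2)" by (intro divide_left_mono) (auto simp: n_def)
    then have Gd: "NP p (%x. ch x *\<^sub>R G n x - g x) <= d2" using Gn[of n] n2 by (simp add: inverse_eq_divide)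
    have "NP p (%x. f n x - \<phi> x) < d1" by (rule n1) (simp add: n_def)
    then have 1: "\<bar>(LBINT x. (f n x - \<phi> x) \<bullet> (H x \<bullet> i))\<bar> <= e / 2" by (intro d1(2) lp_diff(1) f \<phi>(1) p0) simp
    have 2: "\<bar>(LBINT x. (ch x *\<^sub>R G n x - g x) \<bullet> (\<psi> x *\<^sub>R i))\<bar> <= e / 2" by (intro d2(2) lp_diff(1) lG g p0 Gd)
    have ibp: "(LBINT x. f n x \<bullet> (H x \<bullet> i)) = - (LBINT x. (ch x *\<^sub>R G n x) \<bullet> (\<psi> x *\<^sub>R i))"
    proof -
     have C: "C1_gradient (%x. \<eta> n x - mean (\<eta> n)) (G n)" by (rule C1_diff_const[OF C1])
     have i1: "integrable lborel (%x. (\<eta> n x - mean (\<eta> n)) *\<^sub>R H x)"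
      by (rule cc_integrable[OF cc_scaleR_left[OF C1_continuous[OF C] z(2)]])
     have i2: "integrable lborel (%x. \<psi> x *\<^sub>R G n x)"
      by (rule cc_integrable[OF cc_scaleR_right[OF z(1) C1_gradient_cont[OF C]]])
     have "(LBINT x. f n x \<bullet> (H x \<bullet> i)) = (LBINT x. ((\<eta> n x - mean (\<eta> n)) *\<^sub>R H x) \<bullet> i)"
      by (intro bint_cong refl) (use z(4) in \<open>auto simp: f_def indicator_def\<close>)
     also have "\<dots> = (LBINT x. (\<eta> n x - mean (\<eta> n)) *\<^sub>R H x) \<bullet> i" by (rule integral_inner_left[OF i1])
     also have "(LBINT x. (\<eta> n x - mean (\<eta> n)) *\<^sub>R H x) = - (LBINT x. \<psi> x *\<^sub>R G n x)" by (rule integration_by_parts[OF C \<psi> z(1)])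
     also have "- (LBINT x. \<psi> x *\<^sub>R G n x) \<bullet> i = - (LBINT x. (\<psi> x *\<^sub>R G n x) \<bullet> i)"
      unfolding inner_minus_left integral_inner_left[OF i2] ..
     also have "(LBINT x. (\<psi> x *\<^sub>R G n x) \<bullet> i) = (LBINT x. (ch x *\<^sub>R G n x) \<bullet> (\<psi> x *\<^sub>R i))"
      by (intro bint_cong refl) (use z(3) in \<open>auto simp: indicator_def\<close>)
     finally show ?thesis .
    qed
    have s1: "(LBINT x. (f n x - \<phi> x) \<bullet> (H x \<bullet> i)) = (LBINT x. f n x \<bullet> (H x \<bullet> i)) - (LBINT x. \<phi> x \<bullet> (H x \<bullet> i))"
     unfolding inner_diff_left by (rule bint_diff) (intro lp_inner(1)[OF _ h1 p q_def] f \<phi>(1))+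
    have s2: "(LBINT x. (ch x *\<^sub>R G n x - g x) \<bullet> (\<psi> x *\<^sub>R i))
     = (LBINT x. (ch x *\<^sub>R G n x) \<bullet> (\<psi> x *\<^sub>R i)) - (LBINT x. g x \<bullet> (\<psi> x *\<^sub>R i))"
     unfolding inner_diff_left by (rule bint_diff) (intro lp_inner(1)[OF _ h2 p q_def] lG g)+
    show ?thesis using 1 2 ibp s1 s2 by linarith
   qed
   then have "\<bar>(LBINT x. \<phi> x \<bullet> (H x \<bullet> i)) + (LBINT x. g x \<bullet> (\<psi> x *\<^sub>R i))\<bar> <= 0" by (rule field_le_epsilon)
   then have z0: "(LBINT x. \<phi> x \<bullet> (H x \<bullet> i)) = - (LBINT x. g x \<bullet> (\<psi> x *\<^sub>R i))" by linarith
   have "(LBINT x. \<phi> x *\<^sub>R H x) \<bullet> i = (LBINT x. \<phi> x \<bullet> (H x \<bullet> i))"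
    using integral_inner_left[OF cc_product_integrable[OF \<phi>i z(2)], of i] by simp
   moreover have "(LBINT x. \<psi> x *\<^sub>R g x) \<bullet> i = (LBINT x. g x \<bullet> (\<psi> x *\<^sub>R i))"
    using integral_inner_left[OF cc_product_integrable'[OF gi z(1)], of i] by (simp add: mult.commute)
   ultimately show "(LBINT x. \<phi> x *\<^sub>R H x) \<bullet> i = - (LBINT x. \<psi> x *\<^sub>R g x) \<bullet> i" using z0 by simp
  qed
 qed
 with \<phi>(1) show ?thesis by (rule that)
qed

text \<open>Smooth approximations of \<open>\<phi>\<close> have small gradients, hence are close to
  their means by the Poincare inequality, and these means converge to that of
  \<open>\<phi>\<close>.\<close>

lemma wg_zero_const:
 assumes w: "wg \<phi> (%x. 0)" and \<phi>: "lp 1 \<phi>"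
 shows "AE x in lborel. x \<in> \<Omega> --> \<phi> x = mean \<phi>"
proof -
 define c where "c = mean \<phi>"
 obtain K where K: "0 <= K" "!!\<eta> G. C1_gradient \<eta> G ==>
  NP 1 (%x. ch x *\<^sub>R (\<eta> x - mean \<eta>)) <= K * NP 1 (%x. ch x *\<^sub>R G x)" using poincare[of 1] by auto
 have l0: "lp 1 (%x. 0 :: 'a)" by (rule lp_zero) simp
 have lc: "lp 1 (%x. ch x *\<^sub>R f x)" if "cont f" for f :: "'a => real" by (rule lp_cont[OF that]) simp
 note lcc = lc[OF continuous_on_const]
 have main: "NP 1 (%x. \<phi> x - ch x *\<^sub>R c) <= (6 + 4 * K) * e" if e: "0 < e" for e
 proof -
  obtain \<eta> G where \<eta>: "C1_gradient \<eta> G" "NP 1 (%x. ch x *\<^sub>R G x - 0) <= e" "NP 1 (%x. ch x *\<^sub>R \<eta> x - \<phi> x) <= e"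
   using smooth_approx[OF w \<phi> l0 order_refl e] by blast
  note \<eta>c = C1_continuous[OF \<eta>(1), of UNIV]
  have i: "integrable lborel (%x. ch x *\<^sub>R \<eta> x)" by (rule SI_int[OF \<eta>c])
  have \<phi>O: "ch x *\<^sub>R \<phi> x = \<phi> x" for x using lpD(2)[OF \<phi>, of x] by (auto simp: indicator_def)
  have "(mean \<eta> - c) * vol = (LBINT x. ch x *\<^sub>R \<eta> x - \<phi> x)"
   using vol bint_diff[OF i lp_1[OF \<phi>]] unfolding c_def mean_def \<phi>O by (simp add: left_diff_distrib)
  then have "\<bar>mean \<eta> - c\<bar> * vol = \<bar>(LBINT x. ch x *\<^sub>R \<eta> x - \<phi> x)\<bar>" using vol by (metis abs_mult abs_of_pos)
  also have "\<dots> <= NP 1 (%x. ch x *\<^sub>R \<eta> x - \<phi> x)"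
   unfolding NP_1 real_norm_def[symmetric] by (rule integral_norm_bound)
  also note \<eta>(3)
  finally have m: "\<bar>mean \<eta> - c\<bar> * vol <= e" .
  have 3: "NP 1 (%x. ch x *\<^sub>R (mean \<eta>) - ch x *\<^sub>R c) <= e"
  proof -
   have "NP 1 (%x. ch x *\<^sub>R (mean \<eta>) - ch x *\<^sub>R c) = (LBINT x. \<bar>mean \<eta> - c\<bar> * ch x)"
    unfolding NP_1 by (intro bint_cong refl) (auto simp: indicator_def)
   then show ?thesis using m ind_integrable by (simp add: vol_def)
  qed
  have 2: "NP 1 (%x. ch x *\<^sub>R \<eta> x - ch x *\<^sub>R (mean \<eta>)) <= K * e"
   using order_trans[OF K(2)[OF \<eta>(1)] mult_left_mono[OF \<eta>(2)[unfolded diff_zero] K(1)]] by (simp add: scaleR_diff_right right_diff_distrib)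
  have "NP 1 (%x. ch x *\<^sub>R \<eta> x - ch x *\<^sub>R c) <= 2 * (K * e + e)"
   using NP_tri[OF lc[OF \<eta>c] lcc[of "mean \<eta>"] lcc[of c]] 2 3 by simp
  moreover have "NP 1 (%x. \<phi> x - ch x *\<^sub>R c) <= 2 * (NP 1 (%x. \<phi> x - ch x *\<^sub>R \<eta> x) + NP 1 (%x. ch x *\<^sub>R \<eta> x - ch x *\<^sub>R c))"
   using NP_tri[OF \<phi> lc[OF \<eta>c] lcc[of c]] by simp
  ultimately have "NP 1 (%x. \<phi> x - ch x *\<^sub>R c) <= 2 * (e + 2 * (K * e + e))" using \<eta>(3) NP_swap[of 1 \<phi>] by simp
  then show ?thesis by (simp add: algebra_simps)
 qed
 have "NP 1 (%x. \<phi> x - ch x *\<^sub>R c) <= 0 + e" if e: "0 < e" for e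
 proof -
  have k: "0 < 6 + 4 * K" using K by simp
  have "NP 1 (%x. \<phi> x - ch x *\<^sub>R c) <= (6 + 4 * K) * (e / (6 + 4 * K))" by (rule main) (use e k in simp)
  then show ?thesis using k by simp
 qed
 then have "NP 1 (%x. \<phi> x - ch x *\<^sub>R c) <= 0" by (rule field_le_epsilon)
 then have "NP 1 (%x. \<phi> x - ch x *\<^sub>R c) = 0" using NP_nonneg by (metis antisym)
 from NP_zero_AE[OF lp_diff(1)[OF \<phi> lcc] this] show ?thesis
  by (simp add: c_def) (erule eventually_mono, auto simp: indicator_def)
qed

end

section \<open>The projection onto gradients\<close>

lemma C1_cmult:
 assumes "C1_gradient g G" shows "C1_gradient (%x. c * g x) (%x. c *\<^sub>R G x)"
 using C1_mult[of "%_. c" "%_. 0" g G] assms by (simp add: C1_gradient_def GDERIV_const)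

lemma C1_add:
 assumes "C1_gradient f F" "C1_gradient g G"
 shows "C1_gradient (%x. f x + g x) (%x. F x + G x)"
 using assms unfolding C1_gradient_def by (auto intro!: GDERIV_add continuous_intros)

text \<open>With \<open>\<theta>\<close> as in \<open>proj_lp\<close> this is
  \<open>2 * K / \<theta>\<close>.\<close>

definition Kp :: "real => real => real" where
 "Kp p K = 2 * K / (1 / (2 * K)) powr (p - 1)"

context dom
begin

text \<open>The closure of the smooth gradients; for \<open>1 < p\<close>, \<open>wg_Gp\<close> and
  \<open>Gp_wg\<close> identify it with the weak gradients.\<close>

definition Gp :: "real => ('a => 'a) => bool" where
 "Gp p g \<longleftrightarrow> lp p g & (\<forall>e>0. \<exists>\<eta> G. C1_gradient \<eta> G & NP p (%x. ch x *\<^sub>R G x - g x) <= e)"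

definition orth :: "('a => 'a) => bool" where
 "orth v \<longleftrightarrow> (\<forall>\<zeta> Z. C1_gradient \<zeta> Z --> (LBINT x. v x \<bullet> (ch x *\<^sub>R Z x)) = 0)"

definition proj :: "('a => 'a) => ('a => 'a) => bool" where
 "proj u g \<longleftrightarrow> Gp 2 g & orth (%x. u x - g x)"

definition cs :: "('a => 'a) => bool" where
 "cs u \<longleftrightarrow> cc u & (\<forall>x. x \<notin> \<Omega> --> u x = 0)"

lemma cs_lp: "cs u ==> 0 < p ==> lp p u" using lp_cc[of u p] by (auto simp: cs_def)

lemma cs_diff: "cs u ==> cs v ==> cs (%x. u x - v x)" by (auto simp: cs_def cc_diff)

lemma GpD:
 assumes "Gp p g" shows "lp p g"
  "0 < e ==> \<exists>\<eta> G. C1_gradient \<eta> G & NP p (%x. ch x *\<^sub>R G x - g x) <= e"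
 using assms by (auto simp: Gp_def)

lemma Gp_diff:
 assumes f: "Gp p f" and g: "Gp p g" and p: "0 < p" shows "Gp p (%x. f x - g x)"
 unfolding Gp_def
proof (intro conjI allI impI)
 have p0: "0 <= p" using p by simp
 show "lp p (%x. f x - g x)" by (intro lp_diff(1) GpD f g p0)
 fix e :: real assume "0 < e"
 then have e': "0 < e / (2 * 2 powr p)" by simp
 obtain \<eta> G where 1: "C1_gradient \<eta> G" "NP p (%x. ch x *\<^sub>R G x - f x) <= e / (2 * 2 powr p)" using GpD(2)[OF f e'] by blast
 obtain \<eta>' G' where 2: "C1_gradient \<eta>' G'" "NP p (%x. ch x *\<^sub>R G' x - g x) <= e / (2 * 2 powr p)" using GpD(2)[OF g e'] by blast
 have "NP p (%x. ch x *\<^sub>R (G x - G' x) - (f x - g x)) = NP p (%x. (ch x *\<^sub>R G x - f x) - (ch x *\<^sub>R G' x - g x))"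
  by (simp add: algebra_simps)
 also have "\<dots> <= 2 powr p * (NP p (%x. ch x *\<^sub>R G x - f x) + NP p (%x. ch x *\<^sub>R G' x - g x))"
  by (intro lp_diff lp_grad[OF 1(1) p] lp_grad[OF 2(1) p] GpD(1) f g p0)
 also have "\<dots> <= 2 powr p * (e / (2 * 2 powr p) + e / (2 * 2 powr p))" using 1(2) 2(2) by (intro mult_left_mono add_mono) auto
 also have "\<dots> = e" by simp
 finally show "\<exists>\<eta> G. C1_gradient \<eta> G & NP p (%x. ch x *\<^sub>R G x - (f x - g x)) <= e"
  using C1_diff[OF 1(1) 2(1)] by blast
qed

lemma Gp_closed:
 assumes g: "lp p g" and p: "0 < p" and ap: "!!e. 0 < e ==> \<exists>h. Gp p h & NP p (%x. h x - g x) <= e"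
 shows "Gp p g"
 unfolding Gp_def
proof (intro conjI allI impI g)
 have p0: "0 <= p" using p by simp
 fix e :: real assume "0 < e"
 then have e': "0 < e / (2 * 2 powr p)" by simp
 obtain h where h: "Gp p h" "NP p (%x. h x - g x) <= e / (2 * 2 powr p)" using ap[OF e'] by blast
 obtain \<eta> G where 1: "C1_gradient \<eta> G" "NP p (%x. ch x *\<^sub>R G x - h x) <= e / (2 * 2 powr p)" using GpD(2)[OF h(1) e'] by blast
 have "NP p (%x. ch x *\<^sub>R G x - g x) <= 2 powr p * (NP p (%x. ch x *\<^sub>R G x - h x) + NP p (%x. h x - g x))"
  by (rule NP_tri[OF lp_grad[OF 1(1) p] GpD(1)[OF h(1)] g p0])
 also have "\<dots> <= 2 powr p * (e / (2 * 2 powr p) + e / (2 * 2 powr p))" using 1(2) h(2) by (intro mult_left_mono add_mono) auto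
 also have "\<dots> = e" by simp
 finally show "\<exists>\<eta> G. C1_gradient \<eta> G & NP p (%x. ch x *\<^sub>R G x - g x) <= e" using 1(1) by blast
qed

lemma wg_Gp: "wg \<phi> g ==> lp 1 \<phi> ==> lp p g ==> 1 <= p ==> Gp p g"
 unfolding Gp_def using smooth_approx[of \<phi> g p] by metis

lemma Gp_wg: "Gp p g ==> 1 < p ==> \<exists>\<phi>. lp p \<phi> & wg \<phi> g"
 using gradient_limit[of p g] by (metis GpD)

text \<open>Being a weak gradient does not mention an exponent: the L2 potential is integrable, and
  \<open>smooth_approx\<close> then works in the exponent to which \<open>g\<close> belongs.\<close>

lemma Gp_upgrade:
 assumes "Gp 2 g" "lp p g" "1 <= p" shows "Gp p g"
proof -
 obtain \<phi> where "lp 2 \<phi>" "wg \<phi> g" using Gp_wg[OF assms(1)] by auto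
 then show ?thesis using wg_Gp[OF _ lp_lower assms(2,3)] by simp
qed

lemma orth_lim:
 assumes p: "1 < p" and v: "lp p v" and ap: "!!e. 0 < e ==> \<exists>w. lp p w & orth w & NP p (%x. w x - v x) <= e"
 shows "orth v"
 unfolding orth_def
proof (intro allI impI)
 fix \<zeta> :: "'a => real" and Z assume Z: "C1_gradient \<zeta> Z"
 define q where "q = p / (p - 1)"
 have q: "0 < q" using p by (simp add: q_def)
 let ?z = "%x. ch x *\<^sub>R Z x"
 have z: "lp q ?z" by (rule lp_grad[OF Z q])
 have "\<bar>(LBINT x. v x \<bullet> ?z x)\<bar> <= 0 + e" if e: "0 < e" for e
 proof -
  obtain d where d: "0 < d" "!!f. lp p f ==> NP p f <= d ==> \<bar>(LBINT x. f x \<bullet> ?z x)\<bar> <= e"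
   using small_pairing[OF z p q_def e] by blast
  obtain w where w: "lp p w" "orth w" "NP p (%x. w x - v x) <= d" using ap[OF d(1)] by blast
  have "\<bar>(LBINT x. (w x - v x) \<bullet> ?z x)\<bar> <= e" by (intro d(2) lp_diff(1) w v) (use p in simp)
  moreover have "(LBINT x. (w x - v x) \<bullet> ?z x) = (LBINT x. w x \<bullet> ?z x) - (LBINT x. v x \<bullet> ?z x)"
   unfolding inner_diff_left by (rule bint_diff) (intro lp_inner(1)[OF _ z p q_def] w v)+
  moreover have "(LBINT x. w x \<bullet> ?z x) = 0" using w(2) Z unfolding orth_def by blast
  ultimately show ?thesis by simp
 qed
 then have "\<bar>(LBINT x. v x \<bullet> ?z x)\<bar> <= 0" by (rule field_le_epsilon)
 then show "(LBINT x. v x \<bullet> ?z x) = 0" by simp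
qed

lemma Gp_orth:
 assumes f: "Gp p f" and v: "lp q v" "orth v" and p: "1 < p" "q = p / (p - 1)"
 shows "(LBINT x. f x \<bullet> v x) = 0"
proof -
 have "\<bar>(LBINT x. f x \<bullet> v x)\<bar> <= 0 + e" if e: "0 < e" for e
 proof -
  obtain d where d: "0 < d" "!!f. lp p f ==> NP p f <= d ==> \<bar>(LBINT x. f x \<bullet> v x)\<bar> <= e"
   using small_pairing[OF v(1) p e] by blast
  obtain \<eta> G where 1: "C1_gradient \<eta> G" "NP p (%x. ch x *\<^sub>R G x - f x) <= d" using GpD(2)[OF f d(1)] by blast
  let ?z = "%x. ch x *\<^sub>R G x"
  have z: "lp p ?z" by (rule lp_grad[OF 1(1)]) (use p in simp)
  have "\<bar>(LBINT x. (?z x - f x) \<bullet> v x)\<bar> <= e" by (intro d(2) lp_diff(1) z GpD(1)[OF f] 1) (use p in simp)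
  moreover have "(LBINT x. (?z x - f x) \<bullet> v x) = (LBINT x. ?z x \<bullet> v x) - (LBINT x. f x \<bullet> v x)"
   unfolding inner_diff_left by (rule bint_diff) (intro lp_inner(1)[OF _ v(1) p] z GpD(1)[OF f])+
  moreover have "(LBINT x. v x \<bullet> ?z x) = 0" using v(2) 1(1) unfolding orth_def by blast
  moreover have "(LBINT x. ?z x \<bullet> v x) = (LBINT x. v x \<bullet> ?z x)"
   by (intro bint_cong refl) (rule inner_commute)
  ultimately show ?thesis by simp
 qed
 then have "\<bar>(LBINT x. f x \<bullet> v x)\<bar> <= 0" by (rule field_le_epsilon)
 then show ?thesis by simp
qed

lemma NP2: "NP 2 f = (LBINT x. f x \<bullet> f x)"
 unfolding NP_def by (intro bint_cong refl) (simp add: powr_numeral power2_norm_eq_inner)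

lemma lp2_inner: "lp 2 f ==> lp 2 g ==> integrable lborel (%x. f x \<bullet> g x)"
 by (rule lp_inner(1)[of 2 f 2 g]) auto

lemma NP2_add_scaled:
 assumes "lp 2 f" "lp 2 g"
 shows "NP 2 (%x. f x + s *\<^sub>R g x) = NP 2 f + 2 * s * (LBINT x. f x \<bullet> g x) + s^2 * NP 2 g"
proof -
 have "NP 2 (%x. f x + s *\<^sub>R g x) = (LBINT x. f x \<bullet> f x + (2 * s) * (f x \<bullet> g x) + s^2 * (g x \<bullet> g x))"
  unfolding NP2 by (intro bint_cong refl)
   (simp add: inner_add_left inner_add_right inner_commute power2_eq_square algebra_simps)
 then show ?thesis using lp2_inner[OF assms] lp2_inner[OF assms(1,1)] lp2_inner[OF assms(2,2)] by (simp add: NP2)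
qed

lemma NP2_diff:
 assumes "lp 2 f" "lp 2 g"
 shows "NP 2 (%x. f x - g x) = NP 2 f - 2 * (LBINT x. f x \<bullet> g x) + NP 2 g"
 using NP2_add_scaled[OF assms, of "- 1"] by simp

lemma parallelogram:
 assumes "lp 2 f" "lp 2 g"
 shows "NP 2 (%x. f x - g x) = 2 * NP 2 f + 2 * NP 2 g - 4 * NP 2 (%x. (1/2) *\<^sub>R (f x + g x))"
proof -
 have "NP 2 (%x. (1/2) *\<^sub>R (f x + g x)) = (1/4) * NP 2 (%x. f x + 1 *\<^sub>R g x)"
  using lp_scale(2)[OF lp_add(1)[OF assms], of "1/2"] by (simp add: powr_numeral power2_eq_square)
 then show ?thesis unfolding NP2_add_scaled[OF assms, of 1] NP2_diff[OF assms] by simp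
qed

text \<open>The projection theorem by hand: a minimising sequence is Cauchy by the parallelogram
  law, and the first variation at its limit vanishes.\<close>

lemma proj_exists:
 assumes u: "cs u"
 obtains g where "proj u g"
proof -
 have lu: "lp 2 u" by (rule cs_lp[OF u]) simp
 define J where "J Z = NP 2 (%x. ch x *\<^sub>R Z x - u x)" for Z
 define S where "S = {J Z | Z. \<exists>\<zeta>. C1_gradient \<zeta> Z}"
 define m where "m = Inf S"
 have C0: "C1_gradient (%x. 0 :: real) (%x. 0 :: 'a)" by (simp add: C1_gradient_def GDERIV_const)
 have S0: "S ~= {}" "bdd_below S" using C0 by (auto simp: S_def J_def intro!: bdd_belowI[of _ 0] NP_nonneg)
 have mJ: "m <= J Z" if "C1_gradient \<zeta> Z" for \<zeta> Z unfolding m_def by (rule cInf_lower[OF _ S0(2)]) (use that in \<open>auto simp: S_def\<close>)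
 have "\<exists>Z. (\<exists>\<zeta>. C1_gradient \<zeta> Z) & J Z < m + 1 / real (Suc n)" for n
  using cInf_lessD[OF S0(1), of "m + 1 / real (Suc n)"] by (auto simp: S_def m_def)
 then obtain G where G: "!!n. \<exists>\<zeta>. C1_gradient \<zeta> (G n)" "!!n. J (G n) < m + 1 / real (Suc n)" by metis
 define f where "f n x = ch x *\<^sub>R G n x" for n x
 have f: "lp 2 (f n)" for n unfolding f_def using G(1)[of n] lp_grad[of _ "G n" 2] by auto
 have fu: "lp 2 (%x. f n x - u x)" for n by (rule lp_diff(1)[OF f lu]) simp
 have Jf: "J (G n) = NP 2 (%x. f n x - u x)" for n by (simp only: J_def f_def)
 \<comment> \<open>An average of two gradients is a gradient, so it cannot fall below the
   infimum.\<close>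
 have avg: "m <= NP 2 (%x. (1/2) *\<^sub>R ((f i x - u x) + (f j x - u x)))" for i j
 proof -
  obtain \<zeta> \<zeta>' where z: "C1_gradient \<zeta> (G i)" "C1_gradient \<zeta>' (G j)" using G(1) by blast
  have "C1_gradient (%x. (1/2) * (\<zeta> x + \<zeta>' x)) (%x. (1/2) *\<^sub>R (G i x + G j x))"
   by (rule C1_cmult[OF C1_add[OF z]])
  from mJ[OF this] show ?thesis unfolding J_def f_def
   by (rule back_subst[of "%h. m <= NP 2 h"]) (auto simp: fun_eq_iff algebra_simps scaleR_2[symmetric] indicator_def)
 qed
 have fd: "NP 2 (%x. f i x - f j x) <= 2 * (1 / real (Suc i) + 1 / real (Suc j))" for i j
 proof -
  have "NP 2 (%x. f i x - f j x) = NP 2 (%x. (f i x - u x) - (f j x - u x))" by simp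
  also have "\<dots> <= 2 * NP 2 (%x. f i x - u x) + 2 * NP 2 (%x. f j x - u x) - 4 * m"
   unfolding parallelogram[OF fu fu] using avg[of i j] by simp
  also have "\<dots> <= 2 * (1 / real (Suc i) + 1 / real (Suc j))"
  proof -
   have "NP 2 (%x. f k x - u x) <= m + 1 / real (Suc k)" for k
    using less_imp_le[OF G(2)[of k]] unfolding J_def f_def .
   from this[of i] this[of j] have "2 * NP 2 (%x. f i x - u x) + 2 * NP 2 (%x. f j x - u x) - 4 * m <= 2 * (1 / real (Suc i)) + 2 * (1 / real (Suc j))"
    by linarith
   then show ?thesis by simp
  qed
  finally show ?thesis .
 qed
 obtain g where g: "lp 2 g" "(%n. NP 2 (%x. f n x - g x)) \<longlonglongrightarrow> 0"
  using riesz_fischer_rate[OF f _ _ fd] by auto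
 have "Gp 2 g"
  unfolding Gp_def
 proof (intro conjI allI impI g(1))
  fix e :: real assume "0 < e"
  from LIMSEQ_zero_less[OF g(2) this] obtain n where "NP 2 (%x. f n x - g x) < e" by blast
  then show "\<exists>\<eta> G. C1_gradient \<eta> G & NP 2 (%x. ch x *\<^sub>R G x - g x) <= e"
   using G(1)[of n] unfolding f_def by (meson less_imp_le)
 qed
 moreover have "orth (%x. u x - g x)"
  unfolding orth_def
 proof (intro allI impI)
  fix \<zeta> :: "'a => real" and Z assume Z: "C1_gradient \<zeta> Z"
  let ?z = "%x. ch x *\<^sub>R Z x"
  have z: "lp 2 ?z" by (rule lp_grad[OF Z]) simp
  define b where "b = (LBINT x. (g x - u x) \<bullet> ?z x)"
  have gu: "lp 2 (%x. g x - u x)" by (rule lp_diff(1)[OF g(1) lu]) simp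
  \<comment> \<open>Minimality is available only along the sequence, so the inequality for the
    variation by \<open>s\<close> is first recorded with an error \<open>e\<close>.\<close>
  have key: "0 <= 2 * s * b + s^2 * NP 2 ?z + e" if e: "0 < e" for s e
  proof -
   have e2: "0 < e / 2 / (2 * \<bar>s\<bar> + 1)" using e by (simp add: add_nonneg_pos)
   obtain d where d: "0 < d" "!!f. lp 2 f ==> NP 2 f <= d ==> \<bar>(LBINT x. f x \<bullet> ?z x)\<bar> <= e / 2 / (2 * \<bar>s\<bar> + 1)"
    using small_pairing[OF z _ _ e2, of 2] by auto
   obtain n1 where n1: "!!n. n1 <= n ==> NP 2 (%x. f n x - g x) < d" using order_tendstoD(2)[OF g(2) d(1)] by (auto simp: eventually_sequentially)
   obtain n2 where n2: "inverse (real (Suc n2)) < e / 2" using reals_Archimedean[of "e / 2"] e by auto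
   define n where "n = max n1 n2"
   have "1 / real (Suc n) <= 1 / real (Suc n2)" by (intro divide_left_mono) (auto simp: n_def)
   then have 1: "J (G n) <= m + e / 2" using G(2)[of n] n2 by (simp add: inverse_eq_divide)
   have "\<bar>(LBINT x. (f n x - g x) \<bullet> ?z x)\<bar> <= e / 2 / (2 * \<bar>s\<bar> + 1)"
    by (intro d(2) lp_diff(1) f g less_imp_le[OF n1]) (auto simp: n_def)
   then have 2: "(2 * \<bar>s\<bar>) * \<bar>(LBINT x. (f n x - g x) \<bullet> ?z x)\<bar> <= e / 2"
   proof -
    assume a: "\<bar>(LBINT x. (f n x - g x) \<bullet> ?z x)\<bar> <= e / 2 / (2 * \<bar>s\<bar> + 1)"
    have "(2 * \<bar>s\<bar>) * \<bar>(LBINT x. (f n x - g x) \<bullet> ?z x)\<bar> <= (2 * \<bar>s\<bar> + 1) * (e / 2 / (2 * \<bar>s\<bar> + 1))"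
     by (intro mult_mono a) auto
    also have "\<dots> = e / 2"
    proof -
     have "2 * \<bar>s\<bar> + 1 ~= 0" using abs_ge_zero[of s] by linarith
     then show ?thesis by (metis mult.commute nonzero_eq_divide_eq)
    qed
    finally show ?thesis .
   qed
   obtain \<xi> where \<xi>: "C1_gradient \<xi> (G n)" using G(1) by blast
   have "C1_gradient (%x. \<xi> x + s * \<zeta> x) (%x. G n x + s *\<^sub>R Z x)"
    by (rule C1_add[OF \<xi> C1_cmult[OF Z]])
   from mJ[OF this] have "m <= NP 2 (%x. (f n x - u x) + s *\<^sub>R ?z x)" unfolding J_def f_def
    by (rule back_subst[of "%h. m <= NP 2 h"]) (auto simp: fun_eq_iff algebra_simps)
   also have "\<dots> = J (G n) + 2 * s * (LBINT x. (f n x - u x) \<bullet> ?z x) + s^2 * NP 2 ?z"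
    unfolding NP2_add_scaled[OF fu z] Jf ..
   also have "(LBINT x. (f n x - u x) \<bullet> ?z x) = (LBINT x. (f n x - g x) \<bullet> ?z x) + b"
   proof -
    have "(LBINT x. (f n x - u x) \<bullet> ?z x) = (LBINT x. (f n x - g x) \<bullet> ?z x + (g x - u x) \<bullet> ?z x)"
     unfolding inner_add_left[symmetric] by simp
    also have "\<dots> = (LBINT x. (f n x - g x) \<bullet> ?z x) + b" unfolding b_def
     by (rule bint_add[OF lp2_inner[OF lp_diff(1)[OF f g(1)] z] lp2_inner[OF gu z]]) simp
    finally show ?thesis .
   qed
   finally have "m <= J (G n) + 2 * s * (LBINT x. (f n x - g x) \<bullet> ?z x) + 2 * s * b + s^2 * NP 2 ?z" by (simp add: distrib_left)
   moreover have "2 * s * (LBINT x. (f n x - g x) \<bullet> ?z x) <= (2 * \<bar>s\<bar>) * \<bar>(LBINT x. (f n x - g x) \<bullet> ?z x)\<bar>"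
    using abs_ge_self[of "2 * s * (LBINT x. (f n x - g x) \<bullet> ?z x)"] by (simp add: abs_mult)
   ultimately show ?thesis using 1 2 by linarith
  qed
  have key': "0 <= 2 * s * b + s^2 * NP 2 ?z" for s using key[of _ s] field_le_epsilon[of 0 "2 * s * b + s^2 * NP 2 ?z"] by simp
  \<comment> \<open>The choice \<open>s = - b / c\<close> nearly minimises the quadratic; the added
    1 keeps the divisor positive.\<close>
  define c where "c = NP 2 ?z + 1"
  have c: "1 <= c" "NP 2 ?z <= c" using NP_nonneg[of 2 ?z] by (auto simp: c_def)
  have "0 <= 2 * (- b / c) * b + (- b / c)^2 * c"
   using key'[of "- b / c"] mult_left_mono[OF c(2), of "(- b / c)^2"] by simp
  also have "\<dots> = - (b^2 / c)" using c by (simp add: power2_eq_square field_simps)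
  finally have "b^2 <= 0" using c by (simp add: divide_le_0_iff)
  then have "b = 0" by simp
  have "(LBINT x. (u x - g x) \<bullet> ?z x) = (LBINT x. - ((g x - u x) \<bullet> ?z x))"
   unfolding inner_minus_left[symmetric] by simp
  also have "\<dots> = - b" unfolding b_def by (rule bint_minus)
  finally show "(LBINT x. (u x - g x) \<bullet> ?z x) = 0" using \<open>b = 0\<close> by simp
 qed
 ultimately show ?thesis using that[of g] by (simp add: proj_def)
qed

lemma orth_diff:
 assumes "orth v" "orth w" "lp p v" "lp p w" "1 < p" shows "orth (%x. v x - w x)"
 unfolding orth_def
proof (intro allI impI)
 fix \<zeta> :: "'a => real" and Z assume Z: "C1_gradient \<zeta> Z"
 define q where "q = p / (p - 1)"
 have z: "lp q (%x. ch x *\<^sub>R Z x)" by (rule lp_grad[OF Z]) (use assms(5) in \<open>simp add: q_def\<close>)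
 have "(LBINT x. (v x - w x) \<bullet> (ch x *\<^sub>R Z x))
  = (LBINT x. v x \<bullet> (ch x *\<^sub>R Z x)) - (LBINT x. w x \<bullet> (ch x *\<^sub>R Z x))"
  unfolding inner_diff_left by (rule bint_diff) (intro lp_inner(1)[OF _ z assms(5) q_def] assms)+
 then show "(LBINT x. (v x - w x) \<bullet> (ch x *\<^sub>R Z x)) = 0" using assms(1,2) Z unfolding orth_def by simp
qed

lemma proj_lp2:
 assumes "cs u" "proj u g" shows "lp 2 u" "lp 2 g" "lp 2 (%x. u x - g x)"
proof -
 show u: "lp 2 u" by (rule cs_lp[OF assms(1)]) simp
 show g: "lp 2 g" using assms(2) GpD(1) by (auto simp: proj_def)
 show "lp 2 (%x. u x - g x)" by (rule lp_diff(1)[OF u g]) simp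
qed

lemma proj_diff:
 assumes u: "cs u" "proj u g" and v: "cs v" "proj v h" shows "proj (%x. u x - v x) (%x. g x - h x)"
proof -
 have "orth (%x. (u x - g x) - (v x - h x))"
  by (rule orth_diff[OF _ _ proj_lp2(3)[OF u] proj_lp2(3)[OF v]]) (use u v in \<open>auto simp: proj_def\<close>)
 then have "orth (%x. (u x - v x) - (g x - h x))" by (rule back_subst[of orth]) (auto simp: algebra_simps)
 then show ?thesis using Gp_diff[of 2 g h] u v by (simp add: proj_def)
qed

text \<open>Both sides equal the pairing of the two projections, since each remainder is orthogonal
  to gradients.\<close>

lemma proj_symmetric:
 assumes u: "cs u" "proj u g" and v: "cs v" "proj v h"
 shows "(LBINT x. g x \<bullet> v x) = (LBINT x. h x \<bullet> u x)"
proof -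
 have *: "(LBINT x. g x \<bullet> v x) = (LBINT x. g x \<bullet> h x)" if u: "cs u" "proj u g" and v: "cs v" "proj v h" for u g v h
 proof -
  have "(LBINT x. g x \<bullet> (v x - h x)) = 0"
   by (rule Gp_orth[of 2 g 2]) (use u(2) v(2) proj_lp2(3)[OF v] in \<open>auto simp: proj_def\<close>)
  moreover have "(LBINT x. g x \<bullet> (v x - h x)) = (LBINT x. g x \<bullet> v x) - (LBINT x. g x \<bullet> h x)"
   unfolding inner_diff_right
   by (rule bint_diff) (intro lp2_inner proj_lp2(2)[OF u] proj_lp2[OF v])+
  ultimately show ?thesis by simp
 qed
 show ?thesis using *[OF u v] *[OF v u] by (simp add: inner_commute)
qed

lemma proj_pythagoras:
 assumes u: "cs u" "proj u g" and Z: "C1_gradient \<zeta> Z"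
 shows "NP 2 (%x. ch x *\<^sub>R Z x - u x) = NP 2 (%x. ch x *\<^sub>R Z x - g x) + NP 2 (%x. u x - g x)"
proof -
 note l = proj_lp2[OF u]
 have z: "lp 2 (%x. ch x *\<^sub>R Z x)" by (rule lp_grad[OF Z]) simp
 have zg: "lp 2 (%x. ch x *\<^sub>R Z x - g x)" by (rule lp_diff(1)[OF z l(2)]) simp
 have o: "orth (%x. u x - g x)" "Gp 2 g" using u(2) by (auto simp: proj_def)
 have 1: "(LBINT x. g x \<bullet> (u x - g x)) = 0" by (rule Gp_orth[of 2 g 2]) (use l o in auto)
 have "(LBINT x. (u x - g x) \<bullet> (ch x *\<^sub>R Z x)) = 0" using o(1) Z unfolding orth_def by blast
 moreover have "(LBINT x. (ch x *\<^sub>R Z x) \<bullet> (u x - g x)) = (LBINT x. (u x - g x) \<bullet> (ch x *\<^sub>R Z x))"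
  by (intro bint_cong refl) (rule inner_commute)
 ultimately have 2: "(LBINT x. (ch x *\<^sub>R Z x) \<bullet> (u x - g x)) = 0" by linarith
 have 3: "(LBINT x. (ch x *\<^sub>R Z x - g x) \<bullet> (u x - g x)) = 0"
 proof -
  have "(LBINT x. (ch x *\<^sub>R Z x - g x) \<bullet> (u x - g x))
   = (LBINT x. (ch x *\<^sub>R Z x) \<bullet> (u x - g x)) - (LBINT x. g x \<bullet> (u x - g x))"
   unfolding inner_diff_left[of "indicator \<Omega> _ *\<^sub>R Z _"] by (rule bint_diff) (intro lp2_inner z l)+
  then show ?thesis using 1 2 by simp
 qed
 have "NP 2 (%x. ch x *\<^sub>R Z x - u x) = NP 2 (%x. (ch x *\<^sub>R Z x - g x) - (u x - g x))" by simp
 also have "\<dots> = NP 2 (%x. ch x *\<^sub>R Z x - g x) + NP 2 (%x. u x - g x)"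
  unfolding NP2_diff[OF zg l(3)] 3 by simp
 finally show ?thesis .
qed

lemma SI_NP2:
 assumes "cs u" shows "(LINT x:\<Omega>|lborel. (norm (Z x - u x))^2) = NP 2 (%x. ch x *\<^sub>R Z x - u x)"
 unfolding NP_def set_lebesgue_integral_def
 by (intro bint_cong refl) (use assms in \<open>auto simp: cs_def powr_numeral indicator_def\<close>)

text \<open>The near minimiser of \<open>near_projection\<close> is L2 close to the exact projection
  by the Pythagorean identity, so its bilinear bound passes to \<open>g\<close>.\<close>

lemma proj_bilinear_bound:
 assumes bell: "!!R \<epsilon>. 0 < R ==> 0 < \<epsilon> ==> \<exists>(B :: 'a \<times> 'a => real) G L. bellman B G L \<and>
   (\<forall>u w. norm u <= R --> norm w <= R --> B (u, w) <= C * (norm u powr p + norm w powr q) + \<epsilon>)"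
  and C: "0 <= C" and p: "0 < p" "0 < q" and u: "cs u" "proj u g" and w: "cs w"
 shows "\<bar>(LBINT x. g x \<bullet> w x)\<bar> <= 112 * real DIM('a) * C * (NP p u + NP q w)"
proof (rule field_le_epsilon)
 fix e :: real assume "0 < e"
 then have e2: "0 < e / 2" by simp
 have lw: "lp 2 w" by (rule cs_lp[OF w]) simp
 obtain d where d: "0 < d" "!!f. lp 2 f ==> NP 2 f <= d ==> \<bar>(LBINT x. f x \<bullet> w x)\<bar> <= e / 2"
  using small_pairing[OF lw _ _ e2, of 2] by auto
 define e1 where "e1 = min (d / 2) (e / 2)"
 have e1: "0 < e1" using d e2 by (simp add: e1_def)
 obtain \<eta> G where G: "C1_gradient \<eta> G"
  "\<forall>\<zeta> Z. C1_gradient \<zeta> Z & cc \<zeta> --> (LINT x:\<Omega>|lborel. (norm (G x - u x))^2) <= (LINT x:\<Omega>|lborel. (norm (Z x - u x))^2) + e1"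
  "\<bar>LINT x:\<Omega>|lborel. G x \<bullet> w x\<bar> <= 112 * real DIM('a) * C * (LBINT x. norm (u x) powr p + norm (w x) powr q) + e1"
  using near_projection[OF op bd cv ne bell p C _ _ _ _ e1, of u w] u(1) w unfolding cs_def by blast
 note l = proj_lp2[OF u]
 let ?G = "%x. ch x *\<^sub>R G x"
 have lG: "lp 2 ?G" by (rule lp_grad[OF G(1)]) simp
 have "NP 2 (%x. ?G x - g x) <= d"
 proof -
  obtain \<zeta> Z where Z: "C1_gradient \<zeta> Z" "NP 2 (%x. ch x *\<^sub>R Z x - g x) <= d / 2"
   using GpD(2)[of 2 g "d / 2"] u(2) d(1) by (auto simp: proj_def)
  \<comment> \<open>Competitors in \<open>near_projection\<close> have compact support, so the
    potential approximating \<open>g\<close> is cut off away from the bounded domain.\<close>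
  obtain \<xi> X where X: "C1_gradient \<xi> X" "cc \<xi>" "!!x. x \<in> \<Omega> ==> X x = Z x" using cutoff[OF Z(1) bd] by metis
  have XZ: "(%x. ch x *\<^sub>R X x) = (%x. ch x *\<^sub>R Z x)" using X(3) by (auto simp: fun_eq_iff indicator_def)
  have "NP 2 (%x. ?G x - u x) <= NP 2 (%x. ch x *\<^sub>R X x - u x) + e1"
   using G(2) X(1,2) unfolding SI_NP2[OF u(1)] by blast
  then have "NP 2 (%x. ?G x - g x) <= NP 2 (%x. ch x *\<^sub>R X x - g x) + e1"
   unfolding proj_pythagoras[OF u G(1)] proj_pythagoras[OF u X(1)] by simp
  then show ?thesis using Z(2) unfolding fun_cong[OF XZ] by (simp add: e1_def)
 qed
 then have 1: "\<bar>(LBINT x. (?G x - g x) \<bullet> w x)\<bar> <= e / 2" by (intro d(2) lp_diff(1) lG l) auto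
 have 2: "(LBINT x. (?G x - g x) \<bullet> w x) = (LBINT x. ?G x \<bullet> w x) - (LBINT x. g x \<bullet> w x)"
  unfolding inner_diff_left by (rule bint_diff) (intro lp2_inner lG l lw)+
 have 3: "(LINT x:\<Omega>|lborel. G x \<bullet> w x) = (LBINT x. ?G x \<bullet> w x)" by (simp add: set_lebesgue_integral_def)
 have 4: "(LBINT x. norm (u x) powr p + norm (w x) powr q) = NP p u + NP q w"
  unfolding NP_def by (rule bint_add) (intro lpD(3) cs_lp u w p)+
 show "\<bar>(LBINT x. g x \<bullet> w x)\<bar> <= 112 * real DIM('a) * C * (NP p u + NP q w) + e"
  using G(3) 1 2 unfolding 3 4 e1_def by linarith
qed

text \<open>Stated with a sum of powers in place of a product of norms; scaling the test field, as
  \<open>proj_lp\<close> does with \<open>\<theta>\<close>, makes up for the difference.\<close>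

definition est :: "real => real => bool" where
 "est p K \<longleftrightarrow> (\<forall>u w g. cs u & cs w & proj u g --> \<bar>(LBINT x. g x \<bullet> w x)\<bar> <= K * (NP p u + NP (p / (p - 1)) w))"

text \<open>The projection is symmetric, so \<open>u\<close> and \<open>w\<close> can change places;
  conjugation of exponents is an involution.\<close>

lemma est_dual:
 assumes "est p K" "1 < p" shows "est (p / (p - 1)) K"
 unfolding est_def
proof (intro allI impI, elim conjE)
 fix u w g assume u: "cs u" "proj u g" and w: "cs w"
 obtain h where h: "proj w h" using proj_exists[OF w] by blast
 have "p / (p - 1) / (p / (p - 1) - 1) = p" using assms(2) by (simp add: field_simps)
 moreover have "\<bar>(LBINT x. h x \<bullet> u x)\<bar> <= K * (NP p w + NP (p / (p - 1)) u)" using assms(1) u w h unfolding est_def by blast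
 ultimately show "\<bar>(LBINT x. g x \<bullet> w x)\<bar> <= K * (NP (p / (p - 1)) u + NP (p / (p - 1) / (p / (p - 1) - 1)) w)"
  unfolding proj_symmetric[OF u w h] by (simp add: add.commute)
qed

text \<open>Bounded measurable test fields are almost everywhere limits of uniformly bounded
  continuous ones, and \<open>g\<close> is integrable, so dominated convergence applies.\<close>

lemma proj_bounded_test:
 assumes es: "est p K" and p: "1 < p" "q = p / (p - 1)" and u: "cs u" "proj u g"
  and w: "w \<in> borel_measurable borel" "!!x. x \<notin> \<Omega> ==> w x = 0" "!!x. norm (w x) <= T" and T: "0 < T"
 shows "\<bar>(LBINT x. g x \<bullet> w x)\<bar> <= K * (NP p u + NP q w)"
proof -
 have q0: "0 < q" using p by simp
 note l = proj_lp2[OF u]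
 have gi: "integrable lborel g" by (rule lp_integrable[OF l(2)]) simp
 note [measurable] = w(1) lpD(1)[OF l(2)]
 obtain v where v: "!!n. cc (v n)" "!!n x. x \<notin> \<Omega> ==> v n x = 0" "!!n x. norm (v n x) <= T"
  "AE x in lborel. (%n. v n x) \<longlonglongrightarrow> w x" using bounded_approx[OF w T] by blast
 have [measurable]: "v n \<in> borel_measurable borel" for n using v(1) by (intro borel_measurable_continuous_onI cc_cont)
 have 1: "(%n. (LBINT x. g x \<bullet> v n x)) \<longlonglongrightarrow> (LBINT x. g x \<bullet> w x)"
 proof (rule integral_dominated_convergence[where w = "%x. norm (g x) * T"])
  show "integrable lborel (%x. norm (g x) * T)" using gi by simp
  show "AE x in lborel. (%n. g x \<bullet> v n x) \<longlonglongrightarrow> g x \<bullet> w x" using v(4) by eventually_elim (intro tendsto_intros)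
  show "AE x in lborel. norm (g x \<bullet> v n x) <= norm (g x) * T" for n
  proof (rule AE_I2)
   fix x
   have "norm (g x \<bullet> v n x) <= norm (g x) * norm (v n x)" by (simp add: Cauchy_Schwarz_ineq2)
   also have "\<dots> <= norm (g x) * T" using v(3) by (intro mult_left_mono) auto
   finally show "norm (g x \<bullet> v n x) <= norm (g x) * T" .
  qed
 qed measurable
 have 2: "(%n. NP q (v n)) \<longlonglongrightarrow> NP q w"
  unfolding NP_def
 proof (rule integral_dominated_convergence[where w = "%x. T powr q * ch x"])
  show "integrable lborel (%x. T powr q * ch x)" using ind_integrable by simp
  show "AE x in lborel. (%n. norm (v n x) powr q) \<longlonglongrightarrow> norm (w x) powr q"
   using v(4) by eventually_elim (intro tendsto_powr' tendsto_norm tendsto_const; use q0 in simp)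
  show "AE x in lborel. norm (norm (v n x) powr q) <= T powr q * ch x" for n
   by (rule AE_I2) (use v(2,3) q0 in \<open>auto simp: indicator_def intro!: powr_mono2\<close>)
 qed measurable
 have "\<bar>(LBINT x. g x \<bullet> v n x)\<bar> <= K * (NP p u + NP q (v n))" for n
  using es u v(1,2) unfolding est_def cs_def p(2) by blast
 then show ?thesis
  by (intro LIMSEQ_le[OF tendsto_rabs[OF 1] tendsto_mult[OF tendsto_const tendsto_add[OF tendsto_const 2]]]) auto
qed

text \<open>The test field is \<open>\<theta> |g|\<^sup>p\<^sup>-\<^sup>2 g\<close>, truncated; \<open>\<theta>\<close> is chosen to absorb half of the right-hand side.\<close>

lemma proj_lp:
 assumes es: "est p K" and p: "1 < p" and K: "0 < K" and u: "cs u" "proj u g"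
 shows "lp p g" "NP p g <= Kp p K * NP p u"
proof -
 define q where "q = p / (p - 1)"
 have q0: "0 < q" "(p - 1) * q = p" "q - 1 = 1 / (p - 1)" using p by (auto simp: q_def field_simps)
 have p0: "0 < p" using p by simp
 note l = proj_lp2[OF u]
 note [measurable] = lpD(1)[OF l(2)]
 define \<theta> where "\<theta> = (1 / (2 * K)) powr (p - 1)"
 have \<theta>: "0 < \<theta>" using K by (simp add: \<theta>_def)
 have "\<theta> powr q = \<theta> * \<theta> powr (q - 1)" using \<theta> by (simp add: powr_diff)
 also have "\<theta> powr (q - 1) = 1 / (2 * K)" unfolding \<theta>_def q0(3) using K p by (simp add: powr_powr)
 finally have K\<theta>: "K * \<theta> powr q = \<theta> / 2" using K by simp
 \<comment> \<open>At this point \<open>g\<close> is only known to lie in L2; truncation at level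
   \<open>n\<close> makes the integral that is to be absorbed finite.\<close>
 define h where "h n x = indicator {x. norm (g x) <= real n} x * norm (g x) powr p" for n :: nat and x
 have hm[measurable]: "h n \<in> borel_measurable borel" for n unfolding h_def by measurable
 have h0: "0 <= h n x" for n x by (simp add: h_def)
 have g0: "g x = 0" if "x \<notin> \<Omega>" for x using lpD(2)[OF l(2) that] .
 have hi: "integrable lborel (h n)" for n
 proof (rule bintegrable_bound)
  show "integrable lborel (%x. real n powr p * ch x)" using ind_integrable by simp
  show "AE x in lborel. norm (h n x) <= norm (real n powr p * ch x)"
   by (rule AE_I2) (use g0 p0 in \<open>auto simp: h_def indicator_def intro!: powr_mono2\<close>)
 qed measurable
 have hb: "(LBINT x. h n x) <= Kp p K * NP p u" for n
 proof -
  define w where "w x = (indicator {x. norm (g x) <= real n} x * \<theta> * norm (g x) powr (p - 2)) *\<^sub>R g x" for x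
  have wm: "w \<in> borel_measurable borel" unfolding w_def by measurable
  have nw: "norm (w x) = indicator {x. norm (g x) <= real n} x * \<theta> * norm (g x) powr (p - 1)" for x
  proof (cases "g x = 0")
   case False
   have "norm (g x) powr (p - 1) = norm (g x) powr (p - 2) * norm (g x) powr 1" unfolding powr_add[symmetric] by simp
   then show ?thesis using \<theta> False by (simp add: w_def)
  qed (simp add: w_def)
  have wT: "norm (w x) <= \<theta> * real n powr (p - 1) + 1" for x
  proof (cases "norm (g x) <= real n")
   case True
   have "norm (g x) powr (p - 1) <= real n powr (p - 1)" using True p by (intro powr_mono2) auto
   then have "\<theta> * norm (g x) powr (p - 1) <= \<theta> * real n powr (p - 1)" using \<theta> by simp
   then show ?thesis using True by (simp add: nw)
  qed (use \<theta> in \<open>simp add: nw add_nonneg_nonneg\<close>)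
  have w0: "w x = 0" if "x \<notin> \<Omega>" for x using g0[OF that] by (simp add: w_def)
  have T0: "0 < \<theta> * real n powr (p - 1) + 1" using \<theta> by (intro add_nonneg_pos) auto
  have "\<bar>(LBINT x. g x \<bullet> w x)\<bar> <= K * (NP p u + NP q w)"
   by (rule proj_bounded_test[OF es p q_def u wm w0 wT T0])
  moreover have "(LBINT x. g x \<bullet> w x) = \<theta> * (LBINT x. h n x)"
  proof -
   have "g x \<bullet> w x = \<theta> * h n x" for x
   proof (cases "g x = 0")
    case False
    have "norm (g x) powr p = norm (g x) powr (p - 2) * norm (g x) powr 2" unfolding powr_add[symmetric] by simp
    then show ?thesis using False by (simp add: w_def h_def powr_numeral power2_norm_eq_inner)
   qed (simp add: w_def h_def)
   then show ?thesis by simp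
  qed
  moreover have "NP q w = \<theta> powr q * (LBINT x. h n x)"
  proof -
   have "norm (w x) powr q = \<theta> powr q * h n x" for x
   proof (cases "norm (g x) <= real n")
    case True
    then have "norm (w x) powr q = (\<theta> * norm (g x) powr (p - 1)) powr q" by (simp add: nw)
    also have "\<dots> = \<theta> powr q * norm (g x) powr p" using \<theta> q0(2) by (simp add: powr_mult powr_powr)
    finally show ?thesis using True by (simp add: h_def)
   qed (simp add: w_def h_def)
   then show ?thesis by (simp add: NP_def)
  qed
  ultimately have "\<bar>\<theta> * (LBINT x. h n x)\<bar> <= K * NP p u + (K * \<theta> powr q) * (LBINT x. h n x)" by (simp add: distrib_left mult.assoc)
  then have "\<theta> * (LBINT x. h n x) <= 2 * K * NP p u" unfolding K\<theta> by linarith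
  then have "(LBINT x. h n x) <= 2 * K * NP p u / \<theta>" using \<theta> by (simp add: pos_le_divide_eq mult.commute)
  then show ?thesis by (simp add: Kp_def \<theta>_def)
 qed
 have lim: "AE x in lborel. (%n. h n x) \<longlonglongrightarrow> norm (g x) powr p"
 proof (rule AE_I2)
  fix x
  obtain N where N: "norm (g x) <= real N" using real_arch_simple by blast
  show "(%n. h n x) \<longlonglongrightarrow> norm (g x) powr p"
   by (rule tendsto_eventually, use eventually_ge_at_top[of N] in eventually_elim) (use N in \<open>auto simp: h_def\<close>)
 qed
 have gpm: "(%x. norm (g x) powr p) \<in> borel_measurable lborel" by measurable
 have "integrable lborel (%x. norm (g x) powr p)" "(LBINT x. norm (g x) powr p) <= Kp p K * NP p u"
  using fatou_bound[OF hi h0 gpm _ lim, of 0 "Kp p K * NP p u"] hb by auto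
 then show "lp p g" "NP p g <= Kp p K * NP p u" using l(2) by (auto simp: lp_def NP_def)
qed

text \<open>Applied to differences, \<open>proj_lp\<close> makes the projections of a sequence
  approximating \<open>u\<close> converge. Limits of gradients and orthogonality are both preserved
  under such convergence.\<close>

theorem decomposition:
 assumes es: "est p K" and p: "1 < p" and K: "0 < K" and u: "lp p u"
 obtains \<phi> g where "lp p \<phi>" "lp p g" "wg \<phi> g" "orth (%x. u x - g x)"
  "NP p g <= 2 powr p * (Kp p K * 2 powr p) * NP p u"
proof -
 have p0: "0 < p" "0 <= p" "1 <= p" using p by auto
 define a where "a = 2 powr p"
 have a: "0 < a" by (simp add: a_def)
 have Kp: "0 < Kp p K" using K by (simp add: Kp_def)
 have "\<exists>v. cs v & NP p (%x. v x - u x) <= 1 / real (Suc n)" for n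
  using lp_density[OF u p0(1), of "1 / real (Suc n)"] unfolding cs_def by (metis zero_less_divide_1_iff of_nat_0_less_iff zero_less_Suc)
 then obtain v where v: "!!n. cs (v n)" "!!n. NP p (%x. v n x - u x) <= 1 / real (Suc n)" by metis
 have "\<exists>g. proj (v n) g" for n using proj_exists[OF v(1)] by blast
 then obtain g where g: "!!n. proj (v n) (g n)" by metis
 note lv = cs_lp[OF v(1) p0(1)]
 note gl = proj_lp[OF es p K v(1) g]
 have vlim: "(%n. NP p (%x. v n x - u x)) \<longlonglongrightarrow> 0"
  by (rule tendsto_sandwich[OF always_eventually always_eventually tendsto_const LIMSEQ_inverse_real_of_nat])
   (auto intro: NP_nonneg simp only: inverse_eq_divide v(2))
 have gd: "NP p (%x. g i x - g j x) <= Kp p K * a * (1 / real (Suc i) + 1 / real (Suc j))" for i j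
 proof -
  have "NP p (%x. g i x - g j x) <= Kp p K * NP p (%x. v i x - v j x)"
   by (rule proj_lp(2)[OF es p K cs_diff[OF v(1) v(1)] proj_diff[OF v(1) g v(1) g]])
  also have "NP p (%x. v i x - v j x) <= a * (NP p (%x. v i x - u x) + NP p (%x. u x - v j x))"
   unfolding a_def by (rule NP_tri[OF lv u lv p0(2)])
  also have "\<dots> <= a * (1 / real (Suc i) + 1 / real (Suc j))"
   using v(2)[of i] v(2)[of j] NP_swap[of p u "v j"] a by (intro mult_left_mono add_mono) auto
  finally show ?thesis using Kp by (simp add: mult.assoc)
 qed
 obtain f where f: "lp p f" "(%n. NP p (%x. g n x - f x)) \<longlonglongrightarrow> 0" using riesz_fischer_rate[OF gl(1) p0(3) mult_nonneg_nonneg[OF less_imp_le[OF Kp] less_imp_le[OF a]] gd] by blast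
 have Gg: "Gp p (g n)" for n by (rule Gp_upgrade[OF _ gl(1) p0(3)]) (use g[of n] in \<open>simp add: proj_def\<close>)
 have "Gp p f"
 proof (rule Gp_closed[OF f(1) p0(1)])
  fix e :: real assume "0 < e"
  from LIMSEQ_zero_less[OF f(2) this] obtain n where "NP p (%x. g n x - f x) < e" by blast
  then show "\<exists>h. Gp p h & NP p (%x. h x - f x) <= e" using Gg[of n] by (intro exI[of _ "g n"]) simp
 qed
 then obtain \<phi> where \<phi>: "lp p \<phi>" "wg \<phi> f" using Gp_wg p by blast
 have uf: "lp p (%x. u x - f x)" by (rule lp_diff(1)[OF u f(1) p0(2)])
 have vg: "lp p (%x. v n x - g n x)" for n by (rule lp_diff(1)[OF lv gl(1) p0(2)])
 have "orth (%x. u x - f x)"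
 proof (rule orth_lim[OF p uf])
  fix e :: real assume e: "0 < e"
  have "(%n. a * (NP p (%x. v n x - u x) + NP p (%x. g n x - f x))) \<longlonglongrightarrow> a * (0 + 0)"
   by (intro tendsto_intros vlim f(2))
  then obtain n where n: "a * (NP p (%x. v n x - u x) + NP p (%x. g n x - f x)) < e" using LIMSEQ_zero_less[OF _ e] by (metis (no_types, lifting) add_0 mult_zero_right)
  have "NP p (%x. (v n x - g n x) - (u x - f x)) = NP p (%x. (v n x - u x) - (g n x - f x))" by (simp add: algebra_simps)
  also have "\<dots> <= a * (NP p (%x. v n x - u x) + NP p (%x. g n x - f x))"
   unfolding a_def by (rule lp_diff(2)[OF lp_diff(1)[OF lv u p0(2)] lp_diff(1)[OF gl(1) f(1) p0(2)] p0(2)])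
  finally have "NP p (%x. (v n x - g n x) - (u x - f x)) <= e" using n by linarith
  then show "\<exists>w. lp p w & orth w & NP p (%x. w x - (u x - f x)) <= e"
   using vg[of n] g[of n] by (intro exI[of _ "%x. v n x - g n x"]) (simp add: proj_def)
 qed
 moreover have "NP p f <= a * (Kp p K * a) * NP p u"
 proof (rule LIMSEQ_le_const)
  show "\<exists>N. \<forall>n\<ge>N. NP p f <= a * (NP p (%x. g n x - f x) + Kp p K * (a * (NP p (%x. v n x - u x) + NP p u)))"
  proof (intro exI[of _ 0] allI impI)
   fix n
   have "NP p (v n) = NP p (%x. (v n x - u x) + u x)" by simp
   also have "\<dots> <= a * (NP p (%x. v n x - u x) + NP p u)" unfolding a_def by (rule lp_add(2)[OF lp_diff(1)[OF lv u p0(2)] u p0(2)])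
   finally have 1: "NP p (g n) <= Kp p K * (a * (NP p (%x. v n x - u x) + NP p u))"
    by (rule order_trans[OF gl(2) mult_left_mono]) (use Kp in simp)
   have "NP p f = NP p (%x. g n x - (g n x - f x))" by simp
   also have "\<dots> <= a * (NP p (g n) + NP p (%x. g n x - f x))" unfolding a_def by (rule lp_diff(2)[OF gl(1) lp_diff(1)[OF gl(1) f(1) p0(2)] p0(2)])
   also have "\<dots> <= a * (Kp p K * (a * (NP p (%x. v n x - u x) + NP p u)) + NP p (%x. g n x - f x))"
    using 1 a by (intro mult_left_mono add_right_mono) auto
   finally show "NP p f <= a * (NP p (%x. g n x - f x) + Kp p K * (a * (NP p (%x. v n x - u x) + NP p u)))" by (simp add: add.commute)
  qed
  have "(%n. a * (NP p (%x. g n x - f x) + Kp p K * (a * (NP p (%x. v n x - u x) + NP p u)))) \<longlonglongrightarrow> a * (0 + Kp p K * (a * (0 + NP p u)))"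
   by (intro tendsto_intros vlim f(2))
  then show "(%n. a * (NP p (%x. g n x - f x) + Kp p K * (a * (NP p (%x. v n x - u x) + NP p u)))) \<longlonglongrightarrow> a * (Kp p K * a) * NP p u"
   by (simp add: mult.assoc)
 qed
 ultimately show ?thesis using that[OF \<phi>(1) f(1) \<phi>(2)] by (simp add: a_def)
qed

text \<open>Against a test field \<open>w\<close> with projection \<open>h\<close>, split \<open>w = h + (w - h)\<close>: one part is orthogonal to \<open>f\<close> because \<open>f\<close> is
  solenoidal, the other because \<open>f\<close> is a limit of gradients.\<close>

theorem trivial_intersection:
 assumes es: "est p K" and p: "1 < p" and K: "0 < K" and f: "Gp p f" "orth f"
 shows "AE x in lborel. f x = 0"
proof -
 define q where "q = p / (p - 1)"
 have q: "1 < q" "p = q / (q - 1)" using p by (auto simp: q_def field_simps)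
 have esq: "est q K" unfolding q_def by (rule est_dual[OF es p])
 have p0: "0 < p" "0 <= p" "1 <= p" "0 < q" "0 <= q" "1 <= q" using p q by auto
 note lf = GpD(1)[OF f(1)]
 have ortho: "(LBINT x. f x \<bullet> w x) = 0" if w: "cs w" for w
 proof -
  obtain h where h: "proj w h" using proj_exists[OF w] by blast
  note lh = proj_lp(1)[OF esq q(1) K w h]
  have Gh: "Gp q h" by (rule Gp_upgrade[OF _ lh p0(6)]) (use h in \<open>simp add: proj_def\<close>)
  have lw: "lp q w" by (rule cs_lp[OF w p0(4)])
  have lwh: "lp q (%x. w x - h x)" by (rule lp_diff(1)[OF lw lh p0(5)])
  have "(LBINT x. h x \<bullet> f x) = 0" by (rule Gp_orth[OF Gh lf f(2) q])
  moreover have "(LBINT x. f x \<bullet> (w x - h x)) = 0" by (rule Gp_orth[OF f(1) lwh _ p q_def]) (use h in \<open>simp add: proj_def\<close>)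
  moreover have "(LBINT x. f x \<bullet> (w x - h x)) = (LBINT x. f x \<bullet> w x) - (LBINT x. f x \<bullet> h x)"
   unfolding inner_diff_right by (rule bint_diff) (intro lp_inner(1)[OF lf _ p q_def] lw lh)+
  ultimately show ?thesis by (simp add: inner_commute)
 qed
 note fm[measurable] = lpD(1)[OF lf]
 \<comment> \<open>A bounded multiple of \<open>f\<close> for which \<open>f x \<bullet> w x\<close>
   is positive wherever \<open>f x\<close> is nonzero.\<close>
 define w where "w x = (1 / (1 + norm (f x))) *\<^sub>R f x" for x
 have wm[measurable]: "w \<in> borel_measurable borel" unfolding w_def by measurable
 have w0: "w x = 0" if "x \<notin> \<Omega>" for x using lpD(2)[OF lf that] by (simp add: w_def)
 have w1: "norm (w x) <= 1" for x
 proof -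
  have "0 < 1 + norm (f x)" by (simp add: add_pos_nonneg)
  then show ?thesis by (simp add: w_def)
 qed
 obtain v where v: "!!n. cc (v n)" "!!n x. x \<notin> \<Omega> ==> v n x = 0" "!!n x. norm (v n x) <= 1"
  "AE x in lborel. (%n. v n x) \<longlonglongrightarrow> w x" using bounded_approx[OF wm w0 w1 zero_less_one] by blast
 have vm[measurable]: "v n \<in> borel_measurable borel" for n using v(1) by (intro borel_measurable_continuous_onI cc_cont)
 have fi: "integrable lborel f" by (rule lp_integrable[OF lf p0(3)])
 have bnd: "norm (f x \<bullet> y) <= norm (f x)" if "norm y <= 1" for x y
  using Cauchy_Schwarz_ineq2[of "f x" y] mult_left_mono[OF that, of "norm (f x)"] by simp
 have "(%n. (LBINT x. f x \<bullet> v n x)) \<longlonglongrightarrow> (LBINT x. f x \<bullet> w x)"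
 proof (rule integral_dominated_convergence[where w = "%x. norm (f x)"])
  show "AE x in lborel. (%n. f x \<bullet> v n x) \<longlonglongrightarrow> f x \<bullet> w x" using v(4) by eventually_elim (intro tendsto_intros)
  show "AE x in lborel. norm (f x \<bullet> v n x) <= norm (f x)" for n by (rule AE_I2) (rule bnd[OF v(3)])
 qed (use fi in auto)
 moreover have "(LBINT x. f x \<bullet> v n x) = 0" for n by (rule ortho) (use v in \<open>simp add: cs_def\<close>)
 ultimately have z: "(LBINT x. f x \<bullet> w x) = 0" by (simp add: LIMSEQ_const_iff)
 have wi: "integrable lborel (%x. f x \<bullet> w x)"
  by (rule bintegrable_bound[OF integrable_norm[OF fi]]) (use bnd[OF w1] in auto)
 have nn: "0 <= f x \<bullet> w x" for x by (simp add: w_def)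
 have "AE x in lborel. f x \<bullet> w x = 0"
  using integral_nonneg_eq_0_iff_AE[OF wi] nn z by simp
 then show ?thesis
 proof eventually_elim
  case (elim x)
  have "1 + norm (f x) ~= 0" using norm_ge_zero[of "f x"] by linarith
  then show ?case using elim by (simp add: w_def)
 qed
qed

end

text \<open>\<open>K\<close> is fixed before \<open>\<Omega>\<close>: the Bellman function is built
  from \<open>p\<close> alone, and the domain enters only through the weight.\<close>

lemma bellman_const:
 assumes "2 <= p"
 obtains K where "0 < K" "!!\<Omega> :: 'a::euclidean_space set. dom \<Omega> ==> dom.est \<Omega> p K"
proof -
 define q where "q = p / (p - 1)"
 have q: "0 < q" "0 < p" using assms by (auto simp: q_def)
 obtain C where C: "0 < C" "!!R \<epsilon>. 0 < R ==> 0 < \<epsilon> ==> \<exists>(B :: 'a \<times> 'a => real) G L. bellman B G L \<and>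
   (\<forall>u w. norm u <= R --> norm w <= R --> B (u, w) <= C * (norm u powr p + norm w powr (p / (p - 1))) + \<epsilon>)"
  using bellman_function[OF assms] by blast
 show ?thesis
 proof (rule that[of "112 * real DIM('a) * C"])
  show "0 < 112 * real DIM('a) * C" using C(1) by simp
  fix \<Omega> :: "'a set" assume "dom \<Omega>"
  then interpret dom \<Omega> .
  show "est p (112 * real DIM('a) * C)"
   unfolding est_def q_def[symmetric]
   using proj_bilinear_bound[OF C(2)[folded q_def] less_imp_le[OF C(1)] q(2,1)] by blast
 qed
qed

text \<open>Exponents below 2 are reached from their conjugates by \<open>est_dual\<close>.\<close>

lemma est_exists:
 assumes "1 < p"
 obtains K where "0 < K" "!!\<Omega> :: 'a::euclidean_space set. dom \<Omega> ==> dom.est \<Omega> p K"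
proof (cases "2 <= p")
 case True
 show ?thesis by (rule bellman_const[OF True, where 'a = 'a]) (rule that)
next
 case False
 define q where "q = p / (p - 1)"
 have q: "2 <= q" "q / (q - 1) = p" "1 < q" using assms False by (auto simp: q_def field_simps)
 obtain K where K: "0 < K" "!!\<Omega> :: 'a set. dom \<Omega> ==> dom.est \<Omega> q K" using bellman_const[OF q(1)] by metis
 show ?thesis
 proof (rule that[OF K(1)])
  fix \<Omega> :: "'a set" assume d: "dom \<Omega>"
  show "dom.est \<Omega> p K" using dom.est_dual[OF d K(2)[OF d] q(3)] q(2) by simp
 qed
qed

section \<open>The Helmholtz decomposition\<close>

text \<open>A Lebesgue measurable function is almost everywhere a limit of continuous functions, and
  the pointwise \<open>lim\<close> of these is Borel.\<close>

lemma borel_representative: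
 fixes f :: "'a::euclidean_space => 'b::euclidean_space"
 assumes "f \<in> borel_measurable lebesgue"
 obtains h where "h \<in> borel_measurable borel" "AE x in lebesgue. f x = h x"
proof -
 have "f measurable_on UNIV" by (rule lebesgue_measurable_imp_measurable_on[OF assms]) simp
 then obtain N g where N: "negligible N" and gc: "!!n. cont (g n)" and gl: "!!x. x \<notin> N ==> (%n. g n x) \<longlonglongrightarrow> f x"
  unfolding measurable_on_def by auto
 have [measurable]: "g n \<in> borel_measurable borel" for n by (rule borel_measurable_continuous_onI[OF gc])
 have "AE x in lebesgue. x \<notin> N" by (rule AE_not_in) (use N in \<open>simp add: negligible_iff_null_sets\<close>)
 then have "AE x in lebesgue. f x = lim (%n. g n x)" by eventually_elim (use gl limI in metis)
 moreover have "(%x. lim (%n. g n x)) \<in> borel_measurable borel" by measurable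
 ultimately show ?thesis using that by blast
qed

lemma lebesgue_transfer:
 fixes f h :: "'a::euclidean_space => 'b::euclidean_space"
 assumes h: "h \<in> borel_measurable borel" and ae: "AE x in lebesgue. f x = h x"
 shows "f \<in> borel_measurable lebesgue" "integrable lebesgue f \<longleftrightarrow> integrable lborel h" "(\<integral>x. f x \<partial>lebesgue) = (LBINT x. h x)"
proof -
 have hl: "h \<in> borel_measurable lborel" using h by simp
 then have hL: "h \<in> borel_measurable lebesgue" by (rule measurable_completion)
 have ae': "AE x in lebesgue. h x = f x" using ae by eventually_elim simp
 show f: "f \<in> borel_measurable lebesgue" by (rule borel_measurable_AE[OF hL ae'])
 show "integrable lebesgue f \<longleftrightarrow> integrable lborel h"
  using integrable_cong_AE[OF f hL ae] integrable_completion[OF hl] by simp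
 show "(\<integral>x. f x \<partial>lebesgue) = (LBINT x. h x)"
  using integral_cong_AE[OF f hL ae] integral_completion[OF hl] by simp
qed

context dom
begin

text \<open>Here \<open>h\<close> is a Borel representative of \<open>u\<close> on
  \<open>\<Omega>\<close>, extended by 0: the bridge from the Lebesgue formulation of the result to
  \<open>lp\<close>.\<close>

definition rp :: "('a => 'b::euclidean_space) => ('a => 'b) => bool" where
 "rp u h \<longleftrightarrow> h \<in> borel_measurable borel & (\<forall>x. x \<notin> \<Omega> --> h x = 0) & (AE x in lebesgue. x \<in> \<Omega> --> u x = h x)"

text \<open>One transfer rule for all integrands; \<open>F x\<close> has to vanish at 0 because
  \<open>h\<close> does so outside \<open>\<Omega>\<close>, where \<open>u\<close> is
  arbitrary.\<close>

lemma rp_transfer: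
 fixes F :: "'a => 'b::euclidean_space => 'c::euclidean_space"
 assumes r: "rp u h" and F: "(%x. F x (h x)) \<in> borel_measurable borel" "!!x. F x 0 = 0"
 shows "set_borel_measurable lebesgue \<Omega> (%x. F x (u x))"
  "set_integrable lebesgue \<Omega> (%x. F x (u x)) \<longleftrightarrow> integrable lborel (%x. F x (h x))"
  "(LINT x:\<Omega>|lebesgue. F x (u x)) = (LBINT x. F x (h x))"
proof -
 have r1: "AE x in lebesgue. x \<in> \<Omega> --> u x = h x" and r0: "!!x. x \<notin> \<Omega> ==> h x = 0" using r by (auto simp: rp_def)
 have "AE x in lebesgue. ch x *\<^sub>R F x (u x) = F x (h x)"
  using r1 by eventually_elim (auto simp: indicator_def r0 F(2))
 note t = lebesgue_transfer[OF F(1) this]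
 show "set_borel_measurable lebesgue \<Omega> (%x. F x (u x))"
  "set_integrable lebesgue \<Omega> (%x. F x (u x)) \<longleftrightarrow> integrable lborel (%x. F x (h x))"
  "(LINT x:\<Omega>|lebesgue. F x (u x)) = (LBINT x. F x (h x))"
  using t by (simp_all add: set_borel_measurable_def set_integrable_def set_lebesgue_integral_def)
qed

lemma rp_borel: "rp u h ==> h \<in> borel_measurable borel" by (simp add: rp_def)

lemma rp_Lp:
 assumes r: "rp u h"
 shows "u \<in> Lp p \<Omega> \<longleftrightarrow> lp p h" "(LINT x:\<Omega>|lebesgue. norm (u x) powr p) = NP p h"
proof -
 have [measurable]: "h \<in> borel_measurable borel" by (rule rp_borel[OF r])
 have m: "(%x. norm (h x) powr p) \<in> borel_measurable borel" by measurable
 note t = rp_transfer[OF r, of "%x y. norm y powr p", OF m, simplified]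
 have s: "set_borel_measurable lebesgue \<Omega> u" using rp_transfer(1)[OF r, of "%x y. y"] rp_borel[OF r] by simp
 show "u \<in> Lp p \<Omega> \<longleftrightarrow> lp p h" using s t(2) r unfolding Lp_def lp_def rp_def by auto
 show "(LINT x:\<Omega>|lebesgue. norm (u x) powr p) = NP p h" using t(3) by (simp add: NP_def)
qed

lemma Lp_rp:
 fixes u :: "'a => 'b::euclidean_space"
 assumes "u \<in> Lp p \<Omega>" obtains h where "rp u h" "lp p h"
proof -
 have "(%x. ch x *\<^sub>R u x) \<in> borel_measurable lebesgue" using assms by (simp add: Lp_def set_borel_measurable_def)
 then obtain h where h: "h \<in> borel_measurable borel" "AE x in lebesgue. ch x *\<^sub>R u x = h x" using borel_representative by blast
 have [measurable]: "h \<in> borel_measurable borel" by (rule h(1))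
 have "rp u (%x. ch x *\<^sub>R h x)"
  unfolding rp_def
 proof (intro conjI)
  show "(%x. ch x *\<^sub>R h x) \<in> borel_measurable borel" by measurable
  show "AE x in lebesgue. x \<in> \<Omega> --> u x = ch x *\<^sub>R h x" using h(2) by eventually_elim auto
 qed simp
 then show ?thesis using that rp_Lp(1) assms by blast
qed

lemma rp_self: "lp p h ==> rp h h" by (simp add: rp_def lp_def)

lemma rp_AE: "rp u h ==> AE x in lebesgue. x \<in> \<Omega> --> u x = h x" by (simp add: rp_def)

lemma rp_ae_eq:
 assumes u: "rp u h" and v: "rp v k"
 shows "ae_eq_on \<Omega> u v \<longleftrightarrow> (AE x in lborel. h x = k x)"
proof -
 have 0: "h x = k x" if "x \<notin> \<Omega>" for x using u v that by (simp add: rp_def)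
 have "ae_eq_on \<Omega> u v \<longleftrightarrow> (AE x in lebesgue. h x = k x)"
  unfolding ae_eq_on_def
 proof
  assume a: "AE x in lebesgue. x \<in> \<Omega> --> u x = v x"
  show "AE x in lebesgue. h x = k x" using a rp_AE[OF u] rp_AE[OF v] by eventually_elim (use 0 in metis)
 next
  assume a: "AE x in lebesgue. h x = k x"
  show "AE x in lebesgue. x \<in> \<Omega> --> u x = v x" using a rp_AE[OF u] rp_AE[OF v] by eventually_elim simp
 qed
 then show ?thesis by (simp only: AE_completion_iff)
qed

lemma rp_cong:
 assumes "rp u h" "ae_eq_on \<Omega> u v" shows "rp v h"
proof -
 have "AE x in lebesgue. x \<in> \<Omega> --> v x = h x"
  using rp_AE[OF assms(1)] assms(2)[unfolded ae_eq_on_def] by eventually_elim simp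
 then show ?thesis using assms(1) by (simp add: rp_def)
qed

lemma rp_add:
 assumes "rp u h" "rp v k" shows "rp (%x. u x + v x) (%x. h x + k x)"
proof -
 have "AE x in lebesgue. x \<in> \<Omega> --> u x + v x = h x + k x"
  using rp_AE[OF assms(1)] rp_AE[OF assms(2)] by eventually_elim simp
 then show ?thesis using assms borel_measurable_add[OF rp_borel[OF assms(1)] rp_borel[OF assms(2)]] by (simp add: rp_def)
qed

lemma has_weak_gradient_rp:
 assumes f: "rp \<phi> f" "lp 1 f" and h: "rp g h" "lp 1 h"
 shows "has_weak_gradient \<Omega> \<phi> g \<longleftrightarrow> wg f h"
proof -
 note [measurable] = rp_borel[OF f(1)] rp_borel[OF h(1)]
 have i1: "set_integrable lebesgue \<Omega> \<phi>" using rp_transfer(2)[OF f(1), of "%x y. y"] lp_1[OF f(2)] by simp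
 have i2: "set_integrable lebesgue \<Omega> g" using rp_transfer(2)[OF h(1), of "%x y. y"] lp_1[OF h(2)] by simp
 have K: "set_integrable lebesgue K \<phi> & set_integrable lebesgue K g" if "compact K" "K \<subseteq> \<Omega>" for K
  using set_integrable_subset[OF i1 _ that(2)] set_integrable_subset[OF i2 _ that(2)] lmeasurable_compact[OF that(1)]
  by (simp add: fmeasurableD)
 have e1: "(LINT x:\<Omega>|lebesgue. \<phi> x *\<^sub>R G x) = (LBINT x. f x *\<^sub>R G x)" if G: "C1_gradient \<eta> G" for \<eta> G
 proof (rule rp_transfer(3)[OF f(1), of "%x y. y *\<^sub>R G x"])
  have [measurable]: "G \<in> borel_measurable borel" by (rule borel_measurable_continuous_onI[OF C1_gradient_cont[OF G]])
  show "(%x. f x *\<^sub>R G x) \<in> borel_measurable borel" by measurable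
 qed simp
 have e2: "(LINT x:\<Omega>|lebesgue. \<eta> x *\<^sub>R g x) = (LBINT x. \<eta> x *\<^sub>R h x)" if G: "C1_gradient \<eta> G" for \<eta> G
 proof (rule rp_transfer(3)[OF h(1), of "%x y. \<eta> x *\<^sub>R y"])
  have [measurable]: "\<eta> \<in> borel_measurable borel" by (rule borel_measurable_continuous_onI[OF C1_continuous[OF G]])
  show "(%x. \<eta> x *\<^sub>R h x) \<in> borel_measurable borel" by measurable
 qed simp
 show ?thesis
 proof
  assume w: "has_weak_gradient \<Omega> \<phi> g"
  show "wg f h"
   unfolding wg_def
  proof (intro allI impI)
   fix \<eta> G assume a: "C1_gradient \<eta> G & compact (closure {x. \<eta> x ~= 0}) & closure {x. \<eta> x ~= 0} \<subseteq> \<Omega>"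
   then have "(LINT x:\<Omega>|lebesgue. \<phi> x *\<^sub>R G x) = - (LINT x:\<Omega>|lebesgue. \<eta> x *\<^sub>R g x)"
    using w unfolding has_weak_gradient_def by blast
   then show "(LBINT x. f x *\<^sub>R G x) = - (LBINT x. \<eta> x *\<^sub>R h x)"
    unfolding e1[OF conjunct1[OF a]] e2[OF conjunct1[OF a]] .
  qed
 next
  assume w: "wg f h"
  show "has_weak_gradient \<Omega> \<phi> g"
   unfolding has_weak_gradient_def
  proof (intro conjI allI impI)
   fix \<eta> G assume a: "C1_gradient \<eta> G & compact (closure {x. \<eta> x ~= 0}) & closure {x. \<eta> x ~= 0} \<subseteq> \<Omega>"
   then have "(LBINT x. f x *\<^sub>R G x) = - (LBINT x. \<eta> x *\<^sub>R h x)" using w unfolding wg_def by blast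
   then show "(LINT x:\<Omega>|lebesgue. \<phi> x *\<^sub>R G x) = - (LINT x:\<Omega>|lebesgue. \<eta> x *\<^sub>R g x)"
    unfolding e1[OF conjunct1[OF a]] e2[OF conjunct1[OF a]] .
  qed (use K in blast)+
 qed
qed

text \<open>A weak gradient is only locally integrable, so the domain is exhausted by compact sets.
  With translated mollifiers as test functions, both candidates have the same mollifications on each
  of them.\<close>

lemma weak_gradient_unique:
 assumes 1: "has_weak_gradient \<Omega> \<phi> g" and 2: "has_weak_gradient \<Omega> \<phi> g'"
 shows "ae_eq_on \<Omega> g g'"
proof -
 obtain C where C: "!!n. compact (C n)" "!!n. C n \<subseteq> \<Omega>" "!!n. C n \<subseteq> interior (C (Suc n))" "\<Union>(range C) = \<Omega>"
  using open_Union_compact_subsets[OF op] by metis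
 have loc: "AE x in lebesgue. x \<in> C n --> g x = g' x" for n
 proof -
  define K where "K = C (Suc n)"
  have K: "compact K" "K \<subseteq> \<Omega>" "C n \<subseteq> interior K" using C by (auto simp: K_def)
  have Kb[measurable]: "K \<in> sets borel" using K(1) by (rule borel_compact)
  \<comment> \<open>A margin such that kernels of radius below \<open>d\<close>, centred on
    \<open>C n\<close>, are supported in \<open>K\<close>.\<close>
  obtain d where d: "0 < d" "!!y. y \<in> C n ==> ball y d \<subseteq> K"
  proof (cases "C n = {}")
   case False
   have "\<exists>d>0. (\<Union>y\<in>C n. ball y d) \<subseteq> interior K"
    using compact_subset_open_imp_ball_epsilon_subset[OF C(1) open_interior K(3)] by metis
   then show ?thesis using that interior_subset by blast
  qed (use that[of 1] in auto)
  have rep: "\<exists>h. lp 1 h & (\<forall>x. x \<notin> K --> h x = 0) & (AE x in lebesgue. x \<in> K --> g x = h x)"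
   if "set_integrable lebesgue K g" for g :: "'a => 'a"
  proof -
   have i: "integrable lebesgue (%x. indicator K x *\<^sub>R g x)" using that by (simp add: set_integrable_def)
   obtain h where h: "h \<in> borel_measurable borel" "AE x in lebesgue. indicator K x *\<^sub>R g x = h x"
    using borel_representative[OF borel_measurable_integrable[OF i]] by blast
   have [measurable]: "h \<in> borel_measurable borel" by (rule h(1))
   have m: "(%x. indicator K x *\<^sub>R h x) \<in> borel_measurable borel" by measurable
   have ae: "AE x in lebesgue. indicator K x *\<^sub>R g x = indicator K x *\<^sub>R h x" using h(2) by eventually_elim (auto simp: indicator_def)
   have "integrable lborel (%x. indicator K x *\<^sub>R h x)" using lebesgue_transfer(2)[OF m ae] i by simp
   then have "lp 1 (%x. indicator K x *\<^sub>R h x)" unfolding lp_def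
    using m K(2) integrable_norm[of lborel "%x. indicator K x *\<^sub>R h x"] by (auto simp: indicator_def)
   moreover have "AE x in lebesgue. x \<in> K --> g x = indicator K x *\<^sub>R h x" using ae by eventually_elim auto
   ultimately show ?thesis by (intro exI[of _ "%x. indicator K x *\<^sub>R h x"]) auto
  qed
  obtain h where h: "lp 1 h" "!!x. x \<notin> K ==> h x = 0" "AE x in lebesgue. x \<in> K --> g x = h x"
   using rep[of g] 1 K(1,2) unfolding has_weak_gradient_def by blast
  obtain h' where h': "lp 1 h'" "!!x. x \<notin> K ==> h' x = 0" "AE x in lebesgue. x \<in> K --> g' x = h' x"
   using rep[of g'] 2 K(1,2) unfolding has_weak_gradient_def by blast
  \<comment> \<open>The right-hand side does not mention \<open>G\<close>: the mollification is
    determined by \<open>\<phi>\<close> alone.\<close>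
  have conv: "conv \<rho> k y = - (LINT x:\<Omega>|lebesgue. \<phi> x *\<^sub>R - gr (y - x))"
   if \<delta>: "\<delta> < d" and \<rho>: "mollifier \<delta> \<rho> gr" and y: "y \<in> C n" and w: "has_weak_gradient \<Omega> \<phi> G"
    and k: "lp 1 k" "!!x. x \<notin> K ==> k x = 0" "AE x in lebesgue. x \<in> K --> G x = k x" for \<delta> \<rho> gr y G k
  proof -
   have b: "cball y \<delta> \<subseteq> K" by (rule order_trans[OF _ d(2)[OF y]]) (use \<delta> in \<open>auto simp: subset_iff\<close>)
   have \<rho>0: "\<rho> (y - z) = 0" if "z \<notin> K" for z
   proof -
    have "\<delta> <= norm (y - z)" using that b by (force simp: dist_norm)
    then show ?thesis using \<rho> by (simp add: mollifier_def)
   qed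
   note mt = mollifier_test[OF \<rho> order_trans[OF b K(2)]]
   have [measurable]: "\<rho> \<in> borel_measurable borel" using mollifier_cc(1)[OF \<rho>] by (intro borel_measurable_continuous_onI cc_cont)
   have [measurable]: "k \<in> borel_measurable borel" by (rule lpD[OF k(1)])
   have m: "(%z. \<rho> (y - z) *\<^sub>R k z) \<in> borel_measurable borel" by measurable
   have "AE z in lebesgue. ch z *\<^sub>R (\<rho> (y - z) *\<^sub>R G z) = \<rho> (y - z) *\<^sub>R k z"
    using k(3)
   proof eventually_elim
    case (elim z)
    then show ?case using K(2) \<rho>0[of z] by (cases "z \<in> K") (auto simp: subset_iff)
   qed
   then have "(LINT z:\<Omega>|lebesgue. \<rho> (y - z) *\<^sub>R G z) = conv \<rho> k y"
    unfolding set_lebesgue_integral_def conv_def by (rule lebesgue_transfer(3)[OF m])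
   moreover have "(LINT x:\<Omega>|lebesgue. \<phi> x *\<^sub>R - gr (y - x)) = - (LINT z:\<Omega>|lebesgue. \<rho> (y - z) *\<^sub>R G z)"
    using w mt unfolding has_weak_gradient_def by blast
   ultimately show ?thesis by simp
  qed
  have "AE x in lborel. x \<in> C n --> h x - h' x = 0"
  proof (rule conv_zero_imp_zero[OF lp_diff(1)[OF h(1) h'(1)] d(1) C(2)])
   fix \<delta> :: real and \<rho> :: "'a => real" and gr y assume a: "\<delta> < d" "mollifier \<delta> \<rho> gr" "y \<in> C n"
   show "conv \<rho> (%x. h x - h' x) y = 0"
    using conv_diff[OF lp_1[OF h(1)] lp_1[OF h'(1)] mollifier_cc(1)[OF a(2)], of y]
     conv[OF a 1 h] conv[OF a 2 h'] by simp
  qed (use C(1) in \<open>auto intro: borel_compact\<close>)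
  then have "AE x in lebesgue. x \<in> C n --> h x - h' x = 0" by (simp only: AE_completion_iff)
  then show ?thesis using h(3) h'(3)
  proof eventually_elim
   case (elim x)
   then show ?case using K(3) interior_subset by fastforce
  qed
 qed
 have "AE x in lebesgue. \<forall>n. x \<in> C n --> g x = g' x" unfolding AE_all_countable using loc by blast
 then show ?thesis unfolding ae_eq_on_def by eventually_elim (use C(4) in blast)
qed

text \<open>Uniqueness makes the arbitrarily chosen \<open>weak_gradient\<close> agree with any weak
  gradient that is already known.\<close>

lemma weak_gradient_rp:
 assumes \<phi>: "rp \<phi> f" "lp p f" and h: "lp p h" and w: "wg f h" and p: "1 <= p"
 shows "\<phi> \<in> W1p p \<Omega>" "rp (weak_gradient \<Omega> \<phi>) h"
proof -
 have l1: "lp 1 f" "lp 1 h" using lp_lower[of p _ 1] \<phi>(2) h p by auto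
 have hw: "has_weak_gradient \<Omega> \<phi> h" using has_weak_gradient_rp[OF \<phi>(1) l1(1) rp_self[OF h] l1(2)] w by simp
 have "h \<in> Lp p \<Omega>" "\<phi> \<in> Lp p \<Omega>" using rp_Lp(1)[OF rp_self[OF h]] h rp_Lp(1)[OF \<phi>(1)] \<phi>(2) by auto
 then show "\<phi> \<in> W1p p \<Omega>" using hw by (auto simp: W1p_def)
 have "has_weak_gradient \<Omega> \<phi> (weak_gradient \<Omega> \<phi>)" unfolding weak_gradient_def by (rule someI[of "has_weak_gradient \<Omega> \<phi>", OF hw])
 then have "ae_eq_on \<Omega> h (weak_gradient \<Omega> \<phi>)" by (rule weak_gradient_unique[OF hw])
 then show "rp (weak_gradient \<Omega> \<phi>) h" by (rule rp_cong[OF rp_self[OF h]])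
qed

lemma W1p_rp:
 assumes "\<phi> \<in> W1p p \<Omega>" and p: "1 <= p"
 obtains f h where "rp \<phi> f" "lp p f" "rp (weak_gradient \<Omega> \<phi>) h" "lp p h" "wg f h"
proof -
 obtain g where g: "\<phi> \<in> Lp p \<Omega>" "g \<in> Lp p \<Omega>" "has_weak_gradient \<Omega> \<phi> g" using assms(1) by (auto simp: W1p_def)
 obtain f where f: "rp \<phi> f" "lp p f" using Lp_rp[OF g(1)] by blast
 obtain h where h: "rp g h" "lp p h" using Lp_rp[OF g(2)] by blast
 have "lp 1 f" by (rule lp_lower[OF f(2)]) (use p in auto)
 moreover have "lp 1 h" by (rule lp_lower[OF h(2)]) (use p in auto)
 ultimately have "wg f h" using has_weak_gradient_rp[OF f(1) _ h(1)] g(3) by blast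
 then show ?thesis using that[OF f weak_gradient_rp(2)[OF f h(2) _ p] h(2)] by blast
qed

lemma Lp_sigma_rp:
 assumes r: "rp v h" shows "v \<in> Lp_sigma p \<Omega> \<longleftrightarrow> lp p h & orth h"
proof -
 note [measurable] = rp_borel[OF r]
 have e: "(LINT x:\<Omega>|lebesgue. v x \<bullet> G x) = (LBINT x. h x \<bullet> (ch x *\<^sub>R G x))" if G: "C1_gradient \<eta> G" for \<eta> G
 proof -
  have [measurable]: "G \<in> borel_measurable borel" by (rule borel_measurable_continuous_onI[OF C1_gradient_cont[OF G]])
  have "(LINT x:\<Omega>|lebesgue. v x \<bullet> G x) = (LBINT x. h x \<bullet> G x)"
   by (rule rp_transfer(3)[OF r, of "%x y. y \<bullet> G x"]) simp_all
  also have "\<dots> = (LBINT x. h x \<bullet> (ch x *\<^sub>R G x))"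
   by (intro bint_cong refl) (use r in \<open>auto simp: rp_def indicator_def\<close>)
  finally show ?thesis .
 qed
 show ?thesis unfolding Lp_sigma_def orth_def using e rp_Lp(1)[OF r, of p] by auto
qed

lemma wg_diff:
 assumes "wg f h" "wg f' h'" "lp 1 f" "lp 1 h" "lp 1 f'" "lp 1 h'"
 shows "wg (%x. f x - f' x) (%x. h x - h' x)"
 unfolding wg_def
proof (intro allI impI, elim conjE)
 fix \<psi> :: "'a => real" and H assume \<psi>: "C1_gradient \<psi> H" and t: "compact (closure {x. \<psi> x ~= 0})" "closure {x. \<psi> x ~= 0} \<subseteq> \<Omega>"
 note z = test_zero_outside[OF \<psi> t]
 have "(LBINT x. (f x - f' x) *\<^sub>R H x) = (LBINT x. f x *\<^sub>R H x) - (LBINT x. f' x *\<^sub>R H x)"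
  unfolding scaleR_diff_left by (intro bint_diff cc_product_integrable lp_1 assms z)
 moreover have "(LBINT x. \<psi> x *\<^sub>R (h x - h' x)) = (LBINT x. \<psi> x *\<^sub>R h x) - (LBINT x. \<psi> x *\<^sub>R h' x)"
  unfolding scaleR_diff_right by (intro bint_diff cc_product_integrable' lp_1 assms z)
 moreover have "(LBINT x. f x *\<^sub>R H x) = - (LBINT x. \<psi> x *\<^sub>R h x)" "(LBINT x. f' x *\<^sub>R H x) = - (LBINT x. \<psi> x *\<^sub>R h' x)"
  using assms(1,2) \<psi> t unfolding wg_def by blast+
 ultimately show "(LBINT x. (f x - f' x) *\<^sub>R H x) = - (LBINT x. \<psi> x *\<^sub>R (h x - h' x))" by simp
qed

lemma wg_AE_zero:
 assumes "wg f h" "AE x in lborel. h x = 0" shows "wg f (%x. 0)"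
proof -
 have "(LBINT x. \<psi> x *\<^sub>R h x) = 0" for \<psi> :: "'a => real"
  by (rule integral_eq_zero_AE) (use assms(2) in \<open>eventually_elim, simp\<close>)
 then show ?thesis using assms(1) unfolding wg_def by simp
qed

text \<open>Lets \<open>orth\<close> pass between representatives, as the two descriptions of the
  same field in the uniqueness proof agree only almost everywhere.\<close>

lemma orth_AE_cong:
 assumes "orth v" "AE x in lborel. v x = w x" "v \<in> borel_measurable borel" "w \<in> borel_measurable borel" shows "orth w"
 unfolding orth_def
proof (intro allI impI)
 fix \<zeta> :: "'a => real" and Z assume Z: "C1_gradient \<zeta> Z"
 note [measurable] = assms(3,4)
 have [measurable]: "Z \<in> borel_measurable borel" by (rule borel_measurable_continuous_onI[OF C1_gradient_cont[OF Z]])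
 have "(LBINT x. w x \<bullet> (ch x *\<^sub>R Z x)) = (LBINT x. v x \<bullet> (ch x *\<^sub>R Z x))"
  by (rule integral_cong_AE) (measurable, use assms(2) in \<open>eventually_elim, simp\<close>)
 then show "(LBINT x. w x \<bullet> (ch x *\<^sub>R Z x)) = 0" using assms(1) Z unfolding orth_def by simp
qed

lemma Lp_norm_rp: "rp u h ==> Lp_norm p \<Omega> u = NP p h powr (1 / p)"
 by (simp add: Lp_norm_def rp_Lp(2))

lemma Lp_sigma_obtain:
 assumes "v \<in> Lp_sigma p \<Omega>" obtains h where "rp v h" "lp p h" "orth h"
proof -
 have "v \<in> Lp p \<Omega>" using assms by (simp add: Lp_sigma_def)
 then obtain h where "rp v h" "lp p h" using Lp_rp by blast
 then show ?thesis using that Lp_sigma_rp assms by blast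
qed

text \<open>For uniqueness, the difference of two gradient parts equals a difference of solenoidal
  parts, so \<open>trivial_intersection\<close> applies to it; \<open>wg_zero_const\<close> then
  determines the potential up to a constant.\<close>

theorem helmholtz_decomposition:
 assumes es: "est p K" and p: "1 < p" and K: "0 < K" and u: "u \<in> Lp p \<Omega>"
 defines "c \<equiv> 2 powr p * (Kp p K * 2 powr p)"
 shows "\<exists>\<phi> \<in> W1p p \<Omega>. \<exists>v \<in> Lp_sigma p \<Omega>.
   ae_eq_on \<Omega> u (%x. weak_gradient \<Omega> \<phi> x + v x) \<and>
   (\<forall>\<phi>' \<in> W1p p \<Omega>. \<forall>v' \<in> Lp_sigma p \<Omega>.
    ae_eq_on \<Omega> u (%x. weak_gradient \<Omega> \<phi>' x + v' x) -->
    (\<exists>c. ae_eq_on \<Omega> \<phi>' (%x. \<phi> x + c)) & ae_eq_on \<Omega> v' v) \<and>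
   max (Lp_norm p \<Omega> (weak_gradient \<Omega> \<phi>)) (Lp_norm p \<Omega> v) <= (2 powr p * (1 + c)) powr (1 / p) * Lp_norm p \<Omega> u"
proof -
 have p0: "0 < p" "0 <= p" "1 <= p" using p by auto
 have Kp: "0 < Kp p K" using K by (simp add: Kp_def)
 have c0: "0 <= c" using Kp by (simp add: c_def)
 have l1: "lp 1 f" if "lp p f" for f :: "'a => 'b::euclidean_space" by (rule lp_lower[OF that]) (use p in auto)
 obtain ut where ut: "rp u ut" "lp p ut" using Lp_rp[OF u] by blast
 obtain \<phi> g where d: "lp p \<phi>" "lp p g" "wg \<phi> g" "orth (%x. ut x - g x)" "NP p g <= c * NP p ut"
  using decomposition[OF es p K ut(2)] unfolding c_def by blast
 define v where "v x = ut x - g x" for x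
 have v: "lp p v" "orth v" using lp_diff(1)[OF ut(2) d(2) p0(2)] d(4) by (simp_all add: v_def[abs_def])
 have W: "\<phi> \<in> W1p p \<Omega>" "rp (weak_gradient \<Omega> \<phi>) g"
  using weak_gradient_rp[OF rp_self[OF d(1)] d(1,2,3) p0(3)] by auto
 have vs: "v \<in> Lp_sigma p \<Omega>" using Lp_sigma_rp[OF rp_self[OF v(1)]] v by simp
 have sum: "rp (%x. weak_gradient \<Omega> \<phi> x + v x) (%x. g x + v x)" by (rule rp_add[OF W(2) rp_self[OF v(1)]])
 have eq: "ae_eq_on \<Omega> u (%x. weak_gradient \<Omega> \<phi> x + v x)" unfolding rp_ae_eq[OF ut(1) sum] by (simp add: v_def)
 have uniq: "(\<exists>c. ae_eq_on \<Omega> \<phi>' (%x. \<phi> x + c)) & ae_eq_on \<Omega> v' v"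
  if \<phi>': "\<phi>' \<in> W1p p \<Omega>" and v': "v' \<in> Lp_sigma p \<Omega>" and e: "ae_eq_on \<Omega> u (%x. weak_gradient \<Omega> \<phi>' x + v' x)" for \<phi>' v'
 proof -
  obtain f h where f: "rp \<phi>' f" "lp p f" "rp (weak_gradient \<Omega> \<phi>') h" "lp p h" "wg f h" using W1p_rp[OF \<phi>' p0(3)] by blast
  obtain k where k: "rp v' k" "lp p k" "orth k" using Lp_sigma_obtain[OF v'] by blast
  have ae: "AE x in lborel. ut x = h x + k x" using e unfolding rp_ae_eq[OF ut(1) rp_add[OF f(3) k(1)]] .
  define F where "F x = h x - g x" for x
  have lF: "lp p F" unfolding F_def[abs_def] by (rule lp_diff(1)[OF f(4) d(2) p0(2)])
  have wF: "wg (%x. f x - \<phi> x) F" unfolding F_def[abs_def] by (rule wg_diff[OF f(5) d(3)]; rule l1; rule f d)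
  have lfd: "lp p (%x. f x - \<phi> x)" by (rule lp_diff(1)[OF f(2) d(1) p0(2)])
  have G: "Gp p F" by (rule wg_Gp[OF wF l1[OF lfd] lF p0(3)])
  have vk: "lp p (%x. v x - k x)" by (rule lp_diff(1)[OF v(1) k(2) p0(2)])
  have "orth (%x. v x - k x)" by (rule orth_diff[OF v(2) k(3) v(1) k(2) p])
  moreover have aeF: "AE x in lborel. v x - k x = F x" using ae by eventually_elim (simp add: v_def F_def)
  ultimately have "orth F" by (rule orth_AE_cong[OF _ _ lpD(1)[OF vk] lpD(1)[OF lF]])
  then have F0: "AE x in lborel. F x = 0" by (rule trivial_intersection[OF es p K G])
  have vv: "ae_eq_on \<Omega> v' v" unfolding rp_ae_eq[OF k(1) rp_self[OF v(1)]]
   using F0 aeF by eventually_elim simp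
  have "AE x in lborel. x \<in> \<Omega> --> f x - \<phi> x = mean (%x. f x - \<phi> x)"
   by (rule wg_zero_const[OF wg_AE_zero[OF wF F0] l1[OF lfd]])
  then have "AE x in lebesgue. x \<in> \<Omega> --> f x - \<phi> x = mean (%x. f x - \<phi> x)" by (simp only: AE_completion_iff)
  then have "AE x in lebesgue. x \<in> \<Omega> --> \<phi>' x = \<phi> x + mean (%x. f x - \<phi> x)"
   using rp_AE[OF f(1)] by eventually_elim auto
  then show ?thesis using vv unfolding ae_eq_on_def by blast
 qed
 \<comment> \<open>The \<open>p\<close>-th root is taken only here, to return from \<open>NP\<close>
   to norms.\<close>
 have bound: "NP p h powr (1 / p) <= (2 powr p * (1 + c)) powr (1 / p) * NP p ut powr (1 / p)" if "NP p h <= (2 powr p * (1 + c)) * NP p ut" for h :: "'a => 'a"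
 proof -
  have "NP p h powr (1 / p) <= ((2 powr p * (1 + c)) * NP p ut) powr (1 / p)" using that p0 NP_nonneg by (intro powr_mono2) auto
  also have "\<dots> = (2 powr p * (1 + c)) powr (1 / p) * NP p ut powr (1 / p)" using c0 NP_nonneg[of p ut] by (simp add: powr_mult)
  finally show ?thesis .
 qed
 have "NP p v <= 2 powr p * (NP p ut + NP p g)" unfolding v_def[abs_def] by (rule lp_diff(2)[OF ut(2) d(2) p0(2)])
 also have "\<dots> <= 2 powr p * (NP p ut + c * NP p ut)" using d(5) by (intro mult_left_mono add_left_mono) auto
 also have "\<dots> = (2 powr p * (1 + c)) * NP p ut" by (simp add: algebra_simps)
 finally have bv: "NP p v <= (2 powr p * (1 + c)) * NP p ut" .
 have bg: "NP p g <= (2 powr p * (1 + c)) * NP p ut"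
 proof (rule order_trans[OF d(5) mult_right_mono[OF _ NP_nonneg]])
  have "1 * c <= 2 powr p * (1 + c)" using c0 p0 ge_one_powr_ge_zero[of 2 p] by (intro mult_mono) auto
  then show "c <= 2 powr p * (1 + c)" by simp
 qed
 show ?thesis
 proof (intro bexI[OF _ W(1)] bexI[OF _ vs] conjI ballI impI)
  show "max (Lp_norm p \<Omega> (weak_gradient \<Omega> \<phi>)) (Lp_norm p \<Omega> v) <= (2 powr p * (1 + c)) powr (1 / p) * Lp_norm p \<Omega> u"
   unfolding Lp_norm_rp[OF W(2)] Lp_norm_rp[OF rp_self[OF v(1)]] Lp_norm_rp[OF ut(1)] using bound[OF bg] bound[OF bv] by simp
 qed (use eq uniq in blast)+
qed

theorem helmholtz_direct_sum:
 assumes es: "est p K" and p: "1 < p" and K: "0 < K"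
 shows "ae_direct_sum \<Omega> (Lp p \<Omega>) (grad_W1p p \<Omega>) (Lp_sigma p \<Omega>)"
 unfolding ae_direct_sum_def
proof (intro conjI ballI impI)
 have p0: "0 < p" "0 <= p" "1 <= p" using p by auto
 have l1: "lp 1 f" if "lp p f" for f :: "'a => 'b::euclidean_space" by (rule lp_lower[OF that]) (use p in auto)
 show "grad_W1p p \<Omega> \<subseteq> Lp p \<Omega>"
 proof
  fix y assume "y \<in> grad_W1p p \<Omega>"
  then obtain \<phi> where \<phi>: "\<phi> \<in> W1p p \<Omega>" "y = weak_gradient \<Omega> \<phi>" by (auto simp: grad_W1p_def)
  obtain f h where f: "rp \<phi> f" "lp p f" "rp (weak_gradient \<Omega> \<phi>) h" "lp p h" "wg f h" using W1p_rp[OF \<phi>(1) p0(3)] by blast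
  then show "y \<in> Lp p \<Omega>" unfolding \<phi>(2) by (simp add: rp_Lp(1)[OF f(3)])
 qed
 show "Lp_sigma p \<Omega> \<subseteq> Lp p \<Omega>" by (auto simp: Lp_sigma_def)
 show "\<exists>y\<in>grad_W1p p \<Omega>. \<exists>z\<in>Lp_sigma p \<Omega>. ae_eq_on \<Omega> u (%x. y x + z x)" if "u \<in> Lp p \<Omega>" for u
  using helmholtz_decomposition[OF es p K that] unfolding grad_W1p_def by blast
 fix y z assume y: "y \<in> grad_W1p p \<Omega>" and z: "z \<in> Lp_sigma p \<Omega>" and e: "ae_eq_on \<Omega> y z"
 obtain \<phi> where \<phi>: "\<phi> \<in> W1p p \<Omega>" "y = weak_gradient \<Omega> \<phi>" using y by (auto simp: grad_W1p_def)
 obtain f h where f: "rp \<phi> f" "lp p f" "rp (weak_gradient \<Omega> \<phi>) h" "lp p h" "wg f h" using W1p_rp[OF \<phi>(1) p0(3)] by blast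
 obtain k where k: "rp z k" "lp p k" "orth k" using Lp_sigma_obtain[OF z] by blast
 have "AE x in lborel. k x = h x" using e unfolding \<phi>(2) rp_ae_eq[OF f(3) k(1)] by eventually_elim simp
 then have "orth h" by (rule orth_AE_cong[OF k(3) _ lpD(1)[OF k(2)] lpD(1)[OF f(4)]])
 then have h0: "AE x in lborel. h x = 0" by (rule trivial_intersection[OF es p K wg_Gp[OF f(5) l1[OF f(2)] f(4) p0(3)]])
 have r0: "rp (%x. 0 :: 'a) (%x. 0)" by (rule rp_self[OF lp_zero[OF p0(1)]])
 show "ae_eq_on \<Omega> y (%_. 0)" unfolding \<phi>(2) rp_ae_eq[OF f(3) r0] by (rule h0)
qed

end

theorem theorem1p3:
  fixes p :: real
  assumes "CARD('n::finite) \<ge> 2" and "1 < p"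
  shows "\<exists>K :: real \<Rightarrow> real \<Rightarrow> nat \<Rightarrow> real.
    \<forall>\<Omega> :: (real ^ 'n) set. open \<Omega> \<and> \<Omega> \<noteq> {} \<and> bounded \<Omega> \<and> convex \<Omega> \<longrightarrow>
      ae_direct_sum \<Omega> (Lp p \<Omega>) (grad_W1p p \<Omega>) (Lp_sigma p \<Omega>) \<and>
      (\<exists>C. (\<forall>u \<in> Lp p \<Omega>. \<exists>\<phi> \<in> W1p p \<Omega>. \<exists>v \<in> Lp_sigma p \<Omega>.
              ae_eq_on \<Omega> u (\<lambda>x. weak_gradient \<Omega> \<phi> x + v x) \<and>
              (\<forall>\<phi>' \<in> W1p p \<Omega>. \<forall>v' \<in> Lp_sigma p \<Omega>.
                 ae_eq_on \<Omega> u (\<lambda>x. weak_gradient \<Omega> \<phi>' x + v' x) \<longrightarrow>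
                 (\<exists>c. ae_eq_on \<Omega> \<phi>' (\<lambda>x. \<phi> x + c)) \<and> ae_eq_on \<Omega> v' v) \<and>
              max (Lp_norm p \<Omega> (weak_gradient \<Omega> \<phi>)) (Lp_norm p \<Omega> v) \<le> C * Lp_norm p \<Omega> u) \<and>
           (\<forall>r\<^sub>0 M N. lipschitz_character \<Omega> r\<^sub>0 M N \<longrightarrow> C \<le> K r\<^sub>0 M N))"
proof -
 obtain K where K: "0 < K" "!!\<Omega> :: (real ^ 'n) set. dom \<Omega> ==> dom.est \<Omega> p K" using est_exists[OF assms(2)] by metis
 \<comment> \<open>The factor of \<open>helmholtz_decomposition\<close> for the \<open>K\<close>
   chosen above, hence determined by \<open>p\<close> and the dimension; the constant function with
   this value is the witness.\<close>
 define C where "C = (2 powr p * (1 + 2 powr p * (Kp p K * 2 powr p))) powr (1 / p)"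
 show ?thesis
 proof (intro exI[of _ "%_ _ _. C"] allI impI)
  fix \<Omega> :: "(real ^ 'n) set" assume "open \<Omega> & \<Omega> ~= {} & bounded \<Omega> & convex \<Omega>"
  then interpret dom \<Omega> by unfold_locales auto
  show "ae_direct_sum \<Omega> (Lp p \<Omega>) (grad_W1p p \<Omega>) (Lp_sigma p \<Omega>) \<and>
   (\<exists>C'. (\<forall>u \<in> Lp p \<Omega>. \<exists>\<phi> \<in> W1p p \<Omega>. \<exists>v \<in> Lp_sigma p \<Omega>.
       ae_eq_on \<Omega> u (%x. weak_gradient \<Omega> \<phi> x + v x) \<and>
       (\<forall>\<phi>' \<in> W1p p \<Omega>. \<forall>v' \<in> Lp_sigma p \<Omega>.
        ae_eq_on \<Omega> u (%x. weak_gradient \<Omega> \<phi>' x + v' x) -->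
        (\<exists>c. ae_eq_on \<Omega> \<phi>' (%x. \<phi> x + c)) & ae_eq_on \<Omega> v' v) \<and>
       max (Lp_norm p \<Omega> (weak_gradient \<Omega> \<phi>)) (Lp_norm p \<Omega> v) <= C' * Lp_norm p \<Omega> u) \<and>
     (\<forall>r\<^sub>0 M N. lipschitz_character \<Omega> r\<^sub>0 M N --> C' <= C))"
   using helmholtz_direct_sum[OF K(2)[OF dom_axioms] assms(2) K(1)]
    helmholtz_decomposition[OF K(2)[OF dom_axioms] assms(2) K(1)] unfolding C_def[symmetric] by blast
 qed
qed

end
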